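(* For any skew diagram $\lambda/\mu$ satisfying the positivity condition $\lambda'_{i+1}-\mu'_i\le n$ ($i=1,\dots,l-1$, $l=\lambda_1$) and any $a\in\mathbb C$, $$\chi_{\lambda/\mu,a}=\sum_{p\in P(\lambda/\mu)}z_a^p,$$ where $P(\lambda/\mu)$ is the set of all tuples $p=(p_1,\dots,p_l)$ of paths, $p_i$ from $u_i$ to $v_i$ for each $i$, such that (i) $p$ does not have any ordinarily intersecting adjacent pair $(p_i,p_{i+1})$, and (ii) $p$ does not have any odd $\mathrm{II}$-region.
   Context: Ring and determinant. Fix a positive integer $n$ (rank of type $D_n$). $I=\{1,2,\dots,n,\overline n,\dots,\overline 2,\overline 1\}$. $\mathcal Z$ is the commutative ring over $\mathbb Z$ generated by $z_{i,a}$ ($i\in I$, $a\in\mathbb C$) with relations $z_{i,a}z_{\overline i,a-2n+2i}=z_{i-1,a}z_{\overline{i-1},a-2n+2i}$ ($i=1,\dots,n$), where $z_{0,a}=z_{\overline 0,a}=1$. In the non-commutative ring generated by $\mathcal Z$ and $\mathbb Z[[X]]$ with $Xz_{i,a}=z_{i,a-2}X$, put $E_a(z,X)=(1+z_{1,a}X)\cdots(1+z_{n,a}X)\,(1-z_{\overline n,a}Xz_{n,a}X)^{-1}\,(1+z_{\overline n,a}X)\cdots(1+z_{\overline 1,a}X)=\sum_{i\ge0}e_{i,a}X^i$ with $e_{i,a}\in\mathcal Z$, and $e_{i,a}=0$ for $i<0$. A skew diagram $\lambda/\mu$ is a pair of partitions with $\lambda_i\ge\mu_i$ for all $i$; $\lambda',\mu'$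 are the conjugates. $\chi_{\lambda/\mu,a}=\det(e_{\lambda'_i-\mu'_j-i+j,\,a-2(\mu'_j-j+1)})_{1\le i,j\le l}$ with $l=\lambda_1$. Paths. For $w=(x,y)\in\mathbb R^2$ put $\mathrm{ht}(w)=x+y$ (height), $\mathrm{hp}(w)=\frac12(x-y)$ (horizontal position). Steps on $\mathbb Z^2$: NE-step $(x,y)\to(x+1,y)$, NW-step $(x,y)\to(x,y+1)$, E-step $(x,y)\to(x+1,y-1)$. A path is a sequence of consecutive NE-, NW-, E-steps from a lattice point of height $-n$ to one of height $n$, where E-steps occur only at height $0$ and their number is even. The weight $z_a^p$ of a path $p$ is the product over its NE- and E-steps $s$ of $z_{L^1(s),a-2x}$, where $s$ starts at $(x,y)$, $m=x+y$, and $L^1(s)$ is: $n+1+m$ if $m<0$; $n$ if $m=0$ and $s$ is the 2nd, 4th, 6th, ... E-step of $p$; $\overline{n-m}$ otherwise. The weight of a tuple is $z_a^p=\prod_iz_a^{p_i}$. Put $u_i=(\mu'_i+1-i,-n-\mu'_i-1+i)$, $v_i=(\lambda'_i+1-i,n-\lambda'_i-1+i)$ for $1\le i\le l$. Two paths intersect if they share a lattice point. An intersecting pair $(p_i,p_j)$ is specially intersecting if the intersection occurs only at height $0$ and $p_i(0)-p_j(0)$ is odd, where $p_i(0)$ is the horizontal position of the leftmost point of $p_i$ at height $0$; otherwise it is ordinarily intersecting. Odd $\mathrm{II}$-regions. $S_+=\{0\le\mathrm{ht}\le n\}$, $S_-=\{-n\le\mathrm{ht}\le0\}$. A lower (resp.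 upper) path is a sequence of consecutive NE/NW-steps from height $-n$ to $0$ (resp. from $0$ to $n$); $\alpha(r)$ denotes the horizontal position at height $r$. Duals: $\alpha^*(r)=\alpha(-r)-1$, $\beta^*(-r)=\beta(r)+1$ ($0\le r\le n$) for a lower path $\alpha$ and an upper path $\beta$. For a tuple $p$ with property (i), removing all E-steps gives $\pi(p)=(\alpha;\beta)=(\alpha_1,\dots,\alpha_l;\beta_1,\dots,\beta_l)$, where $\alpha_i$ is the lower path starting at $u_i$ and $\beta_i$ the upper path ending at $v_i$. A unit $U\subset S_\pm$ is a unit square of the lattice inside $S_\pm$, or the half in $S_\pm$ of a unit square whose horizontal diagonal lies on the boundary of $S_\pm$; its height is the height of its left vertex; its left and right vertices have horizontal positions $a$ and $a'=a+1$. With $\pm r=\mathrm{ht}(U)$, $U$ is a $\mathrm{II}$-unit if for some $0\le i\le l$: $\beta_{i+1}(r)\le a<a'\le\alpha_i^*(r)$ (if $U\subset S_+$), resp. $\beta^*_{i+1}(-r)\le a<a'\le\alpha_i(-r)$ (if $U\subset S_-$), where $\beta_{l+1}=\beta_{l+1}^*=-\infty$, $\alpha_0=\alpha_0^*=+\infty$; it is a boundary $\mathrm{II}$-unit if this holds with $i=0$, or $i=l$, or $r=n$. Two units are adjacent if the left or right vertex of one is also a vertex of the other. A connected component of the $\mathrm{II}$-units is the union of an equivalence class for the equivalence relation on the set of $\mathrm{II}$-units generated by adjacency. A $\mathrm{II}$-region of $p$ is a connected component containing at least one $\mathrm{II}$-unit of height $0$ and no boundary $\mathrm{II}$-unit.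 The pair $(\alpha_i,\beta_{i+1})$ ($1\le i\le l-1$) is an even hole if $\alpha_i(0)-\beta_{i+1}(0)$ is positive and even; it intersects $V$ at height $0$ if the height-$0$ endpoint of $\alpha_i$ lies in a unit of $V$ in $S_-$ or that of $\beta_{i+1}$ lies in a unit of $V$ in $S_+$. A $\mathrm{II}$-region $V$ is odd if the number of even holes $(\alpha_i,\beta_{i+1})$ intersecting $V$ at height $0$ is odd.
   Formalization: Two units count as adjacent only if both lie in S_+ or both in S_-: units in different strips are never adjacent, even when they share a vertex at height 0. With the literal adjacency the formula fails already for n=1, λ=(2), μ=∅. *)

theory Defs
  imports
    Complex_Main
    "HOL-Library.FuncSet"
    "HOL-Library.Cardinality"
    "HOL-Library.Poly_Mapping"
    "HOL-Computational_Algebra.Formal_Power_Series"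
    "Jordan_Normal_Form.Determinant"
begin

section \<open>The ring Z\<close>

text \<open>
  The rank is \<open>n = CARD('n)\<close>, where \<open>'n\<close> ranges over the finite types; it enters the ring as
  a phantom type parameter.
\<close>

datatype letter = Unbarred nat | Barred nat

definition letters :: "nat \<Rightarrow> letter set" where
  "letters n = Unbarred ` {1..n} \<union> Barred ` {1..n}"

type_synonym zpoly = "((letter \<times> complex) \<Rightarrow>\<^sub>0 nat) \<Rightarrow>\<^sub>0 int"

definition var :: "letter \<Rightarrow> complex \<Rightarrow> zpoly" where
  "var k a = Poly_Mapping.single (Poly_Mapping.single (k, a) 1) 1"

text \<open>
  The type \<^typ>\<open>zpoly\<close> has indeterminates for all letters.  Those with index 0 stand for
  \<open>z\<^bsub>0,a\<^esub> = 1\<close>; those with index above \<open>n\<close> are not generators of the ring and are removed by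
  setting them to 1 as well.
\<close>

definition relators :: "nat \<Rightarrow> zpoly set" where
  "relators n =
     {var (Unbarred i) a * var (Barred i) (a - 2 * of_nat n + 2 * of_nat i)
      - var (Unbarred (i - 1)) a * var (Barred (i - 1)) (a - 2 * of_nat n + 2 * of_nat i)
      | i a. 1 \<le> i \<and> i \<le> n}
     \<union> {var k a - 1 | k a. k \<notin> letters n}"

interpretation ideal: Modules.module "(*) :: zpoly \<Rightarrow> zpoly \<Rightarrow> zpoly"
  by standard (simp_all add: algebra_simps)

definition zcong :: "'n::finite itself \<Rightarrow> zpoly \<Rightarrow> zpoly \<Rightarrow> bool" where
  "zcong _ p q \<longleftrightarrow> p - q \<in> ideal.span (relators CARD('n))"

lemma zcong_eqI: "p = q \<Longrightarrow> zcong TYPE('n::finite) p q"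
  by (simp add: zcong_def ideal.span_zero)

lemma equivp_zcong: "equivp (zcong TYPE('n::finite))"
proof (rule equivpI)
  show "reflp (zcong TYPE('n))"
    by (auto simp: reflp_def zcong_def ideal.span_zero)
  show "symp (zcong TYPE('n))"
    unfolding symp_def zcong_def by (metis ideal.span_neg minus_diff_eq)
  show "transp (zcong TYPE('n))"
  proof (rule transpI)
    fix p q r
    assume "zcong TYPE('n) p q" "zcong TYPE('n) q r"
    then have "(p - q) + (q - r) \<in> ideal.span (relators CARD('n))"
      unfolding zcong_def by (rule ideal.span_add)
    then show "zcong TYPE('n) p r"
      by (simp add: zcong_def)
  qed
qed

quotient_type 'n zring = zpoly / "zcong TYPE('n::finite)"
  by (rule equivp_zcong)

lemma poly_mapping_add_induct:
  fixes p :: "'k \<Rightarrow>\<^sub>0 'c::monoid_add"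
  assumes "P 0" "\<And>k v. P (Poly_Mapping.single k v)" "\<And>p q. P p \<Longrightarrow> P q \<Longrightarrow> P (p + q)"
  shows "P p"
proof (induction p rule: Poly_Mapping.update_induct)
  case const
  then show ?case by (rule assms(1))
next
  case (update f k v)
  have "Poly_Mapping.update k v f = f + Poly_Mapping.single k v"
    using update(1)
    by (intro poly_mapping_eqI) (auto simp: lookup_update lookup_add lookup_single in_keys_iff)
  then show ?case using assms update by simp
qed

definition coeff_sum :: "zpoly \<Rightarrow> int" where
  "coeff_sum p = (\<Sum>m\<in>Poly_Mapping.keys p. Poly_Mapping.lookup p m)"

lemma coeff_sum_0: "coeff_sum 0 = 0"
  by (simp add: coeff_sum_def)

lemma coeff_sum_single: "coeff_sum (Poly_Mapping.single m c) = c"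
  by (simp add: coeff_sum_def)

lemma coeff_sum_add: "coeff_sum (p + q) = coeff_sum p + coeff_sum q"
  unfolding coeff_sum_def by (rule setsum_keys_plus_distrib) simp_all

lemma coeff_sum_diff: "coeff_sum (p - q) = coeff_sum p - coeff_sum q"
  by (metis add_diff_cancel_right' coeff_sum_add diff_add_cancel)

lemma coeff_sum_mult: "coeff_sum (p * q) = coeff_sum p * coeff_sum q"
proof (induction p rule: poly_mapping_add_induct)
  case (2 k v)
  show ?case
    by (induction q rule: poly_mapping_add_induct)
       (simp_all add: coeff_sum_0 coeff_sum_single coeff_sum_add mult_single algebra_simps)
qed (simp_all add: coeff_sum_0 coeff_sum_add algebra_simps)

lemma coeff_sum_span: "p \<in> ideal.span (relators n) \<Longrightarrow> coeff_sum p = 0"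
proof (induction p rule: ideal.span_induct_alt)
  case base
  show ?case by (rule coeff_sum_0)
next
  case (step c x y)
  have "coeff_sum 1 = 1"
    by (metis coeff_sum_single single_one)
  with step(1) have "coeff_sum x = 0"
    by (auto simp: relators_def coeff_sum_diff coeff_sum_mult var_def coeff_sum_single)
  with step show ?case by (simp add: coeff_sum_add coeff_sum_mult)
qed

instantiation zring :: (finite) comm_ring_1
begin

lift_definition zero_zring :: "'a zring" is 0 .
lift_definition one_zring :: "'a zring" is 1 .

lift_definition plus_zring :: "'a zring \<Rightarrow> 'a zring \<Rightarrow> 'a zring" is "(+)"
  unfolding zcong_def add_diff_add by (rule ideal.span_add)

lift_definition uminus_zring :: "'a zring \<Rightarrow> 'a zring" is uminus
  unfolding zcong_def minus_diff_minus by (rule ideal.span_neg)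

lift_definition minus_zring :: "'a zring \<Rightarrow> 'a zring \<Rightarrow> 'a zring" is "(-)"
proof -
  fix p p' q q' :: zpoly
  assume "zcong TYPE('a) p p'" "zcong TYPE('a) q q'"
  then have "(p - p') - (q - q') \<in> ideal.span (relators CARD('a))"
    unfolding zcong_def by (rule ideal.span_diff)
  moreover have "(p - p') - (q - q') = p - q - (p' - q')"
    by simp
  ultimately show "zcong TYPE('a) (p - q) (p' - q')"
    unfolding zcong_def by (simp only:)
qed

lift_definition times_zring :: "'a zring \<Rightarrow> 'a zring \<Rightarrow> 'a zring" is "(*)"
proof -
  fix p p' q q' :: zpoly
  assume "zcong TYPE('a) p p'" "zcong TYPE('a) q q'"
  moreover have "p * q - p' * q' = q * (p - p') + p' * (q - q')"
    by (simp add: algebra_simps)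
  ultimately show "zcong TYPE('a) (p * q) (p' * q')"
    by (simp add: zcong_def ideal.span_add ideal.span_scale)
qed

instance
proof
  fix a b c :: "'a zring"
  show "a * b * c = a * (b * c)"
    by transfer (rule zcong_eqI, rule mult.assoc)
  show "a * b = b * a"
    by transfer (rule zcong_eqI, rule mult.commute)
  show "1 * a = a"
    by transfer (rule zcong_eqI, rule mult_1)
  show "a + b + c = a + (b + c)"
    by transfer (rule zcong_eqI, rule add.assoc)
  show "a + b = b + a"
    by transfer (rule zcong_eqI, rule add.commute)
  show "0 + a = a"
    by transfer (rule zcong_eqI, rule add_0)
  show "- a + a = 0"
    by transfer (rule zcong_eqI, rule left_minus)
  show "a - b = a + - b"
    by transfer (rule zcong_eqI, rule diff_conv_add_uminus)
  show "(a + b) * c = a * c + b * c"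
    by transfer (rule zcong_eqI, rule distrib_right)
  show "(0::'a zring) \<noteq> 1"
  proof transfer
    have "coeff_sum (0 - 1) = -1"
      by (metis coeff_sum_0 coeff_sum_diff coeff_sum_single diff_0 single_one)
    then show "\<not> zcong TYPE('a) 0 1"
      using coeff_sum_span by (fastforce simp only: zcong_def)
  qed
qed

end

lift_definition zgen :: "letter \<Rightarrow> complex \<Rightarrow> 'n::finite zring" is var .

lemma zgen_relation:
  assumes "1 \<le> i" "i \<le> CARD('n::finite)"
  shows "zgen (Unbarred i) a * zgen (Barred i) (a - 2 * of_nat CARD('n) + 2 * of_nat i)
       = (zgen (Unbarred (i - 1)) a
          * zgen (Barred (i - 1)) (a - 2 * of_nat CARD('n) + 2 * of_nat i) :: 'n zring)"
  using assms by transfer (unfold zcong_def, rule ideal.span_base, auto simp: relators_def)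

lemma zgen_eq_1:
  assumes "k \<notin> letters CARD('n::finite)"
  shows "zgen k a = (1 :: 'n zring)"
  using assms by transfer (unfold zcong_def, rule ideal.span_base, auto simp: relators_def)


section \<open>Conjugation by X\<close>

definition reparam :: "complex \<Rightarrow> letter \<times> complex \<Rightarrow> letter \<times> complex" where
  "reparam c = (\<lambda>(k, a). (k, a + c))"

lemma bij_reparam: "bij (reparam c)"
  by (rule bij_betw_byWitness[where f' = "reparam (- c)"]) (auto simp: reparam_def)

lemma inj_reparam: "inj (reparam c)"
  using bij_reparam by (rule bij_is_inj)

lemma reparam_mon_inverse:
  "Poly_Mapping.map_key (reparam c) (Poly_Mapping.map_key (reparam (- c)) m) = m"
  by (subst map_key_compose[OF inj_reparam inj_reparam])
     (simp add: reparam_def comp_def case_prod_beta map_key_id)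

lemma bij_reparam_mon: "bij (Poly_Mapping.map_key (reparam c))"
  by (rule bij_betw_byWitness[where f' = "Poly_Mapping.map_key (reparam (- c))"])
     (use reparam_mon_inverse[of c] reparam_mon_inverse[of "- c"] in auto)

lemma inj_reparam_mon: "inj (Poly_Mapping.map_key (reparam c))"
  using bij_reparam_mon by (rule bij_is_inj)

text \<open>The substitution \<open>z\<^bsub>k,a\<^esub> \<mapsto> z\<^bsub>k,a-2\<^esub>\<close> on polynomials; see \<open>poly_shift_var\<close>.\<close>

definition poly_shift :: "zpoly \<Rightarrow> zpoly" where
  "poly_shift = Poly_Mapping.map_key (Poly_Mapping.map_key (reparam (- 2)))"

lemma poly_shift_single:
  "poly_shift (Poly_Mapping.single m c)
     = Poly_Mapping.single (Poly_Mapping.map_key (reparam 2) m) c"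
  unfolding poly_shift_def
  using map_key_single[OF inj_reparam_mon, of "- 2" "Poly_Mapping.map_key (reparam 2) m" c]
    reparam_mon_inverse[of "- 2" m] by simp

lemma poly_shift_var: "poly_shift (var k a) = var k (a - 2)"
proof -
  have "Poly_Mapping.map_key (reparam 2) (Poly_Mapping.single (k, a) 1)
      = (Poly_Mapping.single (k, a - 2) 1 :: _ \<Rightarrow>\<^sub>0 nat)"
    using map_key_single[OF inj_reparam, of 2 "(k, a - 2)" "1 :: nat"] by (simp add: reparam_def)
  then show ?thesis
    unfolding var_def poly_shift_single by (simp only:)
qed

lemma poly_shift_1: "poly_shift 1 = 1"
  unfolding single_one[symmetric] poly_shift_single
  by (simp add: map_key_zero[OF inj_reparam])

lemma poly_shift_0: "poly_shift 0 = 0"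
  unfolding poly_shift_def by (rule map_key_zero[OF inj_reparam_mon])

lemma poly_shift_add: "poly_shift (p + q) = poly_shift p + poly_shift q"
  unfolding poly_shift_def by (rule map_key_plus[OF inj_reparam_mon])

lemma poly_shift_diff: "poly_shift (p - q) = poly_shift p - poly_shift q"
  by (metis add_diff_cancel_right' poly_shift_add diff_add_cancel)

lemma poly_shift_mult: "poly_shift (p * q) = poly_shift p * poly_shift q"
proof (induction p rule: poly_mapping_add_induct)
  case (2 k v)
  show ?case
    by (induction q rule: poly_mapping_add_induct)
       (simp_all add: poly_shift_0 poly_shift_single poly_shift_add mult_single
          map_key_plus[OF inj_reparam] distrib_left)
qed (simp_all add: poly_shift_0 poly_shift_add distrib_right)

lemma poly_shift_relators: "p \<in> relators n \<Longrightarrow> poly_shift p \<in> relators n"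
  unfolding relators_def
proof (elim UnE, goal_cases)
  case 1
  then obtain i a where i: "1 \<le> i" "i \<le> n" and p: "p =
      var (Unbarred i) a * var (Barred i) (a - 2 * of_nat n + 2 * of_nat i)
      - var (Unbarred (i - 1)) a * var (Barred (i - 1)) (a - 2 * of_nat n + 2 * of_nat i)"
    by blast
  have "poly_shift p =
      var (Unbarred i) (a - 2) * var (Barred i) (a - 2 - 2 * of_nat n + 2 * of_nat i)
      - var (Unbarred (i - 1)) (a - 2)
        * var (Barred (i - 1)) (a - 2 - 2 * of_nat n + 2 * of_nat i)"
    by (simp add: p poly_shift_diff poly_shift_mult poly_shift_var algebra_simps)
  with i show ?case by blast
next
  case 2
  then obtain k a where k: "k \<notin> letters n" and p: "p = var k a - 1"
    by blast
  have "poly_shift p = var k (a - 2) - 1"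
    by (simp add: p poly_shift_diff poly_shift_var poly_shift_1)
  with k show ?case by blast
qed

lemma poly_shift_span:
  "p \<in> ideal.span (relators n) \<Longrightarrow> poly_shift p \<in> ideal.span (relators n)"
proof (induction p rule: ideal.span_induct_alt)
  case base
  show ?case by (simp add: poly_shift_0 ideal.span_zero)
next
  case (step c x y)
  then show ?case
    by (simp add: poly_shift_add poly_shift_mult ideal.span_add ideal.span_scale
        ideal.span_base poly_shift_relators)
qed

lift_definition zshift :: "'n::finite zring \<Rightarrow> 'n zring" is poly_shift
  unfolding zcong_def by (metis poly_shift_diff poly_shift_span)

lemma zshift_zgen: "zshift (zgen k a) = zgen k (a - 2)"
  by transfer (rule zcong_eqI, rule poly_shift_var)

lemma zshift_0: "zshift 0 = 0"
  by transfer (rule zcong_eqI, rule poly_shift_0)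

lemma zshift_1: "zshift 1 = 1"
  by transfer (rule zcong_eqI, rule poly_shift_1)

lemma zshift_add: "zshift (x + y) = zshift x + zshift y"
  by transfer (rule zcong_eqI, rule poly_shift_add)

lemma zshift_mult: "zshift (x * y) = zshift x * zshift y"
  by transfer (rule zcong_eqI, rule poly_shift_mult)

lemma zshift_pow_0: "(zshift ^^ k) 0 = 0"
  by (induction k) (simp_all add: zshift_0)

lemma zshift_pow_1: "(zshift ^^ k) 1 = 1"
  by (induction k) (simp_all add: zshift_1)

lemma zshift_pow_add: "(zshift ^^ k) (x + y) = (zshift ^^ k) x + (zshift ^^ k) y"
  by (induction k) (simp_all add: zshift_add)

lemma zshift_pow_mult: "(zshift ^^ k) (x * y) = (zshift ^^ k) x * (zshift ^^ k) y"
  by (induction k) (simp_all add: zshift_mult)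

lemma zshift_pow_sum: "(zshift ^^ k) (sum f A) = (\<Sum>i\<in>A. (zshift ^^ k) (f i))"
  by (induction A rule: infinite_finite_induct) (simp_all add: zshift_pow_0 zshift_pow_add)


section \<open>Power series in X with coefficients on the left\<close>

text \<open>
  A series \<open>f\<close> is the formal sum of the \<open>skew_nth f k \<cdot> X\<^sup>k\<close>; products are governed by
  \<open>X z = zshift z X\<close>, see \<open>skew_X_const\<close>.
\<close>

typedef (overloaded) 'n skew_series = "UNIV :: (nat \<Rightarrow> 'n::finite zring) set"
  morphisms skew_nth Skew by simp

lemmas skew_nth_Skew [simp] = Skew_inverse[OF UNIV_I]

lemma skew_eqI: "(\<And>k. skew_nth f k = skew_nth g k) \<Longrightarrow> f = g"
  by (metis ext skew_nth_inject)

instantiation skew_series :: (finite) ring_1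
begin

definition "0 = Skew (\<lambda>_. 0)"
definition "1 = Skew (\<lambda>k. if k = 0 then 1 else 0)"
definition "f + g = Skew (\<lambda>k. skew_nth f k + skew_nth g k)"
definition "- f = Skew (\<lambda>k. - skew_nth f k)"
definition "f - g = Skew (\<lambda>k. skew_nth f k - skew_nth g k)"
definition "f * g = Skew (\<lambda>k. \<Sum>i=0..k. skew_nth f i * (zshift ^^ i) (skew_nth g (k - i)))"

lemmas skew_nth_simps =
  zero_skew_series_def one_skew_series_def plus_skew_series_def uminus_skew_series_def
  minus_skew_series_def times_skew_series_def

instance
proof
  fix f g h :: "'a skew_series"
  show "f * g * h = f * (g * h)"
  proof (rule skew_eqI)
    fix k
    have "skew_nth (f * g * h) k = (\<Sum>j=0..k. \<Sum>i=0..j. skew_nth f i *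
        (zshift ^^ i) (skew_nth g (j - i)) * (zshift ^^ (i + (j - i))) (skew_nth h (k - j)))"
      by (simp add: skew_nth_simps sum_distrib_right)
    also have "\<dots> = (\<Sum>j=0..k. \<Sum>i=0..k-j. skew_nth f j *
        (zshift ^^ j) (skew_nth g i) * (zshift ^^ (j + i)) (skew_nth h (k - j - i)))"
      by (rule fps_mult_assoc_lemma)
    also have "\<dots> = skew_nth (f * (g * h)) k"
      by (simp add: skew_nth_simps sum_distrib_left zshift_pow_sum zshift_pow_mult funpow_add
          mult.assoc)
    finally show "skew_nth (f * g * h) k = skew_nth (f * (g * h)) k" .
  qed
  show "1 * f = f"
    by (rule skew_eqI) (simp add: skew_nth_simps if_distrib[of "\<lambda>x. x * _"] sum.delta cong: if_cong)
  show "f * 1 = f"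
  proof (rule skew_eqI)
    fix k
    have "skew_nth (f * 1) k = (\<Sum>i=0..k. if i = k then skew_nth f i else 0)"
      unfolding skew_nth_simps skew_nth_Skew
      by (rule sum.cong) (auto simp: zshift_pow_0 zshift_pow_1)
    then show "skew_nth (f * 1) k = skew_nth f k" by simp
  qed
  show "(f + g) * h = f * h + g * h"
    by (rule skew_eqI) (simp add: skew_nth_simps distrib_right sum.distrib)
  show "f * (g + h) = f * g + f * h"
    by (rule skew_eqI) (simp add: skew_nth_simps zshift_pow_add distrib_left sum.distrib)
  show "(0 :: 'a skew_series) \<noteq> 1"
  proof
    assume "(0 :: 'a skew_series) = 1"
    then have "skew_nth (0 :: 'a skew_series) 0 = skew_nth 1 0" by simp
    then show False by (simp add: skew_nth_simps)
  qed
qed (rule skew_eqI; simp add: skew_nth_simps)+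

end

definition skew_const :: "'n::finite zring \<Rightarrow> 'n skew_series" where
  "skew_const x = Skew (\<lambda>k. if k = 0 then x else 0)"

definition skew_X :: "'n::finite skew_series" where
  "skew_X = Skew (\<lambda>k. if k = 1 then 1 else 0)"

lemma skew_X_const: "skew_X * skew_const x = skew_const (zshift x) * skew_X"
proof (rule skew_eqI)
  fix k
  have "skew_nth (skew_X * skew_const x) k = (\<Sum>i=0..k. if i = 1 then (if k = 1 then zshift x else 0) else 0)"
    unfolding skew_nth_simps skew_X_def skew_const_def skew_nth_Skew
    by (rule sum.cong) (auto simp: zshift_pow_0 zshift_0)
  moreover have "skew_nth (skew_const (zshift x) * skew_X) k = (\<Sum>i=0..k. if i = 0 then (if k = 1 then zshift x else 0) else 0)"
    unfolding skew_nth_simps skew_X_def skew_const_def skew_nth_Skew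
    by (rule sum.cong) auto
  ultimately show "skew_nth (skew_X * skew_const x) k = skew_nth (skew_const (zshift x) * skew_X) k"
    by (simp add: sum.delta)
qed

definition skew_inverse :: "'n::finite skew_series \<Rightarrow> 'n skew_series" where
  "skew_inverse f = (THE g. f * g = 1 \<and> g * f = 1)"

fun right_inverse_nth :: "'n::finite skew_series \<Rightarrow> nat \<Rightarrow> 'n zring" where
  "right_inverse_nth f k = (if k = 0 then 1 else
     - (\<Sum>i=1..k. skew_nth f i * (zshift ^^ i) (right_inverse_nth f (k - i))))"

declare right_inverse_nth.simps [simp del]

lemma skew_right_inverse:
  assumes "skew_nth f 0 = 1"
  shows "f * Skew (right_inverse_nth f) = 1"
proof (rule skew_eqI)
  fix k
  show "skew_nth (f * Skew (right_inverse_nth f)) k = skew_nth 1 k"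
    using assms right_inverse_nth.simps[of f k]
    by (simp add: skew_nth_simps sum.atLeast_Suc_atMost)
qed

lemma skew_inverse:
  assumes "skew_nth f 0 = 1"
  shows "f * skew_inverse f = 1" "skew_inverse f * f = 1"
proof -
  define g where "g = Skew (right_inverse_nth f)"
  have fg: "f * g = 1"
    unfolding g_def using assms by (rule skew_right_inverse)
  have "skew_nth g 0 = 1"
    by (simp add: g_def right_inverse_nth.simps)
  then obtain h where gh: "g * h = 1"
    using skew_right_inverse by blast
  have "h = f * g * h" by (simp add: fg)
  also have "\<dots> = f" by (simp add: mult.assoc gh)
  finally have gf: "g * f = 1" using gh by simp
  have "skew_inverse f = g"
    unfolding skew_inverse_def
    by (rule the_equality) (use fg gf in \<open>auto intro: skew_eqI\<close>, metis mult.assoc mult_1 mult_1_right)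
  then show "f * skew_inverse f = 1" "skew_inverse f * f = 1"
    using fg gf by simp_all
qed


section \<open>The determinant\<close>

definition E_series :: "complex \<Rightarrow> 'n::finite skew_series" where
  "E_series a =
     (\<Prod>i\<leftarrow>[1..<Suc CARD('n)]. 1 + skew_const (zgen (Unbarred i) a) * skew_X)
     * skew_inverse (1 - skew_const (zgen (Barred CARD('n)) a) * skew_X
                         * skew_const (zgen (Unbarred CARD('n)) a) * skew_X)
     * (\<Prod>i\<leftarrow>rev [1..<Suc CARD('n)]. 1 + skew_const (zgen (Barred i) a) * skew_X)"

lemma E_series_denominator:
  "skew_nth (1 - skew_const x * skew_X * skew_const y * skew_X) 0 = 1"
  by (simp add: skew_nth_simps skew_const_def skew_X_def)

definition e_coeff :: "int \<Rightarrow> complex \<Rightarrow> 'n::finite zring" where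
  "e_coeff i a = (if i < 0 then 0 else skew_nth (E_series a) (nat i))"

text \<open>
  Partitions are functions on the positive integers; the value at 0 is never used.
\<close>

definition is_partition :: "(nat \<Rightarrow> nat) \<Rightarrow> bool" where
  "is_partition lam \<longleftrightarrow> (\<forall>i\<ge>1. lam (i + 1) \<le> lam i) \<and> finite {i. 1 \<le> i \<and> lam i \<noteq> 0}"

definition conjugate_partition :: "(nat \<Rightarrow> nat) \<Rightarrow> nat \<Rightarrow> nat" where
  "conjugate_partition lam j = card {i. 1 \<le> i \<and> j \<le> lam i}"

definition skew_diagram :: "(nat \<Rightarrow> nat) \<Rightarrow> (nat \<Rightarrow> nat) \<Rightarrow> bool" where
  "skew_diagram lam mu \<longleftrightarrow>
     is_partition lam \<and> is_partition mu \<and> (\<forall>i\<ge>1. mu i \<le> lam i)"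

definition chi_det :: "(nat \<Rightarrow> nat) \<Rightarrow> (nat \<Rightarrow> nat) \<Rightarrow> complex \<Rightarrow> 'n::finite zring" where
  "chi_det lam mu a =
     (let l = lam 1;
          lam' = (\<lambda>i. int (conjugate_partition lam i));
          mu' = (\<lambda>j. int (conjugate_partition mu j));
          entry = (\<lambda>i j. e_coeff (lam' i - mu' j - int i + int j)
                           (a - 2 * of_int (mu' j - int j + 1)))
      in det (mat l l (\<lambda>(r, c). entry (r + 1) (c + 1))))"


section \<open>Paths\<close>

type_synonym point = "int \<times> int"

fun ht :: "point \<Rightarrow> int" where
  "ht (x, y) = x + y"

fun hp :: "point \<Rightarrow> real" where
  "hp (x, y) = of_int (x - y) / 2"

fun NE_step :: "point \<Rightarrow> point \<Rightarrow> bool" where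
  "NE_step (x, y) w \<longleftrightarrow> w = (x + 1, y)"

fun NW_step :: "point \<Rightarrow> point \<Rightarrow> bool" where
  "NW_step (x, y) w \<longleftrightarrow> w = (x, y + 1)"

fun E_step :: "point \<Rightarrow> point \<Rightarrow> bool" where
  "E_step (x, y) w \<longleftrightarrow> w = (x + 1, y - 1)"

text \<open>
  A path is the list of its lattice points; step \<open>k\<close> leads from \<open>p ! k\<close> to \<open>p ! Suc k\<close>.
\<close>

type_synonym path = "point list"

definition E_steps :: "path \<Rightarrow> nat set" where
  "E_steps p = {k. Suc k < length p \<and> E_step (p ! k) (p ! Suc k)}"

definition NE_steps :: "path \<Rightarrow> nat set" where
  "NE_steps p = {k. Suc k < length p \<and> NE_step (p ! k) (p ! Suc k)}"

definition is_path :: "nat \<Rightarrow> path \<Rightarrow> bool" where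
  "is_path n p \<longleftrightarrow>
     p \<noteq> [] \<and> ht (hd p) = - int n \<and> ht (last p) = int n \<and>
     (\<forall>k. Suc k < length p \<longrightarrow>
        NE_step (p ! k) (p ! Suc k) \<or> NW_step (p ! k) (p ! Suc k) \<or>
        E_step (p ! k) (p ! Suc k) \<and> ht (p ! k) = 0) \<and>
     even (card (E_steps p))"

text \<open>An E-step is the 2nd, 4th, ... one iff the number of E-steps up to and including it is even.\<close>

definition step_label :: "nat \<Rightarrow> path \<Rightarrow> nat \<Rightarrow> letter" where
  "step_label n p k =
     (let m = ht (p ! k) in
      if m < 0 then Unbarred (nat (int n + 1 + m))
      else if m = 0 \<and> k \<in> E_steps p \<and> even (card (E_steps p \<inter> {..k})) then Unbarred n
      else Barred (nat (int n - m)))"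

definition path_weight :: "complex \<Rightarrow> path \<Rightarrow> 'n::finite zring" where
  "path_weight a p =
     (\<Prod>k\<in>NE_steps p \<union> E_steps p. zgen (step_label CARD('n) p k) (a - 2 * of_int (fst (p ! k))))"

definition tuple_weight :: "nat \<Rightarrow> complex \<Rightarrow> (nat \<Rightarrow> path) \<Rightarrow> 'n::finite zring" where
  "tuple_weight l a p = (\<Prod>i=1..l. path_weight a (p i))"

definition start_point :: "nat \<Rightarrow> (nat \<Rightarrow> nat) \<Rightarrow> nat \<Rightarrow> point" where
  "start_point n mu i =
     (let m = int (conjugate_partition mu i) in (m + 1 - int i, - int n - m - 1 + int i))"

definition end_point :: "nat \<Rightarrow> (nat \<Rightarrow> nat) \<Rightarrow> nat \<Rightarrow> point" where
  "end_point n lam i =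
     (let m = int (conjugate_partition lam i) in (m + 1 - int i, int n - m - 1 + int i))"

definition leftmost_hp0 :: "path \<Rightarrow> real" where
  "leftmost_hp0 p = Min (hp ` {w \<in> set p. ht w = 0})"

definition intersecting :: "path \<Rightarrow> path \<Rightarrow> bool" where
  "intersecting p q \<longleftrightarrow> set p \<inter> set q \<noteq> {}"

definition specially_intersecting :: "path \<Rightarrow> path \<Rightarrow> bool" where
  "specially_intersecting p q \<longleftrightarrow>
     intersecting p q \<and> (\<forall>w\<in>set p \<inter> set q. ht w = 0) \<and>
     (\<exists>d::int. odd d \<and> leftmost_hp0 p - leftmost_hp0 q = of_int d)"

definition ordinarily_intersecting :: "path \<Rightarrow> path \<Rightarrow> bool" where
  "ordinarily_intersecting p q \<longleftrightarrow> intersecting p q \<and> \<not> specially_intersecting p q"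


section \<open>Odd II-regions\<close>

text \<open>
  Removing the E-steps cuts a path into its lower part, which ends in the first point of height 0,
  and its upper part, which begins in the last point of height 0.
\<close>

definition lower_part :: "path \<Rightarrow> path" where
  "lower_part p = filter (\<lambda>w. ht w < 0) p @ [hd (filter (\<lambda>w. ht w = 0) p)]"

definition upper_part :: "path \<Rightarrow> path" where
  "upper_part p = last (filter (\<lambda>w. ht w = 0) p) # filter (\<lambda>w. ht w > 0) p"

definition hp_at :: "path \<Rightarrow> int \<Rightarrow> real" where
  "hp_at p r = (THE x. \<exists>w\<in>set p. ht w = r \<and> hp w = x)"

definition alpha :: "(nat \<Rightarrow> path) \<Rightarrow> nat \<Rightarrow> int \<Rightarrow> real" where
  "alpha p i r = hp_at (lower_part (p i)) r"

definition beta :: "(nat \<Rightarrow> path) \<Rightarrow> nat \<Rightarrow> int \<Rightarrow> real" where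
  "beta p i r = hp_at (upper_part (p i)) r"

definition alpha_dual :: "(nat \<Rightarrow> path) \<Rightarrow> nat \<Rightarrow> int \<Rightarrow> real" where
  "alpha_dual p i r = alpha p i (- r) - 1"

definition beta_dual :: "(nat \<Rightarrow> path) \<Rightarrow> nat \<Rightarrow> int \<Rightarrow> real" where
  "beta_dual p i r = beta p i (- r) + 1"

datatype strip = Plus | Minus

fun in_strip :: "nat \<Rightarrow> strip \<Rightarrow> point \<Rightarrow> bool" where
  "in_strip n Plus w \<longleftrightarrow> 0 \<le> ht w \<and> ht w \<le> int n"
| "in_strip n Minus w \<longleftrightarrow> - int n \<le> ht w \<and> ht w \<le> 0"

text \<open>
  A unit is given by its strip and its left vertex.  The unit square with left vertex \<open>(x, y)\<close> has
  the corners \<open>(x, y)\<close> (left), \<open>(x + 1, y - 1)\<close> (right), \<open>(x + 1, y)\<close> (top) and \<open>(x, y - 1)\<close>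
  (bottom); when its horizontal diagonal is on the boundary of the strip, only the half in the
  strip is taken, and one of the last two corners is lost.
\<close>

type_synonym tile = "strip \<times> point"

definition tiles :: "nat \<Rightarrow> tile set" where
  "tiles n = {(s, w). in_strip n s w}"

fun tile_ht :: "tile \<Rightarrow> int" where
  "tile_ht (s, w) = ht w"

fun side_vertices :: "tile \<Rightarrow> point set" where
  "side_vertices (s, (x, y)) = {(x, y), (x + 1, y - 1)}"

fun vertices :: "nat \<Rightarrow> tile \<Rightarrow> point set" where
  "vertices n (s, (x, y)) =
     {w \<in> {(x, y), (x + 1, y - 1), (x + 1, y), (x, y - 1)}. in_strip n s w}"

text \<open>
  Regions live in the disjoint union of the two strips: a point of height 0 of the upper strip is
  not identified with the same point of the lower strip, so adjacent units are in the same strip.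
  Identifying them would join the units of a hole to boundary II-units at height 0 (already for
  \<open>n = 1\<close>, \<open>\<lambda> = (2)\<close>, \<open>\<mu> = ()\<close>, where the path formula would then fail).
\<close>

definition adjacent :: "nat \<Rightarrow> tile \<Rightarrow> tile \<Rightarrow> bool" where
  "adjacent n U W \<longleftrightarrow>
     fst U = fst W \<and>
     (side_vertices U \<inter> vertices n W \<noteq> {} \<or> side_vertices W \<inter> vertices n U \<noteq> {})"

text \<open>
  The disjuncts \<open>i = l\<close> and \<open>i = 0\<close> encode \<open>\<beta>\<^bsub>l+1\<^esub> = -\<infinity>\<close> and \<open>\<alpha>\<^bsub>0\<^esub> = +\<infinity>\<close>, also for the duals.
\<close>

fun II_cond :: "nat \<Rightarrow> (nat \<Rightarrow> path) \<Rightarrow> nat \<Rightarrow> tile \<Rightarrow> bool" where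
  "II_cond l p i (Plus, w) \<longleftrightarrow>
     (i = l \<or> beta p (i + 1) (ht w) \<le> hp w) \<and>
     (i = 0 \<or> hp w + 1 \<le> alpha_dual p i (ht w))"
| "II_cond l p i (Minus, w) \<longleftrightarrow>
     (i = l \<or> beta_dual p (i + 1) (ht w) \<le> hp w) \<and>
     (i = 0 \<or> hp w + 1 \<le> alpha p i (ht w))"

definition II_tiles :: "nat \<Rightarrow> nat \<Rightarrow> (nat \<Rightarrow> path) \<Rightarrow> tile set" where
  "II_tiles n l p = {U \<in> tiles n. \<exists>i\<le>l. II_cond l p i U}"

definition boundary_II_tile :: "nat \<Rightarrow> nat \<Rightarrow> (nat \<Rightarrow> path) \<Rightarrow> tile \<Rightarrow> bool" where
  "boundary_II_tile n l p U \<longleftrightarrow>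
     U \<in> II_tiles n l p \<and> (II_cond l p 0 U \<or> II_cond l p l U \<or> \<bar>tile_ht U\<bar> = int n)"

text \<open>Components and regions are represented by the set of their units.\<close>

definition II_connected :: "nat \<Rightarrow> nat \<Rightarrow> (nat \<Rightarrow> path) \<Rightarrow> (tile \<times> tile) set" where
  "II_connected n l p =
     {(U, W). U \<in> II_tiles n l p \<and> W \<in> II_tiles n l p \<and>
        equivclp (\<lambda>U W. U \<in> II_tiles n l p \<and> W \<in> II_tiles n l p \<and> adjacent n U W) U W}"

definition II_components :: "nat \<Rightarrow> nat \<Rightarrow> (nat \<Rightarrow> path) \<Rightarrow> tile set set" where
  "II_components n l p = II_tiles n l p // II_connected n l p"

definition II_regions :: "nat \<Rightarrow> nat \<Rightarrow> (nat \<Rightarrow> path) \<Rightarrow> tile set set" where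
  "II_regions n l p =
     {V \<in> II_components n l p. (\<exists>U\<in>V. tile_ht U = 0) \<and> (\<forall>U\<in>V. \<not> boundary_II_tile n l p U)}"

definition even_hole :: "(nat \<Rightarrow> path) \<Rightarrow> nat \<Rightarrow> bool" where
  "even_hole p i \<longleftrightarrow>
     (\<exists>d::int. d > 0 \<and> even d \<and> alpha p i 0 - beta p (i + 1) 0 = of_int d)"

text \<open>A lattice point lies in a unit iff it is one of its vertices.\<close>

definition hole_meets :: "nat \<Rightarrow> (nat \<Rightarrow> path) \<Rightarrow> nat \<Rightarrow> tile set \<Rightarrow> bool" where
  "hole_meets n p i V \<longleftrightarrow>
     (\<exists>w. (Minus, w) \<in> V \<and> last (lower_part (p i)) \<in> vertices n (Minus, w)) \<or>
     (\<exists>w. (Plus, w) \<in> V \<and> hd (upper_part (p (i + 1))) \<in> vertices n (Plus, w))"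

definition odd_II_region :: "nat \<Rightarrow> nat \<Rightarrow> (nat \<Rightarrow> path) \<Rightarrow> tile set \<Rightarrow> bool" where
  "odd_II_region n l p V \<longleftrightarrow>
     V \<in> II_regions n l p \<and> odd (card {i \<in> {1..<l}. even_hole p i \<and> hole_meets n p i V})"

definition path_tuples :: "nat \<Rightarrow> (nat \<Rightarrow> nat) \<Rightarrow> (nat \<Rightarrow> nat) \<Rightarrow> (nat \<Rightarrow> path) set" where
  "path_tuples n lam mu =
     {p \<in> (\<Pi>\<^sub>E i\<in>{1..lam 1}. {q. is_path n q \<and> hd q = start_point n mu i \<and> last q = end_point n lam i}).
        (\<forall>i\<in>{1..<lam 1}. \<not> ordinarily_intersecting (p i) (p (i + 1))) \<and>
        \<not> (\<exists>V. odd_II_region n (lam 1) p V)}"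

end

theory Submission
  imports Defs
begin

text \<open>
  Expanding the determinant row by row along the linear factors of \<open>E_series\<close> turns it into a sum over
  pairs of non-intersecting families, one of upper paths and one of dual lower paths, in which the
  middle factor contributes a minor of the 0/1-kernel \<open>hop\<close> with a sign.  By the relations of the ring,
  the weight of such a pair depends only on the union, at every height, of the vertices of the two
  families.  So it suffices to show, for a fixed union, that the signed number of pairs is the number of
  pairs satisfying the conditions of the path formula.

  With the union fixed, a pair is a height function on a strip: at every point, the number of upper
  minus the number of dual lower paths further right, minus one.  Its II-units are the points with
  negative value; at the top there are no positive values.  When the strip is
  swept from the top to the bottom, the number of extensions of a given bottom row changes by the cup
  and cap operators of the Temperley-Lieb algebra.  Hence, as a function of the word of values along the
  bottom row, it is a planar function: a multiple of an indicator of one nonpositive word, followed by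
  cups.  Induction over the cups gives a dichotomy.  Either the signed sum is the sum over admissible
  words and no admissible word can be flipped on a set of odd size, or the signed sum vanishes and all
  admissible words are negative on a common set of odd size that can be flipped, which is an odd II-region.
\<close>

section \<open>Planar functions on words\<close>

text \<open>Admissible words may contain arbitrarily large letters, while the signed sum only sees
  the letters -1, 0, 1. So the two sums are not compared word by word, but only after pairing with a
  planar function; this is why the counts have to be shown to be planar at all. The loop value 2 of
  the Temperley-Lieb relations is the number of neighbours of an integer. The positivity condition
  is what makes the top row nonpositive: the indicator at the start of a planar function then has no
  letter 1, and both statistics agree on it. That weights depend only on the union rests on the
  generators being units: a step weight becomes a quotient of vertex weights, and by the relations
  the vertex weights of the two families are proportional in every row. Condition (i) at height 0 is
  not a function of the union. It splits into a bound on an alternating sum, which is one, and a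
  condition on the height function, which is the admissibility of its bottom word.\<close>

text \<open>The letters are the values of a row of a height function, one for every maximal run.\<close>

definition walk :: "int list \<Rightarrow> bool" where
  "walk w \<longleftrightarrow> w \<noteq> [] \<and> hd w = - 1 \<and> successively (\<lambda>a b. \<bar>a - b\<bar> = 1) w"

text \<open>Call a pattern \<open>a, b, a\<close> with \<open>b\<close> next to \<open>a\<close> a
  spike, \<open>a\<close> its host. \<open>cup i f\<close> is supported on the words with a spike in
  positions \<open>i\<close> to \<open>i + 2\<close> and evaluates \<open>f\<close> after
  contracting it; \<open>cap\<close> is the transposed operation and sums over the two spikes that
  can be inserted. These are the Temperley-Lieb generators acting on walks, with all matrix entries
  0 or 1.\<close>

definition cup :: "nat \<Rightarrow> (int list \<Rightarrow> nat) \<Rightarrow> int list \<Rightarrow> nat" where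
  "cup i f w = (if i + 2 < length w \<and> w ! (i + 2) = w ! i \<and> \<bar>w ! (i + 1) - w ! i\<bar> = 1
     then f (take (Suc i) w @ drop (i + 3) w) else 0)"

definition cap :: "nat \<Rightarrow> (int list \<Rightarrow> 'b::comm_monoid_add) \<Rightarrow> int list \<Rightarrow> 'b" where
  "cap i f w = (if i < length w
     then \<Sum>b\<in>{w ! i - 1, w ! i + 1}. f (take (Suc i) w @ b # drop i w) else 0)"

lemma cup_append:
  "length u = i \<Longrightarrow> cup i f (u @ a # b # c # v) = (if c = a \<and> \<bar>b - a\<bar> = 1 then f (u @ a # v) else 0)"
  by (auto simp: cup_def nth_append)

lemma cup_short: "length w \<le> i + 2 \<Longrightarrow> cup i f w = 0"
  by (simp add: cup_def)

lemma cap_append: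
  "length u = i \<Longrightarrow> cap i f (u @ a # v) = (\<Sum>b\<in>{a - 1, a + 1}. f (u @ a # b # a # v))"
  by (simp add: cap_def nth_append)

lemma cap_short: "length w \<le> i \<Longrightarrow> cap i f w = 0"
  by (simp add: cap_def)

lemma split_at: "i < length w \<Longrightarrow> \<exists>u a v. w = u @ a # v \<and> length u = i"
  by (metis id_take_nth_drop length_take min.absorb4)

text \<open>A normal form without caps: \<open>pl_cap\<close> shows that caps do not lead out of it.
  The factor \<open>k\<close> absorbs closed loops and admits the zero function; the index is the
  word length.\<close>

inductive planar :: "nat \<Rightarrow> (int list \<Rightarrow> nat) \<Rightarrow> bool" where
  base: "walk w0 \<Longrightarrow> (\<forall>x\<in>set w0. x \<le> 0) \<Longrightarrow> planar (length w0) (\<lambda>w. if w = w0 then k else 0)"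
| cup: "planar m f \<Longrightarrow> i < m \<Longrightarrow> planar (m + 2) (cup i f)"

lemma walk_append3: "walk (u @ a # b # a # v) \<longleftrightarrow> walk (u @ a # v) \<and> \<bar>b - a\<bar> = 1"
  by (cases u) (auto simp: walk_def successively_append_iff successively_Cons hd_append split: if_splits)

lemma pl_supp: "planar m f \<Longrightarrow> f w \<noteq> 0 \<Longrightarrow> walk w \<and> length w = m"
proof (induction arbitrary: w rule: planar.induct)
  case (base w0 k)
  then show ?case by (auto split: if_splits)
next
  case (cup m f i)
  then have "i + 2 < length w" by (auto simp: cup_def split: if_splits)
  then obtain u a v where w: "w = u @ a # v" "length u = i" and "length v \<ge> 2" using split_at[of i w] by auto
  then obtain b c v' where v: "v = b # c # v'" by (metis Suc_le_length_iff numeral_2_eq_2)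
  with cup w have *: "c = a" "\<bar>b - a\<bar> = 1" "f (u @ a # v') \<noteq> 0" by (auto simp: cup_append split: if_splits)
  with cup.IH[of "u @ a # v'"] w v show ?case by (auto simp: walk_append3)
qed

text \<open>The rule \<open>base\<close> asks for some nonpositive walk of the given length even if
  the coefficient is 0; the descending walk \<open>-1, -2, ...\<close> serves.\<close>

lemma pl_zero:
  assumes "0 < m" shows "planar m (\<lambda>w. 0)"
proof -
  have "\<exists>w0. length w0 = m \<and> walk w0 \<and> (\<forall>x\<in>set w0. x \<le> 0)" using assms
  proof (induction m)
    case (Suc m)
    show ?case
    proof (cases "m = 0")
      case True
      then show ?thesis by (intro exI[of _ "[-1]"]) (auto simp: walk_def)
    next
      case False
      then obtain w0 where w0: "length w0 = m" "walk w0" "\<forall>x\<in>set w0. x \<le> 0" using Suc by auto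
      have "last w0 \<le> 0" using w0 False by (metis last_in_set length_0_conv)
      then have lst: "last w0 - 1 \<le> 0" by linarith
      show ?thesis using w0 False lst by (intro exI[of _ "w0 @ [last w0 - 1]"])
           (auto simp: walk_def successively_append_iff simp del: diff_le_0_iff_le diff_le_eq le_diff_eq diff_le_0_iff_le)
    qed
  qed simp
  then obtain w0 where "length w0 = m" "walk w0" "\<forall>x\<in>set w0. x \<le> 0" by auto
  then show ?thesis using planar.base[of w0 0] by simp
qed

text \<open>Closing a cup by the cap at the same place makes a loop, whose value is 2 because the
  host has the two neighbours \<open>a - 1\<close> and \<open>a + 1\<close>.\<close>

lemma cap_cup_same:
  assumes "i < m" "planar m f"
  shows "cap i (cup i f) = (\<lambda>w. 2 * f w)"
proof
  fix w
  show "cap i (cup i f) w = 2 * f w"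
  proof (cases "i < length w")
    case True
    then obtain u a v where "w = u @ a # v" "length u = i" using split_at by blast
    then show ?thesis by (simp add: cap_append cup_append)
  next
    case False
    then show ?thesis using pl_supp[OF assms(2), of w] assms by (auto simp: cap_short)
  qed
qed

lemma walk_step: "walk (u @ a # b # v) \<Longrightarrow> \<bar>a - b\<bar> = 1"
  by (auto simp: walk_def successively_append_iff)

text \<open>Straightening of a zigzag: the cup demands that the inserted letter equal the following
  letter, so one of the two summands survives. If none can survive, the word is not a walk or too
  short, and \<open>f\<close> vanishes by \<open>pl_supp\<close>.\<close>

lemma cap_cup_Suc:
  assumes "Suc i < m" "planar m f"
  shows "cap i (cup (Suc i) f) = f"
proof
  fix w
  show "cap i (cup (Suc i) f) w = f w"
  proof (cases "Suc i < length w")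
    case True
    then obtain u a v where w: "w = u @ a # v" and l: "length u = i" and "v \<noteq> []"
      using split_at[of i w] by auto
    then obtain c v' where v: "v = c # v'" by (cases v) auto
    have "cap i (cup (Suc i) f) w = (\<Sum>b\<in>{a - 1, a + 1}. cup (Suc i) f ((u @ [a]) @ b # a # c # v'))"
      by (simp add: w v cap_append l)
    also have "\<dots> = (\<Sum>b\<in>{a - 1, a + 1}. if c = b \<and> \<bar>a - b\<bar> = 1 then f ((u @ [a]) @ b # v') else 0)"
      by (subst cup_append) (simp_all add: l)
    also have "\<dots> = f w"
    proof (cases "\<bar>a - c\<bar> = 1")
      case False
      then have "\<not> walk w" using walk_step[of u a c v'] by (auto simp: w v)
      then have "f w = 0" using pl_supp[OF assms(2)] by auto
      with False show ?thesis by auto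
    next
      case True
      then have "c = a - 1 \<or> c = a + 1" by arith
      then show ?thesis by (auto simp: w v)
    qed
    finally show ?thesis .
  next
    case False
    then have "f w = 0" using pl_supp[OF assms(2), of w] assms(1) by auto
    moreover have "cap i (cup (Suc i) f) w = 0"
    proof (cases "i < length w")
      case True
      then show ?thesis using False by (auto simp: cap_def cup_short)
    qed (simp add: cap_short)
    ultimately show ?thesis by simp
  qed
qed

text \<open>The mirror-image zigzag: here the inserted letter must equal the letter before its
  host.\<close>

lemma cap_Suc_cup:
  assumes "Suc i < m" "planar m f"
  shows "cap (Suc i) (cup i f) = f"
proof
  fix w
  show "cap (Suc i) (cup i f) w = f w"
  proof (cases "Suc i < length w")
    case True
    then obtain u a v where w: "w = u @ a # v" and l: "length u = i" and "v \<noteq> []"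
      using split_at[of i w] by auto
    then obtain c v' where v: "v = c # v'" by (cases v) auto
    have w': "w = (u @ [a]) @ c # v'" by (simp add: w v)
    have "cap (Suc i) (cup i f) w = (\<Sum>b\<in>{c - 1, c + 1}. cup i f (u @ a # c # b # c # v'))"
      unfolding w' by (subst cap_append) (simp_all add: l)
    also have "\<dots> = (\<Sum>b\<in>{c - 1, c + 1}. if b = a \<and> \<bar>c - a\<bar> = 1 then f (u @ a # c # v') else 0)"
      by (subst cup_append) (simp_all add: l)
    also have "\<dots> = f w"
    proof (cases "\<bar>a - c\<bar> = 1")
      case False
      then have "\<not> walk w" using walk_step[of u a c v'] by (auto simp: w v)
      then have "f w = 0" using pl_supp[OF assms(2)] by auto
      with False show ?thesis by auto
    next
      case True
      then have "a = c - 1 \<or> a = c + 1" by arith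
      then show ?thesis by (auto simp: w v)
    qed
    finally show ?thesis .
  next
    case False
    then have "f w = 0" using pl_supp[OF assms(2), of w] assms(1) by auto
    then show ?thesis using False by (simp add: cap_short)
  qed
qed

text \<open>The two operations act at separate places. The index of the cup changes by 2 because a
  spike is inserted on its left. In the case \<open>d = 0\<close> the two spikes share the letter
  \<open>a\<close>.\<close>

lemma cap_cup_less:
  assumes "Suc i < j"
  shows "cap i (cup j f) = cup (j - 2) (cap i f)"
proof
  fix w
  obtain d where d: "j = i + 2 + d" using assms less_iff_Suc_add by fastforce
  show "cap i (cup j f) w = cup (j - 2) (cap i f) w"
  proof (cases "j < length w")
    case True
    then obtain u a v where w: "w = u @ a # v" and l: "length u = i" and "d + 1 < length v"
      using split_at[of i w] d by auto
    then obtain v1 p where v: "v = v1 @ p" and lv: "length v1 + 1 = d \<or> (d = 0 \<and> v1 = [])" and lp: "2 \<le> length p" "d > 0 \<Longrightarrow> 3 \<le> length p"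
      by (rule_tac that[of "take (d - 1) v" "drop (d - 1) v"]) auto
    show ?thesis
    proof (cases "d = 0")
      case True
      then have "v1 = []" using lv by auto
      then obtain b c v' where v: "v = b # c # v'" using lp v
        by (metis Suc_le_length_iff append_Nil numeral_2_eq_2)
      have "cap i (cup j f) w = (\<Sum>z\<in>{a - 1, a + 1}. cup j f ((u @ [a, z]) @ a # b # c # v'))"
        by (simp add: w v cap_append l)
      also have "\<dots> = (\<Sum>z\<in>{a - 1, a + 1}. if c = a \<and> \<bar>b - a\<bar> = 1 then f ((u @ [a, z]) @ a # v') else 0)"
        by (subst cup_append) (simp_all add: l d True)
      also have "\<dots> = cup (j - 2) (cap i f) w" by (simp add: w v d True l cup_append cap_append)
      finally show ?thesis .
    next
      case False
      then obtain x b c v' where p: "p = x # b # c # v'" using lp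
        by (metis Suc_le_length_iff numeral_3_eq_3 not_gr_zero)
      have lv: "length v1 + 1 = d" using lv False by auto
      have "cap i (cup j f) w = (\<Sum>z\<in>{a - 1, a + 1}. cup j f ((u @ [a, z, a] @ v1) @ x # b # c # v'))"
        by (simp add: w v p cap_append l)
      also have "\<dots> = (\<Sum>z\<in>{a - 1, a + 1}. if c = x \<and> \<bar>b - x\<bar> = 1 then f ((u @ [a, z, a] @ v1) @ x # v') else 0)"
        by (subst cup_append) (use lv in \<open>simp_all add: l d\<close>)
      also have "\<dots> = cup (j - 2) (cap i f) ((u @ a # v1) @ x # b # c # v')"
        by (subst cup_append) (use lv in \<open>simp_all add: l d cap_append\<close>)
      finally show ?thesis by (simp add: w v p)
    qed
  next
    case False
    have "cup (j - 2) (cap i f) w = 0" using False assms by (intro cup_short) linarith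
    moreover have "cap i (cup j f) w = 0"
    proof (cases "i < length w")
      case True
      then show ?thesis using False by (auto simp: cap_def cup_short)
    qed (simp add: cap_short)
    ultimately show ?thesis by simp
  qed
qed

text \<open>Mirror image of \<open>cap_cup_less\<close>: now the cap is shifted, by the spike that
  the cup contracts on its left.\<close>

lemma cap_cup_greater:
  assumes "Suc j < i" "planar m f"
  shows "cap i (cup j f) = cup j (cap (i - 2) f)"
proof
  fix w
  obtain d where d: "i = j + 2 + d" using assms less_iff_Suc_add by fastforce
  show "cap i (cup j f) w = cup j (cap (i - 2) f) w"
  proof (cases "j + 2 < length w")
    case False
    have "cup j (cap (i - 2) f) w = 0" using False by (intro cup_short) simp
    then show ?thesis using False d by (simp add: cap_short)
  next
    case True
    then obtain u a v where w: "w = u @ a # v" and l: "length u = j" and "2 \<le> length v"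
      using split_at[of j w] by auto
    then obtain b c v' where v: "v = b # c # v'" by (metis Suc_le_length_iff numeral_2_eq_2)
    show ?thesis
    proof (cases "d = 0")
      case True
      have "cap i (cup j f) w = cap i (cup j f) ((u @ [a, b]) @ c # v')" by (simp add: w v)
      also have "\<dots> = (\<Sum>z\<in>{c - 1, c + 1}. cup j f (u @ a # b # c # z # c # v'))"
        by (subst cap_append) (simp_all add: l d True)
      also have "\<dots> = (\<Sum>z\<in>{c - 1, c + 1}. if c = a \<and> \<bar>b - a\<bar> = 1 then f (u @ a # z # c # v') else 0)"
        by (subst cup_append) (simp_all add: l)
      also have "\<dots> = cup j (cap (i - 2) f) w" by (auto simp add: w v d True l cup_append cap_append)
      finally show ?thesis .
    next
      case False
      show ?thesis
      proof (cases "d \<le> length v'")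
        case dl: False
        have "cap i (cup j f) w = 0" using dl by (simp add: cap_short w v l d)
        moreover have "cup j (cap (i - 2) f) w = 0" using dl by (simp add: w v cup_append l cap_short d)
        ultimately show ?thesis by simp
      next
        case dl: True
        then obtain v1 x v2 where v': "v' = v1 @ x # v2" and lv: "length v1 = d - 1"
          using split_at[of "d - 1" v'] False dl by force
        have "cap i (cup j f) w = cap i (cup j f) ((u @ [a, b, c] @ v1) @ x # v2)" by (simp add: w v v')
        also have "\<dots> = (\<Sum>z\<in>{x - 1, x + 1}. cup j f (u @ a # b # c # v1 @ x # z # x # v2))"
          by (subst cap_append) (use False lv in \<open>simp_all add: l d\<close>)
        also have "\<dots> = (\<Sum>z\<in>{x - 1, x + 1}. if c = a \<and> \<bar>b - a\<bar> = 1 then f ((u @ a # v1) @ x # z # x # v2) else 0)"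
          by (subst cup_append) (simp_all add: l)
        also have "\<dots> = (if c = a \<and> \<bar>b - a\<bar> = 1 then cap (i - 2) f ((u @ a # v1) @ x # v2) else 0)"
          by (subst cap_append) (use False lv in \<open>simp_all add: l d\<close>)
        also have "\<dots> = cup j (cap (i - 2) f) w" by (simp add: w v v' cup_append l)
        finally show ?thesis .
      qed
    qed
  qed
qed

lemma pl_scale: "planar m f \<Longrightarrow> planar m (\<lambda>w. c * f w)"
proof (induction rule: planar.induct)
  case (base w0 k)
  have "(\<lambda>w. c * (if w = w0 then k else 0)) = (\<lambda>w. if w = w0 then c * k else 0)" by auto
  then show ?case using planar.base[OF base, of "c * k"] by simp
next
  case (cup m f i)
  have "(\<lambda>w. c * cup i f w) = cup i (\<lambda>w. c * f w)" by (auto simp: cup_def)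
  then show ?case using planar.cup[OF cup.IH cup.hyps(2)] by simp
qed

text \<open>The cap is pushed inwards through the cups. It either meets a cup at distance at most 1,
  where a loop or a zigzag removes both, or passes it, and in the end it meets the indicator. There
  it contracts a spike of \<open>w0\<close>, or gives 0 if \<open>w0\<close> has none at
  \<open>i\<close>; contraction keeps the letters nonpositive.\<close>

lemma pl_cap: "planar m f \<Longrightarrow> i + 2 < m \<Longrightarrow> planar (m - 2) (cap i f)"
proof (induction arbitrary: i rule: planar.induct)
  case (base w0 k)
  show ?case
  proof (cases "w0 ! i = w0 ! (i + 2)")
    case True
    obtain u a v where w: "w0 = u @ a # v" and l: "length u = i" and "2 \<le> length v"
      using split_at[of i w0] base by auto
    then obtain b c v' where v: "v = b # c # v'" by (metis Suc_le_length_iff numeral_2_eq_2)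
    with True w l have c: "c = a" by (auto simp: nth_append)
    have wk: "walk (u @ a # v')" and b: "\<bar>b - a\<bar> = 1" using base w v c by (auto simp: walk_append3)
    have "cap i (\<lambda>w. if w = w0 then k else 0) = (\<lambda>w. if w = u @ a # v' then k else 0)"
    proof
      fix w'
      show "cap i (\<lambda>w. if w = w0 then k else 0) w' = (if w' = u @ a # v' then k else 0)"
      proof (cases "i < length w'")
        case True
        then obtain u1 a1 v1 where w1: "w' = u1 @ a1 # v1" "length u1 = i" using split_at by blast
        have "b = a - 1 \<or> b = a + 1" using b by arith
        then show ?thesis using w1 l by (auto simp: cap_append w v c)
      next
        case False
        then show ?thesis using l by (auto simp: cap_short)
      qed
    qed
    then show ?thesis using planar.base[OF wk, of k] base w v c by auto
  next
    case False
    have "cap i (\<lambda>w. if w = w0 then k else 0) = (\<lambda>w. 0)"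
    proof
      fix w'
      show "cap i (\<lambda>w. if w = w0 then k else 0) w' = 0"
      proof (cases "i < length w'")
        case True
        then obtain u1 a1 v1 where w1: "w' = u1 @ a1 # v1" "length u1 = i" using split_at by blast
        then show ?thesis using False by (auto simp: cap_append nth_append)
      qed (simp add: cap_short)
    qed
    then show ?thesis using base pl_zero[of "length w0 - 2"] by simp
  qed
next
  case (cup m f j)
  consider "i = j" | "Suc i = j" | "i = Suc j" | "Suc i < j" | "Suc j < i" by linarith
  then show ?case
  proof cases
    case 1
    then show ?thesis using cap_cup_same[OF cup.hyps(2,1)] pl_scale[OF cup.hyps(1)] by simp
  next
    case 2
    then show ?thesis using cap_cup_Suc[of i m f] cup by simp
  next
    case 3
    then show ?thesis using cap_Suc_cup[of j m f] cup by simp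
  next
    case 4
    then have "planar (m - 2 + 2) (cup (j - 2) (cap i f))" using cup by (intro planar.cup) auto
    moreover have "m - 2 + 2 = m" using cup 4 by simp
    ultimately show ?thesis using 4 by (simp add: cap_cup_less)
  next
    case 5
    then have "planar (m - 2 + 2) (cup j (cap (i - 2) f))" using cup by (intro planar.cup) auto
    moreover have "m - 2 + 2 = m" using cup 5 by simp
    ultimately show ?thesis using cap_cup_greater[OF 5 cup.hyps(1)] by simp
  qed
qed

section \<open>Inserting spikes into words; run lengths\<close>

definition walks :: "nat \<Rightarrow> int list set" where
  "walks m = {w. walk w \<and> length w = m}"

definition graft :: "nat \<Rightarrow> int \<Rightarrow> int list \<Rightarrow> int list" where
  "graft i b w = take (Suc i) w @ b # drop i w"

text \<open>Run lengths after contracting a spike at \<open>i\<close>: the runs \<open>i\<close> and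
  \<open>i + 2\<close> carry the same letter and become one, and the run of the spike letter is
  dropped.\<close>

definition merge :: "nat \<Rightarrow> (nat \<Rightarrow> nat) \<Rightarrow> nat \<Rightarrow> nat" where
  "merge i s k = (if k < i then s k else if k = i then s i + s (i + 2) else s (k + 2))"

lemma walk_bound: "walk w \<Longrightarrow> k < length w \<Longrightarrow> \<bar>w ! k\<bar> \<le> int k + 1"
proof (induction k)
  case 0
  then show ?case by (auto simp: walk_def hd_conv_nth[symmetric])
next
  case (Suc k)
  then have "\<bar>w ! k - w ! Suc k\<bar> = 1" unfolding walk_def by (meson successively_nth)
  with Suc show ?case by auto
qed

text \<open>A walk starts at -1 and every step changes the parity. Hence the index of a cup tells
  its kind: at odd \<open>i\<close> the host is even and the spike letter odd.\<close>

lemma walk_parity: "walk w \<Longrightarrow> k < length w \<Longrightarrow> even (w ! k) \<longleftrightarrow> odd k"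
proof (induction k)
  case 0
  then show ?case by (auto simp: walk_def hd_conv_nth[symmetric])
next
  case (Suc k)
  then have "\<bar>w ! k - w ! Suc k\<bar> = 1" unfolding walk_def by (meson successively_nth)
  then have "w ! Suc k = w ! k + 1 \<or> w ! Suc k = w ! k - 1" by arith
  with Suc show ?case by auto
qed

lemma finite_walks: "finite (walks m)"
proof (rule finite_subset)
  show "walks m \<subseteq> {w. set w \<subseteq> {- int m..int m} \<and> length w = m}"
  proof
    fix w assume w: "w \<in> walks m"
    have "set w \<subseteq> {- int m..int m}"
    proof
      fix x assume "x \<in> set w"
      then obtain k where "k < m" "x = w ! k" using w by (auto simp: walks_def in_set_conv_nth)
      then show "x \<in> {- int m..int m}" using walk_bound[of w k] w by (auto simp: walks_def)
    qed
    then show "w \<in> {w. set w \<subseteq> {- int m..int m} \<and> length w = m}" using w by (auto simp: walks_def)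
  qed
  show "finite {w. set w \<subseteq> {- int m..int m} \<and> length w = m}" by (rule finite_lists_length_eq) simp
qed

lemma graft_append: "length u = i \<Longrightarrow> graft i b (u @ a # v) = u @ a # b # a # v"
  by (simp add: graft_def)

lemma graft_nth:
  assumes "i < length w"
  shows "graft i b w ! k = (if k \<le> i then w ! k else if k = Suc i then b else w ! (k - 2))"
proof -
  obtain u a v where w: "w = u @ a # v" "length u = i" using split_at assms by blast
  show ?thesis
  proof (cases "i + 2 \<le> k")
    case True
    then obtain d where "k = i + 2 + d" using le_Suc_ex by blast
    then show ?thesis using w by (auto simp: graft_append nth_append nth_Cons split: nat.split)
  next
    case False
    then consider "k < i" | "k = i" | "k = Suc i" by linarith
    then show ?thesis by cases (use w in \<open>auto simp: graft_append nth_append\<close>)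
  qed
qed

lemma length_graft: "i < length w \<Longrightarrow> length (graft i b w) = length w + 2"
  using split_at[of i w] by (auto simp: graft_append)

lemma graft_walks:
  assumes "w \<in> walks m" "i < m" "\<bar>b - w ! i\<bar> = 1"
  shows "graft i b w \<in> walks (m + 2)"
proof -
  obtain u a v where w: "w = u @ a # v" "length u = i" using split_at[of i w] assms by (auto simp: walks_def)
  then show ?thesis using assms by (auto simp: graft_append walks_def walk_append3)
qed

lemma set_graft: "i < length w \<Longrightarrow> set (graft i b w) = insert b (set w)"
proof -
  assume "i < length w"
  then obtain u a v where w: "w = u @ a # v" "length u = i" using split_at by blast
  then show ?thesis by (auto simp: graft_append)
qed

lemma cup_graft:
  "i < length w \<Longrightarrow> \<bar>b - w ! i\<bar> = 1 \<Longrightarrow> cup i f (graft i b w) = f w"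
proof -
  assume *: "i < length w" "\<bar>b - w ! i\<bar> = 1"
  then obtain u a v where w: "w = u @ a # v" "length u = i" using split_at by blast
  then show ?thesis using * by (auto simp: graft_append cup_append)
qed

lemma cup_nonzeroE:
  assumes "cup i f w \<noteq> 0" "planar m f"
  obtains w0 b where "w0 \<in> walks m" "i < m" "\<bar>b - w0 ! i\<bar> = 1" "w = graft i b w0" "f w0 = cup i f w"
proof -
  have "i + 2 < length w" using assms by (auto simp: cup_def split: if_splits)
  then obtain u a v where w: "w = u @ a # v" "length u = i" and "2 \<le> length v" using split_at[of i w] by auto
  then obtain b c v' where v: "v = b # c # v'" by (metis Suc_le_length_iff numeral_2_eq_2)
  have *: "c = a" "\<bar>b - a\<bar> = 1" "f (u @ a # v') \<noteq> 0"
    using assms w v by (auto simp: cup_append split: if_splits)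
  show ?thesis by (rule that[of "u @ a # v'" b])
       (use * pl_supp[OF assms(2) *(3)] w v in \<open>auto simp: walks_def graft_append cup_append\<close>)
qed

text \<open>Transposition of a cup: \<open>graft i\<close> is injective on pairs of a word and a
  neighbour of its letter \<open>i\<close>, and its image contains the support of
  \<open>cup i f\<close>.\<close>

lemma sum_cup:
  fixes g :: "int list \<Rightarrow> int"
  assumes "planar m f" "i < m"
  shows "(\<Sum>w\<in>walks (m + 2). g w * int (cup i f w))
    = (\<Sum>w\<in>walks m. (\<Sum>b\<in>{w ! i - 1, w ! i + 1}. g (graft i b w)) * int (f w))"
proof -
  let ?P = "SIGMA w:walks m. {w ! i - 1, w ! i + 1}"
  have "(\<Sum>w\<in>walks m. (\<Sum>b\<in>{w ! i - 1, w ! i + 1}. g (graft i b w)) * int (f w))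
      = (\<Sum>(w, b)\<in>?P. g (graft i b w) * int (f w))"
    by (subst sum.Sigma[symmetric]) (auto simp: finite_walks distrib_right)
  also have "\<dots> = (\<Sum>w\<in>(\<lambda>(w, b). graft i b w) ` ?P. g w * int (cup i f w))"
  proof (subst sum.reindex)
    show "inj_on (\<lambda>(w, b). graft i b w) ?P"
    proof (rule inj_onI, clarify)
      fix w b w' b'
      assume *: "w \<in> walks m" "w' \<in> walks m" "graft i b w = graft i b' w'"
      then obtain u a v u' a' v' where "w = u @ a # v" "length u = i" "w' = u' @ a' # v'" "length u' = i"
        using split_at[of i w] split_at[of i w'] assms by (auto simp: walks_def)
      then show "w = w' \<and> b = b'" using * by (auto simp: graft_append)
    qed
    have "g (graft i b w) * int (f w) = g (graft i b w) * int (cup i f (graft i b w))"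
      if "(w, b) \<in> ?P" for w b using that assms by (subst cup_graft) (auto simp: walks_def)
    then show "(\<Sum>(w, b)\<in>?P. g (graft i b w) * int (f w)) =
      sum ((\<lambda>w. g w * int (cup i f w)) \<circ> (\<lambda>(w, b). graft i b w)) ?P" by (intro sum.cong) auto
  qed
  also have "\<dots> = (\<Sum>w\<in>walks (m + 2). g w * int (cup i f w))"
  proof (rule sum.mono_neutral_left)
    show "finite (walks (m + 2))" by (rule finite_walks)
    show "(\<lambda>(w, b). graft i b w) ` ?P \<subseteq> walks (m + 2)"
      using assms graft_walks[OF _ assms(2)] by auto
    show "\<forall>w\<in>walks (m + 2) - (\<lambda>(w, b). graft i b w) ` ?P. g w * int (cup i f w) = 0"
    proof clarify
      fix w assume w: "w \<in> walks (m + 2)" "w \<notin> (\<lambda>(w, b). graft i b w) ` ?P"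
      have "cup i f w = 0"
      proof (rule ccontr)
        assume "cup i f w \<noteq> 0"
        then obtain w0 b where *: "w0 \<in> walks m" "i < m" "\<bar>b - w0 ! i\<bar> = 1" "w = graft i b w0"
          using cup_nonzeroE assms by metis
        then have "b = w0 ! i - 1 \<or> b = w0 ! i + 1" by arith
        with * have "(w0, b) \<in> ?P" by auto
        with * w show False by force
      qed
      then show "g w * int (cup i f w) = 0" by simp
    qed
  qed
  finally show ?thesis by simp
qed

text \<open>The index \<open>Suc i\<close> splits off, and \<open>i\<close> and
  \<open>i + 2\<close>, where \<open>G\<close> agrees, fall together. Applied to exponents of signs,
  to lengths of flipped sets and to pulled-back index sets.\<close>

lemma sum_merge:
  assumes "i < m" "\<And>k. k \<le> i \<Longrightarrow> G k = H k" "\<And>k. i \<le> k \<Longrightarrow> k < m \<Longrightarrow> G (k + 2) = H k"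
  shows "(\<Sum>k<m + 2. s k * G k) = (\<Sum>k<m. merge i s k * H k) + s (Suc i) * (G (Suc i) :: nat)"
proof -
  have a: "{..<m + 2} = {..<i} \<union> {i, Suc i, i + 2} \<union> (\<lambda>k. k + 2) ` {Suc i..<m}"
  proof -
    have "k \<in> (\<lambda>k. k + 2) ` {Suc i..<m}" if "k < m + 2" "\<not> k < i" "k \<noteq> i" "k \<noteq> Suc i" "k \<noteq> i + 2" for k
      by (rule image_eqI[of _ _ "k - 2"]) (use that in auto)
    then show ?thesis using assms(1) by auto
  qed
  have b: "{..<m} = {..<i} \<union> {i} \<union> {Suc i..<m}" using assms(1) by auto
  have h: "G (Suc (Suc k)) = H k" if "i \<le> k" "k < m" for k using assms(3)[OF that] by simp
  have "(\<Sum>k<m + 2. s k * G k) = (\<Sum>k<i. s k * G k) + (s i * G i + s (Suc i) * G (Suc i) + s (i + 2) * G (i + 2))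
      + (\<Sum>k=Suc i..<m. s (k + 2) * G (k + 2))"
    unfolding a by (subst sum.union_disjoint; (subst sum.union_disjoint)?; (auto simp: sum.reindex inj_on_def simp del: add_2_eq_Suc add_2_eq_Suc')?)
      (use sum.shift_bounds_nat_ivl[of "\<lambda>k. s k * G k" "Suc i" 2 m] in \<open>simp add: numeral_3_eq_3\<close>)
  moreover have "(\<Sum>k<m. merge i s k * H k) = (\<Sum>k<i. s k * G k) + (s i + s (i + 2)) * H i
      + (\<Sum>k=Suc i..<m. s (k + 2) * G (k + 2))"
    unfolding b by (subst sum.union_disjoint; (subst sum.union_disjoint)?; (auto simp: merge_def assms(1,2) h intro!: sum.cong)?)
  moreover have "G i = H i" "G (i + 2) = H i" using assms by auto
  ultimately show ?thesis by (simp add: algebra_simps)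
qed

text \<open>The \<open>k\<close>-th letter stands for a run of \<open>s k\<close> equal values.\<close>

definition signed_weight :: "(nat \<Rightarrow> nat) \<Rightarrow> int list \<Rightarrow> int" where
  "signed_weight s w = (if \<forall>x\<in>set w. \<bar>x\<bar> \<le> 1
     then (- 1) ^ (\<Sum>k<length w. s k * of_bool (w ! k = 1)) else 0)"

text \<open>The word form of condition (i) at height 0, once the alternating sum
  \<open>charge\<close> is bounded; see \<open>row_matched_iff\<close> and
  \<open>bottom_admissible_iff\<close>. The first and the last letter are exempt from the second
  clause.\<close>

definition admissible :: "(nat \<Rightarrow> nat) \<Rightarrow> int list \<Rightarrow> bool" where
  "admissible s w \<longleftrightarrow> (\<forall>x\<in>set w. - 1 \<le> x) \<and> (\<forall>k. 0 < k \<and> k + 1 < length w \<and> 1 \<le> w ! k \<and> odd (w ! k) \<longrightarrow>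
        (even (s k) \<longleftrightarrow> w ! (k - 1) = w ! (k + 1)))"

lemma signed_weight_graft:
  assumes "w \<in> walks m" "i < m" "\<bar>b - w ! i\<bar> = 1"
  shows "signed_weight s (graft i b w)
    = (if \<bar>b\<bar> \<le> 1 then (- 1) ^ (s (Suc i) * of_bool (b = 1)) else 0) * signed_weight (merge i s) w"
proof -
  have l: "length w = m" using assms by (simp add: walks_def)
  have "(\<Sum>k<m + 2. s k * of_bool (graft i b w ! k = 1))
      = (\<Sum>k<m. merge i s k * of_bool (w ! k = 1)) + s (Suc i) * of_bool (graft i b w ! Suc i = 1)"
    by (rule sum_merge) (use assms l in \<open>auto simp: graft_nth\<close>)
  then show ?thesis
    using assms l by (simp add: signed_weight_def set_graft length_graft graft_nth power_add)
qed

text \<open>If the host is 0, the spikes -1 and 1 contribute 1 and the sign of the new run. Any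
  other even host has absolute value at least 2 and annihilates both sides.\<close>

lemma signed_leaf_odd:
  assumes "w \<in> walks m" "i < m" "even (w ! i)"
  shows "(\<Sum>b\<in>{w ! i - 1, w ! i + 1}. signed_weight s (graft i b w))
    = (1 + (- 1) ^ s (Suc i)) * signed_weight (merge i s) w"
proof (cases "w ! i = 0")
  case True
  then show ?thesis using assms by (simp add: signed_weight_graft algebra_simps)
next
  case False
  then have "\<not> \<bar>w ! i\<bar> \<le> 1" using assms(3) by (cases "w ! i = 1"; cases "w ! i = -1") auto
  moreover have "w ! i \<in> set w" using assms by (simp add: walks_def)
  ultimately have "signed_weight (merge i s) w = 0" by (auto simp: signed_weight_def)
  then show ?thesis using assms by (simp add: signed_weight_graft)
qed

text \<open>Of the two even neighbours of a host 1 or -1 only 0 has nonzero weight, and it carries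
  no sign. Hosts of larger absolute value annihilate both sides.\<close>

lemma signed_leaf_even:
  assumes "w \<in> walks m" "i < m" "odd (w ! i)"
  shows "(\<Sum>b\<in>{w ! i - 1, w ! i + 1}. signed_weight s (graft i b w)) = signed_weight (merge i s) w"
proof (cases "\<bar>w ! i\<bar> = 1")
  case True
  then have "w ! i = 1 \<or> w ! i = -1" by arith
  then show ?thesis using assms by (auto simp add: signed_weight_graft)
next
  case False
  then have "\<not> \<bar>w ! i\<bar> \<le> 1" using assms(3) by (cases "w ! i = 0") auto
  moreover have "w ! i \<in> set w" using assms by (simp add: walks_def)
  ultimately have "signed_weight (merge i s) w = 0" by (auto simp: signed_weight_def)
  then show ?thesis using assms by (simp add: signed_weight_graft)
qed

abbreviation turn :: "(nat \<Rightarrow> nat) \<Rightarrow> int list \<Rightarrow> nat \<Rightarrow> bool" where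
  "turn s w k \<equiv> 1 \<le> w ! k \<longrightarrow> odd (w ! k) \<longrightarrow> (even (s k) \<longleftrightarrow> w ! (k - 1) = w ! (k + 1))"

lemma admissible_alt:
  "admissible s w \<longleftrightarrow> (\<forall>x\<in>set w. - 1 \<le> x) \<and> (\<forall>k. 0 < k \<longrightarrow> k + 1 < length w \<longrightarrow> turn s w k)"
  by (auto simp: admissible_def)

text \<open>Conditions away from the spike keep their letters and neighbours. The spike letter sits
  between two copies of its host, so its own condition says that its run is even; the two copies get
  the spike letter as a neighbour.\<close>

lemma admissible_graft:
  assumes "w \<in> walks m" "i < m" "\<bar>b - w ! i\<bar> = 1"
  shows "admissible s (graft i b w) \<longleftrightarrow> (\<forall>x\<in>set w. - 1 \<le> x) \<and> - 1 \<le> b \<and>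
    (\<forall>k. 0 < k \<longrightarrow> k + 1 < m \<longrightarrow> k \<noteq> i \<longrightarrow> turn (merge i s) w k) \<and> (1 \<le> b \<longrightarrow> odd b \<longrightarrow> even (s (Suc i))) \<and>
    (1 \<le> w ! i \<longrightarrow> odd (w ! i) \<longrightarrow> (0 < i \<longrightarrow> (even (s i) \<longleftrightarrow> w ! (i - 1) = b)) \<and>
       (i + 1 < m \<longrightarrow> (even (s (i + 2)) \<longleftrightarrow> b = w ! (i + 1))))"
proof -
  have l: "length w = m" using assms by (simp add: walks_def)
  let ?w = "graft i b w"
  have n: "?w ! k = (if k \<le> i then w ! k else if k = Suc i then b else w ! (k - 2))" if "k < m + 2" for k
    using that assms l by (simp add: graft_nth)
  have "(\<forall>k. 0 < k \<longrightarrow> k + 1 < m + 2 \<longrightarrow> turn s ?w k) \<longleftrightarrow> (\<forall>k. 0 < k \<longrightarrow> k + 1 < m \<longrightarrow> k \<noteq> i \<longrightarrow> turn (merge i s) w k) \<and>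
    turn s ?w (Suc i) \<and> (0 < i \<longrightarrow> turn s ?w i) \<and> (i + 1 < m \<longrightarrow> turn s ?w (i + 2))" (is "?L \<longleftrightarrow> ?R1 \<and> ?R2")
  proof
    assume L: ?L
    have ?R1
    proof (intro allI impI)
      fix k assume k: "0 < k" "k + 1 < m" "k \<noteq> i" "1 \<le> w ! k" "odd (w ! k)"
      show "even (merge i s k) \<longleftrightarrow> w ! (k - 1) = w ! (k + 1)"
      proof (cases "k < i")
        case True
        then show ?thesis using L[rule_format, of k] k by (simp add: n merge_def)
      next
        case False
        with k(3) have "i < k" by simp
        then have "?w ! (k + 2 - 1) = w ! (k - 1)" using k by (simp add: n)
        then show ?thesis using L[rule_format, of "k + 2"] k \<open>i < k\<close> by (simp add: n merge_def)
      qed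
    qed
    then show "?R1 \<and> ?R2" using L assms(2) by simp
  next
    assume R: "?R1 \<and> ?R2"
    show ?L
    proof (intro allI impI)
      fix k assume k: "0 < k" "k + 1 < m + 2" "1 \<le> ?w ! k" "odd (?w ! k)"
      consider "k < i" | "k = i" | "k = Suc i" | "k = i + 2" | "i + 2 < k" by linarith
      then show "even (s k) \<longleftrightarrow> ?w ! (k - 1) = ?w ! (k + 1)"
      proof cases
        case 1
        then show ?thesis using R[THEN conjunct1, rule_format, of k] k assms(2) by (simp add: n merge_def)
      next
        case 5
        then obtain d where kd: "k = i + 3 + d" using less_iff_Suc_add by fastforce
        have e: "?w ! (k - 1) = w ! (i + d)" "?w ! k = w ! (i + 1 + d)" "?w ! (k + 1) = w ! (i + 2 + d)"
          using n[of "k - 1"] n[of k] n[of "k + 1"] kd k(2) by simp_all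
        have "turn (merge i s) w (i + 1 + d)"
          using R[THEN conjunct1, rule_format, of "i + 1 + d"] k(2) kd by simp
        moreover have "merge i s (i + 1 + d) = s k" by (simp add: merge_def kd numeral_3_eq_3)
        ultimately show ?thesis using k(3,4) e by simp
      next
        case 2
        then show ?thesis using R k assms(2) by auto
      next
        case 3
        then show ?thesis using R k by auto
      next
        case 4
        then show ?thesis using R k assms(2) by auto
      qed
    qed
  qed
  moreover have "turn s ?w (Suc i) \<longleftrightarrow> (1 \<le> b \<longrightarrow> odd b \<longrightarrow> even (s (Suc i)))" using assms(2) by (simp add: n)
  moreover have "(0 < i \<longrightarrow> turn s ?w i) \<longleftrightarrow> (1 \<le> w ! i \<longrightarrow> odd (w ! i) \<longrightarrow> (0 < i \<longrightarrow> (even (s i) \<longleftrightarrow> w ! (i - 1) = b)))"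
    using assms(2) by (auto simp add: n)
  moreover have "(i + 1 < m \<longrightarrow> turn s ?w (i + 2)) \<longleftrightarrow> (1 \<le> w ! i \<longrightarrow> odd (w ! i) \<longrightarrow> (i + 1 < m \<longrightarrow> (even (s (i + 2)) \<longleftrightarrow> b = w ! (i + 1))))"
    using assms(2) by (auto simp add: n)
  ultimately have "(\<forall>k. 0 < k \<longrightarrow> k + 1 < m + 2 \<longrightarrow> turn s ?w k) \<longleftrightarrow>
    (\<forall>k. 0 < k \<longrightarrow> k + 1 < m \<longrightarrow> k \<noteq> i \<longrightarrow> turn (merge i s) w k) \<and> (1 \<le> b \<longrightarrow> odd b \<longrightarrow> even (s (Suc i))) \<and>
    (1 \<le> w ! i \<longrightarrow> odd (w ! i) \<longrightarrow> (0 < i \<longrightarrow> (even (s i) \<longleftrightarrow> w ! (i - 1) = b)) \<and>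
       (i + 1 < m \<longrightarrow> (even (s (i + 2)) \<longleftrightarrow> b = w ! (i + 1))))" by argo
  moreover have "length ?w = m + 2" using assms l by (simp add: length_graft)
  moreover have "(\<forall>x\<in>set ?w. - 1 \<le> x) \<longleftrightarrow> (\<forall>x\<in>set w. - 1 \<le> x) \<and> - 1 \<le> b"
    using assms l by (simp add: set_graft conj_commute)
  ultimately show ?thesis unfolding admissible_alt by (simp only: conj_assoc)
qed

text \<open>The host is even, so its merged run carries no condition and only the spike contributes.
  An even host that is at least -1 is at least 0, so the spike is at least -1.\<close>

lemma admissible_leaf_odd:
  assumes "w \<in> walks m" "i < m" "\<bar>b - w ! i\<bar> = 1" "even (w ! i)"
  shows "admissible s (graft i b w) \<longleftrightarrow>
    admissible (merge i s) w \<and> (1 \<le> b \<longrightarrow> even (s (Suc i)))"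
proof -
  have l: "length w = m" using assms by (simp add: walks_def)
  have h1: "- 1 \<le> w ! i" if "\<forall>x\<in>set w. - 1 \<le> x" using that assms l by simp
  have h2: "odd b" using assms(3,4) by (cases "b = w ! i + 1"; cases "b = w ! i - 1") (auto simp: abs_if split: if_splits)
  have h3: "w ! i \<noteq> - 1" using assms(4) by auto
  have h4: "(\<forall>k. 0 < k \<longrightarrow> k + 1 < m \<longrightarrow> k \<noteq> i \<longrightarrow> turn (merge i s) w k) \<longleftrightarrow>
      (\<forall>k. 0 < k \<longrightarrow> k + 1 < length w \<longrightarrow> turn (merge i s) w k)" (is "?A \<longleftrightarrow> ?B")
  proof
    assume A: ?A
    show ?B
    proof (intro allI impI)
      fix k assume k: "0 < k" "k + 1 < length w" "1 \<le> w ! k" "odd (w ! k)"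
      with assms(4) have "k \<noteq> i" by auto
      with A k l show "even (merge i s k) \<longleftrightarrow> w ! (k - 1) = w ! (k + 1)" by simp
    qed
  qed (use l in simp)
  have h5: "(\<forall>x\<in>set w. - 1 \<le> x) \<longrightarrow> - 1 \<le> b" using h1 h3 assms(3) by fastforce
  define S where "S \<longleftrightarrow> (\<forall>x\<in>set w. - 1 \<le> x)"
  define T where "T \<longleftrightarrow> (\<forall>k. 0 < k \<longrightarrow> k + 1 < m \<longrightarrow> k \<noteq> i \<longrightarrow> turn (merge i s) w k)"
  have "admissible s (graft i b w) \<longleftrightarrow> S \<and> - 1 \<le> b \<and> T \<and> (1 \<le> b \<longrightarrow> odd b \<longrightarrow> even (s (Suc i)))"
    unfolding admissible_graft[OF assms(1-3)] unfolding S_def[symmetric] T_def[symmetric] using assms(4) by simp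
  moreover have "admissible (merge i s) w \<longleftrightarrow> S \<and> T" unfolding admissible_alt h4[symmetric] S_def T_def by simp
  ultimately show ?thesis using h2 h5 unfolding S_def[symmetric] by blast
qed

text \<open>The letter \<open>b\<close> is \<open>A - 1\<close> or \<open>A + 1\<close>, and each of
  the two equivalences holds for exactly one choice. They select the same one iff the equivalence on
  the right holds.\<close>

lemma fork_count:
  fixes A p q :: int
  assumes "1 \<le> A" "p = A - 1 \<or> p = A + 1" "q = A - 1 \<or> q = A + 1"
  shows "of_bool ((e \<longleftrightarrow> p = A - 1) \<and> (e' \<longleftrightarrow> A - 1 = q)) + of_bool ((e \<longleftrightarrow> p = A + 1) \<and> (e' \<longleftrightarrow> A + 1 = q))
    = (of_bool ((e \<longleftrightarrow> e') \<longleftrightarrow> p = q) :: int)"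
  using assms(2,3) by (elim disjE; cases e; cases e'; simp)

text \<open>An even spike splits an odd run into two, and the conditions on the parts fix the spike
  letter; by \<open>fork_count\<close> they are compatible exactly under the condition on the merged
  run. A host -1 only admits the spike 0, and if the host is the last letter only its left part
  imposes a condition.\<close>

lemma admissible_leaf_even:
  assumes "w \<in> walks m" "i < m" "odd (w ! i)"
  shows "(\<Sum>b\<in>{w ! i - 1, w ! i + 1}. of_bool (admissible s (graft i b w)))
    = (of_bool (admissible (merge i s) w) :: int)"
proof -
  have l: "length w = m" and wk: "walk w" using assms by (auto simp: walks_def)
  define P where "P \<longleftrightarrow> (\<forall>x\<in>set w. - 1 \<le> x) \<and> (\<forall>k. 0 < k \<longrightarrow> k + 1 < m \<longrightarrow> k \<noteq> i \<longrightarrow> turn (merge i s) w k)"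
  define R where "R b \<longleftrightarrow> - 1 \<le> b \<and> (1 \<le> w ! i \<longrightarrow> (0 < i \<longrightarrow> (even (s i) \<longleftrightarrow> w ! (i - 1) = b)) \<and>
       (i + 1 < m \<longrightarrow> (even (s (i + 2)) \<longleftrightarrow> b = w ! (i + 1))))" for b
  have eb: "even b" if "\<bar>b - w ! i\<bar> = 1" for b
    using that assms(3) by (cases "b = w ! i + 1"; cases "b = w ! i - 1") (auto simp: abs_if split: if_splits)
  have ins: "admissible s (graft i b w) \<longleftrightarrow> P \<and> R b" if "\<bar>b - w ! i\<bar> = 1" for b
    using eb[OF that] assms unfolding admissible_graft[OF assms(1,2) that] P_def R_def by auto
  have mrg: "admissible (merge i s) w \<longleftrightarrow> P \<and> (0 < i \<longrightarrow> i + 1 < m \<longrightarrow> turn (merge i s) w i)"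
    unfolding admissible_alt P_def l by blast
  have two: "(\<Sum>b\<in>{a - 1, a + 1}. g b) = g (a - 1) + g (a + 1)" for a :: int and g :: "int \<Rightarrow> int" by simp
  show ?thesis
  proof (cases P)
    case False
    then show ?thesis unfolding two by (simp add: ins mrg)
  next
    case True
    have "- 1 \<le> w ! i" using True assms l by (simp add: P_def)
    show ?thesis
    proof (cases "w ! i = - 1")
      case True
      then show ?thesis unfolding two using \<open>P\<close> by (simp add: ins mrg R_def)
    next
      case False
      then have w1: "1 \<le> w ! i" using \<open>- 1 \<le> w ! i\<close> assms(3) by (cases "w ! i = 0") auto
      have i0: "0 < i" using w1 wk by (cases i) (auto simp: walk_def hd_conv_nth[symmetric])
      have s1: "\<bar>w ! (i - 1) - w ! i\<bar> = 1"
        using wk i0 assms(2) l successively_nth[of _ w "i - 1"] by (auto simp: walk_def)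
      then have c1: "w ! (i - 1) = w ! i - 1 \<or> w ! (i - 1) = w ! i + 1" by arith
      show ?thesis
      proof (cases "i + 1 < m")
        case False
        have "R (w ! i - 1) \<longleftrightarrow> (even (s i) \<longleftrightarrow> w ! (i - 1) = w ! i - 1)"
          "R (w ! i + 1) \<longleftrightarrow> (even (s i) \<longleftrightarrow> w ! (i - 1) = w ! i + 1)" unfolding R_def using False w1 i0 by auto
        then show ?thesis unfolding two using \<open>P\<close> c1 False by (auto simp add: ins mrg)
      next
        case True
        have "\<bar>w ! i - w ! (i + 1)\<bar> = 1" using wk True l successively_nth[of _ w i] by (auto simp: walk_def)
        then have c2: "w ! (i + 1) = w ! i - 1 \<or> w ! (i + 1) = w ! i + 1" by arith
        have "R (w ! i - 1) \<longleftrightarrow> (even (s i) \<longleftrightarrow> w ! (i - 1) = w ! i - 1) \<and> (even (s (i + 2)) \<longleftrightarrow> w ! i - 1 = w ! (i + 1))"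
          "R (w ! i + 1) \<longleftrightarrow> (even (s i) \<longleftrightarrow> w ! (i - 1) = w ! i + 1) \<and> (even (s (i + 2)) \<longleftrightarrow> w ! i + 1 = w ! (i + 1))"
          unfolding R_def using True w1 i0 by auto
        moreover have "admissible (merge i s) w \<longleftrightarrow> ((even (s i) \<longleftrightarrow> even (s (i + 2))) \<longleftrightarrow> w ! (i - 1) = w ! (i + 1))"
          unfolding mrg using \<open>P\<close> True i0 w1 assms(3) by (simp add: merge_def)
        ultimately show ?thesis
          unfolding two using fork_count[OF w1 c1 c2, of "even (s i)" "even (s (i + 2))"] \<open>P\<close>
          by (simp add: ins)
      qed
    qed
  qed
qed

section \<open>The dichotomy for planar functions\<close>

text \<open>\<open>D\<close> consists of runs that have letter -1 in every admissible word of the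
  support and may be raised to 1 without changing \<open>f\<close>. The flip clause asks for zero
  neighbours, so that raising keeps adjacent letters at distance 1; it ranges over all lists of
  length \<open>m\<close>, so contracted lists need not be shown to be walks.\<close>

definition obstructed :: "nat \<Rightarrow> (nat \<Rightarrow> nat) \<Rightarrow> (int list \<Rightarrow> nat) \<Rightarrow> bool" where
  "obstructed m s f \<longleftrightarrow> (\<Sum>w\<in>walks m. signed_weight s w * int (f w)) = 0 \<and> (\<exists>D\<subseteq>{0<..<m - 1}. odd (\<Sum>k\<in>D. s k) \<and>
      (\<forall>w\<in>walks m. 0 < f w \<longrightarrow> admissible s w \<longrightarrow> (\<forall>k\<in>D. w ! k = - 1)) \<and> (\<forall>w w'. length w = m \<and> length w' = m \<and>
         (\<forall>k\<in>D. w ! k = - 1 \<and> w' ! k = 1 \<and> w ! (k - 1) = 0 \<and> w ! (k + 1) = 0) \<and>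
         (\<forall>k<m. k \<notin> D \<longrightarrow> w' ! k = w ! k) \<longrightarrow> f w = f w'))"

text \<open>The second clause is the counterpart of the flip clause in \<open>obstructed\<close>:
  within the support, letters -1 are never raised to 1 on an odd total length. It is what excludes
  odd regions later.\<close>

definition balanced :: "nat \<Rightarrow> (nat \<Rightarrow> nat) \<Rightarrow> (int list \<Rightarrow> nat) \<Rightarrow> bool" where
  "balanced m s f \<longleftrightarrow>
    (\<Sum>w\<in>walks m. signed_weight s w * int (f w)) = (\<Sum>w\<in>walks m. of_bool (admissible s w) * int (f w)) \<and>
    (\<forall>w w'. 0 < f w \<longrightarrow> 0 < f w' \<longrightarrow> (\<forall>k<m. w' ! k = w ! k \<or> w ! k = - 1 \<and> w' ! k = 1) \<longrightarrow>
       even (\<Sum>k<m. s k * of_bool (w' ! k \<noteq> w ! k)))"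

lemma sum_signed_cup:
  assumes "planar m f" "i < m"
  shows "(\<Sum>w\<in>walks (m + 2). signed_weight s w * int (cup i f w))
    = (if odd i then 1 + (- 1) ^ s (Suc i) else 1) * (\<Sum>w\<in>walks m. signed_weight (merge i s) w * int (f w))"
proof -
  have "(\<Sum>b\<in>{w ! i - 1, w ! i + 1}. signed_weight s (graft i b w))
     = (if odd i then 1 + (- 1) ^ s (Suc i) else 1) * signed_weight (merge i s) w" if "w \<in> walks m" for w
    using that assms(2) walk_parity[of w i] signed_leaf_odd[OF that assms(2)] signed_leaf_even[OF that assms(2)]
    by (simp add: walks_def)
  then show ?thesis
    unfolding sum_cup[OF assms] sum_distrib_left by (intro sum.cong) (simp_all add: mult.assoc)
qed

lemma sum_admissible_cup:
  assumes "planar m f" "i < m" "odd i \<longrightarrow> even (s (Suc i))"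
  shows "(\<Sum>w\<in>walks (m + 2). of_bool (admissible s w) * int (cup i f w))
    = (if odd i then 2 else 1) * (\<Sum>w\<in>walks m. of_bool (admissible (merge i s) w) * int (f w))"
proof -
  have "(\<Sum>b\<in>{w ! i - 1, w ! i + 1}. of_bool (admissible s (graft i b w)))
     = (if odd i then 2 else 1) * (of_bool (admissible (merge i s) w) :: int)" if "w \<in> walks m" for w
    using that assms(2,3) walk_parity[of w i] admissible_leaf_odd[OF that assms(2)] admissible_leaf_even[OF that assms(2)]
    by (simp add: walks_def)
  then show ?thesis
    unfolding sum_cup[OF assms(1,2)] sum_distrib_left by (intro sum.cong) (simp_all add: mult.assoc)
qed

text \<open>The factor \<open>1 + (- 1) ^ s (Suc i)\<close> vanishes for an odd run. Admissibility
  forbids a positive spike with an odd run, so the new letter is -1; and over a host 0 a cup takes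
  the same value on the spikes -1 and 1.\<close>

lemma obstructed_new_leaf:
  assumes "planar m f" "i < m" "odd i" "odd (s (Suc i))"
  shows "obstructed (m + 2) s (cup i f)"
  unfolding obstructed_def
proof (intro conjI exI[of _ "{Suc i}"] ballI allI impI)
  show "(\<Sum>w\<in>walks (m + 2). signed_weight s w * int (cup i f w)) = 0"
    using sum_signed_cup[OF assms(1,2), of s] assms by simp
  show "{Suc i} \<subseteq> {0<..<m + 2 - 1}" using assms by auto
  show "odd (\<Sum>k\<in>{Suc i}. s k)" using assms by simp
next
  fix w k assume *: "w \<in> walks (m + 2)" "0 < cup i f w" "admissible s w" "k \<in> {Suc i}"
  obtain w0 b where w: "w0 \<in> walks m" "\<bar>b - w0 ! i\<bar> = 1" "w = graft i b w0"
    by (rule cup_nonzeroE[of i f w m]) (use * assms in auto)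
  then have l: "length w0 = m" by (simp add: walks_def)
  have ev: "even (w0 ! i)" using walk_parity[of w0 i] w assms by (simp add: walks_def)
  have "\<not> 1 \<le> b" using * w assms admissible_leaf_odd[OF w(1) assms(2) w(2) ev] by auto
  moreover have "- 1 \<le> b" using * w assms(2) admissible_graft[OF w(1) assms(2) w(2)] by auto
  moreover have "b \<noteq> 0" using ev w(2) by presburger
  ultimately have "b = - 1" by linarith
  then show "w ! k = - 1" using * w assms l by (simp add: graft_nth)
next
  fix w w' :: "int list"
  assume *: "length w = m + 2 \<and> length w' = m + 2 \<and>
    (\<forall>k\<in>{Suc i}. w ! k = - 1 \<and> w' ! k = 1 \<and> w ! (k - 1) = 0 \<and> w ! (k + 1) = 0) \<and>
    (\<forall>k<m + 2. k \<notin> {Suc i} \<longrightarrow> w' ! k = w ! k)"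
  then have "take (Suc i) w = take (Suc i) w'" "drop (i + 3) w = drop (i + 3) w'"
    using assms(2) by (auto intro!: nth_equalityI)
  moreover have "w' ! i = w ! i" "w' ! (i + 2) = w ! (i + 2)" using * assms(2) by auto
  ultimately show "cup i f w = cup i f w'" using * by (simp add: cup_def)
qed

lemma sum_pullback:
  fixes s :: "nat \<Rightarrow> nat"
  assumes "i < m" "D \<subseteq> {..<m}"
  shows "(\<Sum>k | k < m + 2 \<and> k \<noteq> Suc i \<and> (if k \<le> i then k else k - 2) \<in> D. s k) = (\<Sum>k\<in>D. merge i s k)"
proof -
  have a: "(\<Sum>k<m + 2. s k * of_bool (k \<noteq> Suc i \<and> (if k \<le> i then k else k - 2) \<in> D))
    = (\<Sum>k<m. merge i s k * of_bool (k \<in> D)) + s (Suc i) * of_bool (Suc i \<noteq> Suc i \<and> (if Suc i \<le> i then Suc i else Suc i - 2) \<in> D)"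
    by (rule sum_merge) (use assms in auto)
  have b: "(\<Sum>k<m. merge i s k * of_bool (k \<in> D)) = (\<Sum>k\<in>D. merge i s k)"
    using assms(2) by (intro sum.mono_neutral_cong_right) auto
  have c: "(\<Sum>k<m + 2. s k * of_bool (k \<noteq> Suc i \<and> (if k \<le> i then k else k - 2) \<in> D))
     = (\<Sum>k | k < m + 2 \<and> k \<noteq> Suc i \<and> (if k \<le> i then k else k - 2) \<in> D. s k)"
    by (intro sum.mono_neutral_cong_right) auto
  show ?thesis unfolding b[symmetric] c[symmetric] a by (simp only: refl simp_thms of_bool_eq mult_0_right add_0_right)
qed

text \<open>The new set is the preimage of the old one under deleting \<open>Suc i\<close> and
  identifying \<open>i + 2\<close> with \<open>i\<close>; by \<open>sum_pullback\<close> its total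
  length is the old one for the merged runs.\<close>

lemma obstructed_cup:
  assumes "planar m f" "i < m" "odd i \<longrightarrow> even (s (Suc i))" "obstructed m (merge i s) f"
  shows "obstructed (m + 2) s (cup i f)"
proof -
  obtain D0 where R: "D0 \<subseteq> {0<..<m - 1} \<and> odd (\<Sum>k\<in>D0. merge i s k) \<and>
      (\<forall>w\<in>walks m. 0 < f w \<longrightarrow> admissible (merge i s) w \<longrightarrow> (\<forall>k\<in>D0. w ! k = - 1)) \<and>
      (\<forall>w w'. length w = m \<and> length w' = m \<and>
         (\<forall>k\<in>D0. w ! k = - 1 \<and> w' ! k = 1 \<and> w ! (k - 1) = 0 \<and> w ! (k + 1) = 0) \<and>
         (\<forall>k<m. k \<notin> D0 \<longrightarrow> w' ! k = w ! k) \<longrightarrow> f w = f w')"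
    using assms(4)[unfolded obstructed_def, THEN conjunct2] by (elim exE)
  have D0: "D0 \<subseteq> {0<..<m - 1}" "odd (\<Sum>k\<in>D0. merge i s k)" using R by simp_all
  have neg: "w ! k = - 1" if "w \<in> walks m" "0 < f w" "admissible (merge i s) w" "k \<in> D0" for w k
    using R[THEN conjunct2, THEN conjunct2, THEN conjunct1] that by simp
  have flip: "f w = f w'" if "length w = m" "length w' = m"
         "\<And>k. k \<in> D0 \<Longrightarrow> w ! k = - 1 \<and> w' ! k = 1 \<and> w ! (k - 1) = 0 \<and> w ! (k + 1) = 0"
         "\<And>k. k < m \<Longrightarrow> k \<notin> D0 \<Longrightarrow> w' ! k = w ! k" for w w'
    by (rule R[THEN conjunct2, THEN conjunct2, THEN conjunct2, rule_format]) (use that in simp)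
  define D where "D = {k. k < m + 2 \<and> k \<noteq> Suc i \<and> (if k \<le> i then k else k - 2) \<in> D0}"
  have Dle: "k \<in> D \<longleftrightarrow> k \<in> D0" if "k \<le> i" for k using that assms(2) by (auto simp: D_def)
  have Dge: "k + 2 \<in> D \<longleftrightarrow> k \<in> D0" if "i \<le> k" for k using that D0(1) by (fastforce simp: D_def)
  have Dmid: "Suc i \<notin> D" by (simp add: D_def)
  show ?thesis unfolding obstructed_def
  proof (intro conjI exI[of _ D] ballI allI impI)
    show "(\<Sum>w\<in>walks (m + 2). signed_weight s w * int (cup i f w)) = 0"
      using assms(4) unfolding sum_signed_cup[OF assms(1,2)] obstructed_def by simp
    show "D \<subseteq> {0<..<m + 2 - 1}"
    proof
      fix k assume "k \<in> D"
      then have "k < m + 2" "k \<noteq> Suc i" "(if k \<le> i then k else k - 2) \<in> D0" by (auto simp: D_def)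
      moreover from this(3) have "0 < (if k \<le> i then k else k - 2)" "(if k \<le> i then k else k - 2) < m - 1"
        using D0(1) by (auto simp del: split_paired_All)
      ultimately show "k \<in> {0<..<m + 2 - 1}" by (auto split: if_splits)
    qed
    show "odd (\<Sum>k\<in>D. s k)" using D0 sum_pullback[OF assms(2), of D0 s] unfolding D_def by force
  next
    fix w k assume *: "w \<in> walks (m + 2)" "0 < cup i f w" "admissible s w" "k \<in> D"
    obtain w0 b where w: "w0 \<in> walks m" "\<bar>b - w0 ! i\<bar> = 1" "w = graft i b w0" "f w0 = cup i f w"
      by (rule cup_nonzeroE[of i f w m]) (use * assms in auto)
    have l: "length w0 = m" using w by (simp add: walks_def)
    have "admissible (merge i s) w0"
    proof (cases "odd i")
      case True
      then have "even (w0 ! i)" using walk_parity[of w0 i] w assms by (simp add: walks_def)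
      then show ?thesis using admissible_leaf_odd[OF w(1) assms(2) w(2)] * w by auto
    next
      case False
      then have "odd (w0 ! i)" using walk_parity[of w0 i] w assms by (simp add: walks_def)
      from admissible_leaf_even[OF w(1) assms(2) this, of s]
      have "(\<Sum>b\<in>{w0 ! i - 1, w0 ! i + 1}. of_bool (admissible s (graft i b w0)))
        = (of_bool (admissible (merge i s) w0) :: int)" .
      moreover have "of_bool (admissible s (graft i b w0))
        \<le> (\<Sum>b\<in>{w0 ! i - 1, w0 ! i + 1}. of_bool (admissible s (graft i b w0)) :: int)"
        by (rule member_le_sum) (use w(2) in auto)
      ultimately show ?thesis using *(3) w(3) by (cases "admissible (merge i s) w0") simp_all
    qed
    then have "w0 ! (if k \<le> i then k else k - 2) = - 1" using neg[OF w(1)] w(4) * by (auto simp: D_def)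
    moreover have "k \<noteq> Suc i" using *(4) Dmid by blast
    ultimately show "w ! k = - 1" using assms(2) l by (cases "k \<le> i") (simp_all add: w(3) graft_nth)
  next
    fix w w' :: "int list"
    assume a: "length w = m + 2 \<and> length w' = m + 2 \<and>
      (\<forall>k\<in>D. w ! k = - 1 \<and> w' ! k = 1 \<and> w ! (k - 1) = 0 \<and> w ! (k + 1) = 0) \<and>
      (\<forall>k<m + 2. k \<notin> D \<longrightarrow> w' ! k = w ! k)"
    then have l: "length w = m + 2" "length w' = m + 2"
      and D: "\<And>k. k \<in> D \<Longrightarrow> w ! k = - 1 \<and> w' ! k = 1 \<and> w ! (k - 1) = 0 \<and> w ! (k + 1) = 0"
      and nD: "\<And>k. k < m + 2 \<Longrightarrow> k \<notin> D \<Longrightarrow> w' ! k = w ! k" by auto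
    define v where "v = take (Suc i) w @ drop (i + 3) w"
    define v' where "v' = take (Suc i) w' @ drop (i + 3) w'"
    have lv: "length v = m" "length v' = m" using l assms(2) by (simp_all add: v_def v'_def)
    have vn: "v ! k = (if k \<le> i then w ! k else w ! (k + 2))" "v' ! k = (if k \<le> i then w' ! k else w' ! (k + 2))"
      if "k < m" for k using that l assms(2) by (auto simp: v_def v'_def nth_append min_def)
    have vlo: "v ! k = w ! k \<and> v' ! k = w' ! k" if "k \<le> i" for k using vn[of k] that assms(2) by simp
    have vhi: "v ! k = w ! (k + 2) \<and> v' ! k = w' ! (k + 2)" if "i < k" "k < m" for k
      using vn[of k] that by simp
    show "cup i f w = cup i f w'"
    proof (cases "i \<in> D0")
      case True
      \<comment> \<open>If the host itself is raised, both its copies lie in \<open>D\<close>, and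
        the spike between them is 0. As 0 is adjacent to -1 and to 1, both words contract.\<close>
      then have "w ! i = - 1" "w' ! i = 1" "w ! Suc i = 0" "w ! (i + 2) = - 1" "w' ! (i + 2) = 1"
        using D[of i] D[of "i + 2"] Dle[of i] Dge[of i] by auto
      moreover have "w' ! Suc i = w ! Suc i" using nD Dmid assms(2) by simp
      moreover have "f v = f v'"
      proof (rule flip)
        fix k assume k: "k \<in> D0"
        then have k1: "0 < k" "k < m - 1" using D0(1) by auto
        show "v ! k = - 1 \<and> v' ! k = 1 \<and> v ! (k - 1) = 0 \<and> v ! (k + 1) = 0"
        proof -
          consider "k < i" | "k = i" | "i < k" by linarith
          then show ?thesis
          proof cases
            case 1
            then show ?thesis using D[of k] Dle[of k] k k1 vlo[of "k - 1"] vlo[of k] vlo[of "k + 1"] by simp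
          next
            case 2
            then show ?thesis using D[of i] D[of "i + 2"] Dle[of i] Dge[of i] k k1 vlo[of "k - 1"] vlo[of k] vhi[of "k + 1"] by simp
          next
            case 3
            \<comment> \<open>Only \<open>k = Suc i\<close> is delicate: its left neighbour is the
              letter \<open>i\<close> after the contraction and the letter \<open>i + 2\<close>
              before it, and these agree.\<close>
            have "v ! (k - 1) = w ! (k + 2 - 1)"
            proof (cases "k - 1 \<le> i")
              case True
              then have "k = Suc i" using 3 by simp
              then show ?thesis using vlo[of i] \<open>w ! i = - 1\<close> \<open>w ! (i + 2) = - 1\<close> by simp
            next
              case False
              then show ?thesis using k1 vhi[of "k - 1"] by simp
            qed
            then show ?thesis using D[of "k + 2"] Dge[of k] k k1 3 vhi[of k] vhi[of "k + 1"] by simp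
          qed
        qed
      next
        fix k assume "k < m" "k \<notin> D0"
        then show "v' ! k = v ! k" using nD[of k] nD[of "k + 2"] Dle[of k] Dge[of k] vlo[of k] vhi[of k]
          by (cases "k \<le> i") simp_all
      qed (use lv in auto)
      ultimately show ?thesis using l by (simp add: cup_def v_def v'_def)
    next
      case False
      then have e: "w' ! i = w ! i" "w' ! (i + 2) = w ! (i + 2)" "w' ! Suc i = w ! Suc i"
        using nD[of i] nD[of "i + 2"] nD[of "Suc i"] Dle[of i] Dge[of i] Dmid assms(2) by auto
      show ?thesis
      proof (cases "w ! (i + 2) = w ! i")
        case False
        then show ?thesis using e by (simp add: cup_def)
      next
        case ret: True
        have "f v = f v'"
        proof (rule flip)
          fix k assume k: "k \<in> D0"
          then have k1: "0 < k" "k < m - 1" using D0(1) by auto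
          have "k \<noteq> i" using k False by auto
          then consider "k < i" | "i < k" by linarith
          then show "v ! k = - 1 \<and> v' ! k = 1 \<and> v ! (k - 1) = 0 \<and> v ! (k + 1) = 0"
          proof cases
            case 1
            then show ?thesis using D[of k] Dle[of k] k k1 vlo[of "k - 1"] vlo[of k] vlo[of "k + 1"] by simp
          next
            case 2
            have "v ! (k - 1) = w ! (k + 2 - 1)"
            proof (cases "k - 1 \<le> i")
              case True
              then have "k = Suc i" using 2 by simp
              then show ?thesis using ret vlo[of i] by simp
            next
              case False
              then show ?thesis using k1 vhi[of "k - 1"] by simp
            qed
            then show ?thesis using D[of "k + 2"] Dge[of k] k k1 2 vhi[of k] vhi[of "k + 1"] by simp
          qed
        next
          fix k assume "k < m" "k \<notin> D0"
          then show "v' ! k = v ! k" using nD[of k] nD[of "k + 2"] Dle[of k] Dge[of k] vlo[of k] vhi[of k]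
            by (cases "k \<le> i") simp_all
        qed (use lv in auto)
        then show ?thesis using e l by (simp add: cup_def v_def v'_def)
      qed
    qed
  qed
qed

text \<open>An odd spike has a run of even length by assumption, and an even spike is never -1, so
  it is not raised. Either way the spike does not affect the parity of the raised length.\<close>

lemma balanced_cup:
  assumes "planar m f" "i < m" "odd i \<longrightarrow> even (s (Suc i))" "balanced m (merge i s) f"
  shows "balanced (m + 2) s (cup i f)"
  unfolding balanced_def
proof (intro conjI allI impI)
  show "(\<Sum>w\<in>walks (m + 2). signed_weight s w * int (cup i f w))
    = (\<Sum>w\<in>walks (m + 2). of_bool (admissible s w) * int (cup i f w))"
    using assms(4) unfolding sum_signed_cup[OF assms(1,2)] sum_admissible_cup[where s = s, OF assms(1-3)] balanced_def
    using assms(3) by simp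
next
  fix w w' assume *: "0 < cup i f w" "0 < cup i f w'" "\<forall>k<m + 2. w' ! k = w ! k \<or> w ! k = - 1 \<and> w' ! k = 1"
  obtain v b where w: "v \<in> walks m" "\<bar>b - v ! i\<bar> = 1" "w = graft i b v" "f v = cup i f w"
    by (rule cup_nonzeroE[of i f w m]) (use * assms in auto)
  obtain v' b' where w': "v' \<in> walks m" "\<bar>b' - v' ! i\<bar> = 1" "w' = graft i b' v'" "f v' = cup i f w'"
    by (rule cup_nonzeroE[of i f w' m]) (use * assms in auto)
  have l: "length v = m" "length v' = m" using w w' by (auto simp: walks_def)
  have n: "w ! k = (if k \<le> i then v ! k else if k = Suc i then b else v ! (k - 2))"
     "w' ! k = (if k \<le> i then v' ! k else if k = Suc i then b' else v' ! (k - 2))" for k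
    using w w' l assms(2) by (auto simp: graft_nth)
  have "\<forall>k<m. v' ! k = v ! k \<or> v ! k = - 1 \<and> v' ! k = 1"
  proof (intro allI impI)
    fix k assume "k < m"
    then show "v' ! k = v ! k \<or> v ! k = - 1 \<and> v' ! k = 1"
      using *(3)[rule_format, of k] *(3)[rule_format, of "k + 2"] by (cases "k \<le> i") (auto simp: n)
  qed
  then have "even (\<Sum>k<m. merge i s k * of_bool (v' ! k \<noteq> v ! k))"
    using assms(4) * w w' unfolding balanced_def by auto
  moreover have "(\<Sum>k<m + 2. s k * of_bool (w' ! k \<noteq> w ! k))
    = (\<Sum>k<m. merge i s k * of_bool (v' ! k \<noteq> v ! k)) + s (Suc i) * of_bool (w' ! Suc i \<noteq> w ! Suc i)"
    by (rule sum_merge) (use assms(2) in \<open>auto simp: n\<close>)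
  moreover have "even (s (Suc i) * of_bool (w' ! Suc i \<noteq> w ! Suc i))"
  proof (cases "odd i")
    case True
    then show ?thesis using assms(3) by simp
  next
    case False
    then have "odd (v ! i)" using walk_parity[of v i] w assms by (simp add: walks_def)
    then have "b \<noteq> - 1" using w(2) by presburger
    then have "w' ! Suc i = w ! Suc i" using *(3)[rule_format, of "Suc i"] assms(2) by (auto simp: n)
    then show ?thesis by simp
  qed
  ultimately show "even (\<Sum>k<m + 2. s k * of_bool (w' ! k \<noteq> w ! k))" by simp
qed

text \<open>The run lengths \<open>s\<close> are generalised because each cup replaces them by
  \<open>merge i s\<close>. An odd spike over a run of odd length creates an obstruction; any other
  cup passes on whichever alternative holds for the shorter words. A nonpositive base word has no
  letter 1, so there the signed weight is the indicator of admissibility.\<close>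

theorem planar_dichotomy: "planar m f \<Longrightarrow> obstructed m s f \<or> balanced m s f"
proof (induction arbitrary: s rule: planar.induct)
  case (base w0 k)
  have "balanced (length w0) s (\<lambda>w. if w = w0 then k else 0)" unfolding balanced_def
  proof (intro conjI allI impI)
    have w0: "w0 \<in> walks (length w0)" using base by (simp add: walks_def)
    have "signed_weight s w0 = of_bool (admissible s w0)"
    proof -
      have neg: "w0 ! k \<le> 0" if "k < length w0" for k using base(2) that by (meson nth_mem)
      have "(\<Sum>k<length w0. s k * of_bool (w0 ! k = 1)) = 0"
      proof (rule sum.neutral, rule ballI)
        fix k assume "k \<in> {..<length w0}"
        then show "s k * of_bool (w0 ! k = 1) = 0" using neg[of k] by simp
      qed
      moreover have "(\<forall>x\<in>set w0. \<bar>x\<bar> \<le> 1) \<longleftrightarrow> (\<forall>x\<in>set w0. - 1 \<le> x)"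
        using base(2) by (intro ball_cong) (auto simp: abs_le_iff)
      moreover have "admissible s w0 \<longleftrightarrow> (\<forall>x\<in>set w0. - 1 \<le> x)"
      proof -
        have "\<not> 1 \<le> w0 ! k" if "k + 1 < length w0" for k using neg[of k] that by linarith
        then show ?thesis unfolding admissible_def by blast
      qed
      ultimately show ?thesis by (simp add: signed_weight_def)
    qed
    then show "(\<Sum>w\<in>walks (length w0). signed_weight s w * int (if w = w0 then k else 0)) =
      (\<Sum>w\<in>walks (length w0). of_bool (admissible s w) * int (if w = w0 then k else 0))"
      by (intro sum.cong) auto
  next
    fix w w' assume "0 < (if w = w0 then k else 0)" "0 < (if w' = w0 then k else 0)"
    then have "w' = w" by (auto split: if_splits)
    then show "even (\<Sum>k<length w0. s k * of_bool (w' ! k \<noteq> w ! k))" by simp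
  qed
  then show ?case ..
next
  case (cup m f i)
  show ?case
  proof (cases "odd i \<and> odd (s (Suc i))")
    case True
    then show ?thesis using obstructed_new_leaf cup by blast
  next
    case False
    then show ?thesis using obstructed_cup balanced_cup cup by blast
  qed
qed

lemma walk_nth: "walk w \<Longrightarrow> Suc i < length w \<Longrightarrow> \<bar>w ! i - w ! Suc i\<bar> = 1"
  using successively_nth[of "\<lambda>a b. \<bar>a - b\<bar> = 1" w i] by (simp add: walk_def)

section \<open>Height functions on a strip\<close>

locale strip_box =
  fixes lo hi :: int
  assumes lo_less_hi: "lo < hi"
begin

definition idx :: "(int \<Rightarrow> bool) \<Rightarrow> int \<Rightarrow> nat" where
  "idx j x = card {z. lo \<le> z \<and> z < x \<and> j z}"

definition lift :: "(int \<Rightarrow> bool) \<Rightarrow> int list \<Rightarrow> int \<Rightarrow> int" where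
  "lift j w x = (if lo \<le> x \<and> x \<le> hi then w ! idx j x else 0)"

definition row_ok :: "(int \<Rightarrow> bool) \<Rightarrow> (int \<Rightarrow> int) \<Rightarrow> bool" where
  "row_ok j y \<longleftrightarrow> y lo = - 1 \<and>
     (\<forall>x. lo \<le> x \<and> x < hi \<longrightarrow> (if j x then \<bar>y x - y (x + 1)\<bar> = 1 else y x = y (x + 1))) \<and>
     (\<forall>x. x < lo \<or> hi < x \<longrightarrow> y x = 0)"

text \<open>\<open>E\<close> lives on rows and \<open>f\<close> on words. The last clause confines
  \<open>E\<close> to rows of the right shape, which all come from words by \<open>ex_word\<close>,
  so nothing is lost in passing to \<open>f\<close>.\<close>

definition rep :: "(int \<Rightarrow> bool) \<Rightarrow> ((int \<Rightarrow> int) \<Rightarrow> nat) \<Rightarrow> (int list \<Rightarrow> nat) \<Rightarrow> bool" where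
  "rep j E f \<longleftrightarrow> planar (Suc (idx j hi)) f \<and> (\<forall>w\<in>walks (Suc (idx j hi)). E (lift j w) = f w) \<and>
     (\<forall>y. E y \<noteq> 0 \<longrightarrow> row_ok j y)"

lemma finite_idx: "finite {z. lo \<le> z \<and> z < (x::int) \<and> j z}"
  by (rule finite_subset[of _ "{lo..x}"]) auto

lemma idx_lo: "idx j lo = 0"
proof -
  have "{z. lo \<le> z \<and> z < lo \<and> j z} = {}" by auto
  then show ?thesis unfolding idx_def by (simp only: card.empty)
qed

lemma idx_Suc: "lo \<le> x \<Longrightarrow> idx j (x + 1) = idx j x + of_bool (j x)"
proof -
  assume x: "lo \<le> x"
  have "{z. lo \<le> z \<and> z < x + 1 \<and> j z} = (if j x then insert x {z. lo \<le> z \<and> z < x \<and> j z} else {z. lo \<le> z \<and> z < x \<and> j z})"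
    using x by (auto simp: order_le_less zless_add1_eq)
  then show ?thesis unfolding idx_def using finite_idx[of x j] by auto
qed

lemma idx_mono: "x \<le> x' \<Longrightarrow> idx j x \<le> idx j x'"
  unfolding idx_def by (rule card_mono[OF finite_idx]) auto

lemma idx_cong: "(\<And>z. lo \<le> z \<Longrightarrow> z < x \<Longrightarrow> j z = j' z) \<Longrightarrow> idx j x = idx j' x"
  unfolding idx_def by (rule arg_cong[of _ _ card]) auto

lemma idx_shift:
  assumes "lo \<le> a" "a \<le> x" "\<And>z. a \<le> z \<Longrightarrow> z < x \<Longrightarrow> j z = j' z"
  shows "idx j x + idx j' a = idx j' x + idx j a"
  using assms(2,3)
proof (induction x rule: int_ge_induct)
  case (step x)
  then have "j x = j' x" "idx j x + idx j' a = idx j' x + idx j a" by auto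
  then show ?case using step.hyps assms(1) by (simp add: idx_Suc)
qed simp

lemma idx_surj:
  assumes "lo \<le> x" "k \<le> idx j x"
  shows "\<exists>z. lo \<le> z \<and> z \<le> x \<and> idx j z = k"
  using assms
proof (induction x rule: int_ge_induct)
  case base
  then show ?case by (auto simp: idx_lo)
next
  case (step x)
  show ?case
  proof (cases "k \<le> idx j x")
    case True
    then show ?thesis using step by (metis add.commute order_trans zle_add1_eq_le zless_add1_eq)
  next
    case False
    then have "k = idx j (x + 1)" using step by (cases "j x") (auto simp: idx_Suc)
    then show ?thesis using step by (intro exI[of _ "x + 1"]) auto
  qed
qed

text \<open>Every maximal run of equal values becomes one letter, and a jump becomes a step of the
  walk. The word grows while the right end \<open>z\<close> moves from \<open>lo\<close> to
  \<open>hi\<close>.\<close>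

lemma ex_word:
  assumes "row_ok j y"
  shows "\<exists>w\<in>walks (Suc (idx j hi)). y = lift j w"
proof -
  have "\<exists>w. walk w \<and> length w = Suc (idx j z) \<and> (\<forall>x. lo \<le> x \<longrightarrow> x \<le> z \<longrightarrow> y x = w ! idx j x)"
    if "lo \<le> z" "z \<le> hi" for z using that
  proof (induction z rule: int_ge_induct)
    case base
    then show ?case using assms
      by (intro exI[of _ "[-1]"]) (auto simp: walk_def idx_lo row_ok_def dest!: antisym)
  next
    case (step z)
    then obtain w where w: "walk w" "length w = Suc (idx j z)"
      "\<And>x. lo \<le> x \<Longrightarrow> x \<le> z \<Longrightarrow> y x = w ! idx j x" by auto
    have lst: "last w = y z" using w step by (metis diff_Suc_1 last_conv_nth list.size(3) nat.distinct(1) order_refl)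
    have bd: "idx j x < length w" if "x \<le> z" for x using idx_mono[OF that, of j] w(2) by simp
    show ?case
    proof (cases "j z")
      case True
      then have "\<bar>y z - y (z + 1)\<bar> = 1" using assms step by (auto simp: row_ok_def)
      then have wk: "walk (w @ [y (z + 1)])" using w(1) lst by (auto simp: walk_def successively_append_iff)
      have yx: "y x = (w @ [y (z + 1)]) ! idx j x" if "lo \<le> x" "x \<le> z + 1" for x
      proof (cases "x = z + 1")
        case True
        have "idx j (z + 1) = length w" using w(2) step.hyps \<open>j z\<close> by (simp add: idx_Suc)
        then show ?thesis using True by simp
      next
        case False
        then have "x \<le> z" using that by linarith
        then show ?thesis using w(3)[OF that(1)] bd[of x] by (simp only: nth_append if_True)
      qed
      have "length (w @ [y (z + 1)]) = Suc (idx j (z + 1))" using w(2) step.hyps True by (simp add: idx_Suc)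
      with wk yx show ?thesis by blast
    next
      case False
      then have "y z = y (z + 1)" using assms step by (auto simp: row_ok_def)
      have yx: "y x = w ! idx j x" if "lo \<le> x" "x \<le> z + 1" for x
      proof (cases "x = z + 1")
        case True
        have "idx j (z + 1) = idx j z" using step.hyps False by (simp add: idx_Suc)
        then show ?thesis using w(3)[OF step.hyps order_refl] True \<open>y z = _\<close> by simp
      next
        case False
        then have "x \<le> z" using that by linarith
        then show ?thesis using w(3)[OF that(1)] by simp
      qed
      have "length w = Suc (idx j (z + 1))" using w(2) step.hyps False by (simp add: idx_Suc)
      with w(1) yx show ?thesis by blast
    qed
  qed
  from this[of hi] lo_less_hi obtain w where w: "walk w" "length w = Suc (idx j hi)"
    "\<forall>x. lo \<le> x \<longrightarrow> x \<le> hi \<longrightarrow> y x = w ! idx j x" by auto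
  have "y = lift j w"
  proof
    fix x
    show "y x = lift j w x"
    proof (cases "lo \<le> x \<and> x \<le> hi")
      case True
      then show ?thesis using w(3) by (simp add: lift_def)
    next
      case False
      then have "y x = 0" using assms unfolding row_ok_def by (metis not_le)
      then show ?thesis using False by (simp only: lift_def if_False)
    qed
  qed
  then show ?thesis using w by (auto simp: walks_def)
qed

lemma lift_row_ok:
  assumes "w \<in> walks (Suc (idx j hi))"
  shows "row_ok j (lift j w)"
  unfolding row_ok_def
proof (intro conjI allI impI)
  have w: "walk w" "length w = Suc (idx j hi)" using assms by (auto simp: walks_def)
  show "lift j w lo = - 1" using lo_less_hi w by (auto simp: lift_def idx_lo walk_def hd_conv_nth[symmetric])
  fix x assume x: "lo \<le> x \<and> x < hi"
  then have "idx j (x + 1) \<le> idx j hi" by (intro idx_mono) simp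
  then have "\<bar>w ! idx j x - w ! Suc (idx j x)\<bar> = 1" if "j x"
    using that x w walk_nth[of w "idx j x"] by (simp add: idx_Suc)
  then show "if j x then \<bar>lift j w x - lift j w (x + 1)\<bar> = 1 else lift j w x = lift j w (x + 1)"
    using x by (simp add: lift_def idx_Suc)
qed (use lo_less_hi in \<open>auto simp: lift_def\<close>)

text \<open>A letter hidden in column \<open>k\<close> can be read off in another column of the same
  run. This is used when column \<open>k\<close> is the one whose value changes.\<close>

lemma lift_inj_except:
  assumes "w \<in> walks (Suc (idx j hi))" "w' \<in> walks (Suc (idx j hi))"
    and "\<And>x. lo \<le> x \<Longrightarrow> x \<le> hi \<Longrightarrow> x \<noteq> k \<Longrightarrow> lift j w x = lift j w' x"
    and "\<exists>k'. k' \<noteq> k \<and> lo \<le> k' \<and> k' \<le> hi \<and> idx j k' = idx j k"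
  shows "w = w'"
proof (rule nth_equalityI)
  show "length w = length w'" using assms by (simp add: walks_def)
  fix i assume "i < length w"
  then obtain z where z: "lo \<le> z" "z \<le> hi" "idx j z = i"
    using idx_surj[of hi i j] lo_less_hi assms by (auto simp: walks_def)
  obtain z' where "lo \<le> z'" "z' \<le> hi" "idx j z' = i" "z' \<noteq> k" using z assms(4) by metis
  then show "w ! i = w' ! i" using assms(3)[of z'] by (simp add: lift_def)
qed

lemma rep_row_ok: "rep j E f \<Longrightarrow> E y \<noteq> 0 \<Longrightarrow> row_ok j y"
  by (simp add: rep_def)

lemma rep_lift: "rep j E f \<Longrightarrow> w \<in> walks (Suc (idx j hi)) \<Longrightarrow> E (lift j w) = f w"
  by (simp add: rep_def)

section \<open>Changing a row in one column\<close>

abbreviation toggle :: "(int \<Rightarrow> bool) \<Rightarrow> int \<Rightarrow> int \<Rightarrow> bool" where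
  "toggle j k \<equiv> j(k - 1 := \<not> j (k - 1), k := \<not> j k)"

definition local_ok :: "(int \<Rightarrow> bool) \<Rightarrow> int \<Rightarrow> (int \<Rightarrow> int) \<Rightarrow> bool" where
  "local_ok j k y \<longleftrightarrow> (if j (k - 1) then \<bar>y (k - 1) - y k\<bar> = 1 else y (k - 1) = y k) \<and>
     (if j k then \<bar>y k - y (k + 1)\<bar> = 1 else y k = y (k + 1))"

lemma row_ok_local:
  assumes "row_ok J y" "lo < k" "k < hi"
  shows "local_ok J k y"
proof -
  have r: "lo \<le> x \<and> x < hi \<longrightarrow> (if J x then \<bar>y x - y (x + 1)\<bar> = 1 else y x = y (x + 1))" for x
    using assms(1) unfolding row_ok_def by blast
  from r[of "k - 1", unfolded diff_add_cancel] r[of k] show ?thesis using assms(2,3) unfolding local_ok_def by simp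
qed

text \<open>The value in column \<open>k\<close> changes by 1 while the jumps on its two sides are
  toggled. A single jump slides past the column and the word stays the same; two jumps that
  disappear make a cap; two jumps that appear make a cup.\<close>

lemma rep_flip:
  assumes "rep j E f" "lo < k" "k < hi"
    and E': "\<And>y. E' y = (\<Sum>v\<in>{y k - 1, y k + 1}. if local_ok (toggle j k) k y then E (y(k := v)) else 0)"
  shows "\<exists>f'. rep (toggle j k) E' f'"
proof -
  define J where "J = toggle j k"
  have Jv: "J (k - 1) = (\<not> j (k - 1))" "J k = (\<not> j k)" "\<And>x. x \<noteq> k - 1 \<Longrightarrow> x \<noteq> k \<Longrightarrow> J x = j x"
    by (simp_all add: J_def)
  have E': "\<And>y. E' y = (\<Sum>v\<in>{y k - 1, y k + 1}. if local_ok J k y then E (y(k := v)) else 0)"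
    using E' by (simp only: J_def)
  define i where "i = idx j (k - 1)"
  have ik: "idx j k = i + of_bool (j (k - 1))" "idx j (k + 1) = i + of_bool (j (k - 1)) + of_bool (j k)"
    using idx_Suc[of "k - 1" j] idx_Suc[of k j] assms(2) by (simp_all add: i_def)
  have lt: "idx J x = idx j x" if "x \<le> k - 1" for x by (rule idx_cong) (use that Jv(3) in auto)
  have ik': "idx J k = i + of_bool (\<not> j (k - 1))" "idx J (k + 1) = i + of_bool (\<not> j (k - 1)) + of_bool (\<not> j k)"
    using idx_Suc[of "k - 1" J] idx_Suc[of k J] assms(2) lt[of "k - 1"] Jv by (simp_all add: i_def)
  have gt: "idx J x + (of_bool (j (k - 1)) + of_bool (j k)) = idx j x + (of_bool (\<not> j (k - 1)) + of_bool (\<not> j k))"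
    if "k + 1 \<le> x" for x using idx_shift[of "k + 1" x J j] assms(2) that ik ik' Jv(3) by auto
  have hi: "k + 1 \<le> hi" using assms by simp
  have ok: "row_ok J y" if "E' y \<noteq> 0" for y
  proof -
    have "\<exists>v. local_ok J k y \<and> E (y(k := v)) \<noteq> 0"
    proof (rule ccontr)
      assume "\<not> ?thesis"
      then have "E' y = 0" unfolding E' by (intro sum.neutral) auto
      with that show False by simp
    qed
    then obtain v where v: "local_ok J k y" "E (y(k := v)) \<noteq> 0" by auto
    then have r: "row_ok j (y(k := v))" by (intro rep_row_ok[OF assms(1)])
    show ?thesis unfolding row_ok_def
    proof (intro conjI allI impI)
      show "y lo = - 1" using r assms(2) by (auto simp: row_ok_def)
      fix x assume x: "lo \<le> x \<and> x < hi"
      show "if J x then \<bar>y x - y (x + 1)\<bar> = 1 else y x = y (x + 1)"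
      proof (cases "x = k - 1 \<or> x = k")
        case True
        then show ?thesis using v(1) by (auto simp: local_ok_def Jv)
      next
        case False
        then have "if j x then \<bar>(y(k := v)) x - (y(k := v)) (x + 1)\<bar> = 1 else (y(k := v)) x = (y(k := v)) (x + 1)"
          using r x unfolding row_ok_def by blast
        then show ?thesis using False Jv(3)[of x] by auto
      qed
    next
      fix x assume "x < lo \<or> hi < x"
      moreover have "x \<noteq> k" using calculation assms(2,3) by linarith
      moreover have "x < lo \<or> hi < x \<longrightarrow> (y(k := v)) x = 0" using r unfolding row_ok_def by blast
      ultimately show "y x = 0" by simp
    qed
  qed
  have loc: "local_ok J k (lift J w)" if "w \<in> walks (Suc (idx J hi))" for w
  proof -
    show ?thesis by (intro row_ok_local lift_row_ok that assms(2,3))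
  qed
  have E'l: "E' (lift J w) = (\<Sum>v\<in>{lift J w k - 1, lift J w k + 1}. E ((lift J w)(k := v)))"
    if "w \<in> walks (Suc (idx J hi))" for w using loc[OF that] by (simp add: E')
  have lk: "lift J w k = w ! (i + of_bool (\<not> j (k - 1)))" for w using assms(2,3) ik' by (simp add: lift_def)
  show ?thesis unfolding J_def[symmetric]
  proof (cases "j (k - 1) = j k")
    case False
    \<comment> \<open>One jump: outside column \<open>k\<close> the run numbers agree, so the old
      and the new row have the same word, and the old value \<open>v0\<close> is the letter on the
      other side of the jump.\<close>
    have same: "idx J x = idx j x" if "x \<noteq> k" for x
      using lt[of x] gt[of x] that False by (cases "x \<le> k - 1") auto
    define v0 where "v0 w = w ! idx j k" for w :: "int list"
    have upd: "(lift J w)(k := v0 w) = lift j w" for w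
      using assms(2,3) by (auto simp: lift_def same v0_def fun_eq_iff)
    have uniq: "v = v0 w" if wW: "w \<in> walks (Suc (idx J hi))" and vE: "E ((lift J w)(k := v)) \<noteq> 0" for v w
    proof -
      have "row_ok j ((lift J w)(k := v))" by (rule rep_row_ok[OF assms(1)]) (rule vE)
      from ex_word[OF this] obtain w2 where w2: "w2 \<in> walks (Suc (idx j hi))" "(lift J w)(k := v) = lift j w2"
        by (rule bexE)
      have "w2 = w"
      proof (rule lift_inj_except[of _ j _ k])
        show "w \<in> walks (Suc (idx j hi))" using wW hi same[of hi] by simp
        show "\<exists>k'. k' \<noteq> k \<and> lo \<le> k' \<and> k' \<le> hi \<and> idx j k' = idx j k" using ik False assms(2,3)
          by (cases "j k") (auto intro: exI[of _ "k - 1"] exI[of _ "k + 1"] simp: i_def)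
        fix x assume "lo \<le> x" "x \<le> hi" "x \<noteq> k"
        then show "lift j w2 x = lift j w x" using fun_cong[OF w2(2), of x] same[of x] by (simp add: lift_def)
      qed (rule w2)
      then show ?thesis using fun_cong[OF w2(2), of k] assms(2,3) by (simp add: lift_def v0_def)
    qed
    have "E' (lift J w) = f w" if w: "w \<in> walks (Suc (idx J hi))" for w
    proof -
      have w': "w \<in> walks (Suc (idx j hi))" using w hi same[of hi] by simp
      have "v0 w \<in> {lift J w k - 1, lift J w k + 1}"
      proof -
        have len: "length w = Suc (idx j hi)" "walk w" using w' by (auto simp: walks_def)
        have "idx j (k + 1) \<le> idx j hi" using hi by (rule idx_mono)
        then have "Suc i < length w" using len ik False by auto
        then have "\<bar>w ! i - w ! Suc i\<bar> = 1" using len walk_nth[of w i] by auto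
        then show ?thesis using False ik by (cases "j k") (auto simp: lk v0_def)
      qed
      moreover have "E ((lift J w)(k := v)) = 0" if "v \<noteq> v0 w" for v using uniq[OF w] that by blast
      ultimately have "E' (lift J w) = E ((lift J w)(k := v0 w))" unfolding E'l[OF w] by auto
      then show ?thesis using rep_lift[OF assms(1) w'] by (simp only: upd)
    qed
    moreover have "planar (Suc (idx J hi)) f" using assms(1) same[of hi] hi by (simp add: rep_def)
    ultimately have "rep J E' f" using ok by (auto simp: rep_def)
    then show "\<exists>f'. rep J E' f'" by (rule_tac exI)
  next
    case eq: True
    show "\<exists>f'. rep J E' f'"
    proof (cases "j k")
      case True
      \<comment> \<open>Two old jumps: the new row is flat around \<open>k\<close>, and the old
        value was a spike on it, summed over both directions.\<close>
      have j: "j (k - 1)" "j k" using eq True by auto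
      have gt2: "idx j x = idx J x + 2" if "k + 1 \<le> x" for x using gt[OF that] j by simp
      have mhi: "idx j hi = idx J hi + 2" using gt2 hi by simp
      have ihi: "i \<le> idx J hi" using idx_mono[OF hi, of J] ik' by simp
      have "E' (lift J w) = cap i f w" if w: "w \<in> walks (Suc (idx J hi))" for w
      proof -
        have len: "length w = Suc (idx J hi)" using w by (simp add: walks_def)
        have "E ((lift J w)(k := v)) = f (graft i v w)" if v: "v \<in> {w ! i - 1, w ! i + 1}" for v
        proof -
          have ins: "graft i v w \<in> walks (Suc (idx j hi))"
            using graft_walks[OF w, of i v] v ihi mhi by auto
          have "(lift J w)(k := v) = lift j (graft i v w)"
          proof
            fix x
            consider "x \<le> k - 1" | "x = k" | "k + 1 \<le> x" by linarith
            then show "((lift J w)(k := v)) x = lift j (graft i v w) x"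
            proof cases
              case 1
              then have "idx j x \<le> i" unfolding i_def by (rule idx_mono)
              then show ?thesis using 1 lt[of x] ihi len by (simp add: lift_def graft_nth)
            next
              case 2
              then show ?thesis using assms(2,3) ik j ihi len by (simp add: lift_def graft_nth)
            next
              case 3
              have "idx J (k + 1) \<le> idx J x" using 3 by (rule idx_mono)
              then have "i \<le> idx J x" using ik' j by simp
              then show ?thesis using 3 gt2[of x] ihi len by (simp add: lift_def graft_nth)
            qed
          qed
          then show ?thesis using rep_lift[OF assms(1) ins] by simp
        qed
        moreover have "lift J w k = w ! i" using lk j by simp
        ultimately show ?thesis
          unfolding E'l[OF w] cap_def using ihi len by (auto simp: graft_def intro!: sum.cong)
      qed
      moreover have "planar (Suc (idx J hi)) (cap i f)"
        using pl_cap[of "Suc (idx j hi)" f i] assms(1) ihi mhi by (simp add: rep_def)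
      ultimately have "rep J E' (cap i f)" using ok by (auto simp: rep_def)
      then show ?thesis by (rule_tac exI)
    next
      case False
      \<comment> \<open>No old jumps: the old row was flat around \<open>k\<close>, so the new row
        has a spike in column \<open>k\<close>, and the values on its two sides must agree.\<close>
      have j: "\<not> j (k - 1)" "\<not> j k" using eq False by auto
      have gt2: "idx J x = idx j x + 2" if "k + 1 \<le> x" for x using gt[OF that] j by simp
      have mhi: "idx J hi = idx j hi + 2" using gt2 hi by simp
      have ihi: "i \<le> idx j hi" using idx_mono[OF hi, of j] ik by simp
      have pl: "planar (Suc (idx j hi)) f" using assms(1) by (simp add: rep_def)
      have "E' (lift J w) = cup i f w" if w: "w \<in> walks (Suc (idx J hi))" for w
      proof -
        have len: "length w = Suc (idx j hi) + 2" "walk w" using w mhi by (auto simp: walks_def)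
        define a where "a = w ! i"
        have vals: "lift J w (k - 1) = a" "lift J w k = w ! (i + 1)" "lift J w (k + 1) = w ! (i + 2)"
          using assms(2,3) lt[of "k - 1"] ik' j by (auto simp: lift_def i_def a_def)
        have st: "\<bar>w ! (i + 1) - a\<bar> = 1" using len ihi walk_nth[of w i] by (auto simp: a_def)
        define w0 where "w0 = take (Suc i) w @ drop (i + 3) w"
        have nz: "v = a \<and> w ! (i + 2) = a" if "E ((lift J w)(k := v)) \<noteq> 0" for v
        proof -
          have "row_ok j ((lift J w)(k := v))" by (rule rep_row_ok[OF assms(1)]) (rule that)
          then have r: "\<And>x. lo \<le> x \<and> x < hi \<longrightarrow> (if j x then \<bar>((lift J w)(k := v)) x - ((lift J w)(k := v)) (x + 1)\<bar> = 1
              else ((lift J w)(k := v)) x = ((lift J w)(k := v)) (x + 1))" unfolding row_ok_def by blast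
          show ?thesis using r[of "k - 1", unfolded diff_add_cancel] r[of k] j assms(2,3) vals by simp
        qed
        show ?thesis
        proof (cases "w ! (i + 2) = a")
          case False
          then have "E' (lift J w) = 0" unfolding E'l[OF w] using nz by (intro sum.neutral) auto
          then show ?thesis using False by (simp add: cup_def a_def)
        next
          case True
          have w0: "w0 \<in> walks (Suc (idx j hi))" "w = graft i (w ! (i + 1)) w0"
          proof -
            obtain u a' v where "w = u @ a' # v" "length u = i" "2 \<le> length v"
              using split_at[of i w] len ihi by auto
            then obtain b c v' where w: "w = u @ a' # b # c # v'" "length u = i"
              by (metis Suc_le_length_iff numeral_2_eq_2)
            with True have "c = a'" by (simp add: a_def nth_append)
            with w show "w = graft i (w ! (i + 1)) w0"
              by (simp add: w0_def graft_append nth_append numeral_3_eq_3)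
            show "w0 \<in> walks (Suc (idx j hi))"
              using len w \<open>c = a'\<close> by (auto simp: w0_def walks_def walk_append3 numeral_3_eq_3)
          qed
          have len0: "length w0 = Suc (idx j hi)" using w0 by (simp add: walks_def)
          have "w0 ! i = a" using len ihi by (simp add: w0_def a_def nth_append min_def)
          have eqa: "(lift J w)(k := a) = lift j w0"
          proof
            fix x
            have wn: "w ! y = (if y \<le> i then w0 ! y else if y = Suc i then w ! (i + 1) else w0 ! (y - 2))" for y
              using w0(2) graft_nth[of i w0 "w ! (i + 1)" y] ihi len0 by simp
            consider "x \<le> k - 1" | "x = k" | "k + 1 \<le> x" by linarith
            then show "((lift J w)(k := a)) x = lift j w0 x"
            proof cases
              case 1
              then have "idx j x \<le> i" unfolding i_def by (rule idx_mono)
              then show ?thesis using 1 lt[of x] wn[of "idx j x"] by (simp add: lift_def)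
            next
              case 2
              then show ?thesis using assms(2,3) ik j \<open>w0 ! i = a\<close> by (simp add: lift_def)
            next
              case 3
              have "idx j (k + 1) \<le> idx j x" using 3 by (rule idx_mono)
              then have "i \<le> idx j x" using ik j by simp
              then show ?thesis using 3 gt2[of x] wn[of "idx j x + 2"] by (simp add: lift_def)
            qed
          qed
          have "a \<in> {lift J w k - 1, lift J w k + 1}" using st vals by auto
          moreover have "E ((lift J w)(k := v)) = 0" if "v \<noteq> a" for v using nz that by blast
          ultimately have E'a: "E' (lift J w) = E ((lift J w)(k := a))" unfolding E'l[OF w] by auto
          have "E' (lift J w) = f w0" using rep_lift[OF assms(1) w0(1)] by (simp only: E'a eqa)
          moreover have "i + 2 < length w" using len ihi by simp
          ultimately show ?thesis using True st by (simp add: cup_def a_def w0_def)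
        qed
      qed
      moreover have "planar (Suc (idx J hi)) (cup i f)" using planar.cup[OF pl, of i] ihi mhi by simp
      ultimately have "rep J E' (cup i f)" using ok by (auto simp: rep_def)
      then show ?thesis by (rule_tac exI)
    qed
  qed
qed

end

text \<open>
  A height function changes by one across an edge where the vertex total drops by one, since then exactly
  one of the two families contributes, and stays constant where it drops by zero or two.
\<close>

definition parity_step :: "int \<Rightarrow> int \<Rightarrow> int \<Rightarrow> bool" where
  "parity_step d u v \<longleftrightarrow> (if odd d then \<bar>u - v\<bar> = 1 else u = v)"

text \<open>The edges of a triangular lattice, each oriented in the direction in which vertex totals
  do not increase. They are also the adjacencies of units, see
  \<open>adjacent_tile_at\<close>.\<close>

definition edge :: "nat \<times> int \<Rightarrow> nat \<times> int \<Rightarrow> bool" where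
  "edge t u \<longleftrightarrow> u = (fst t, snd t + 1) \<or> (fst t = Suc (fst u) \<and> snd u = snd t) \<or> u = (Suc (fst t), snd t + 1)"

section \<open>Sweeping a strip from the top to the bottom\<close>

text \<open>\<open>S (r, x)\<close> stands for the number of vertices of both families in row
  \<open>r\<close> to the right of \<open>x\<close>. The inequalities are those of interlacing rows,
  the equations at \<open>lo\<close> and \<open>hi\<close> hold because no vertex crosses these
  columns, and \<open>top_nonpos\<close> is what the positivity condition provides.\<close>

locale strip_heights = strip_box +
  fixes n :: nat and S :: "nat \<times> int \<Rightarrow> int" and top :: "int \<Rightarrow> int"
  assumes n_pos: "0 < n" and S_up: "\<And>r x. r < n \<Longrightarrow> S (r, x) \<le> S (Suc r, x)"
    and S_down: "\<And>r x. r < n \<Longrightarrow> S (Suc r, x + 1) \<le> S (r, x)"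
    and S_drop: "\<And>r x. r \<le> n \<Longrightarrow> S (r, x) - S (r, x + 1) \<le> 2" and S_lo: "\<And>r. r < n \<Longrightarrow> S (r, lo) = S (Suc r, lo)"
    and S_hi: "\<And>r. r < n \<Longrightarrow> S (r, hi) = S (Suc r, hi)"
    and top_ok: "row_ok (\<lambda>x. odd (S (n, x) - S (n, x + 1))) top" and top_nonpos: "\<And>x. top x \<le> 0"
begin

definition hom :: "(nat \<times> int) set \<Rightarrow> (nat \<times> int \<Rightarrow> int) \<Rightarrow> bool" where
  "hom D c \<longleftrightarrow> (\<forall>t\<in>D. \<forall>u\<in>D. edge t u \<longrightarrow> parity_step (S t - S u) (c t) (c u))"

definition configs :: "(nat \<times> int) set \<Rightarrow> (nat \<times> int \<Rightarrow> int) set" where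
  "configs D = {c. hom D c \<and> (\<forall>t. t \<notin> D \<longrightarrow> c t = 0) \<and> (\<forall>x. c (n, x) = top x)}"

definition box :: "(nat \<times> int) set" where
  "box = {(r, x). r \<le> n \<and> lo \<le> x \<and> x \<le> hi}"

text \<open>The sweep goes through the rows from \<open>n\<close> downwards and through each row
  from left to right. Just before \<open>(r, k)\<close> is added, the lower rim of the swept points
  is the \<open>front\<close>: row \<open>r\<close> to the left of \<open>k\<close> and row
  \<open>Suc r\<close> from \<open>k\<close> on.\<close>

definition swept :: "nat \<Rightarrow> int \<Rightarrow> (nat \<times> int) set" where
  "swept r k = {(r', x). r' \<le> n \<and> lo \<le> x \<and> x \<le> hi \<and> (r < r' \<or> r' = r \<and> x < k)}"

definition front :: "nat \<Rightarrow> int \<Rightarrow> (nat \<times> int \<Rightarrow> int) \<Rightarrow> int \<Rightarrow> int" where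
  "front r k c x = (if x < k then c (r, x) else c (Suc r, x))"

definition front_jump :: "nat \<Rightarrow> int \<Rightarrow> int \<Rightarrow> bool" where
  "front_jump r k x = odd (front r k S x - front r k S (x + 1))"

definition count :: "nat \<Rightarrow> int \<Rightarrow> (int \<Rightarrow> int) \<Rightarrow> nat" where
  "count r k y = card {c \<in> configs (swept r k). front r k c = y}"

lemma configs_outside: "c \<in> configs D \<Longrightarrow> t \<notin> D \<Longrightarrow> c t = 0"
  by (cases t) (simp add: configs_def)

lemma configsI: "hom D c \<Longrightarrow> (\<And>t. t \<notin> D \<Longrightarrow> c t = 0) \<Longrightarrow> (\<And>x. c (n, x) = top x) \<Longrightarrow> c \<in> configs D"
  by (simp add: configs_def)

lemma configs_top: "c \<in> configs D \<Longrightarrow> c (n, x) = top x"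
  by (simp add: configs_def)

lemma swept_Suc: "r \<le> n \<Longrightarrow> lo \<le> k \<Longrightarrow> k \<le> hi \<Longrightarrow> swept r (k + 1) = insert (r, k) (swept r k)"
  by (auto simp: swept_def)

lemma not_swept: "(r, k) \<notin> swept r k"
  by (simp add: swept_def)

text \<open>The new point has at most three swept neighbours: above it, to its left, and above to
  its right. All of them lie on the front.\<close>

lemma hom_insert:
  assumes "r < n" "lo \<le> k" "k \<le> hi"
  shows "hom (insert (r, k) (swept r k)) c \<longleftrightarrow> hom (swept r k) c \<and>
    parity_step (S (Suc r, k) - S (r, k)) (c (Suc r, k)) (c (r, k)) \<and>
    (lo < k \<longrightarrow> parity_step (S (r, k - 1) - S (r, k)) (c (r, k - 1)) (c (r, k))) \<and>
    (k < hi \<longrightarrow> parity_step (S (r, k) - S (Suc r, k + 1)) (c (r, k)) (c (Suc r, k + 1)))"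
proof -
  have 1: "u \<in> swept r k \<and> edge (r, k) u \<longleftrightarrow> k < hi \<and> u = (Suc r, k + 1)" for u
    using assms by (cases u) (auto simp: swept_def edge_def)
  have 2: "u \<in> swept r k \<and> edge u (r, k) \<longleftrightarrow> u = (Suc r, k) \<or> lo < k \<and> u = (r, k - 1)" for u
    using assms by (cases u) (auto simp: swept_def edge_def)
  have 3: "\<not> edge (r, k) (r, k)" by (simp add: edge_def)
  have "hom (insert (r, k) (swept r k)) c \<longleftrightarrow> hom (swept r k) c \<and>
     (\<forall>u. u \<in> swept r k \<and> edge (r, k) u \<longrightarrow> parity_step (S (r, k) - S u) (c (r, k)) (c u)) \<and>
     (\<forall>u. u \<in> swept r k \<and> edge u (r, k) \<longrightarrow> parity_step (S u - S (r, k)) (c u) (c (r, k)))"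
    unfolding hom_def using 3 by blast
  then show ?thesis unfolding 1 2 by auto
qed

lemma hom_cong: "(\<And>t. t \<in> D \<Longrightarrow> c t = c' t) \<Longrightarrow> hom D c \<longleftrightarrow> hom D c'"
  by (simp add: hom_def)

text \<open>\<open>v\<close> is the value above the new point, which leaves the front. The
  constraints at the new point only involve front values, so erasing it is a bijection onto the
  configurations whose front has \<open>v\<close> in column \<open>k\<close>.\<close>

lemma card_count:
  assumes "r < n" "lo \<le> k" "k \<le> hi"
  shows "card {c \<in> configs (swept r (k + 1)). front r (k + 1) c = y \<and> c (Suc r, k) = v}
    = (if parity_step (S (Suc r, k) - S (r, k)) v (y k) \<and>
         (lo < k \<longrightarrow> parity_step (S (r, k - 1) - S (r, k)) (y (k - 1)) (y k)) \<and>
         (k < hi \<longrightarrow> parity_step (S (r, k) - S (Suc r, k + 1)) (y k) (y (k + 1)))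
       then count r k (y(k := v)) else 0)" (is "card ?L = (if ?C then _ else 0)")
    and "finite {c \<in> configs (swept r k). front r k c = y(k := v)} \<Longrightarrow>
      finite {c \<in> configs (swept r (k + 1)). front r (k + 1) c = y \<and> c (Suc r, k) = v}"
proof (atomize (full), cases ?C)
  case False
  have e: "?L = {}"
  proof (rule ccontr)
    assume "?L \<noteq> {}"
    then obtain c where c: "c \<in> configs (swept r (k + 1))" "front r (k + 1) c = y" "c (Suc r, k) = v" by auto
    then have "hom (insert (r, k) (swept r k)) c" using swept_Suc assms by (simp add: configs_def)
    moreover have "y k = c (r, k)" "y (k - 1) = c (r, k - 1)" "y (k + 1) = c (Suc r, k + 1)"
      using c(2) by (auto simp: front_def)
    ultimately show False using False c(3) unfolding hom_insert[OF assms] by simp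
  qed
  then show "card ?L = (if ?C then count r k (y(k := v)) else 0) \<and>
      (finite {c \<in> configs (swept r k). front r k c = y(k := v)} \<longrightarrow> finite ?L)"
    unfolding if_not_P[OF False] e by simp
next
  case True
  have "bij_betw (\<lambda>c. c((r, k) := 0)) ?L {c \<in> configs (swept r k). front r k c = y(k := v)}"
  proof (rule bij_betw_byWitness[where f' = "\<lambda>c. c((r, k) := y k)"])
    show "\<forall>c\<in>?L. (c((r, k) := 0))((r, k) := y k) = c" by (auto simp: front_def)
    show "\<forall>c\<in>{c \<in> configs (swept r k). front r k c = y(k := v)}. (c((r, k) := y k))((r, k) := 0) = c"
      using configs_outside[OF _ not_swept] by (auto simp: fun_upd_idem)
    show "(\<lambda>c. c((r, k) := 0)) ` ?L \<subseteq> {c \<in> configs (swept r k). front r k c = y(k := v)}"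
    proof clarify
      fix c assume c: "c \<in> configs (swept r (k + 1))" "y = front r (k + 1) c" "v = c (Suc r, k)"
      then have "hom (swept r k) c" using swept_Suc assms hom_insert[OF assms] by (simp add: configs_def)
      then have "hom (swept r k) (c((r, k) := 0))"
        using hom_cong[of "swept r k" c "c((r, k) := 0)"] not_swept by fastforce
      moreover have "(c((r, k) := 0)) t = 0" if "t \<notin> swept r k" for t
        using configs_outside[OF c(1), of t] that swept_Suc[of r k] assms by auto
      ultimately have "c((r, k) := 0) \<in> configs (swept r k)"
        using configs_top[OF c(1)] assms(1) by (intro configsI) auto
      moreover have "front r k (c((r, k) := 0)) = (front r (k + 1) c)(k := c (Suc r, k))"
        by (auto simp: front_def fun_eq_iff)
      ultimately show "c((r, k) := 0) \<in> configs (swept r k) \<and>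
          front r k (c((r, k) := 0)) = (front r (k + 1) c)(k := c (Suc r, k))" ..
    qed
    show "(\<lambda>c. c((r, k) := y k)) ` {c \<in> configs (swept r k). front r k c = y(k := v)} \<subseteq> ?L"
    proof clarify
      fix c assume c: "c \<in> configs (swept r k)" "front r k c = y(k := v)"
      have cv: "c (Suc r, k) = v" using fun_cong[OF c(2), of k] by (simp add: front_def)
      have vals: "y (k - 1) = c (r, k - 1)" "y (k + 1) = c (Suc r, k + 1)"
        using fun_cong[OF c(2), of "k - 1"] fun_cong[OF c(2), of "k + 1"] by (simp_all add: front_def)
      let ?c = "c((r, k) := y k)"
      have "hom (swept r k) c" using c(1) by (simp add: configs_def)
      then have "hom (swept r k) ?c" using hom_cong[of "swept r k" c ?c] not_swept by fastforce
      then have "hom (insert (r, k) (swept r k)) ?c" unfolding hom_insert[OF assms] using True cv vals by simp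
      then have "hom (swept r (k + 1)) ?c" using swept_Suc assms by simp
      moreover have "?c t = 0" if "t \<notin> swept r (k + 1)" for t
        using configs_outside[OF c(1), of t] that swept_Suc[of r k] assms by auto
      ultimately have "?c \<in> configs (swept r (k + 1))"
        using configs_top[OF c(1)] assms(1) by (intro configsI) auto
      moreover have "front r (k + 1) ?c = y"
      proof
        fix x
        show "front r (k + 1) ?c x = y x"
          using fun_cong[OF c(2), of x] by (cases "x = k") (auto simp: front_def)
      qed
      ultimately show "?c \<in> configs (swept r (k + 1)) \<and> front r (k + 1) ?c = y \<and> ?c (Suc r, k) = v"
        using cv by simp
    qed
  qed
  then have "card ?L = card {c \<in> configs (swept r k). front r k c = y(k := v)}"
    "finite ?L \<longleftrightarrow> finite {c \<in> configs (swept r k). front r k c = y(k := v)}"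
    by (rule bij_betw_same_card, rule bij_betw_finite)
  then show "card ?L = (if ?C then count r k (y(k := v)) else 0) \<and>
      (finite {c \<in> configs (swept r k). front r k c = y(k := v)} \<longrightarrow> finite ?L)"
    unfolding if_P[OF True] count_def by simp
qed

lemma rep_cong:
  assumes "\<And>x. lo \<le> x \<Longrightarrow> x < hi \<Longrightarrow> j x = j' x"
  shows "rep j E f = rep j' E f"
proof -
  have i: "idx j x = idx j' x" if "x \<le> hi" for x by (rule idx_cong) (use assms that in auto)
  have "lift j w = lift j' w" for w by (rule ext) (simp add: lift_def i)
  moreover have "row_ok j y = row_ok j' y" for y using assms unfolding row_ok_def by auto
  ultimately show ?thesis unfolding rep_def i[OF order_refl] by simp
qed

lemma count_Suc_sum:
  assumes "r < n" "lo \<le> k" "k \<le> hi" "finite V"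
    and fin: "\<And>y. finite {c \<in> configs (swept r k). front r k c = y}"
    and "\<And>v. parity_step (S (Suc r, k) - S (r, k)) v (y k) \<Longrightarrow> v \<in> V"
  shows "count r (k + 1) y = (\<Sum>v\<in>V. card {c \<in> configs (swept r (k + 1)). front r (k + 1) c = y \<and> c (Suc r, k) = v})"
    and "finite {c \<in> configs (swept r (k + 1)). front r (k + 1) c = y}"
proof -
  have un: "{c \<in> configs (swept r (k + 1)). front r (k + 1) c = y} =
      (\<Union>v\<in>V. {c \<in> configs (swept r (k + 1)). front r (k + 1) c = y \<and> c (Suc r, k) = v})"
  proof (intro equalityI subsetI)
    fix c assume "c \<in> {c \<in> configs (swept r (k + 1)). front r (k + 1) c = y}"
    then have c: "c \<in> configs (swept r (k + 1))" "front r (k + 1) c = y" by auto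
    then have "hom (insert (r, k) (swept r k)) c" using swept_Suc assms by (simp add: configs_def)
    then have "parity_step (S (Suc r, k) - S (r, k)) (c (Suc r, k)) (c (r, k))"
      unfolding hom_insert[OF assms(1-3)] by simp
    moreover have "c (r, k) = y k" using c(2) by (auto simp: front_def)
    ultimately show "c \<in> (\<Union>v\<in>V. {c \<in> configs (swept r (k + 1)). front r (k + 1) c = y \<and> c (Suc r, k) = v})"
      using c assms(6) by auto
  qed auto
  have f: "finite {c \<in> configs (swept r (k + 1)). front r (k + 1) c = y \<and> c (Suc r, k) = v}" for v
    by (rule card_count(2)[OF assms(1-3) fin])
  show "count r (k + 1) y = (\<Sum>v\<in>V. card {c \<in> configs (swept r (k + 1)). front r (k + 1) c = y \<and> c (Suc r, k) = v})"
    unfolding count_def un using f assms(4) by (subst card_UN_disjoint) auto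
  show "finite {c \<in> configs (swept r (k + 1)). front r (k + 1) c = y}" unfolding un using f assms(4) by blast
qed

definition represented :: "nat \<Rightarrow> int \<Rightarrow> bool" where
  "represented r k \<longleftrightarrow> (\<exists>f. rep (front_jump r k) (count r k) f) \<and>
    (\<forall>y. finite {c \<in> configs (swept r k). front r k c = y})"

text \<open>\<open>q\<close> is the difference of the vertex totals above and at the new point. If
  it is even, the value is copied and no jump changes; if it is 1, the value moves by 1 and both
  neighbouring jumps toggle, which is the situation of \<open>rep_flip\<close>.\<close>

lemma represented_step:
  assumes "r < n" "lo \<le> k" "k \<le> hi" "represented r k"
  shows "represented r (k + 1)"
proof -
  obtain f where rep: "rep (front_jump r k) (count r k) f"
    and fin: "\<And>y. finite {c \<in> configs (swept r k). front r k c = y}"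
    using assms(4) unfolding represented_def by auto
  define q where "q = S (Suc r, k) - S (r, k)"
  define p where "p = S (r, k - 1) - S (Suc r, k)"
  define s where "s = S (r, k) - S (Suc r, k + 1)"
  \<comment> \<open>The upper bound compares both totals with the one at
    \<open>(Suc r, k + 1)\<close>.\<close>
  have q: "0 \<le> q" "q \<le> 2"
    using S_up[of r k] S_down[of r k] S_drop[of "Suc r" k] assms(1) by (auto simp: q_def)
  have pq: "S (r, k - 1) - S (r, k) = p + q" by (simp add: p_def q_def)
  have jk: "front_jump r k (k - 1) = odd p" "front_jump r k k = odd (q + s)"
    "front_jump r (k + 1) (k - 1) = odd (p + q)" "front_jump r (k + 1) k = odd s"
    by (simp_all add: front_jump_def front_def p_def q_def s_def)
  have jo: "front_jump r (k + 1) x = front_jump r k x" if "x \<noteq> k - 1" "x \<noteq> k" for x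
    using that by (auto simp: front_jump_def front_def)
  have card: "card {c \<in> configs (swept r (k + 1)). front r (k + 1) c = y \<and> c (Suc r, k) = v}
    = (if parity_step q v (y k) \<and> (lo < k \<longrightarrow> parity_step (p + q) (y (k - 1)) (y k)) \<and>
         (k < hi \<longrightarrow> parity_step s (y k) (y (k + 1))) then count r k (y(k := v)) else 0)" for y v
    using card_count(1)[OF assms(1-3), of y v] unfolding q_def[symmetric] pq s_def[symmetric] .
  show ?thesis
  proof (cases "even q")
    case True
    have V: "parity_step (S (Suc r, k) - S (r, k)) v (y k) \<Longrightarrow> v \<in> {y k}" for y v
      using True by (simp add: parity_step_def q_def)
    have fin': "finite {c \<in> configs (swept r (k + 1)). front r (k + 1) c = y}" for y
      by (rule count_Suc_sum(2)[OF assms(1-3) _ fin V]) simp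
    have "count r (k + 1) y = count r k y" for y
    proof -
      have "count r (k + 1) y = (\<Sum>v\<in>{y k}. card {c \<in> configs (swept r (k + 1)). front r (k + 1) c = y \<and> c (Suc r, k) = v})"
        by (rule count_Suc_sum(1)[OF assms(1-3) _ fin V]) simp
      also have "\<dots> = (if parity_step q (y k) (y k) \<and> (lo < k \<longrightarrow> parity_step (p + q) (y (k - 1)) (y k)) \<and>
         (k < hi \<longrightarrow> parity_step s (y k) (y (k + 1))) then count r k y else 0)" unfolding card
        by (simp only: sum.insert sum.empty finite.emptyI empty_iff not_False_eq_True add_0_right fun_upd_triv)
      also have "\<dots> = count r k y"
      proof (cases "count r k y = 0")
        case False
        have ro: "row_ok (front_jump r k) y" by (rule rep_row_ok[OF rep]) (rule False)
        have r: "lo \<le> x \<and> x < hi \<longrightarrow> (if front_jump r k x then \<bar>y x - y (x + 1)\<bar> = 1 else y x = y (x + 1))" for x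
          using ro unfolding row_ok_def by blast
        show ?thesis using r[of "k - 1", unfolded diff_add_cancel] r[of k] assms(2,3) True jk(1,2)
          by (auto simp: parity_step_def)
      qed simp
      finally show ?thesis .
    qed
    then have "count r (k + 1) = count r k" by (rule ext)
    moreover have "rep (front_jump r (k + 1)) (count r k) f"
    proof -
      have "front_jump r (k + 1) x = front_jump r k x" for x
        using jo[of x] jk True by (cases "x = k - 1"; cases "x = k") auto
      then have "front_jump r (k + 1) = front_jump r k" by (rule ext)
      then show ?thesis using rep by simp
    qed
    ultimately show ?thesis unfolding represented_def using fin' by auto
  next
    case False
    then have q1: "q = 1" using q by (cases "q = 0"; cases "q = 2") auto
    \<comment> \<open>The total is constant along the border columns, so \<open>q = 1\<close> only
      occurs in a column with neighbours on both sides, as \<open>rep_flip\<close> requires.\<close>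
    have "k \<noteq> lo" "k \<noteq> hi" using q1 S_lo[OF assms(1)] S_hi[OF assms(1)] by (auto simp: q_def)
    then have k: "lo < k" "k < hi" using assms by auto
    have V: "parity_step (S (Suc r, k) - S (r, k)) v (y k) \<Longrightarrow> v \<in> {y k - 1, y k + 1}" for y v
      using False by (auto simp: parity_step_def q_def)
    have fin': "finite {c \<in> configs (swept r (k + 1)). front r (k + 1) c = y}" for y
      by (rule count_Suc_sum(2)[OF assms(1-3) _ fin V]) simp
    have loc: "local_ok (toggle (front_jump r k) k) k y \<longleftrightarrow>
      parity_step (p + q) (y (k - 1)) (y k) \<and> parity_step s (y k) (y (k + 1))" for y
      using jk q1 by (simp add: local_ok_def parity_step_def)
    have "count r (k + 1) y = (\<Sum>v\<in>{y k - 1, y k + 1}. if local_ok (toggle (front_jump r k) k) k y then count r k (y(k := v)) else 0)" for y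
    proof -
      have "count r (k + 1) y = (\<Sum>v\<in>{y k - 1, y k + 1}. card {c \<in> configs (swept r (k + 1)). front r (k + 1) c = y \<and> c (Suc r, k) = v})"
        by (rule count_Suc_sum(1)[OF assms(1-3) _ fin V]) simp
      also have "\<dots> = (\<Sum>v\<in>{y k - 1, y k + 1}. if local_ok (toggle (front_jump r k) k) k y then count r k (y(k := v)) else 0)"
        unfolding card loc using k q1 by (intro sum.cong refl) (auto simp: parity_step_def)
      finally show ?thesis .
    qed
    from rep_flip[OF rep k this] obtain f' where "rep (toggle (front_jump r k) k) (count r (k + 1)) f'" ..
    moreover have "toggle (front_jump r k) k x = front_jump r (k + 1) x" for x using jo[of x] jk q1 by auto
    then have "toggle (front_jump r k) k = front_jump r (k + 1)" by (rule ext)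
    ultimately show ?thesis unfolding represented_def using fin' by auto
  qed
qed

lemma lift_inj:
  assumes "w \<in> walks (Suc (idx j hi))" "w' \<in> walks (Suc (idx j hi))" "lift j w = lift j w'"
  shows "w = w'"
proof (rule lift_inj_except[OF assms(1,2), of "lo - 1"])
  have "{z. lo \<le> z \<and> z < lo - 1 \<and> j z} = {}" by auto
  then have "idx j (lo - 1) = 0" unfolding idx_def by (simp only: card.empty)
  then show "\<exists>k'. k' \<noteq> lo - 1 \<and> lo \<le> k' \<and> k' \<le> hi \<and> idx j k' = idx j (lo - 1)"
    using lo_less_hi idx_lo by (intro exI[of _ lo]) simp
qed (use assms(3) in simp)

text \<open>Only the prescribed top row is present, so the count is the indicator of its word. That
  word is nonpositive, hence of the form \<open>planar.base\<close>.\<close>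

lemma represented_top: "represented (n - 1) lo"
proof -
  let ?j = "\<lambda>x. odd (S (n, x) - S (n, x + 1))"
  define c0 where "c0 t = (if fst t = n then top (snd t) else 0)" for t
  have n: "Suc (n - 1) = n" using n_pos by simp
  have sw: "swept (n - 1) lo = {(n, x) | x. lo \<le> x \<and> x \<le> hi}" using n_pos by (auto simp: swept_def)
  have out: "top x = 0" if "x < lo \<or> hi < x" for x using top_ok that unfolding row_ok_def by blast
  have "configs (swept (n - 1) lo) = {c0}"
  proof (intro equalityI subsetI)
    fix c assume c: "c \<in> configs (swept (n - 1) lo)"
    have "c t = c0 t" for t
    proof (cases "fst t = n")
      case True
      then show ?thesis using configs_top[OF c, of "snd t"] by (cases t) (simp add: c0_def)
    next
      case False
      then have "t \<notin> swept (n - 1) lo" unfolding sw by auto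
      then show ?thesis using configs_outside[OF c, of t] False by (simp add: c0_def)
    qed
    then show "c \<in> {c0}" by auto
  next
    fix c assume "c \<in> {c0}"
    moreover have "c0 \<in> configs (swept (n - 1) lo)"
    proof (rule configsI)
      show "hom (swept (n - 1) lo) c0" unfolding hom_def
      proof (intro ballI impI)
        fix t u assume t: "t \<in> swept (n - 1) lo" "u \<in> swept (n - 1) lo" "edge t u"
        then obtain x where "t = (n, x)" "u = (n, x + 1)" "lo \<le> x" "x < hi"
          unfolding sw by (auto simp: edge_def)
        then show "parity_step (S t - S u) (c0 t) (c0 u)"
          using top_ok by (simp add: row_ok_def parity_step_def c0_def)
      qed
    qed (unfold sw, auto simp: c0_def not_le out)
    ultimately show "c \<in> configs (swept (n - 1) lo)" by simp
  qed
  moreover have "front (n - 1) lo c0 = top" using n_pos by (auto simp: front_def c0_def fun_eq_iff out)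
  ultimately have ct: "{c \<in> configs (swept (n - 1) lo). front (n - 1) lo c = y} = (if y = top then {c0} else {})" for y
    by auto
  then have cnt: "count (n - 1) lo y = (if y = top then 1 else 0)" for y by (simp add: count_def)
  have fj: "front_jump (n - 1) lo x = ?j x" if "lo \<le> x" "x < hi" for x
    using that n by (simp add: front_jump_def front_def)
  obtain w0 where w0: "w0 \<in> walks (Suc (idx ?j hi))" "top = lift ?j w0"
    using ex_word[OF top_ok] by (rule bexE)
  have "rep ?j (count (n - 1) lo) (\<lambda>w. if w = w0 then 1 else 0)" unfolding rep_def
  proof (intro conjI ballI allI impI)
    have "\<forall>x\<in>set w0. x \<le> 0"
    proof
      fix x assume "x \<in> set w0"
      then obtain i where i: "i < length w0" "x = w0 ! i" by (auto simp: in_set_conv_nth)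
      then obtain z where "lo \<le> z" "z \<le> hi" "idx ?j z = i"
        using idx_surj[of hi i ?j] lo_less_hi w0 by (auto simp: walks_def)
      then have "top z = x" using i w0(2) by (simp add: lift_def)
      then show "x \<le> 0" using top_nonpos[of z] by simp
    qed
    then show "planar (Suc (idx ?j hi)) (\<lambda>w. if w = w0 then 1 else 0)"
      using planar.base[of w0 1] w0 by (simp add: walks_def)
  next
    fix w assume w: "w \<in> walks (Suc (idx ?j hi))"
    show "count (n - 1) lo (lift ?j w) = (if w = w0 then 1 else 0)"
      unfolding cnt using lift_inj[OF w w0(1)] w0(2) by auto
  next
    fix y assume "count (n - 1) lo y \<noteq> 0"
    then have "y = top" unfolding cnt by (simp split: if_splits)
    then show "row_ok ?j y" using top_ok by (simp only:)
  qed
  then have "rep (front_jump (n - 1) lo) (count (n - 1) lo) (\<lambda>w. if w = w0 then 1 else 0)"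
    using rep_cong[of "front_jump (n - 1) lo" ?j] fj by blast
  then show ?thesis unfolding represented_def ct by (auto simp: exI)
qed

lemma represented_row:
  assumes "r < n" "represented r lo"
  shows "represented r (hi + 1)"
proof -
  have "represented r k" if "lo \<le> k" "k \<le> hi + 1" for k using that
  proof (induction k rule: int_ge_induct)
    case base
    show ?case by (rule assms(2))
  next
    case (step k)
    then show ?case using represented_step[OF assms(1)] by auto
  qed
  then show ?thesis using lo_less_hi by simp
qed

lemma represented_next:
  assumes "Suc r < n" "represented (Suc r) (hi + 1)"
  shows "represented r lo"
proof -
  have sw: "swept (Suc r) (hi + 1) = swept r lo" by (auto simp: swept_def)
  have fr: "front (Suc r) (hi + 1) c = front r lo c" if c: "c \<in> configs (swept r lo)" for c
  proof
    fix x
    have "c (r, x) = 0" "x < lo \<or> hi < x \<Longrightarrow> c (Suc r, x) = 0" "hi < x \<Longrightarrow> c (Suc (Suc r), x) = 0" if "x < lo \<or> hi < x"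
      using configs_outside[OF c] that by (auto simp: swept_def)
    then show "front (Suc r) (hi + 1) c x = front r lo c x" using lo_less_hi by (auto simp: front_def)
  qed
  have eq: "{c \<in> configs (swept (Suc r) (hi + 1)). front (Suc r) (hi + 1) c = y} = {c \<in> configs (swept r lo). front r lo c = y}" for y
    unfolding sw using fr by auto
  then have "count (Suc r) (hi + 1) = count r lo" by (simp add: count_def fun_eq_iff)
  moreover have "front_jump (Suc r) (hi + 1) x = front_jump r lo x" if "lo \<le> x" "x < hi" for x
    using that by (simp add: front_jump_def front_def)
  then have "rep (front_jump (Suc r) (hi + 1)) E f = rep (front_jump r lo) E f" for E f by (rule rep_cong)
  ultimately show ?thesis using assms(2) unfolding represented_def eq by metis
qed

definition jumps :: "int \<Rightarrow> bool" where
  "jumps x \<longleftrightarrow> odd (S (0, x) - S (0, x + 1))"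

definition extensions :: "(int \<Rightarrow> int) \<Rightarrow> (nat \<times> int \<Rightarrow> int) set" where
  "extensions y = {c \<in> configs box. (\<lambda>x. c (0, x)) = y}"

theorem extensions_rep:
  obtains f where "rep jumps (\<lambda>y. card (extensions y)) f" "\<And>y. finite (extensions y)"
proof -
  have "represented r lo" if "r < n" for r using that
  proof (induction "n - 1 - r" arbitrary: r)
    case 0
    then have "r = n - 1" by simp
    then show ?case using represented_top by simp
  next
    case (Suc d)
    then have "represented (Suc r) lo" by simp
    then show ?case using represented_row represented_next Suc by simp
  qed
  then have r0: "represented 0 (hi + 1)" using represented_row n_pos by simp
  have sw: "swept 0 (hi + 1) = box" by (auto simp: swept_def box_def)
  have fr: "front 0 (hi + 1) c = (\<lambda>x. c (0, x))" if c: "c \<in> configs box" for c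
  proof
    fix x
    have "c (0, x) = 0" "c (Suc 0, x) = 0" if "hi < x"
      using configs_outside[OF c] that by (auto simp: box_def)
    then show "front 0 (hi + 1) c x = c (0, x)" by (auto simp: front_def)
  qed
  have eq: "{c \<in> configs (swept 0 (hi + 1)). front 0 (hi + 1) c = y} = extensions y" for y
    unfolding sw extensions_def using fr by auto
  then have "count 0 (hi + 1) = (\<lambda>y. card (extensions y))" by (simp add: count_def fun_eq_iff)
  moreover have "front_jump 0 (hi + 1) x = jumps x" if "lo \<le> x" "x < hi" for x
    using that by (simp add: front_jump_def front_def jumps_def)
  then have "rep (front_jump 0 (hi + 1)) E f = rep jumps E f" for E f by (rule rep_cong)
  ultimately show ?thesis using r0 that unfolding represented_def eq by metis
qed

end

section \<open>Regions of height functions and sign changes\<close>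

context strip_heights
begin

text \<open>Only nonvanishing is required: values joined by an edge differ by at most 1, so linked
  points of a configuration have equal signs (\<open>region_sign\<close>). In this form regions are
  unaffected by sign changes (\<open>region_cong\<close>).\<close>

definition link :: "(nat \<times> int \<Rightarrow> int) \<Rightarrow> ((nat \<times> int) \<times> (nat \<times> int)) set" where
  "link c = {(t, u). t \<in> box \<and> u \<in> box \<and> c t \<noteq> 0 \<and> c u \<noteq> 0 \<and> (edge t u \<or> edge u t)}"

definition region :: "(nat \<times> int \<Rightarrow> int) \<Rightarrow> nat \<times> int \<Rightarrow> (nat \<times> int) set" where
  "region c t = {u. (t, u) \<in> (link c)\<^sup>*}"

definition odd_region :: "(nat \<times> int \<Rightarrow> int) \<Rightarrow> bool" where
  "odd_region c \<longleftrightarrow> (\<exists>t\<in>box. c t < 0 \<and> (\<forall>u\<in>region c t. fst u \<noteq> n) \<and> odd (card {x. (0, x) \<in> region c t}))"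

definition flip :: "(nat \<times> int) set \<Rightarrow> (nat \<times> int \<Rightarrow> int) \<Rightarrow> nat \<times> int \<Rightarrow> int" where
  "flip V c t = (if t \<in> V then - c t else c t)"

definition run_length :: "nat \<Rightarrow> nat" where
  "run_length k = card {x. lo \<le> x \<and> x \<le> hi \<and> idx jumps x = k}"

abbreviation runs :: nat where
  "runs \<equiv> Suc (idx jumps hi)"

definition bottom_admissible :: "(nat \<times> int \<Rightarrow> int) \<Rightarrow> bool" where
  "bottom_admissible c \<longleftrightarrow> (\<exists>w\<in>walks runs. (\<lambda>x. c (0, x)) = lift jumps w \<and> admissible run_length w)"

definition bottom_sign :: "(nat \<times> int \<Rightarrow> int) \<Rightarrow> int" where
  "bottom_sign c = (if \<forall>x. \<bar>c (0, x)\<bar> \<le> 1 then (- 1) ^ card {x. c (0, x) = 1} else 0)"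

lemma sym_link: "sym (link c)"
  by (auto simp: sym_def link_def)

lemma region_refl: "t \<in> region c t"
  by (simp add: region_def)

lemma region_trans: "u \<in> region c t \<Longrightarrow> v \<in> region c u \<Longrightarrow> v \<in> region c t"
  by (simp add: region_def)

lemma region_sym: "u \<in> region c t \<Longrightarrow> t \<in> region c u"
  unfolding region_def using symD[OF sym_rtrancl[OF sym_link[of c]]] by simp

lemma region_cong:
  assumes "\<And>t. c t = 0 \<longleftrightarrow> c' t = 0"
  shows "region c t = region c' t"
  unfolding region_def link_def assms ..

lemma region_support:
  assumes "u \<in> region c t" "t \<in> box" "c t \<noteq> 0"
  shows "u \<in> box \<and> c u \<noteq> 0"
proof -
  have "(t, u) \<in> (link c)\<^sup>*" using assms(1) by (simp add: region_def)
  then show ?thesis by (cases rule: rtrancl.cases) (use assms(2,3) in \<open>simp_all add: link_def\<close>)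
qed

lemma configs_parity_step:
  assumes "c \<in> configs box" "t \<in> box" "u \<in> box" "edge t u \<or> edge u t"
  shows "c t = c u \<or> \<bar>c t - c u\<bar> = 1"
proof -
  have "parity_step (S v - S v') (c v) (c v')" if "v \<in> box" "v' \<in> box" "edge v v'" for v v'
    using assms(1) that by (auto simp: configs_def hom_def)
  from this[of t u] this[of u t] show ?thesis
    using assms(2-4) by (auto simp: parity_step_def split: if_splits)
qed

lemma region_sign:
  assumes "c \<in> configs box" "u \<in> region c t"
  shows "c t < 0 \<longleftrightarrow> c u < 0" "c t > 0 \<longleftrightarrow> c u > 0"
proof -
  have "(t, u) \<in> (link c)\<^sup>*" using assms(2) by (simp add: region_def)
  then have "(c t < 0 \<longleftrightarrow> c u < 0) \<and> (c t > 0 \<longleftrightarrow> c u > 0)"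
  proof (induction rule: rtrancl_induct)
    case (step v u)
    then have "v \<in> box" "u \<in> box" "c v \<noteq> 0" "c u \<noteq> 0" "edge v u \<or> edge u v" by (auto simp: link_def)
    with configs_parity_step[OF assms(1) this(1,2,5)] step.IH show ?case by arith
  qed simp
  then show "c t < 0 \<longleftrightarrow> c u < 0" "c t > 0 \<longleftrightarrow> c u > 0" by auto
qed

text \<open>An edge leaving \<open>V\<close> ends in a zero, which equals its own negative, and
  inside \<open>V\<close> both values change sign; \<open>parity_step\<close> is invariant in either
  case. Rows below the top are free, so \<open>V\<close> only has to avoid row
  \<open>n\<close>.\<close>

lemma flip_configs:
  assumes c: "c \<in> configs box" and V: "V \<subseteq> {t \<in> box. c t \<noteq> 0}" "\<And>t. t \<in> V \<Longrightarrow> fst t \<noteq> n"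
    and closed: "\<And>t u. t \<in> V \<Longrightarrow> u \<in> region c t \<Longrightarrow> u \<in> V"
  shows "flip V c \<in> configs box"
proof (rule configsI)
  show "flip V c t = 0" if "t \<notin> box" for t using configs_outside[OF c that] by (simp add: flip_def)
  show "flip V c (n, x) = top x" for x using configs_top[OF c] V(2)[of "(n, x)"] by (auto simp: flip_def)
  show "hom box (flip V c)" unfolding hom_def
  proof (intro ballI impI)
    fix t u assume tu: "t \<in> box" "u \<in> box" "edge t u"
    have ps: "parity_step (S t - S u) (c t) (c u)" using c tu by (auto simp: configs_def hom_def)
    have zero: "c v = 0" if "v' \<in> V" "v \<notin> V" "v \<in> box" "edge v' v \<or> edge v v'" for v v'
    proof (rule ccontr)
      assume "c v \<noteq> 0"
      then have "(v', v) \<in> link c" using that V(1) by (auto simp: link_def)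
      then have "v \<in> region c v'" by (auto simp: region_def)
      with closed that show False by blast
    qed
    have "u \<in> V \<Longrightarrow> t \<notin> V \<Longrightarrow> c t = 0" "t \<in> V \<Longrightarrow> u \<notin> V \<Longrightarrow> c u = 0" using zero tu by blast+
    then show "parity_step (S t - S u) (flip V c t) (flip V c u)"
      using ps by (auto simp: parity_step_def flip_def split: if_splits)
  qed
qed

lemma card_runs:
  "(\<Sum>k<runs. run_length k * of_bool (P k)) = card {x. lo \<le> x \<and> x \<le> hi \<and> P (idx jumps x)}"
proof -
  have fin: "finite {x. lo \<le> x \<and> x \<le> hi \<and> R x}" for R by (rule finite_subset[of _ "{lo..hi}"]) auto
  have "{x. lo \<le> x \<and> x \<le> hi \<and> P (idx jumps x)}
    = (\<Union>k\<in>{k. k < runs \<and> P k}. {x. lo \<le> x \<and> x \<le> hi \<and> idx jumps x = k})"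
    using idx_mono[of _ hi jumps] by (auto simp: less_Suc_eq_le)
  also have "card \<dots> = (\<Sum>k\<in>{k. k < runs \<and> P k}. run_length k)"
    unfolding run_length_def by (rule card_UN_disjoint) (auto intro: fin)
  also have "\<dots> = (\<Sum>k<runs. run_length k * of_bool (P k))" by (intro sum.mono_neutral_cong_left) auto
  finally show ?thesis ..
qed

lemma extensions_row: "c \<in> extensions y \<Longrightarrow> c (0, x) = y x"
  by (auto simp: extensions_def)

lemma bottom_word:
  assumes "rep jumps (\<lambda>y. card (extensions y)) f" "\<And>y. finite (extensions y)" "c \<in> configs box"
  shows "\<exists>w\<in>walks runs. c \<in> extensions (lift jumps w) \<and> 0 < f w"
proof -
  define y where "y x = c (0, x)" for x
  have c: "c \<in> extensions y" using assms(3) by (auto simp: extensions_def y_def)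
  then have "card (extensions y) \<noteq> 0" using assms(2)[of y] by auto
  then have "row_ok jumps y" by (rule rep_row_ok[OF assms(1)])
  then obtain w where w: "w \<in> walks runs" "y = lift jumps w" using ex_word by blast
  moreover have "0 < f w" using rep_lift[OF assms(1) w(1)] \<open>card (extensions y) \<noteq> 0\<close> w(2) by simp
  ultimately show ?thesis using c by blast
qed

lemma word_at:
  assumes "w \<in> walks runs" "k < runs"
  shows "\<exists>x. lo \<le> x \<and> x \<le> hi \<and> idx jumps x = k"
  using idx_surj[of hi k jumps] lo_less_hi assms by auto

lemma bottom_sign_word:
  assumes "w \<in> walks runs" "c \<in> extensions (lift jumps w)"
  shows "bottom_sign c = signed_weight run_length w"
proof -
  have len: "length w = runs" using assms by (simp add: walks_def)
  have c: "c (0, x) = lift jumps w x" for x using assms by (simp add: extensions_row)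
  have "(\<forall>x. \<bar>c (0, x)\<bar> \<le> 1) \<longleftrightarrow> (\<forall>v\<in>set w. \<bar>v\<bar> \<le> 1)"
  proof
    assume L: "\<forall>x. \<bar>c (0, x)\<bar> \<le> 1"
    show "\<forall>v\<in>set w. \<bar>v\<bar> \<le> 1"
    proof
      fix v assume "v \<in> set w"
      then obtain k where k: "k < runs" "v = w ! k" using len by (auto simp: in_set_conv_nth)
      then obtain x where "lo \<le> x" "x \<le> hi" "idx jumps x = k" using word_at[OF assms(1)] by blast
      then show "\<bar>v\<bar> \<le> 1" using L[rule_format, of x] k by (simp add: c lift_def)
    qed
  next
    assume R: "\<forall>v\<in>set w. \<bar>v\<bar> \<le> 1"
    show "\<forall>x. \<bar>c (0, x)\<bar> \<le> 1"
    proof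
      fix x
      show "\<bar>c (0, x)\<bar> \<le> 1"
        using R idx_mono[of x hi jumps] len by (auto simp: c lift_def less_Suc_eq_le)
    qed
  qed
  moreover have "{x. c (0, x) = 1} = {x. lo \<le> x \<and> x \<le> hi \<and> w ! idx jumps x = 1}"
    by (auto simp: c lift_def split: if_splits)
  then have "card {x. c (0, x) = 1} = (\<Sum>k<length w. run_length k * of_bool (w ! k = 1))"
    unfolding len card_runs by simp
  ultimately show ?thesis by (simp only: bottom_sign_def signed_weight_def)
qed

lemma lift_eq_iff:
  "w \<in> walks runs \<Longrightarrow> w' \<in> walks runs \<Longrightarrow> lift jumps w = lift jumps w' \<longleftrightarrow> w = w'"
  using lift_inj by blast

lemma bottom_admissible_word:
  assumes "w \<in> walks runs" "c \<in> extensions (lift jumps w)"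
  shows "bottom_admissible c \<longleftrightarrow> admissible run_length w"
  using assms lift_eq_iff[OF assms(1)] unfolding bottom_admissible_def extensions_def by auto

lemma sum_configs:
  fixes g :: "(nat \<times> int \<Rightarrow> int) \<Rightarrow> int"
  assumes rep: "rep jumps (\<lambda>y. card (extensions y)) f" and fin: "\<And>y. finite (extensions y)"
    and g: "\<And>w c. w \<in> walks runs \<Longrightarrow> c \<in> extensions (lift jumps w) \<Longrightarrow> g c = h w"
  shows "(\<Sum>c\<in>configs box. g c) = (\<Sum>w\<in>walks runs. h w * int (f w))" and "finite (configs box)"
proof -
  have un: "configs box = (\<Union>w\<in>walks runs. extensions (lift jumps w))"
    using bottom_word[OF rep fin] by (auto simp: extensions_def)
  show "finite (configs box)" unfolding un using finite_walks fin by blast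
  have "(\<Sum>c\<in>configs box. g c) = (\<Sum>w\<in>walks runs. \<Sum>c\<in>extensions (lift jumps w). g c)" unfolding un
  proof (rule sum.UNION_disjoint)
    show "\<forall>w\<in>walks runs. \<forall>w'\<in>walks runs. w \<noteq> w' \<longrightarrow>
        extensions (lift jumps w) \<inter> extensions (lift jumps w') = {}"
      using lift_eq_iff by (auto simp: extensions_def)
  qed (use finite_walks fin in auto)
  also have "\<dots> = (\<Sum>w\<in>walks runs. h w * int (f w))"
  proof (rule sum.cong)
    fix w assume w: "w \<in> walks runs"
    have "(\<Sum>c\<in>extensions (lift jumps w). g c) = (\<Sum>c\<in>extensions (lift jumps w). h w)"
      by (rule sum.cong) (use g[OF w] in auto)
    also have "\<dots> = h w * int (card (extensions (lift jumps w)))" by simp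
    finally show "(\<Sum>c\<in>extensions (lift jumps w). g c) = h w * int (f w)"
      using rep_lift[OF rep w] by simp
  qed simp
  finally show "(\<Sum>c\<in>configs box. g c) = (\<Sum>w\<in>walks runs. h w * int (f w))" .
qed

text \<open>Changing the sign of an odd negative region gives another configuration with the same
  top. Its bottom word arises by raising letters -1 to 1, lower letters being excluded by
  admissibility, on runs of odd total length; \<open>balanced\<close> forbids this.\<close>

lemma balanced_no_odd_region:
  assumes rep: "rep jumps (\<lambda>y. card (extensions y)) f" and fin: "\<And>y. finite (extensions y)"
    and bal: "balanced runs run_length f" and c: "c \<in> configs box" "bottom_admissible c"
  shows "\<not> odd_region c"
proof
  assume "odd_region c"
  then obtain t where t: "t \<in> box" "c t < 0" "\<forall>u\<in>region c t. fst u \<noteq> n" "odd (card {x. (0, x) \<in> region c t})"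
    by (auto simp: odd_region_def)
  let ?c = "flip (region c t) c"
  have c': "?c \<in> configs box"
    using t region_support[of _ c t] by (intro flip_configs[OF c(1)]) (auto intro: region_trans)
  obtain w where w: "w \<in> walks runs" "c \<in> extensions (lift jumps w)" "0 < f w"
    using bottom_word[OF rep fin c(1)] by blast
  obtain w' where w': "w' \<in> walks runs" "?c \<in> extensions (lift jumps w')" "0 < f w'"
    using bottom_word[OF rep fin c'] by blast
  have len: "length w = runs" using w by (simp add: walks_def)
  have val: "c (0, x) = w ! idx jumps x" "?c (0, x) = w' ! idx jumps x" if "lo \<le> x" "x \<le> hi" for x
    using extensions_row[OF w(2), of x] extensions_row[OF w'(2), of x] that by (simp_all add: lift_def)
  have ge: "- 1 \<le> w ! k" if "k < runs" for k
    using c(2) bottom_admissible_word[OF w(1,2)] that len by (auto simp: admissible_def)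
  have neg: "c u < 0" if "u \<in> region c t" for u using region_sign[OF c(1) that] t(2) by simp
  have "\<forall>k<runs. w' ! k = w ! k \<or> w ! k = - 1 \<and> w' ! k = 1"
  proof (intro allI impI)
    fix k assume k: "k < runs"
    then obtain x where x: "lo \<le> x" "x \<le> hi" "idx jumps x = k" using word_at[OF w(1)] by blast
    show "w' ! k = w ! k \<or> w ! k = - 1 \<and> w' ! k = 1"
      using val[OF x(1,2)] x(3) ge[OF k] neg[of "(0, x)"] by (auto simp: flip_def split: if_splits)
  qed
  then have "even (\<Sum>k<runs. run_length k * of_bool (w' ! k \<noteq> w ! k))"
    using bal w w' unfolding balanced_def by blast
  moreover have "{x. lo \<le> x \<and> x \<le> hi \<and> w' ! idx jumps x \<noteq> w ! idx jumps x} = {x. (0, x) \<in> region c t}"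
  proof (intro Collect_cong)
    fix x
    show "(lo \<le> x \<and> x \<le> hi \<and> w' ! idx jumps x \<noteq> w ! idx jumps x) \<longleftrightarrow> (0, x) \<in> region c t"
    proof (cases "lo \<le> x \<and> x \<le> hi")
      case True
      then show ?thesis using val[of x] neg[of "(0, x)"] by (auto simp: flip_def split: if_splits)
    next
      case False
      then have "(0, x) \<notin> box" by (auto simp: box_def)
      then show ?thesis using False region_support[of "(0, x)" c t] t by auto
    qed
  qed
  ultimately show False using t(4) unfolding card_runs by simp
qed

lemma row_region_even:
  assumes "finite X" "\<And>x. x \<in> X \<Longrightarrow> even (card {x'. x' \<in> X \<and> (0, x') \<in> region c (0, x)})"
  shows "even (card X)"
proof -
  define q where "q = {(x, x'). x \<in> X \<and> x' \<in> X \<and> (0::nat, x') \<in> region c (0, x)}"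
  have "equiv X q"
    by (auto simp: q_def equiv_def refl_on_def sym_def trans_def region_refl intro: region_sym region_trans)
  moreover have "2 dvd card Y" if "Y \<in> X // q" for Y
  proof -
    from that obtain x where "x \<in> X" "Y = q `` {x}" by (auto simp: quotient_def)
    then have "Y = {x'. x' \<in> X \<and> (0, x') \<in> region c (0, x)}" by (auto simp: q_def)
    then show ?thesis using assms(2)[OF \<open>x \<in> X\<close>] by simp
  qed
  ultimately show ?thesis using equiv_imp_dvd_card[OF assms(1)] by blast
qed

text \<open>Folding all values to the negative side respects edges, because values joined by an edge
  never have opposite signs, and it fixes the top row, which is nonpositive.\<close>

lemma neg_abs_configs:
  assumes "c \<in> configs box"
  shows "(\<lambda>t. - \<bar>c t\<bar>) \<in> configs box"
proof (rule configsI)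
  show "hom box (\<lambda>t. - \<bar>c t\<bar>)" unfolding hom_def
  proof (intro ballI impI)
    fix t u assume "t \<in> box" "u \<in> box" "edge t u"
    then have "parity_step (S t - S u) (c t) (c u)" using assms by (auto simp: configs_def hom_def)
    then show "parity_step (S t - S u) (- \<bar>c t\<bar>) (- \<bar>c u\<bar>)" by (auto simp: parity_step_def)
  qed
qed (use configs_outside[OF assms] configs_top[OF assms] top_nonpos in auto)

text \<open>The point is that the regions of \<open>c\<close> through the runs in \<open>D\<close>
  avoid the top row. Above a word that is 1 on these runs they do, since positive regions cannot
  reach a nonpositive row. Flipping them injects the configurations above \<open>v'\<close> into
  those above \<open>v\<close>; the numbers agree, so every configuration above \<open>v\<close>
  arises in this way, in particular the folded one of \<open>c\<close>. The regions meet the bottom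
  row exactly in \<open>X\<close>, a set of odd size, so one of them meets it in an odd number of
  points.\<close>

lemma obstructed_odd_region:
  assumes rep: "rep jumps (\<lambda>y. card (extensions y)) f" and fin: "\<And>y. finite (extensions y)"
    and obs: "obstructed runs run_length f" and c: "c \<in> configs box" "bottom_admissible c"
  shows "odd_region c"
proof -
  obtain D where D: "D \<subseteq> {0<..<runs - 1}" "odd (\<Sum>k\<in>D. run_length k)"
    and Dneg: "\<forall>w\<in>walks runs. 0 < f w \<longrightarrow> admissible run_length w \<longrightarrow> (\<forall>k\<in>D. w ! k = - 1)"
    and Dflip: "\<forall>w w'. length w = runs \<and> length w' = runs \<and>
         (\<forall>k\<in>D. w ! k = - 1 \<and> w' ! k = 1 \<and> w ! (k - 1) = 0 \<and> w ! (k + 1) = 0) \<and>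
         (\<forall>k<runs. k \<notin> D \<longrightarrow> w' ! k = w ! k) \<longrightarrow> f w = f w'"
    using obs unfolding obstructed_def by (elim conjE exE)
  have Dr: "0 < k" "Suc k < runs" if "k \<in> D" for k using D(1) that by auto
  define X where "X = {x. lo \<le> x \<and> x \<le> hi \<and> idx jumps x \<in> D}"
  have finX: "finite X" by (rule finite_subset[of _ "{lo..hi}"]) (auto simp: X_def)
  have oddX: "odd (card X)"
  proof -
    have "(\<Sum>k<runs. run_length k * of_bool (k \<in> D)) = (\<Sum>k\<in>D. run_length k)"
    proof (rule sum.mono_neutral_cong_right)
      show "D \<subseteq> {..<runs}" using Dr(2) by (auto intro: Suc_lessD)
    qed auto
    then show ?thesis using D(2) unfolding card_runs X_def by simp
  qed
  obtain w where w: "w \<in> walks runs" "c \<in> extensions (lift jumps w)" "0 < f w"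
    using bottom_word[OF rep fin c(1)] by blast
  have len: "length w = runs" and wk: "walk w" using w by (auto simp: walks_def)
  have adm: "admissible run_length w" using bottom_admissible_word[OF w(1,2)] c(2) by simp
  have wD: "w ! k = - 1" if "k \<in> D" for k using Dneg w adm that by blast
  have wDn: "w ! (k - 1) = 0" "w ! (k + 1) = 0" if k: "k \<in> D" for k
  proof -
    have "\<bar>w ! (k - 1) - w ! k\<bar> = 1" "\<bar>w ! k - w ! (k + 1)\<bar> = 1"
      using walk_nth[OF wk, of "k - 1"] walk_nth[OF wk, of k] Dr[OF k] len by auto
    moreover have "- 1 \<le> w ! (k - 1)" "- 1 \<le> w ! (k + 1)"
      using adm Dr[OF k] len by (auto simp: admissible_def)
    ultimately show "w ! (k - 1) = 0" "w ! (k + 1) = 0" using wD[OF k] by auto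
  qed
  \<comment> \<open>The bottom word of the folded configuration; \<open>v'\<close> is the same word
    raised to 1 on \<open>D\<close>.\<close>
  define v where "v = map (\<lambda>a. - \<bar>a\<bar>) w"
  define v' where "v' = map (\<lambda>k. if k \<in> D then 1 else v ! k) [0..<runs]"
  have lenv: "length v = runs" "length v' = runs" by (simp_all add: v_def v'_def len del: upt_Suc)
  have vn: "v ! k = - \<bar>w ! k\<bar>" "v' ! k = (if k \<in> D then 1 else v ! k)" if "k < runs" for k
    using that by (simp_all add: v_def v'_def len del: upt_Suc)
  have hd0: "w ! 0 = - 1" using wk by (auto simp: walk_def hd_conv_nth[symmetric])
  have walkI: "u \<in> walks runs" if "length u = runs" "u ! 0 = - 1" "\<And>k. Suc k < runs \<Longrightarrow> \<bar>u ! k - u ! Suc k\<bar> = 1" for u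
  proof -
    have "u \<noteq> []" using that(1) by auto
    then have "hd u = - 1" using that(2) by (simp add: hd_conv_nth)
    then show ?thesis using that \<open>u \<noteq> []\<close> by (auto simp: walks_def walk_def successively_conv_nth)
  qed
  have v: "v \<in> walks runs"
  proof (rule walkI)
    show "\<bar>v ! k - v ! Suc k\<bar> = 1" if "Suc k < runs" for k
      using walk_nth[OF wk, of k] that len by (auto simp: vn)
  qed (use lenv hd0 vn[of 0] in auto)
  have v': "v' \<in> walks runs"
  proof (rule walkI)
    show "v' ! 0 = - 1" using Dr[of 0] vn[of 0] hd0 by auto
    show "\<bar>v' ! k - v' ! Suc k\<bar> = 1" if k: "Suc k < runs" for k
    proof -
      have n1: "\<bar>v ! k - v ! Suc k\<bar> = 1" using walk_nth[OF wk, of k] k len by (auto simp: vn)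
      have "k \<in> D \<Longrightarrow> Suc k \<notin> D \<and> v ! Suc k = 0" using wDn[of k] wD[of "Suc k"] k by (auto simp: vn)
      moreover have "Suc k \<in> D \<Longrightarrow> k \<notin> D \<and> v ! k = 0" using wDn[of "Suc k"] wD[of k] k by (auto simp: vn)
      ultimately show ?thesis using n1 k vn[of k] vn[of "Suc k"] by auto
    qed
  qed (use lenv in simp)
  have fv: "f v = f v'"
  proof (rule Dflip[rule_format], intro conjI ballI allI impI)
    fix k assume k: "k \<in> D"
    then have "k < runs" "k - 1 < runs" "k + 1 < runs" using Dr[OF k] by auto
    then show "v ! k = - 1" "v' ! k = 1" "v ! (k - 1) = 0" "v ! (k + 1) = 0"
      using k wD[OF k] wDn[OF k] by (simp_all add: vn)
  qed (use lenv vn in auto)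
  let ?y = "lift jumps v" and ?y' = "lift jumps v'"
  have card_eq: "card (extensions ?y) = card (extensions ?y')"
    using rep_lift[OF rep v] rep_lift[OF rep v'] fv by simp
  have idx_lt: "idx jumps x < runs" if "x \<le> hi" for x using idx_mono[OF that, of jumps] by simp
  have y_neg: "?y x \<le> 0" for x using vn(1)[OF idx_lt] by (auto simp: lift_def)
  have yX: "?y x = - 1" "?y' x = 1" if "x \<in> X" for x
    using that vn[OF idx_lt] wD by (auto simp: lift_def X_def)
  have ynX: "?y' x = ?y x" if "x \<notin> X" for x using that vn[OF idx_lt] by (auto simp: lift_def X_def)
  define U where "U c = (\<Union>x\<in>X. region c (0, x))" for c
  define N where "N e = {t \<in> box. e t \<noteq> (0::int)}" for e
  have U_cong: "U e = U e'" if "\<And>t. e t = 0 \<longleftrightarrow> e' t = 0" for e e'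
    unfolding U_def using region_cong[of e e'] that by simp
  have flip0: "flip V e t = 0 \<longleftrightarrow> e t = 0" for V e t by (simp add: flip_def)
  have Xbox: "(0, x) \<in> box" if "x \<in> X" for x using that by (auto simp: X_def box_def)
  have U_closed: "u \<in> U e" if "t \<in> U e" "u \<in> region e t" for e t u
    using that unfolding U_def by (auto intro: region_trans)
  have pos: "0 < e t" if "e \<in> extensions ?y'" "t \<in> U e" for e t
  proof -
    from that(2) obtain x where x: "x \<in> X" "t \<in> region e (0, x)" by (auto simp: U_def)
    have "e (0, x) = 1" using extensions_row[OF that(1), of x] yX x by simp
    moreover have "e \<in> configs box" using that(1) by (simp add: extensions_def)
    ultimately show ?thesis using region_sign(2)[of e t "(0, x)"] x(2) by simp
  qed
  have Ubox: "U e \<subseteq> {t \<in> box. e t \<noteq> 0}" if "e \<in> extensions ?y'" for e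
  proof
    fix t assume t: "t \<in> U e"
    then obtain x where x: "x \<in> X" "t \<in> region e (0, x)" by (auto simp: U_def)
    have "e (0, x) = 1" using extensions_row[OF that(1), of x] yX x by simp
    then show "t \<in> {t \<in> box. e t \<noteq> 0}" using region_support[OF x(2) Xbox[OF x(1)]] by simp
  qed
  have Utop: "fst t \<noteq> n" if "e \<in> extensions ?y'" "t \<in> U e" for e t
  proof
    assume "fst t = n"
    moreover have "e \<in> configs box" using that(1) by (simp add: extensions_def)
    ultimately have "e t \<le> 0" using configs_top[of e box "snd t"] top_nonpos[of "snd t"] by (cases t) auto
    with pos[OF that] show False by simp
  qed
  have Urow: "(0, x) \<in> U e \<longleftrightarrow> x \<in> X" if "e \<in> extensions ?y'" for e x
  proof
    assume "(0, x) \<in> U e"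
    then have "0 < ?y' x" using pos[OF that, of "(0, x)"] extensions_row[OF that, of x] by simp
    then show "x \<in> X" using ynX[of x] y_neg[of x] by force
  next
    assume "x \<in> X"
    then show "(0, x) \<in> U e" unfolding U_def using region_refl by blast
  qed
  define \<Phi> where "\<Phi> e = flip (U e) e" for e
  have \<Phi>: "\<Phi> e \<in> extensions ?y" if e: "e \<in> extensions ?y'" for e
  proof -
    have "e \<in> configs box" using e by (simp add: extensions_def)
    then have "\<Phi> e \<in> configs box"
      unfolding \<Phi>_def by (rule flip_configs) (use Ubox[OF e] Utop[OF e] U_closed in auto)
    moreover have "\<Phi> e (0, x) = ?y x" for x
      using Urow[OF e, of x] extensions_row[OF e, of x] yX[of x] ynX[of x] by (auto simp: \<Phi>_def flip_def)
    ultimately show ?thesis by (auto simp: extensions_def)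
  qed
  have U\<Phi>: "U (\<Phi> e) = U e" for e by (rule U_cong) (simp add: \<Phi>_def flip0)
  have inj: "inj_on \<Phi> (extensions ?y')"
  proof (rule inj_onI)
    fix e e' assume "\<Phi> e = \<Phi> e'"
    then have "flip (U (\<Phi> e)) (\<Phi> e) = flip (U (\<Phi> e')) (\<Phi> e')" by simp
    then have "flip (U e) (flip (U e) e) = flip (U e') (flip (U e') e')" unfolding U\<Phi> unfolding \<Phi>_def .
    moreover have "flip V (flip V e) = e" for V e by (rule ext) (simp add: flip_def)
    ultimately show "e = e'" by simp
  qed
  \<comment> \<open>Surjectivity comes from counting. A direct inverse is not at hand, since a
    negative region above \<open>v\<close> could a priori touch the top row.\<close>
  have surj: "\<Phi> ` extensions ?y' = extensions ?y"
    by (rule card_subset_eq[OF fin]) (use \<Phi> card_image[OF inj] card_eq in auto)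
  let ?c = "\<lambda>t. - \<bar>c t\<bar>"
  have "?c \<in> extensions ?y" using neg_abs_configs[OF c(1)] extensions_row[OF w(2)] idx_lt
    by (auto simp: extensions_def lift_def vn fun_eq_iff)
  then obtain e where e: "e \<in> extensions ?y'" "?c = \<Phi> e" using surj by auto
  \<comment> \<open>Regions depend only on where the values vanish, so the regions of
    \<open>c\<close> through \<open>X\<close> are those of \<open>e\<close>, which is positive on
    them.\<close>
  have Uc: "U c = U e"
  proof -
    have "U c = U ?c" by (rule U_cong) simp
    then show ?thesis using e(2) U\<Phi> by simp
  qed
  have "\<exists>x\<in>X. odd (card {x'. x' \<in> X \<and> (0, x') \<in> region c (0, x)})"
    using row_region_even[OF finX, of c] oddX by blast
  then obtain x where x: "x \<in> X" "odd (card {x'. x' \<in> X \<and> (0, x') \<in> region c (0, x)})" by blast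
  have sub: "u \<in> U e" if "u \<in> region c (0, x)" for u using that x(1) Uc unfolding U_def by blast
  have "{x'. x' \<in> X \<and> (0, x') \<in> region c (0, x)} = {x'. (0, x') \<in> region c (0, x)}"
    using sub Urow[OF e(1)] by blast
  moreover have "c (0, x) < 0" using extensions_row[OF w(2), of x] x(1) wD by (simp add: lift_def X_def)
  moreover have "fst u \<noteq> n" if "u \<in> region c (0, x)" for u using Utop[OF e(1) sub[OF that]] .
  ultimately show ?thesis unfolding odd_region_def using x Xbox[OF x(1)] by (intro bexI[of _ "(0, x)"]) auto
qed

theorem signed_count:
  "(\<Sum>c\<in>configs box. bottom_sign c) = int (card {c \<in> configs box. bottom_admissible c \<and> \<not> odd_region c})" (is ?C)
  "finite (configs box)"
proof -
  obtain f where rep: "rep jumps (\<lambda>y. card (extensions y)) f" and fin: "\<And>y. finite (extensions y)"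
    using extensions_rep by blast
  have pl: "planar runs f" using rep by (simp add: rep_def)
  have sgn: "(\<Sum>c\<in>configs box. bottom_sign c) = (\<Sum>w\<in>walks runs. signed_weight run_length w * int (f w))"
    by (rule sum_configs(1)[OF rep fin bottom_sign_word])
  show fc: "finite (configs box)" by (rule sum_configs(2)[OF rep fin bottom_sign_word])
  show ?C using planar_dichotomy[OF pl, of run_length]
  proof
    assume obs: "obstructed runs run_length f"
    then have "(\<Sum>w\<in>walks runs. signed_weight run_length w * int (f w)) = 0" by (simp add: obstructed_def)
    moreover have "{c \<in> configs box. bottom_admissible c \<and> \<not> odd_region c} = {}"
      using obstructed_odd_region[OF rep fin obs] by blast
    ultimately show ?thesis using sgn by (simp only: card.empty of_nat_0)
  next
    assume bal: "balanced runs run_length f"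
    have "(\<Sum>c\<in>configs box. of_bool (bottom_admissible c)) = (\<Sum>w\<in>walks runs. of_bool (admissible run_length w) * int (f w))"
      by (rule sum_configs(1)[OF rep fin]) (simp add: bottom_admissible_word)
    then have "(\<Sum>c\<in>configs box. bottom_sign c) = (\<Sum>c\<in>configs box. of_bool (bottom_admissible c))"
      using bal sgn by (simp add: balanced_def)
    also have "\<dots> = int (card {c \<in> configs box. bottom_admissible c})"
      using fc by (simp add: sum.If_cases Int_def)
    also have "{c \<in> configs box. bottom_admissible c} = {c \<in> configs box. bottom_admissible c \<and> \<not> odd_region c}"
      using balanced_no_odd_region[OF rep fin bal] by blast
    finally show ?thesis .
  qed
qed

end

section \<open>Families of paths\<close>

text \<open>
  Rows are numbered by the distance from height 0.  In a family of lower paths, row \<open>r\<close> holds the positions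
  of the duals at height \<open>r\<close>; a family is built downwards from its prescribed top row \<open>T\<close>.
\<close>

type_synonym family = "nat \<Rightarrow> nat \<Rightarrow> int"

definition tuples :: "nat \<Rightarrow> (nat \<Rightarrow> int) set" where
  "tuples l = {X \<in> extensional {1..l}. \<forall>i j. 1 \<le> i \<longrightarrow> i < j \<longrightarrow> j \<le> l \<longrightarrow> X j < X i}"

text \<open>The counting function of a tuple. Tuples are traded for counting functions because
  interlacing then becomes a set of inequalities, and a pair of families becomes a height
  function.\<close>

definition above :: "nat \<Rightarrow> (nat \<Rightarrow> int) \<Rightarrow> int \<Rightarrow> int" where
  "above l X x = int (card {i \<in> {1..l}. x < X i})"

definition families :: "nat \<Rightarrow> nat \<Rightarrow> (nat \<Rightarrow> int) \<Rightarrow> family set" where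
  "families l n T = {F \<in> extensional {..n}. (\<forall>r\<le>n. F r \<in> tuples l) \<and>
     (\<forall>r<n. \<forall>i\<in>{1..l}. F (Suc r) i = F r i \<or> F (Suc r) i = F r i + 1) \<and> (\<forall>i\<in>{1..l}. F n i = T i)}"

lemma tuples_strict: "X \<in> tuples l \<Longrightarrow> 1 \<le> i \<Longrightarrow> i < j \<Longrightarrow> j \<le> l \<Longrightarrow> X j < X i"
  by (simp add: tuples_def)

lemma tuples_less_iff:
  "X \<in> tuples l \<Longrightarrow> i \<in> {1..l} \<Longrightarrow> j \<in> {1..l} \<Longrightarrow> X i < X j \<longleftrightarrow> j < i"
  using tuples_strict[of X l i j] tuples_strict[of X l j i] by (cases i j rule: linorder_cases) auto

lemma tuples_eq_iff:
  "X \<in> tuples l \<Longrightarrow> i \<in> {1..l} \<Longrightarrow> j \<in> {1..l} \<Longrightarrow> X i = X j \<longleftrightarrow> i = j"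
  using tuples_less_iff[of X l i j] tuples_less_iff[of X l j i] by (cases i j rule: linorder_cases) auto

text \<open>Entries decrease with the index, so the indices of those beyond \<open>x\<close> form an
  initial segment.\<close>

lemma le_above_iff:
  assumes "X \<in> tuples l" "i \<in> {1..l}"
  shows "x < X i \<longleftrightarrow> int i \<le> above l X x"
proof
  assume "x < X i"
  then have "{1..i} \<subseteq> {i \<in> {1..l}. x < X i}"
    using tuples_less_iff[OF assms(1) assms(2)] assms(2) by (force simp: le_less)
  then have "card {1..i} \<le> card {i \<in> {1..l}. x < X i}" by (intro card_mono) auto
  then show "int i \<le> above l X x" by (simp add: above_def)
next
  assume a: "int i \<le> above l X x"
  show "x < X i"
  proof (rule ccontr)
    assume "\<not> x < X i"
    then have "{i \<in> {1..l}. x < X i} \<subseteq> {1..<i}" using tuples_less_iff[OF assms(1) assms(2)] assms(2) by force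
    then have "card {i \<in> {1..l}. x < X i} \<le> card {1..<i}" by (intro card_mono) auto
    then show False using a assms(2) by (auto simp: above_def)
  qed
qed

lemma above_range: "0 \<le> above l X x" "above l X x \<le> int l"
proof -
  have "card {i \<in> {1..l}. x < X i} \<le> card {1..l}" by (intro card_mono) auto
  then show "0 \<le> above l X x" "above l X x \<le> int l" by (auto simp: above_def)
qed

lemma above_diff: "above l X x - above l X (x + 1) = int (card {i \<in> {1..l}. X i = x + 1})"
proof -
  have "{i \<in> {1..l}. x < X i} = {i \<in> {1..l}. x + 1 < X i} \<union> {i \<in> {1..l}. X i = x + 1}" by auto
  moreover have "card ({i \<in> {1..l}. x + 1 < X i} \<union> {i \<in> {1..l}. X i = x + 1}) =
    card {i \<in> {1..l}. x + 1 < X i} + card {i \<in> {1..l}. X i = x + 1}" by (rule card_Un_disjoint) auto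
  ultimately show ?thesis by (simp add: above_def)
qed

lemma above_step:
  assumes "X \<in> tuples l"
  shows "above l X x - above l X (x + 1) = of_bool (\<exists>i\<in>{1..l}. X i = x + 1)"
proof (cases "\<exists>i\<in>{1..l}. X i = x + 1")
  case True
  then obtain i where i: "i \<in> {1..l}" "X i = x + 1" by auto
  have "j = i" if "j \<in> {1..l}" "X j = x + 1" for j
    using tuples_eq_iff[OF assms that(1) i(1)] that(2) i(2) by simp
  then have "{i \<in> {1..l}. X i = x + 1} = {i}" using i by blast
  then show ?thesis using True by (simp add: above_diff)
next
  case False
  then have "{i \<in> {1..l}. X i = x + 1} = {}" by auto
  then show ?thesis using False by (simp add: above_diff)
qed

lemma above_drop:
  assumes "X \<in> tuples l"
  shows "above l X (x + 1) \<le> above l X x" "above l X x \<le> above l X (x + 1) + 1"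
proof -
  have "above l X x - above l X (x + 1) = 0 \<or> above l X x - above l X (x + 1) = 1"
    unfolding above_step[OF assms] of_bool_def by simp
  then show "above l X (x + 1) \<le> above l X x" "above l X x \<le> above l X (x + 1) + 1" by linarith+
qed

lemma above_left: "(\<And>i. i \<in> {1..l} \<Longrightarrow> x < X i) \<Longrightarrow> above l X x = int l"
proof -
  assume "\<And>i. i \<in> {1..l} \<Longrightarrow> x < X i"
  then have "{i \<in> {1..l}. x < X i} = {1..l}" by auto
  then show ?thesis by (simp add: above_def)
qed

lemma above_right: "(\<And>i. i \<in> {1..l} \<Longrightarrow> X i \<le> x) \<Longrightarrow> above l X x = 0"
proof -
  assume "\<And>i. i \<in> {1..l} \<Longrightarrow> X i \<le> x"
  then have "{i \<in> {1..l}. x < X i} = {}" by force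
  then show ?thesis by (simp add: above_def)
qed

lemma above_mono:
  assumes "\<And>i. i \<in> {1..l} \<Longrightarrow> x < X i \<Longrightarrow> y < Y i"
  shows "above l X x \<le> above l Y y"
  unfolding above_def of_nat_le_iff by (rule card_mono) (use assms in auto)

lemma tuples_eqI:
  assumes "X \<in> tuples l" "Y \<in> tuples l" and "\<And>i. i \<in> {1..l} \<Longrightarrow> lo < X i \<and> X i \<le> hi \<and> lo < Y i \<and> Y i \<le> hi"
    and "\<And>x. lo \<le> x \<Longrightarrow> x \<le> hi \<Longrightarrow> above l X x = above l Y x"
  shows "X = Y"
proof (rule extensionalityI)
  show "X \<in> extensional {1..l}" "Y \<in> extensional {1..l}" using assms by (auto simp: tuples_def)
  fix i assume i: "i \<in> {1..l}"
  have eq: "x < X i \<longleftrightarrow> x < Y i" if "lo \<le> x" "x \<le> hi" for x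
    using assms(4)[OF that] le_above_iff[OF assms(1) i] le_above_iff[OF assms(2) i] by simp
  show "X i = Y i" using eq[of "X i - 1"] eq[of "Y i - 1"] assms(3)[OF i] by auto
qed

text \<open>Inverse of the counting function: entry \<open>i\<close> sits where \<open>a\<close>
  falls below \<open>i\<close>, which is located by counting the \<open>x\<close> with
  \<open>i \<le> a x\<close>. As \<open>a\<close> drops by at most 1 at a time, the entries are
  distinct.\<close>

lemma ex_tuple:
  fixes a :: "int \<Rightarrow> int"
  assumes "lo \<le> hi" "a lo = int l" "a hi = 0"
    and drop: "\<And>x. lo \<le> x \<Longrightarrow> x < hi \<Longrightarrow> a (x + 1) \<le> a x \<and> a x \<le> a (x + 1) + 1"
  shows "\<exists>X\<in>tuples l. (\<forall>i\<in>{1..l}. lo < X i \<and> X i \<le> hi) \<and> (\<forall>x. lo \<le> x \<longrightarrow> x \<le> hi \<longrightarrow> above l X x = a x)"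
proof -
  have anti: "a y \<le> a x" if "lo \<le> x" "x \<le> y" "y \<le> hi" for x y using that(2,3)
  proof (induction y rule: int_ge_induct)
    case (step y)
    then show ?case using drop[of y] that(1) by auto
  qed simp
  define X where "X = restrict (\<lambda>i. lo + int (card {x. lo \<le> x \<and> x \<le> hi \<and> int i \<le> a x})) {1..l}"
  have X: "x < X i \<longleftrightarrow> int i \<le> a x" if i: "i \<in> {1..l}" and x: "lo \<le> x" "x \<le> hi" for i x
  proof
    assume "int i \<le> a x"
    then have "{lo..x} \<subseteq> {x. lo \<le> x \<and> x \<le> hi \<and> int i \<le> a x}" using anti x by fastforce
    then have "card {lo..x} \<le> card {x. lo \<le> x \<and> x \<le> hi \<and> int i \<le> a x}"
      by (rule card_mono[rotated]) (rule finite_subset[of _ "{lo..hi}"], auto)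
    then show "x < X i" using i x by (simp add: X_def)
  next
    assume "x < X i"
    show "int i \<le> a x"
    proof (rule ccontr)
      assume "\<not> int i \<le> a x"
      have "y < x" if y: "y \<le> hi" "int i \<le> a y" for y using anti[of x y] x(1) y \<open>\<not> int i \<le> a x\<close> by linarith
      then have "{x. lo \<le> x \<and> x \<le> hi \<and> int i \<le> a x} \<subseteq> {lo..<x}" by auto
      then have "card {x. lo \<le> x \<and> x \<le> hi \<and> int i \<le> a x} \<le> card {lo..<x}" by (intro card_mono) auto
      then show False using i x \<open>x < X i\<close> by (simp add: X_def)
    qed
  qed
  have bnd: "lo < X i \<and> X i \<le> hi" if "i \<in> {1..l}" for i
    using X[OF that, of lo] X[OF that, of hi] assms that by auto
  have range: "0 \<le> a x \<and> a x \<le> int l" if "lo \<le> x" "x \<le> hi" for x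
    using anti[of lo x] anti[of x hi] assms that by auto
  have strict: "X j < X i" if ij: "1 \<le> i" "i < j" "j \<le> l" for i j
  proof (rule ccontr)
    assume "\<not> X j < X i"
    have "X i \<le> hi" "lo < X i" "X j \<le> hi" using bnd ij by auto
    then have "\<not> int i \<le> a (X i)" using X[of i "X i"] ij by auto
    moreover have "int j \<le> a (X i - 1)" using X[of j "X i - 1"] ij \<open>X i \<le> hi\<close> \<open>lo < X i\<close> \<open>\<not> X j < X i\<close> by auto
    moreover have "a (X i - 1) \<le> a (X i) + 1" using drop[of "X i - 1"] \<open>X i \<le> hi\<close> \<open>lo < X i\<close> by auto
    ultimately show False using ij by linarith
  qed
  have cnt: "above l X x = a x" if x: "lo \<le> x" "x \<le> hi" for x
  proof -
    have "{i \<in> {1..l}. x < X i} = {1..nat (a x)}" using X[OF _ x] range[OF x] by auto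
    then show ?thesis using range[OF x] by (simp add: above_def)
  qed
  have "X \<in> tuples l" using strict by (auto simp: tuples_def X_def)
  then show ?thesis using bnd cnt by blast
qed

lemma families_tuples: "F \<in> families l n T \<Longrightarrow> r \<le> n \<Longrightarrow> F r \<in> tuples l"
  by (simp add: families_def)

lemma families_step: "F \<in> families l n T \<Longrightarrow> r < n \<Longrightarrow> i \<in> {1..l} \<Longrightarrow> F (Suc r) i = F r i \<or> F (Suc r) i = F r i + 1"
  by (simp add: families_def)

lemma families_top: "F \<in> families l n T \<Longrightarrow> i \<in> {1..l} \<Longrightarrow> F n i = T i"
  by (simp add: families_def)

lemma families_bound:
  assumes "F \<in> families l n T" "i \<in> {1..l}" "r \<le> n"
  shows "T i - int (n - r) \<le> F r i \<and> F r i \<le> T i"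
  using assms(3)
proof (induction "n - r" arbitrary: r)
  case 0
  then show ?case using families_top[OF assms(1,2)] by simp
next
  case (Suc d)
  then have "r < n" "d = n - Suc r" by auto
  then have "T i - int (n - Suc r) \<le> F (Suc r) i \<and> F (Suc r) i \<le> T i" using Suc.hyps(1)[of "Suc r"] by simp
  then show ?case using families_step[OF assms(1) \<open>r < n\<close> assms(2)] \<open>r < n\<close> by auto
qed

lemma finite_families: "finite (families l n T)"
proof (rule finite_subset)
  show "families l n T \<subseteq> ({..n} \<rightarrow>\<^sub>E ({1..l} \<rightarrow>\<^sub>E (\<Union>i\<in>{1..l}. {T i - int n..T i})))"
  proof
    fix F assume F: "F \<in> families l n T"
    have "F r i \<in> (\<Union>i\<in>{1..l}. {T i - int n..T i})" if "r \<le> n" "i \<in> {1..l}" for r i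
      using families_bound[OF F that(2,1)] that by (intro UN_I[of i]) auto
    moreover have "F \<in> extensional {..n}" using F by (simp add: families_def)
    moreover have "F r \<in> extensional {1..l}" if "r \<le> n" for r
      using families_tuples[OF F that] by (simp add: tuples_def)
    ultimately show "F \<in> ({..n} \<rightarrow>\<^sub>E ({1..l} \<rightarrow>\<^sub>E (\<Union>i\<in>{1..l}. {T i - int n..T i})))" by (auto simp: PiE_iff)
  qed
  show "finite ({..n} \<rightarrow>\<^sub>E ({1..l} \<rightarrow>\<^sub>E (\<Union>i\<in>{1..l}. {T i - int n..T i})))" by (intro finite_PiE) auto
qed

lemma families_interlace:
  assumes "F \<in> families l n T" "r < n"
  shows "above l (F r) x \<le> above l (F (Suc r)) x" "above l (F (Suc r)) (x + 1) \<le> above l (F r) x"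
proof -
  have st: "F (Suc r) i = F r i \<or> F (Suc r) i = F r i + 1" if "i \<in> {1..l}" for i
    by (rule families_step[OF assms that])
  show "above l (F r) x \<le> above l (F (Suc r)) x" by (rule above_mono) (use st in force)
  show "above l (F (Suc r)) (x + 1) \<le> above l (F r) x" by (rule above_mono) (use st in force)
qed

lemma families_eqI:
  assumes "F \<in> families l n T" "F' \<in> families l n T'"
    and "\<And>r i. r \<le> n \<Longrightarrow> i \<in> {1..l} \<Longrightarrow> lo < F r i \<and> F r i \<le> hi \<and> lo < F' r i \<and> F' r i \<le> hi"
    and "\<And>r x. r \<le> n \<Longrightarrow> lo \<le> x \<Longrightarrow> x \<le> hi \<Longrightarrow> above l (F r) x = above l (F' r) x"
  shows "F = F'"
proof (rule extensionalityI)
  show "F \<in> extensional {..n}" "F' \<in> extensional {..n}" using assms by (auto simp: families_def)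
  fix r assume "r \<in> {..n}"
  then show "F r = F' r"
    using families_tuples[OF assms(1), of r] families_tuples[OF assms(2), of r] assms(3,4)[of r]
    by (intro tuples_eqI[where l = l and lo = lo and hi = hi]) auto
qed

text \<open>The rows are recovered one by one from their counting functions; \<open>up\<close> and
  \<open>down\<close> then say that an entry moves by 0 or 1 from one row to the next.\<close>

lemma ex_family:
  fixes a :: "nat \<Rightarrow> int \<Rightarrow> int"
  assumes "lo \<le> hi" and "\<And>r. r \<le> n \<Longrightarrow> a r lo = int l" "\<And>r. r \<le> n \<Longrightarrow> a r hi = 0"
    and "\<And>r x. r \<le> n \<Longrightarrow> lo \<le> x \<Longrightarrow> x < hi \<Longrightarrow> a r (x + 1) \<le> a r x \<and> a r x \<le> a r (x + 1) + 1"
    and up: "\<And>r x. r < n \<Longrightarrow> lo \<le> x \<Longrightarrow> x \<le> hi \<Longrightarrow> a r x \<le> a (Suc r) x"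
    and down: "\<And>r x. r < n \<Longrightarrow> lo \<le> x \<Longrightarrow> x < hi \<Longrightarrow> a (Suc r) (x + 1) \<le> a r x"
    and T: "T \<in> tuples l" "\<And>i. i \<in> {1..l} \<Longrightarrow> lo < T i \<and> T i \<le> hi" "\<And>x. lo \<le> x \<Longrightarrow> x \<le> hi \<Longrightarrow> a n x = above l T x"
  shows "\<exists>F\<in>families l n T. (\<forall>r\<le>n. \<forall>x. lo \<le> x \<longrightarrow> x \<le> hi \<longrightarrow> above l (F r) x = a r x)"
proof -
  have "\<exists>X\<in>tuples l. (\<forall>i\<in>{1..l}. lo < X i \<and> X i \<le> hi) \<and> (\<forall>x. lo \<le> x \<longrightarrow> x \<le> hi \<longrightarrow> above l X x = a r x)"
    if "r \<le> n" for r using assms that by (intro ex_tuple) auto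
  then obtain F0 where F0: "\<And>r. r \<le> n \<Longrightarrow> F0 r \<in> tuples l"
    "\<And>r i. r \<le> n \<Longrightarrow> i \<in> {1..l} \<Longrightarrow> lo < F0 r i \<and> F0 r i \<le> hi"
    "\<And>r x. r \<le> n \<Longrightarrow> lo \<le> x \<Longrightarrow> x \<le> hi \<Longrightarrow> above l (F0 r) x = a r x" by metis
  have gt: "x < F0 r i \<longleftrightarrow> int i \<le> a r x" if "r \<le> n" "i \<in> {1..l}" "lo \<le> x" "x \<le> hi" for r i x
    using le_above_iff[OF F0(1)[OF that(1)] that(2)] F0(3)[OF that(1,3,4)] by simp
  have step: "F0 (Suc r) i = F0 r i \<or> F0 (Suc r) i = F0 r i + 1" if r: "r < n" and i: "i \<in> {1..l}" for r i
  proof -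
    have b: "lo < F0 r i" "F0 r i \<le> hi" "lo < F0 (Suc r) i" "F0 (Suc r) i \<le> hi" using F0(2) r i by auto
    have "F0 r i \<le> F0 (Suc r) i"
      using gt[of r i "F0 r i - 1"] gt[of "Suc r" i "F0 r i - 1"] up[of r "F0 r i - 1"] r i b by auto
    moreover have "F0 (Suc r) i \<le> F0 r i + 1"
    \<comment> \<open>\<open>down\<close> is applied at \<open>F0 (Suc r) i - 2\<close>, which must
      not lie to the left of \<open>lo\<close>.\<close>
    proof (cases "F0 (Suc r) i \<le> lo + 1")
      case False
      then show ?thesis
        using gt[of r i "F0 (Suc r) i - 2"] gt[of "Suc r" i "F0 (Suc r) i - 1"] down[of r "F0 (Suc r) i - 2"] r i b by auto
    qed (use b in auto)
    ultimately show ?thesis by linarith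
  qed
  have top: "F0 n = T" using F0(1-3)[of n] T by (intro tuples_eqI[of _ l _ lo hi]) auto
  have "restrict F0 {..n} \<in> families l n T" using F0(1) step top by (auto simp: families_def)
  then show ?thesis using F0(3) by (intro bexI[of _ "restrict F0 {..n}"]) auto
qed

section \<open>Pairs of families as height functions\<close>

text \<open>\<open>T\<close> prescribes the top row of the dual lower paths and \<open>T'\<close>
  that of the upper paths; \<open>overlap\<close> is the positivity condition in these
  coordinates.\<close>

locale family_pairs =
  fixes l n :: nat and T T' :: "nat \<Rightarrow> int"
  assumes n_pos: "0 < n" and T: "T \<in> tuples l" and T': "T' \<in> tuples l"
    and overlap: "\<And>i. 1 \<le> i \<Longrightarrow> i < l \<Longrightarrow> T' (i + 1) \<le> T i"
begin

abbreviation pairs :: "(family \<times> family) set" where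
  "pairs \<equiv> families l n T \<times> families l n T'"

definition total :: "family \<times> family \<Rightarrow> nat \<times> int \<Rightarrow> int" where
  "total p t = above l (fst p (fst t)) (snd t) + above l (snd p (fst t)) (snd t)"

text \<open>The summand -1 makes the negative values the II-units (\<open>gap_neg\<close>,
  \<open>II_tile_at\<close>) and gives the value -1 at both ends of every row.\<close>

definition gap :: "family \<times> family \<Rightarrow> nat \<times> int \<Rightarrow> int" where
  "gap p t = above l (snd p (fst t)) (snd t) - above l (fst p (fst t)) (snd t) - 1"

text \<open>Positions lie at most \<open>n\<close> to the left of their top positions
  (\<open>families_bound\<close>); the sums bound all tops at once, and the summand 1 makes the
  bounds strict.\<close>

definition M :: int where
  "M = int n + 1 + (\<Sum>i=1..l. \<bar>T i\<bar>) + (\<Sum>i=1..l. \<bar>T' i\<bar>)"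

lemma M_pos: "0 < M"
proof -
  have "0 \<le> (\<Sum>i=1..l. \<bar>T i\<bar>)" "0 \<le> (\<Sum>i=1..l. \<bar>T' i\<bar>)" by (auto intro: sum_nonneg)
  then show ?thesis unfolding M_def by linarith
qed

lemma M_bounds:
  assumes "i \<in> {1..l}"
  shows "\<bar>T i\<bar> + int n < M" "\<bar>T' i\<bar> + int n < M"
proof -
  have "\<bar>T i\<bar> \<le> (\<Sum>i=1..l. \<bar>T i\<bar>)" "\<bar>T' i\<bar> \<le> (\<Sum>i=1..l. \<bar>T' i\<bar>)" using assms by (auto intro!: member_le_sum)
  moreover have "0 \<le> (\<Sum>i=1..l. \<bar>T i\<bar>)" "0 \<le> (\<Sum>i=1..l. \<bar>T' i\<bar>)" by (auto intro: sum_nonneg)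
  ultimately show "\<bar>T i\<bar> + int n < M" "\<bar>T' i\<bar> + int n < M" unfolding M_def by linarith+
qed

lemma pair_bounds:
  assumes "p \<in> pairs" "r \<le> n" "i \<in> {1..l}"
  shows "- M < fst p r i" "fst p r i \<le> M" "- M < snd p r i" "snd p r i \<le> M"
  using families_bound[of "fst p" l n T i r] families_bound[of "snd p" l n T' i r] M_bounds[OF assms(3)] assms
  by auto

lemma pair_left:
  assumes "p \<in> pairs" "r \<le> n" "x \<le> - M"
  shows "above l (fst p r) x = int l" "above l (snd p r) x = int l"
  using pair_bounds(1,3)[OF assms(1,2)] assms(3) by (auto intro!: above_left le_less_trans[OF assms(3)])

lemma pair_right:
  assumes "p \<in> pairs" "r \<le> n" "M \<le> x"
  shows "above l (fst p r) x = 0" "above l (snd p r) x = 0"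
  using pair_bounds(2,4)[OF assms(1,2)] by (auto intro!: above_right order_trans[OF _ assms(3)])

lemma pair_tuples:
  assumes "p \<in> pairs" "r \<le> n" shows "fst p r \<in> tuples l" "snd p r \<in> tuples l"
  using assms by (auto intro: families_tuples)

end

text \<open>Connectedness of II-units, carried over to the points of an unbounded strip. It has no
  border columns, in contrast to \<open>link\<close>, which lives on the box.\<close>

definition neg_link :: "nat \<Rightarrow> (nat \<times> int \<Rightarrow> int) \<Rightarrow> ((nat \<times> int) \<times> (nat \<times> int)) set" where
  "neg_link n c = {(t, u). fst t \<le> n \<and> fst u \<le> n \<and> c t < 0 \<and> c u < 0 \<and> (edge t u \<or> edge u t)}"

definition odd_neg_region :: "nat \<Rightarrow> (nat \<times> int \<Rightarrow> int) \<Rightarrow> bool" where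
  "odd_neg_region n c \<longleftrightarrow> (\<exists>t. fst t \<le> n \<and> c t < 0 \<and> (\<forall>u. (t, u) \<in> (neg_link n c)\<^sup>* \<longrightarrow> fst u \<noteq> n) \<and>
     odd (card {x. (t, (0, x)) \<in> (neg_link n c)\<^sup>*}))"

context family_pairs
begin

abbreviation crown :: "int \<Rightarrow> int" where
  "crown x \<equiv> if - M \<le> x \<and> x \<le> M then above l T' x - above l T x - 1 else 0"

lemma above_family_top: "F \<in> families l n X \<Longrightarrow> above l (F n) x = above l X x"
proof -
  assume F: "F \<in> families l n X"
  have "{i \<in> {1..l}. x < F n i} = {i \<in> {1..l}. x < X i}" using families_top[OF F] by auto
  then show ?thesis by (simp add: above_def)
qed

lemma gap_top: "p \<in> pairs \<Longrightarrow> gap p (n, x) = above l T' x - above l T x - 1"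
  using above_family_top[of "fst p" T x] above_family_top[of "snd p" T' x] by (auto simp: gap_def)

lemma pair_drop:
  assumes "p \<in> pairs" "r \<le> n"
  shows "above l (fst p r) (x + 1) \<le> above l (fst p r) x" "above l (fst p r) x \<le> above l (fst p r) (x + 1) + 1"
    "above l (snd p r) (x + 1) \<le> above l (snd p r) x" "above l (snd p r) x \<le> above l (snd p r) (x + 1) + 1"
  using above_drop[OF pair_tuples(1)[OF assms], of x] above_drop[OF pair_tuples(2)[OF assms], of x] by auto

lemma pair_interlace:
  assumes "p \<in> pairs" "r < n"
  shows "above l (fst p r) x \<le> above l (fst p (Suc r)) x" "above l (fst p (Suc r)) (x + 1) \<le> above l (fst p r) x"
    "above l (snd p r) x \<le> above l (snd p (Suc r)) x" "above l (snd p (Suc r)) (x + 1) \<le> above l (snd p r) x"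
  using families_interlace[of "fst p" l n T r x] families_interlace[of "snd p" l n T' r x] assms by auto

lemma pair_edge:
  assumes "p \<in> pairs" "fst t \<le> n" "fst u \<le> n" "edge t u"
  shows "above l (fst p (fst u)) (snd u) \<le> above l (fst p (fst t)) (snd t)" (is ?A)
    "above l (fst p (fst t)) (snd t) \<le> above l (fst p (fst u)) (snd u) + 1" (is ?A')
    "above l (snd p (fst u)) (snd u) \<le> above l (snd p (fst t)) (snd t)" (is ?B)
    "above l (snd p (fst t)) (snd t) \<le> above l (snd p (fst u)) (snd u) + 1" (is ?B')
proof -
  obtain r x r' x' where tu: "t = (r, x)" "u = (r', x')" by (cases t, cases u) auto
  have r: "r \<le> n" "r' \<le> n" using assms(2,3) tu by auto
  consider "r' = r" "x' = x + 1" | "r = Suc r'" "x' = x" | "r' = Suc r" "x' = x + 1"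
    using assms(4) by (auto simp: edge_def tu)
  then have *: "above l (fst p r') x' \<le> above l (fst p r) x \<and> above l (fst p r) x \<le> above l (fst p r') x' + 1 \<and>
    above l (snd p r') x' \<le> above l (snd p r) x \<and> above l (snd p r) x \<le> above l (snd p r') x' + 1"
  proof cases
    case 1
    then show ?thesis using pair_drop[OF assms(1) r(1), of x] by simp
  next
    case 2
    have "r' < n" using 2 r by simp
    from pair_interlace[OF assms(1) this, of x] pair_drop[OF assms(1) r(1), of x] show ?thesis using 2 by simp
  next
    case 3
    have "r < n" using 3 r by simp
    from pair_interlace[OF assms(1) this, of x] pair_drop[OF assms(1) r(2), of x] show ?thesis using 3 by simp
  qed
  then show ?A ?A' ?B ?B' by (simp_all add: tu)
qed

lemma gap_parity_step:
  assumes "p \<in> pairs" "fst t \<le> n" "fst u \<le> n" "edge t u"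
  shows "parity_step (total p t - total p u) (gap p t) (gap p u)"
proof -
  define a a' b b' where "a = above l (fst p (fst t)) (snd t)" and "a' = above l (fst p (fst u)) (snd u)"
    and "b = above l (snd p (fst t)) (snd t)" and "b' = above l (snd p (fst u)) (snd u)"
  have "a = a' \<or> a = a' + 1" "b = b' \<or> b = b' + 1"
    using pair_edge[OF assms] unfolding a_def a'_def b_def b'_def by linarith+
  then show ?thesis
    unfolding parity_step_def total_def gap_def a_def[symmetric] a'_def[symmetric] b_def[symmetric] b'_def[symmetric]
    by auto
qed

lemma gap_left: "p \<in> pairs \<Longrightarrow> fst t \<le> n \<Longrightarrow> snd t \<le> - M \<Longrightarrow> gap p t = - 1"
  using pair_left[of p "fst t" "snd t"] by (simp add: gap_def)

lemma gap_right: "p \<in> pairs \<Longrightarrow> fst t \<le> n \<Longrightarrow> M \<le> snd t \<Longrightarrow> gap p t = - 1"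
  using pair_right[of p "fst t" "snd t"] by (simp add: gap_def)

text \<open>If \<open>k \<ge> 2\<close> entries of \<open>T'\<close> exceed \<open>x\<close>, then
  \<open>T' k\<close> does, hence by \<open>overlap\<close> also \<open>T (k - 1)\<close>, so at
  least \<open>k - 1\<close> entries of \<open>T\<close> exceed \<open>x\<close>. If at most one
  entry of \<open>T'\<close> does, the bound is trivial.\<close>

lemma crown_nonpos: "crown x \<le> 0"
proof -
  have "above l T' x \<le> above l T x + 1"
  proof (cases "above l T' x \<le> 1")
    case True
    then show ?thesis using above_range(1)[of l T x] by linarith
  next
    case False
    define k where "k = nat (above l T' x)"
    have k: "int k = above l T' x" "2 \<le> k" "k \<le> l" using False above_range[of l T' x] by (auto simp: k_def)
    then have "x < T' k" using le_above_iff[OF T', of k x] by auto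
    also have "T' k \<le> T (k - 1)" using overlap[of "k - 1"] k by auto
    finally have "x < T (k - 1)" .
    moreover have "k - 1 \<in> {1..l}" using k by auto
    ultimately have "int (k - 1) \<le> above l T x" using le_above_iff[OF T, of "k - 1" x] by blast
    then show ?thesis using k by linarith
  qed
  then show ?thesis by simp
qed

lemma strip: "p \<in> pairs \<Longrightarrow> strip_heights (- M) M n (total p) crown"
proof -
  assume p: "p \<in> pairs"
  interpret strip_box "- M" M by standard (use M_pos in simp)
  have eqn: "crown x = gap p (n, x)" if "- M \<le> x" "x \<le> M" for x using gap_top[OF p] that by simp
  show ?thesis
  proof
    show "0 < n" by (rule n_pos)
    fix r x
    show "total p (r, x) \<le> total p (Suc r, x)" if "r < n"
      using pair_interlace[OF p that, of x] by (simp add: total_def)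
    show "total p (Suc r, x + 1) \<le> total p (r, x)" if "r < n"
      using pair_interlace[OF p that, of x] by (simp add: total_def)
    show "total p (r, x) - total p (r, x + 1) \<le> 2" if "r \<le> n"
      using pair_drop[OF p that, of x] by (simp add: total_def)
    show "total p (r, - M) = total p (Suc r, - M)" if "r < n"
      using pair_left[OF p, of r "- M"] pair_left[OF p, of "Suc r" "- M"] that by (simp add: total_def)
    show "total p (r, M) = total p (Suc r, M)" if "r < n"
      using pair_right[OF p, of r M] pair_right[OF p, of "Suc r" M] that by (simp add: total_def)
  next
    show "row_ok (\<lambda>x. odd (total p (n, x) - total p (n, x + 1))) crown" unfolding row_ok_def
    proof (intro conjI allI impI)
      show "crown (- M) = - 1" using eqn[of "- M"] gap_left[OF p, of "(n, - M)"] M_pos by simp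
      fix x assume x: "- M \<le> x \<and> x < M"
      have "parity_step (total p (n, x) - total p (n, x + 1)) (gap p (n, x)) (gap p (n, x + 1))"
        by (rule gap_parity_step[OF p]) (auto simp: edge_def)
      then show "if odd (total p (n, x) - total p (n, x + 1)) then \<bar>crown x - crown (x + 1)\<bar> = 1 else crown x = crown (x + 1)"
        using eqn[of x] eqn[of "x + 1"] x by (simp add: parity_step_def)
    qed auto
  next
    show "crown x \<le> 0" for x by (rule crown_nonpos)
  qed
qed

text \<open>Configurations vanish outside the box, while \<open>gap\<close> is -1 far out; hence the
  truncation.\<close>

definition boxed :: "(nat \<times> int \<Rightarrow> int) \<Rightarrow> nat \<times> int \<Rightarrow> int" where
  "boxed c t = (if fst t \<le> n \<and> - M \<le> snd t \<and> snd t \<le> M then c t else 0)"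

definition same_total :: "family \<times> family \<Rightarrow> family \<times> family \<Rightarrow> bool" where
  "same_total p q \<longleftrightarrow> (\<forall>r x. r \<le> n \<longrightarrow> total p (r, x) = total q (r, x))"

lemma same_totalI:
  assumes "p \<in> pairs" "q \<in> pairs" and "\<And>r x. r \<le> n \<Longrightarrow> - M \<le> x \<Longrightarrow> x \<le> M \<Longrightarrow> total p (r, x) = total q (r, x)"
  shows "same_total p q"
  unfolding same_total_def
proof (intro allI impI)
  fix r x assume r: "r \<le> n"
  consider "x \<le> - M" | "- M \<le> x" "x \<le> M" | "M \<le> x" by linarith
  then show "total p (r, x) = total q (r, x)"
  proof cases
    case 1
    then show ?thesis using pair_left[OF assms(1) r] pair_left[OF assms(2) r] by (simp add: total_def)
  next
    case 2
    then show ?thesis using assms(3) r by simp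
  next
    case 3
    then show ?thesis using pair_right[OF assms(1) r] pair_right[OF assms(2) r] by (simp add: total_def)
  qed
qed

text \<open>Sum and difference determine the two counting functions. Conversely a configuration
  yields candidates \<open>A\<close> and \<open>B\<close> by halving; the parity required for this
  spreads from the left border, and the edge conditions give the interlacing, so
  \<open>ex_family\<close> applies.\<close>

lemma boxed_bij:
  assumes p0: "p0 \<in> pairs"
  shows "bij_betw (\<lambda>p. boxed (gap p)) {p \<in> pairs. same_total p p0}
    (strip_heights.configs n (total p0) crown (strip_heights.box (- M) M n))"
proof -
  interpret strip_heights "- M" M n "total p0" crown by (rule strip[OF p0])
  have inbox: "t \<in> box \<longleftrightarrow> fst t \<le> n \<and> - M \<le> snd t \<and> snd t \<le> M" for t by (cases t) (auto simp: box_def)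
  show ?thesis unfolding bij_betw_def
  proof
    show "inj_on (\<lambda>p. boxed (gap p)) {p \<in> pairs. same_total p p0}"
    proof (rule inj_onI)
      fix p q assume a: "p \<in> {p \<in> pairs. same_total p p0}" "q \<in> {p \<in> pairs. same_total p p0}"
        and eq: "boxed (gap p) = boxed (gap q)"
      have "above l (fst p r) x = above l (fst q r) x \<and> above l (snd p r) x = above l (snd q r) x"
        if "r \<le> n" "- M \<le> x" "x \<le> M" for r x
      proof -
        have "gap p (r, x) = gap q (r, x)" using fun_cong[OF eq, of "(r, x)"] that by (simp add: boxed_def)
        moreover have "total p (r, x) = total q (r, x)" using a that by (simp add: same_total_def)
        ultimately show ?thesis unfolding gap_def total_def by simp
      qed
      then have "fst p = fst q" "snd p = snd q"
        using families_eqI[of "fst p" l n T "fst q" T "- M" M] families_eqI[of "snd p" l n T' "snd q" T' "- M" M]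
          pair_bounds[of p] pair_bounds[of q] a by auto
      then show "p = q" by (simp add: prod_eq_iff)
    qed
    show "(\<lambda>p. boxed (gap p)) ` {p \<in> pairs. same_total p p0} = configs box"
    proof (intro equalityI subsetI)
      fix c assume "c \<in> (\<lambda>p. boxed (gap p)) ` {p \<in> pairs. same_total p p0}"
      then obtain p where p: "p \<in> pairs" "same_total p p0" "c = boxed (gap p)" by auto
      show "c \<in> configs box"
      proof (rule configsI)
        show "c t = 0" if "t \<notin> box" for t using that by (auto simp: p(3) boxed_def inbox)
        show "c (n, x) = crown x" for x using gap_top[OF p(1)] by (simp add: p(3) boxed_def)
        show "hom box c" unfolding hom_def
        proof (intro ballI impI)
          fix t u assume t: "t \<in> box" "u \<in> box" "edge t u"
          have "total p0 t = total p t" "total p0 u = total p u"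
            using p(2) t unfolding same_total_def inbox by (cases t; cases u; auto)+
          then show "parity_step (total p0 t - total p0 u) (c t) (c u)"
            using gap_parity_step[OF p(1), of t u] t by (simp add: p(3) boxed_def inbox)
        qed
      qed
    next
      fix c assume c: "c \<in> configs box"
      define A B where "A t = (total p0 t - c t - 1) div 2" and "B t = (total p0 t + c t + 1) div 2" for t
      have ps: "parity_step (total p0 t - total p0 u) (c t) (c u)" if "t \<in> box" "u \<in> box" "edge t u" for t u
        using c that by (auto simp: configs_def hom_def)
      have left: "total p0 (r, - M) = 2 * int l" "total p0 (r, M) = 0" if "r \<le> n" for r
        using pair_left[OF p0 that, of "- M"] pair_right[OF p0 that, of M] by (simp_all add: total_def)
      \<comment> \<open>The border columns hold -1 in every row: in row \<open>n\<close> by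
        \<open>crown\<close>, and below because the total is constant along them.\<close>
      have cl: "c (r, - M) = - 1 \<and> c (r, M) = - 1" if "r \<le> n" for r using that
      proof (induction "n - r" arbitrary: r)
        case 0
        then have "r = n" by simp
        then show ?case using configs_top[OF c] gap_top[OF p0] gap_left[OF p0, of "(n, - M)"] gap_right[OF p0, of "(n, M)"] M_pos
          by simp
      next
        case (Suc d)
        then have "r < n" "c (Suc r, - M) = - 1 \<and> c (Suc r, M) = - 1" by auto
        moreover have "parity_step (total p0 (Suc r, - M) - total p0 (r, - M)) (c (Suc r, - M)) (c (r, - M))"
          "parity_step (total p0 (Suc r, M) - total p0 (r, M)) (c (Suc r, M)) (c (r, M))"
          using \<open>r < n\<close> M_pos by (auto intro!: ps simp: inbox edge_def)
        ultimately show ?case using left[of r] left[of "Suc r"] by (simp add: parity_step_def)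
      qed
      have par: "even (total p0 (r, x) - c (r, x) - 1)" if r: "r \<le> n" and x: "- M \<le> x" "x \<le> M" for r x using x
      proof (induction x rule: int_ge_induct)
        case base
        then show ?case using left(1)[OF r] cl[OF r] by simp
      next
        case (step x)
        then have "parity_step (total p0 (r, x) - total p0 (r, x + 1)) (c (r, x)) (c (r, x + 1))"
          using r by (auto intro!: ps simp: inbox edge_def)
        moreover define d e where "d = total p0 (r, x) - total p0 (r, x + 1)" and "e = c (r, x) - c (r, x + 1)"
        ultimately have de: "odd d \<longrightarrow> \<bar>e\<bar> = 1" "even d \<longrightarrow> e = 0" by (auto simp: parity_step_def)
        have "even d \<longleftrightarrow> even e" using de by (cases "even d") (auto simp: abs_if split: if_splits)
        moreover have "even (total p0 (r, x) - c (r, x) - 1)" using step by simp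
        ultimately have "even ((total p0 (r, x) - c (r, x) - 1) - d + e)" by simp
        moreover have "total p0 (r, x + 1) - c (r, x + 1) - 1 = (total p0 (r, x) - c (r, x) - 1) - d + e"
          by (simp add: d_def e_def)
        ultimately show ?case by (simp only:)
      qed
      have AB: "total p0 t = A t + B t" "c t = B t - A t - 1" "2 * A t = total p0 t - c t - 1" if "t \<in> box" for t
      proof -
        have "even (total p0 t - c t - 1)" using par[of "fst t" "snd t"] that by (simp add: inbox)
        then obtain m where "total p0 t - c t - 1 = 2 * m" by (elim evenE)
        then have "A t = m" "B t = m + c t + 1" "total p0 t = 2 * m + c t + 1" by (auto simp: A_def B_def)
        then show "total p0 t = A t + B t" "c t = B t - A t - 1" "2 * A t = total p0 t - c t - 1" by auto
      qed
      have edge_AB: "A u \<le> A t \<and> A t \<le> A u + 1 \<and> B u \<le> B t \<and> B t \<le> B u + 1"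
        if tu: "t \<in> box" "u \<in> box" "edge t u" for t u
      proof -
        define d where "d = total p0 t - total p0 u"
        have "0 \<le> d" "d \<le> 2" using pair_edge[OF p0, of t u] tu by (auto simp: d_def total_def inbox)
        then have "d = 0 \<or> d = 1 \<or> d = 2" by arith
        moreover have "parity_step d (c t) (c u)" using ps[OF tu] by (simp only: d_def)
        \<comment> \<open>The total drops by 0, 1 or 2 along an edge. For 0 and 2 both counts drop
          by the same amount, for 1 exactly one of them drops.\<close>
        ultimately have ce: "d = 1 \<and> c t - c u = 1 \<or> d = 1 \<and> c t - c u = - 1 \<or> d = 0 \<and> c t = c u \<or> d = 2 \<and> c t = c u"
          by (auto simp: parity_step_def)
        have "total p0 t - total p0 u = d" by (simp add: d_def)
        then show ?thesis
          using ce AB(1,2)[OF tu(1)] AB(1,2)[OF tu(2)] by (intro conjI; elim disjE conjE; linarith)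
      qed
      have e1: "A (r, x + 1) \<le> A (r, x) \<and> A (r, x) \<le> A (r, x + 1) + 1 \<and> B (r, x + 1) \<le> B (r, x) \<and> B (r, x) \<le> B (r, x + 1) + 1"
        if "r \<le> n" "- M \<le> x" "x < M" for r x
        using edge_AB[of "(r, x)" "(r, x + 1)"] that by (simp add: inbox edge_def)
      have e2: "A (r, x) \<le> A (Suc r, x) \<and> B (r, x) \<le> B (Suc r, x)" if "r < n" "- M \<le> x" "x \<le> M" for r x
        using edge_AB[of "(Suc r, x)" "(r, x)"] that by (simp add: inbox edge_def)
      have e3: "A (Suc r, x + 1) \<le> A (r, x) \<and> B (Suc r, x + 1) \<le> B (r, x)" if "r < n" "- M \<le> x" "x < M" for r x
        using edge_AB[of "(r, x)" "(Suc r, x + 1)"] that by (simp add: inbox edge_def)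
      have ends: "A (r, - M) = int l \<and> B (r, - M) = int l \<and> A (r, M) = 0 \<and> B (r, M) = 0" if "r \<le> n" for r
        using left[OF that] cl[OF that] by (simp add: A_def B_def)
      have tops: "A (n, x) = above l T x \<and> B (n, x) = above l T' x" if "- M \<le> x" "x \<le> M" for x
      proof -
        have "total p0 (n, x) = above l T x + above l T' x"
          using above_family_top[of "fst p0" T x] above_family_top[of "snd p0" T' x] p0 by (auto simp: total_def)
        moreover have "c (n, x) = above l T' x - above l T x - 1" using configs_top[OF c] that by simp
        ultimately show ?thesis using AB[of "(n, x)"] that by (simp add: inbox)
      qed
      have Tb: "- M < T i \<and> T i \<le> M" "- M < T' i \<and> T' i \<le> M" if "i \<in> {1..l}" for i
        using M_bounds[OF that] by auto
      obtain F where F: "F \<in> families l n T" "\<And>r x. r \<le> n \<Longrightarrow> - M \<le> x \<Longrightarrow> x \<le> M \<Longrightarrow> above l (F r) x = A (r, x)"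
        using ex_family[of "- M" M n "\<lambda>r x. A (r, x)" l T] M_pos ends e1 e2 e3 tops T Tb by auto
      obtain G where G: "G \<in> families l n T'" "\<And>r x. r \<le> n \<Longrightarrow> - M \<le> x \<Longrightarrow> x \<le> M \<Longrightarrow> above l (G r) x = B (r, x)"
        using ex_family[of "- M" M n "\<lambda>r x. B (r, x)" l T'] M_pos ends e1 e2 e3 tops T' Tb by auto
      have FG: "(F, G) \<in> pairs" using F G by simp
      have "same_total (F, G) p0"
        by (rule same_totalI[OF FG p0]) (use F(2) G(2) AB(1) in \<open>auto simp: total_def inbox\<close>)
      moreover have "boxed (gap (F, G)) = c"
      proof
        fix t
        show "boxed (gap (F, G)) t = c t"
        proof (cases "t \<in> box")
          case True
          then show ?thesis using F(2) G(2) AB(2)[OF True] by (simp add: boxed_def gap_def inbox)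
        next
          case False
          then show ?thesis using configs_outside[OF c False] by (auto simp: boxed_def inbox)
        qed
      qed
      ultimately show "c \<in> (\<lambda>p. boxed (gap p)) ` {p \<in> pairs. same_total p p0}" using FG by force
    qed
  qed
qed

lemma neg_column:
  assumes p: "p \<in> pairs" and neg: "\<And>r'. r \<le> r' \<Longrightarrow> r' \<le> n \<Longrightarrow> gap p (r', x) < 0" and "r \<le> n"
  shows "((r, x), (n, x)) \<in> (neg_link n (gap p))\<^sup>*"
  using assms(3) neg
proof (induction "n - r" arbitrary: r)
  case 0
  then show ?case by simp
next
  case (Suc d)
  then have "((Suc r, x), (n, x)) \<in> (neg_link n (gap p))\<^sup>*" by auto
  moreover have "((r, x), (Suc r, x)) \<in> neg_link n (gap p)" using Suc by (auto simp: neg_link_def edge_def)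
  ultimately show ?case by (rule converse_rtrancl_into_rtrancl[rotated])
qed

text \<open>In the columns from \<open>M\<close> on and up to \<open>- M\<close> the gap is -1 in
  every row, so a region touching them climbs to row \<open>n\<close> (\<open>neg_column\<close>).
  Regions avoiding row \<open>n\<close> therefore stay strictly inside the box, where both notions
  of region coincide.\<close>

lemma odd_region_boxed:
  assumes p: "p \<in> pairs"
  shows "strip_heights.odd_region (- M) M n (boxed (gap p)) \<longleftrightarrow> odd_neg_region n (gap p)"
proof -
  interpret strip_heights "- M" M n "total p" crown by (rule strip[OF p])
  have inbox: "t \<in> box \<longleftrightarrow> fst t \<le> n \<and> - M \<le> snd t \<and> snd t \<le> M" for t by (cases t) (auto simp: box_def)
  let ?c = "boxed (gap p)" and ?N = "(neg_link n (gap p))\<^sup>*"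
  have conf: "?c \<in> configs box" using boxed_bij[OF p] p unfolding bij_betw_def by (auto simp: same_total_def)
  have val: "?c t = gap p t" if "t \<in> box" for t using that by (simp add: boxed_def inbox)
  have region_neg: "region ?c t = {u. (t, u) \<in> ?N}" if t: "fst t \<le> n" "gap p t < 0" "\<And>u. (t, u) \<in> ?N \<Longrightarrow> fst u \<noteq> n" for t
  proof -
    have fin: "fst u \<le> n \<and> gap p u < 0" if "(t, u) \<in> ?N" for u
      using that t by (cases rule: rtrancl.cases) (auto simp: neg_link_def)
    have bx: "u \<in> box \<and> - M < snd u \<and> snd u < M" if tu: "(t, u) \<in> ?N" for u
    proof -
      have "\<not> (snd u \<le> - M \<or> M \<le> snd u)"
      proof
        assume "snd u \<le> - M \<or> M \<le> snd u"
        then have "((fst u, snd u), (n, snd u)) \<in> ?N"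
          using fin[OF tu] gap_left[OF p] gap_right[OF p] by (intro neg_column[OF p]) auto
        then have "(t, (n, snd u)) \<in> ?N" using tu by (simp add: rtrancl_trans)
        then show False using t(3) by fastforce
      qed
      then show ?thesis using fin[OF tu] by (auto simp: inbox)
    qed
    show ?thesis
    proof (intro equalityI subsetI)
      fix u assume "u \<in> region ?c t"
      then have "(t, u) \<in> (link ?c)\<^sup>*" by (simp add: region_def)
      then have "(t, u) \<in> ?N"
      proof (induction rule: rtrancl_induct)
        case (step v u)
        have "v \<in> box" "u \<in> box" "edge v u \<or> edge u v" "?c u \<noteq> 0" using step.hyps by (auto simp: link_def)
        moreover have "gap p v < 0" using fin step.IH by blast
        moreover have "gap p u < 0"
          using configs_parity_step[OF conf, of v u] calculation val[of v] val[of u] by auto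
        ultimately have "(v, u) \<in> neg_link n (gap p)" by (auto simp: neg_link_def inbox)
        then show ?case using step.IH by (rule rtrancl_into_rtrancl[rotated])
      qed simp
      then show "u \<in> {u. (t, u) \<in> ?N}" by simp
    next
      fix u assume "u \<in> {u. (t, u) \<in> ?N}"
      then have "(t, u) \<in> ?N" by simp
      then show "u \<in> region ?c t"
      proof (induction rule: rtrancl_induct)
        case (step v u)
        have tu: "(t, u) \<in> ?N" using step.hyps by (rule rtrancl_into_rtrancl)
        have "v \<in> box" "u \<in> box" using bx[OF step.hyps(1)] bx[OF tu] by auto
        then have "(v, u) \<in> link ?c" using step.hyps val by (auto simp: link_def neg_link_def)
        then show ?case using step.IH by (auto simp: region_def)
      qed (rule region_refl)
    qed
  qed
  show ?thesis
  proof
    assume "odd_region ?c"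
    then obtain t where t: "t \<in> box" "?c t < 0" "\<forall>u\<in>region ?c t. fst u \<noteq> n" "odd (card {x. (0, x) \<in> region ?c t})"
      by (auto simp: odd_region_def)
    have gt: "fst t \<le> n" "gap p t < 0" using t val by (auto simp: inbox)
    have rg: "gap p u < 0 \<and> u \<in> box" if "u \<in> region ?c t" for u
      using region_sign(1)[OF conf that] region_support[OF that t(1)] t(2) val by auto
    have inner: "- M < snd u \<and> snd u < M" if u: "u \<in> region ?c t" for u
    proof (rule ccontr)
      assume "\<not> ?thesis"
      then have sm: "snd u = - M \<or> snd u = M" using rg[OF u] by (auto simp: inbox)
      have "(r, snd u) \<in> region ?c t" if "fst u \<le> r" "r \<le> n" for r using that
      proof (induction r rule: dec_induct)
        case base
        then show ?case using u by simp
      next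
        case (step r)
        have "gap p (r', snd u) = - 1" if "r' \<le> n" for r'
          using sm gap_left[OF p, of "(r', snd u)"] gap_right[OF p, of "(r', snd u)"] that by auto
        moreover have "(r', snd u) \<in> box" if "r' \<le> n" for r' using that sm M_pos by (auto simp: inbox)
        ultimately have "((r, snd u), (Suc r, snd u)) \<in> link ?c"
          using step val by (auto simp: link_def edge_def)
        then show ?case using step by (auto simp: region_def)
      qed
      from this[of n] show False using t(3) rg[OF u] by (auto simp: inbox)
    qed
    have "u \<in> region ?c t" if "(t, u) \<in> ?N" for u using that
    proof (induction rule: rtrancl_induct)
      case (step v u)
      have v: "v \<in> box" "- M < snd v" "snd v < M" using inner[OF step.IH] rg[OF step.IH] by auto
      have "u \<in> box" using step.hyps(2) v by (auto simp: neg_link_def inbox edge_def)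
      then have "(v, u) \<in> link ?c" using step.hyps(2) v(1) val by (auto simp: link_def neg_link_def)
      then show ?case using step.IH by (auto simp: region_def)
    qed (rule region_refl)
    then have "fst u \<noteq> n" if "(t, u) \<in> ?N" for u using that t(3) by blast
    then have "region ?c t = {u. (t, u) \<in> ?N}" by (rule region_neg[OF gt])
    then show "odd_neg_region n (gap p)" unfolding odd_neg_region_def using t gt by (intro exI[of _ t]) auto
  next
    assume "odd_neg_region n (gap p)"
    then obtain t where t: "fst t \<le> n" "gap p t < 0" "\<forall>u. (t, u) \<in> ?N \<longrightarrow> fst u \<noteq> n"
      "odd (card {x. (t, (0, x)) \<in> ?N})" unfolding odd_neg_region_def by blast
    have rg: "region ?c t = {u. (t, u) \<in> ?N}" by (rule region_neg[OF t(1,2)]) (use t(3) in blast)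
    have "- M \<le> snd t \<and> snd t \<le> M"
    proof (rule ccontr)
      assume "\<not> ?thesis"
      then have "((fst t, snd t), (n, snd t)) \<in> ?N"
        using t gap_left[OF p] gap_right[OF p] by (intro neg_column[OF p]) auto
      then show False using t(3) by fastforce
    qed
    then have "t \<in> box" using t by (simp add: inbox)
    moreover have "\<forall>u\<in>region ?c t. fst u \<noteq> n" unfolding rg using t(3) by blast
    moreover have "odd (card {x. (0, x) \<in> region ?c t})" unfolding rg using t(4) by simp
    ultimately show "odd_region ?c" unfolding odd_region_def using t(2) val by (metis)
  qed
qed

end

section \<open>The row of height 0\<close>

definition sgp :: "int \<Rightarrow> int" where
  "sgp z = (if even z then 1 else - 1)"

lemma even_diff_trans: "even (a - b) \<Longrightarrow> even (b - c) \<Longrightarrow> even (a - c :: int)"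
  by presburger

lemma even_diff_sym: "even (a - b) \<Longrightarrow> even (b - a :: int)"
  by presburger

lemma odd_diff_one:
  fixes p p' q q' a b :: int
  assumes "p = p' + a" "q = q' + b" "a + b = 1"
  shows "odd (q - p) \<longleftrightarrow> even (q' - p')"
proof -
  have "q - p = (q' - p') + (1 - 2 * a)" using assms by simp
  then show ?thesis by simp
qed

locale tuple_pair =
  fixes l :: nat and F G :: "nat \<Rightarrow> int"
  assumes F: "F \<in> tuples l" and G: "G \<in> tuples l"
begin

text \<open>One more than the gap in row 0. If \<open>F i < G i\<close> for all \<open>i\<close>, it
  is the number of indices that are open at \<open>x\<close>, that is
  \<open>F i \<le> x < G i\<close>.\<close>

definition cover :: "int \<Rightarrow> int" where
  "cover x = above l G x - above l F x"

text \<open>An alternating count, with signs by position, of all entries beyond \<open>x\<close>. It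
  depends only on the union of the two tuples, and its bound by 1 is one of the two conditions for a
  nonzero minor of \<open>hop\<close> (\<open>minor_hop\<close>).\<close>

definition charge :: "int \<Rightarrow> int" where
  "charge x = (\<Sum>i=1..l. of_bool (x < F i) * sgp (F i) + of_bool (x < G i) * sgp (G i))"

definition good :: bool where
  "good \<longleftrightarrow> (\<forall>x. \<bar>charge x\<bar> \<le> 1)"

text \<open>Condition (i) at height 0.\<close>

definition matched :: bool where
  "matched \<longleftrightarrow> (\<forall>i\<in>{1..l}. F i < G i \<and> odd (G i - F i) \<and> (i < l \<longrightarrow> G (i + 1) \<le> F i \<or> even (G (i + 1) - F i)))"

definition turning :: bool where
  "turning \<longleftrightarrow> (\<forall>x y. x + 1 < y \<and> odd (cover x) \<and> odd (cover y) \<and> (\<forall>z. x < z \<and> z < y \<longrightarrow> even (cover z) \<and> 0 < cover z) \<longrightarrow>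
     (even (y - x - 1) \<longleftrightarrow> cover x = cover y))"

text \<open>Only its parity matters. For a matched pair and odd cover it is the parity of
  \<open>G j + j\<close> with \<open>j = above l G x\<close>; expressed through the charge it makes
  sense before the pair is known to be matched.\<close>

definition phase :: "int \<Rightarrow> int" where
  "phase x = of_bool (charge x = - 1) + above l G x"

lemma sum_of_bool_sgp:
  "(\<Sum>i=1..l. of_bool (x < X i) * sgp (X i)) - (\<Sum>i=1..l. of_bool (x + 1 < X i) * sgp (X i))
    = sgp (x + 1) * (above l X x - above l X (x + 1))"
proof -
  have "(\<Sum>i=1..l. of_bool (x < X i) * sgp (X i)) - (\<Sum>i=1..l. of_bool (x + 1 < X i) * sgp (X i))
    = (\<Sum>i\<in>{1..l}. if X i = x + 1 then sgp (x + 1) else 0)"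
    unfolding sum_subtractf[symmetric] by (rule sum.cong) auto
  also have "\<dots> = sgp (x + 1) * int (card {i \<in> {1..l}. X i = x + 1})" by (simp add: sum.If_cases Int_def)
  finally show ?thesis by (simp only: above_diff)
qed

lemma charge_step:
  "charge x - charge (x + 1) = sgp (x + 1) * ((above l F x - above l F (x + 1)) + (above l G x - above l G (x + 1)))"
  using sum_of_bool_sgp[of x F] sum_of_bool_sgp[of x G]
  unfolding charge_def sum.distrib by (simp add: distrib_left)

lemma above_card: "above l X x = (\<Sum>i=1..l. of_bool (x < X i))"
  unfolding above_def by (simp add: Int_def)

text \<open>Every sign is odd, so modulo 2 the charge counts all entries beyond
  \<open>x\<close>.\<close>

lemma charge_parity: "even (charge x) \<longleftrightarrow> even (cover x)"
proof -
  have "charge x - (above l F x + above l G x)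
      = (\<Sum>i=1..l. of_bool (x < F i) * (sgp (F i) - 1) + of_bool (x < G i) * (sgp (G i) - 1))"
    unfolding charge_def above_card sum.distrib[symmetric] sum_subtractf[symmetric]
    by (rule sum.cong) (simp_all add: algebra_simps)
  also have "even \<dots>" by (rule dvd_sum) (auto simp: sgp_def)
  finally have "even (charge x - (above l F x + above l G x))" .
  then show ?thesis unfolding cover_def by presburger
qed

lemma drops:
  obtains a b where "above l F x = above l F (x + 1) + a" "above l G x = above l G (x + 1) + b"
    "a = 0 \<or> a = 1" "b = 0 \<or> b = 1" "charge x = charge (x + 1) + sgp (x + 1) * (a + b)"
proof (rule that[of "above l F x - above l F (x + 1)" "above l G x - above l G (x + 1)"])
  show "above l F x - above l F (x + 1) = 0 \<or> above l F x - above l F (x + 1) = 1"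
    using above_drop[OF F, of x] by arith
  show "above l G x - above l G (x + 1) = 0 \<or> above l G x - above l G (x + 1) = 1"
    using above_drop[OF G, of x] by arith
qed (use charge_step[of x] in auto)

lemma tuple_above:
  assumes "X \<in> tuples l" "i \<in> {1..l}" "X i = x + 1"
  shows "above l X x = int i" "above l X (x + 1) = int i - 1"
proof -
  have "int i \<le> above l X x" "\<not> int i \<le> above l X (x + 1)"
    using le_above_iff[OF assms(1,2), of x] le_above_iff[OF assms(1,2), of "x + 1"] assms(3) by auto
  then show "above l X x = int i" "above l X (x + 1) = int i - 1" using above_drop[OF assms(1), of x] by auto
qed

lemma charge_pm:
  assumes good "odd (cover x)"
  shows "charge x = 1 \<or> charge x = - 1"
proof -
  have "odd (charge x)" using assms(2) charge_parity by simp
  moreover have "\<bar>charge x\<bar> \<le> 1" using assms(1) by (simp add: good_def)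
  ultimately have "charge x \<noteq> 0" by auto
  then show ?thesis using \<open>\<bar>charge x\<bar> \<le> 1\<close> by arith
qed

lemma charge_zero:
  assumes good "even (cover x)"
  shows "charge x = 0"
proof -
  have "even (charge x)" using assms(2) charge_parity by simp
  moreover have "\<bar>charge x\<bar> \<le> 1" using assms(1) by (simp add: good_def)
  then have "charge x = 0 \<or> charge x = 1 \<or> charge x = - 1" by arith
  ultimately show ?thesis by auto
qed

text \<open>An entry at \<open>x + 1\<close> moves the charge by at least 1 in the direction of
  \<open>sgp (x + 1)\<close>. Both charges are bounded by 1 and the one at \<open>x\<close> is odd,
  so it has to equal \<open>sgp (x + 1)\<close>.\<close>

lemma phase_left:
  assumes good "odd (cover x)" "above l F x \<noteq> above l F (x + 1) \<or> above l G x \<noteq> above l G (x + 1)"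
  shows "even (phase x - (x + 1 + above l G x))" "charge x = sgp (x + 1)"
proof -
  obtain a b where ab: "above l F x = above l F (x + 1) + a" "above l G x = above l G (x + 1) + b"
    "a = 0 \<or> a = 1" "b = 0 \<or> b = 1" "charge x = charge (x + 1) + sgp (x + 1) * (a + b)" by (rule drops)
  have "a + b \<ge> 1" using ab assms(3) by auto
  moreover have "\<bar>charge (x + 1)\<bar> \<le> 1" using assms(1) by (simp add: good_def)
  ultimately show c: "charge x = sgp (x + 1)"
    using charge_pm[OF assms(1,2)] ab(3-5) by (auto simp: sgp_def split: if_splits)
  show "even (phase x - (x + 1 + above l G x))" unfolding phase_def c by (auto simp: sgp_def)
qed

lemma phase_right:
  assumes good "odd (cover (x + 1))" "above l F x \<noteq> above l F (x + 1) \<or> above l G x \<noteq> above l G (x + 1)"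
  shows "even (phase (x + 1) - (x + above l G (x + 1)))" "charge (x + 1) = - sgp (x + 1)"
proof -
  obtain a b where ab: "above l F x = above l F (x + 1) + a" "above l G x = above l G (x + 1) + b"
    "a = 0 \<or> a = 1" "b = 0 \<or> b = 1" "charge x = charge (x + 1) + sgp (x + 1) * (a + b)" by (rule drops)
  have "a + b \<ge> 1" using ab assms(3) by auto
  moreover have "\<bar>charge x\<bar> \<le> 1" using assms(1) by (simp add: good_def)
  ultimately show c: "charge (x + 1) = - sgp (x + 1)"
    using charge_pm[OF assms(1,2)] ab(3-5) by (auto simp: sgp_def split: if_splits)
  show "even (phase (x + 1) - (x + above l G (x + 1)))" unfolding phase_def c by (auto simp: sgp_def)
qed

lemma phase_F_left:
  assumes good "odd (cover x)" "i \<in> {1..l}" "F i = x + 1"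
  shows "even (phase x - (x + int i))"
proof -
  have "above l F x = int i" "above l F (x + 1) = int i - 1" using tuple_above[OF F assms(3,4)] by auto
  moreover from this have "even (phase x - (x + 1 + above l G x))" by (intro phase_left assms) auto
  ultimately show ?thesis using assms(2) unfolding cover_def by presburger
qed

lemma phase_G_left:
  assumes good "odd (cover x)" "j \<in> {1..l}" "G j = x + 1"
  shows "even (phase x - (x + 1 + int j))"
proof -
  have "above l G x = int j" "above l G (x + 1) = int j - 1" using tuple_above[OF G assms(3,4)] by auto
  moreover from this have "even (phase x - (x + 1 + above l G x))" by (intro phase_left assms) auto
  ultimately show ?thesis by presburger
qed

lemma phase_F_right:
  assumes good "odd (cover (x + 1))" "i \<in> {1..l}" "F i = x + 1"
  shows "even (phase (x + 1) - (x + int i))"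
proof -
  have "above l F x = int i" "above l F (x + 1) = int i - 1" using tuple_above[OF F assms(3,4)] by auto
  moreover from this have "even (phase (x + 1) - (x + above l G (x + 1)))" by (intro phase_right assms) auto
  ultimately show ?thesis using assms(2) unfolding cover_def by presburger
qed

lemma phase_G_right:
  assumes good "odd (cover (x + 1))" "j \<in> {1..l}" "G j = x + 1"
  shows "even (phase (x + 1) - (x + 1 + int j))"
proof -
  have "above l G x = int j" "above l G (x + 1) = int j - 1" using tuple_above[OF G assms(3,4)] by auto
  moreover from this have "even (phase (x + 1) - (x + above l G (x + 1)))" by (intro phase_right assms) auto
  ultimately show ?thesis by presburger
qed

text \<open>The cover is odd at both points, so at \<open>x + 1\<close> there is either no entry or
  one of each tuple.\<close>

lemma phase_adjacent:
  assumes good "odd (cover x)" "odd (cover (x + 1))"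
  shows "even (phase x - phase (x + 1))"
proof (cases "above l F x \<noteq> above l F (x + 1) \<or> above l G x \<noteq> above l G (x + 1)")
  case True
  obtain a b where ab: "above l F x = above l F (x + 1) + a" "above l G x = above l G (x + 1) + b"
    "a = 0 \<or> a = 1" "b = 0 \<or> b = 1" by (rule drops)
  have "a = 1 \<and> b = 1" using True ab assms(2,3) unfolding cover_def by auto
  then show ?thesis
    using phase_left(1)[OF assms(1,2) True] phase_right(1)[OF assms(1,3) True] ab(2) by presburger
next
  case False
  then have "charge x = charge (x + 1)" using charge_step[of x] by simp
  then show ?thesis using False by (simp add: phase_def)
qed

text \<open>Where the cover is even the charge is 0, so all entries concerned lie at
  \<open>x + 1\<close> and at \<open>y\<close>, exactly one at each. Equality of the covers at the
  ends then becomes a parity statement on \<open>above l G\<close>, hence on phases.\<close>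

lemma turn_phase:
  assumes good "x + 1 < y" "odd (cover x)" "odd (cover y)" and "\<And>z. x < z \<Longrightarrow> z < y \<Longrightarrow> even (cover z)"
  shows "(even (y - x - 1) \<longleftrightarrow> cover x = cover y) \<longleftrightarrow> even (phase x - phase y)"
proof -
  have const: "above l F z = above l F (x + 1) \<and> above l G z = above l G (x + 1)" if "x + 1 \<le> z" "z < y" for z
    using that
  proof (induction z rule: int_ge_induct)
    case (step z)
    obtain a b where ab: "above l F z = above l F (z + 1) + a" "above l G z = above l G (z + 1) + b"
      "a = 0 \<or> a = 1" "b = 0 \<or> b = 1" "charge z = charge (z + 1) + sgp (z + 1) * (a + b)" by (rule drops)
    have "charge z = 0" "charge (z + 1) = 0" using charge_zero[OF assms(1)] assms(5) step by auto
    then have "sgp (z + 1) * (a + b) = 0" using ab by simp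
    then have "a + b = 0" by (auto simp: sgp_def split: if_splits)
    then show ?case using ab step by auto
  qed simp
  obtain a b where ab: "above l F x = above l F (x + 1) + a" "above l G x = above l G (x + 1) + b"
    "a = 0 \<or> a = 1" "b = 0 \<or> b = 1" by (rule drops)
  obtain a' b' where ab': "above l F (y - 1) = above l F (y - 1 + 1) + a'" "above l G (y - 1) = above l G (y - 1 + 1) + b'"
    "a' = 0 \<or> a' = 1" "b' = 0 \<or> b' = 1" by (rule drops)
  have yy: "y - 1 + 1 = y" by simp
  have cy: "above l F (y - 1) = above l F (x + 1)" "above l G (y - 1) = above l G (x + 1)"
    using const[of "y - 1"] assms(2) by auto
  have "even (cover (x + 1))" "even (cover (y - 1))" using assms(2,5) by auto
  then have s: "a + b = 1" "a' + b' = 1" using ab ab' assms(3,4) unfolding cover_def yy by auto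
  have "above l F x \<noteq> above l F (x + 1) \<or> above l G x \<noteq> above l G (x + 1)" using ab s by auto
  then have px: "even (phase x - (x + 1 + above l G x))" by (rule phase_left(1)[OF assms(1,3)])
  have "above l F (y - 1) \<noteq> above l F (y - 1 + 1) \<or> above l G (y - 1) \<noteq> above l G (y - 1 + 1)" using ab' s by auto
  then have py: "even (phase y - (y - 1 + above l G y))"
    using phase_right(1)[OF assms(1), of "y - 1", unfolded yy, OF assms(4)] by (simp only: yy)
  have gx: "above l G x = above l G y + b' + b" using ab ab' cy unfolding yy by simp
  have fx: "above l F x = above l F y + a' + a" using ab ab' cy unfolding yy by simp
  have "cover x = cover y \<longleftrightarrow> b + b' = 1" using gx fx s unfolding cover_def by auto
  also have "\<dots> \<longleftrightarrow> odd (b + b')" using ab ab' by auto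
  finally show ?thesis using px py gx by presburger
qed

lemma open_iff: "i \<in> {1..l} \<Longrightarrow> F i \<le> x \<and> x < G i \<longleftrightarrow> above l F x < int i \<and> int i \<le> above l G x"
  using le_above_iff[OF F, of i x] le_above_iff[OF G, of i x] by auto

lemma matched_cover: "matched \<Longrightarrow> 0 \<le> cover x"
proof -
  assume "matched"
  then have "x < G i" if "i \<in> {1..l}" "x < F i" for i
    using that unfolding matched_def by (meson order.strict_trans)
  then show "0 \<le> cover x" using above_mono[of l x F x G] unfolding cover_def by auto
qed

lemma sum_alternating:
  assumes "a \<le> b" "\<And>i. a < i \<Longrightarrow> i < b \<Longrightarrow> odd (G (Suc i) - G i)"
  shows "(\<Sum>i\<in>{a<..b}. sgp (G i)) = (if even (b - a) then 0 else sgp (G b))"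
  using assms
proof (induction b rule: dec_induct)
  case (step b)
  have "{a<..Suc b} = insert (Suc b) {a<..b}" using step by auto
  moreover have "odd (b - a) \<Longrightarrow> sgp (G (Suc b)) = - sgp (G b)"
  proof -
    assume "odd (b - a)"
    then have "a < b" using step.hyps by (cases "a = b") auto
    then have "odd (G (Suc b) - G b)" using step.prems by simp
    then show ?thesis by (auto simp: sgp_def)
  qed
  ultimately show ?case using step by (auto simp: Suc_diff_le)
qed simp

text \<open>It suffices to pass from \<open>j\<close> to \<open>j + 1\<close>. If
  \<open>G (j + 1)\<close> exceeds \<open>F j\<close>, then \<open>G (j + 1) - F j\<close> is even
  while \<open>G j - F j\<close> is odd, so \<open>G j\<close> and \<open>G (j + 1)\<close> have
  opposite parities.\<close>

lemma matched_open_parity: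
  assumes matched "i \<in> {1..l}" "j \<in> {1..l}" "i \<le> j" "F i \<le> x" "x < G j"
  shows "even ((G i + int i) - (G j + int j))"
  using assms(4,3,6)
proof (induction j rule: dec_induct)
  case (step j)
  have j: "j \<in> {1..l}" "j < l" using step assms(2) by auto
  have "G (Suc j) < G j" using tuples_strict[OF G, of j "Suc j"] j by auto
  have "F j \<le> F i" using tuples_strict[OF F, of i j] assms(2) step j by (cases "i = j") auto
  then have "\<not> G (j + 1) \<le> F j" using assms(5) step.prems by simp
  moreover have "F j < G j \<and> odd (G j - F j) \<and> (j < l \<longrightarrow> G (j + 1) \<le> F j \<or> even (G (j + 1) - F j))"
    using assms(1) j(1) unfolding matched_def by blast
  ultimately have "even (G (Suc j) - F j)" "odd (G j - F j)" using j(2) by auto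
  moreover have "even ((G i + int i) - (G j + int j))"
    using step.IH[OF j(1)] step.prems(2) \<open>G (Suc j) < G j\<close> by simp
  ultimately show ?case unfolding of_nat_Suc by presburger
qed simp

text \<open>Indices with both entries beyond \<open>x\<close> cancel, since \<open>F i\<close> and
  \<open>G i\<close> have opposite parities. What remains are the indices open at \<open>x\<close>,
  and their signs alternate by \<open>matched_open_parity\<close>.\<close>

lemma matched_charge:
  assumes matched
  shows "charge x = (if even (cover x) then 0 else sgp (G (nat (above l G x))))"
proof -
  define a b where "a = nat (above l F x)" and "b = nat (above l G x)"
  have ab: "int a = above l F x" "int b = above l G x" "a \<le> b" "b \<le> l"
    using above_range[of l F x] above_range[of l G x] matched_cover[OF assms, of x] by (auto simp: a_def b_def cover_def)
  have "charge x = (\<Sum>i=1..l. if a < i \<and> i \<le> b then sgp (G i) else 0)" unfolding charge_def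
  proof (rule sum.cong)
    fix i assume i: "i \<in> {1..l}"
    have "x < F i \<longleftrightarrow> i \<le> a" "x < G i \<longleftrightarrow> i \<le> b"
      using le_above_iff[OF F i, of x] le_above_iff[OF G i, of x] ab by auto
    moreover have "sgp (F i) + sgp (G i) = 0" using assms i unfolding matched_def sgp_def by auto
    ultimately show "of_bool (x < F i) * sgp (F i) + of_bool (x < G i) * sgp (G i) = (if a < i \<and> i \<le> b then sgp (G i) else 0)"
      using ab(3) by auto
  qed simp
  also have "\<dots> = (\<Sum>i\<in>{a<..b}. sgp (G i))" using ab by (intro sum.mono_neutral_cong_right) auto
  also have "\<dots> = (if even (b - a) then 0 else sgp (G b))"
  proof (rule sum_alternating[OF ab(3)])
    fix i assume i: "a < i" "i < b"
    then have "F i \<le> x" "x < G (Suc i)" using open_iff[of i x] open_iff[of "Suc i" x] ab by auto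
    then have "even ((G i + int i) - (G (Suc i) + int (Suc i)))"
      using i ab by (intro matched_open_parity[OF assms]) auto
    then show "odd (G (Suc i) - G i)" by simp
  qed
  also have "even (b - a) \<longleftrightarrow> even (cover x)"
  proof -
    have "cover x = int (b - a)" using ab(3) unfolding cover_def ab(1,2)[symmetric] by simp
    then show ?thesis by simp
  qed
  finally show ?thesis by (simp only: b_def)
qed

lemma matched_good: "matched \<Longrightarrow> good"
  unfolding good_def by (simp add: matched_charge sgp_def)

text \<open>By \<open>turn_phase\<close> it suffices that the phase is the same at both ends. It is
  carried by the index \<open>J z\<close> of the last entry of \<open>G\<close> beyond
  \<open>z\<close>, and neighbouring points always have an open index in common.\<close>

lemma matched_turning:
  assumes matched shows turning
  unfolding turning_def
proof (intro allI impI, elim conjE)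
  fix x y assume xy: "x + 1 < y" "odd (cover x)" "odd (cover y)" "\<forall>z. x < z \<and> z < y \<longrightarrow> even (cover z) \<and> 0 < cover z"
  have pos: "0 < cover z" if "x \<le> z" "z \<le> y" for z
  proof (cases "z = x \<or> z = y")
    case True
    then have "cover z \<noteq> 0" using xy by auto
    then show ?thesis using matched_cover[OF assms, of z] by simp
  qed (use that xy in auto)
  have ph: "even (phase z - (G j + int j))" if "odd (cover z)" "int j = above l G z" for z j
  proof -
    have "charge z = sgp (G j)" using matched_charge[OF assms, of z] that by (metis nat_int)
    then show ?thesis using that(2) by (auto simp: phase_def sgp_def)
  qed
  define J where "J z = nat (above l G z)" for z
  have J: "int (J z) = above l G z" for z using above_range by (simp add: J_def)
  have Jin: "J z \<in> {1..l}" if "x \<le> z" "z \<le> y" for z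
    using pos[OF that] above_range[of l F z] above_range[of l G z] by (auto simp: J_def cover_def)
  have "even ((G (J x) + int (J x)) - (G (J z) + int (J z)))" if "x \<le> z" "z \<le> y" for z using that
  proof (induction z rule: int_ge_induct)
    case (step z)
    obtain a b where ab: "above l F z = above l F (z + 1) + a" "above l G z = above l G (z + 1) + b"
      "a = 0 \<or> a = 1" "b = 0 \<or> b = 1" by (rule drops)
    \<comment> \<open>One of \<open>z\<close>, \<open>z + 1\<close> has even positive cover, hence
      cover at least 2, and one entry of either tuple at \<open>z + 1\<close> cannot use this
      up.\<close>
    have shared: "above l F z < above l G (z + 1)"
    proof (cases "z = x")
      case True
      then have "even (cover (z + 1))" "0 < cover (z + 1)" using xy by auto
      then have "2 \<le> cover (z + 1)" by (cases "cover (z + 1) = 1") auto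
      then show ?thesis using ab by (auto simp: cover_def)
    next
      case False
      then have "even (cover z)" "0 < cover z" using xy step by auto
      then have "2 \<le> cover z" by (cases "cover z = 1") auto
      then show ?thesis using ab by (auto simp: cover_def)
    qed
    have "J (z + 1) \<le> J z" using ab J[of z] J[of "z + 1"] by auto
    moreover have i1: "J (z + 1) \<in> {1..l}" "J z \<in> {1..l}" using Jin step by auto
    moreover have "F (J (z + 1)) \<le> z" "z < G (J z)"
      using open_iff[OF i1(1), of z] open_iff[OF i1(2), of z] shared ab J[of z] J[of "z + 1"] by auto
    ultimately have "even ((G (J (z + 1)) + int (J (z + 1))) - (G (J z) + int (J z)))"
      by (intro matched_open_parity[OF assms, where x = z])
    moreover have "even ((G (J x) + int (J x)) - (G (J z) + int (J z)))" using step by simp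
    ultimately show ?case by (blast intro: even_diff_trans even_diff_sym)
  qed simp
  moreover have "x \<le> y" using xy(1) by simp
  ultimately have "even ((G (J x) + int (J x)) - (G (J y) + int (J y)))" by blast
  then have "even (phase x - phase y)"
    using ph[OF xy(2) J] ph[OF xy(3) J] by (blast intro: even_diff_trans even_diff_sym)
  then show "even (y - x - 1) \<longleftrightarrow> cover x = cover y"
    using turn_phase[OF matched_good[OF assms] xy(1-3)] xy(4) by blast
qed

text \<open>The phase is meaningful at odd cover only. On a stretch of even cover it is remembered
  from the last odd point, as long as the cover stays positive.\<close>

definition phase_upto :: "int \<Rightarrow> int \<Rightarrow> bool" where
  "phase_upto q z \<longleftrightarrow> (\<exists>u\<le>z. odd (cover u) \<and> (\<forall>v. u < v \<and> v \<le> z \<longrightarrow> even (cover v) \<and> 0 < cover v) \<and> even (phase u - q))"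

lemma turning_phase:
  assumes good turning "u < y - 1" "odd (cover u)" "odd (cover y)" "\<forall>v. u < v \<and> v \<le> y - 1 \<longrightarrow> even (cover v) \<and> 0 < cover v"
  shows "even (phase u - phase y)"
proof -
  have z: "\<forall>z. u < z \<and> z < y \<longrightarrow> even (cover z) \<and> 0 < cover z" using assms(6) by auto
  then have "even (y - u - 1) \<longleftrightarrow> cover u = cover y" using assms(2-5) unfolding turning_def by auto
  then show ?thesis using turn_phase[OF assms(1) _ assms(4,5)] assms(3) z by auto
qed

lemma phase_upto_step:
  assumes good turning "phase_upto q z" "0 < cover (z + 1)"
  shows "phase_upto q (z + 1)"
proof -
  obtain u where u: "u \<le> z" "odd (cover u)" "\<forall>v. u < v \<and> v \<le> z \<longrightarrow> even (cover v) \<and> 0 < cover v" "even (phase u - q)"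
    using assms(3) unfolding phase_upto_def by auto
  show ?thesis
  proof (cases "even (cover (z + 1))")
    case True
    then have "\<forall>v. u < v \<and> v \<le> z + 1 \<longrightarrow> even (cover v) \<and> 0 < cover v"
      using u(3) assms(4) by (metis zle_add1_eq_le order_le_less)
    then show ?thesis unfolding phase_upto_def using u by (intro exI[of _ u]) auto
  next
    case False
    have "even (phase u - phase (z + 1))"
    proof (cases "u = z")
      case True
      then show ?thesis using phase_adjacent[OF assms(1)] u False by simp
    next
      case neq: False
      then show ?thesis using turning_phase[OF assms(1,2), of u "z + 1"] u False by auto
    qed
    then have "even (phase (z + 1) - q)" using u(4) by presburger
    then show ?thesis unfolding phase_upto_def using False by (intro exI[of _ "z + 1"]) auto
  qed
qed

text \<open>While the cover is positive the phase persists: across even stretches by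
  \<open>turning\<close>, between odd neighbours by \<open>phase_adjacent\<close>. It starts near
  \<open>F i\<close> with the parity of \<open>F i + 1 + i\<close> and ends near \<open>G j\<close>
  with that of \<open>G j + j\<close>. For \<open>j = i\<close> and \<open>j = i + 1\<close> these
  are the two parity conditions in \<open>matched\<close>.\<close>

lemma good_turning_matched:
  assumes good "\<And>x. 0 \<le> cover x" turning
  shows matched
proof -
  have FG: "F i < G i" if i: "i \<in> {1..l}" for i
  proof (rule ccontr)
    assume "\<not> F i < G i"
    have eqs: "above l F (F i - 1) = int i" "above l F (F i) = int i - 1"
      using tuple_above[OF F i, of "F i - 1"] by simp_all
    then have "int i \<le> above l G (F i - 1)" using assms(2)[of "F i - 1"] by (simp add: cover_def)
    then have "F i - 1 < G i" using le_above_iff[OF G i] by simp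
    \<comment> \<open>Nonnegative cover leaves only equality; then the charge is 0 on both sides of
      a position where it has to change by 2.\<close>
    then have "G i = F i" using \<open>\<not> F i < G i\<close> by simp
    then have eqs': "above l G (F i - 1) = int i" "above l G (F i) = int i - 1"
      using tuple_above[OF G i, of "F i - 1"] by simp_all
    have "charge (F i - 1) = 0" "charge (F i) = 0"
      using charge_zero[OF assms(1)] eqs eqs' by (auto simp: cover_def)
    then show False using charge_step[of "F i - 1"] eqs eqs' by (auto simp: sgp_def split: if_splits)
  qed
  have link: "even ((F i + 1 + int i) - (G j + int j))" if i: "i \<in> {1..l}" and j: "j \<in> {1..l}" "F i < G j" "G j \<le> G i" for i j
  proof -
    define x where "x = F i - 1"
    have Fx: "F i = x + 1" by (simp add: x_def)
    have pos: "0 < cover z" if "F i \<le> z" "z < G i" for z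
      using open_iff[OF i, of z] that by (auto simp: cover_def)
    have start: "phase_upto (F i + 1 + int i) (F i)"
    proof (cases "odd (cover (F i))")
      case True
      then have "even (phase (x + 1) - (x + int i))" using phase_F_right[OF assms(1) _ i Fx] Fx by simp
      then have "even (phase (F i) - (F i + 1 + int i))" unfolding Fx by presburger
      then show ?thesis unfolding phase_upto_def using True by (intro exI[of _ "F i"]) auto
    next
      case False
      \<comment> \<open>If the cover at \<open>F i\<close> is even, the bound on the charge excludes
        a second entry at this position, so the cover at \<open>F i - 1\<close> is odd and the phase
        can be read off there.\<close>
      obtain a b where ab: "above l F x = above l F (x + 1) + a" "above l G x = above l G (x + 1) + b"
        "a = 0 \<or> a = 1" "b = 0 \<or> b = 1" "charge x = charge (x + 1) + sgp (x + 1) * (a + b)" by (rule drops)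
      have a1: "a = 1" using tuple_above[OF F i Fx] ab by simp
      have "charge (x + 1) = 0" using charge_zero[OF assms(1)] False Fx by simp
      moreover have "\<bar>charge x\<bar> \<le> 1" using assms(1) by (simp add: good_def)
      ultimately have b0: "b = 0" using ab a1 by (auto simp: sgp_def split: if_splits)
      then have "odd (cover x)" using False odd_diff_one[OF ab(1,2)] a1 b0 unfolding cover_def Fx by simp
      then have "even (phase x - (x + int i))" by (rule phase_F_left[OF assms(1) _ i Fx])
      then have "even (phase x - (F i + 1 + int i))" unfolding Fx by presburger
      moreover have "\<forall>v. x < v \<and> v \<le> F i \<longrightarrow> even (cover v) \<and> 0 < cover v"
      proof (intro allI impI)
        fix v assume "x < v \<and> v \<le> F i"
        then have "v = F i" using Fx by simp
        then show "even (cover v) \<and> 0 < cover v" using False pos[of "F i"] FG[OF i] by simp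
      qed
      ultimately show ?thesis unfolding phase_upto_def using \<open>odd (cover x)\<close> Fx by (intro exI[of _ x]) auto
    qed
    have upto: "phase_upto (F i + 1 + int i) z" if "F i \<le> z" "z < G i" for z using that
    proof (induction z rule: int_ge_induct)
      case base
      show ?case by (rule start)
    next
      case (step z)
      then show ?case using pos[of "z + 1"] by (intro phase_upto_step[OF assms(1,3)]) auto
    qed
    define y where "y = G j - 1"
    have Gy: "G j = y + 1" by (simp add: y_def)
    obtain u where u: "u \<le> y" "odd (cover u)" "\<forall>v. u < v \<and> v \<le> y \<longrightarrow> even (cover v) \<and> 0 < cover v"
      "even (phase u - (F i + 1 + int i))" using upto[of y] j unfolding phase_upto_def y_def by auto
    have "even (phase u - (G j + int j))"
    proof (cases "u = y")
      case True
      then show ?thesis using phase_G_left[OF assms(1) _ j(1) Gy] u(2) Gy by simp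
    next
      case False
      then have ev: "even (cover y)" "u < y" using u by auto
      obtain a b where ab: "above l F y = above l F (y + 1) + a" "above l G y = above l G (y + 1) + b"
        "a = 0 \<or> a = 1" "b = 0 \<or> b = 1" "charge y = charge (y + 1) + sgp (y + 1) * (a + b)" by (rule drops)
      have b1: "b = 1" using tuple_above[OF G j(1) Gy] ab by simp
      have "charge y = 0" using charge_zero[OF assms(1) ev(1)] .
      moreover have "\<bar>charge (y + 1)\<bar> \<le> 1" using assms(1) by (simp add: good_def)
      ultimately have a0: "a = 0" using ab b1 by (auto simp: sgp_def split: if_splits)
      then have od: "odd (cover (y + 1))" using ev(1) odd_diff_one[OF ab(1,2)] a0 b1 unfolding cover_def by simp
      then have "even (phase u - phase (y + 1))" using turning_phase[OF assms(1,3), of u "y + 1"] u ev by auto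
      moreover have "even (phase (y + 1) - (y + 1 + int j))" by (rule phase_G_right[OF assms(1) od j(1) Gy])
      ultimately show ?thesis unfolding Gy by presburger
    qed
    then show ?thesis using u(4) by presburger
  qed
  show ?thesis unfolding matched_def
  proof (intro ballI conjI impI)
    fix i assume i: "i \<in> {1..l}"
    show "F i < G i" by (rule FG[OF i])
    have "even ((F i + 1 + int i) - (G i + int i))" by (rule link[OF i i FG[OF i]]) simp
    then show "odd (G i - F i)" by presburger
    assume "i < l"
    then have j: "i + 1 \<in> {1..l}" "G (i + 1) \<le> G i" using tuples_strict[OF G, of i "i + 1"] i by auto
    show "G (i + 1) \<le> F i \<or> even (G (i + 1) - F i)"
    proof (rule disjCI)
      assume "\<not> even (G (i + 1) - F i)"
      show "G (i + 1) \<le> F i"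
      proof (rule ccontr)
        assume "\<not> G (i + 1) \<le> F i"
        then have "even ((F i + 1 + int i) - (G (i + 1) + int (i + 1)))" by (intro link[OF i j(1) _ j(2)]) simp
        then show False using \<open>\<not> even (G (i + 1) - F i)\<close> by simp
      qed
    qed
  qed
qed

text \<open>This splits condition (i) at height 0 into \<open>good\<close>, which depends only on
  the union of the tuples (\<open>row_good_total\<close>), and conditions on the height function,
  which together say that its bottom word is admissible.\<close>

theorem matched_iff: "matched \<longleftrightarrow> good \<and> (\<forall>x. 0 \<le> cover x) \<and> turning"
  using matched_cover matched_good matched_turning good_turning_matched by blast

end

section \<open>Minors as sums over families\<close>

definition minor :: "nat \<Rightarrow> (int \<Rightarrow> int \<Rightarrow> 'a::comm_ring_1) \<Rightarrow> (nat \<Rightarrow> int) \<Rightarrow> (nat \<Rightarrow> int) \<Rightarrow> 'a" where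
  "minor l K s t = det (mat l l (\<lambda>(i, j). K (s (i + 1)) (t (j + 1))))"

definition family_weight :: "nat \<Rightarrow> nat \<Rightarrow> (nat \<Rightarrow> int \<Rightarrow> 'a::comm_ring_1) \<Rightarrow> (nat \<Rightarrow> int \<Rightarrow> 'a) \<Rightarrow> family \<Rightarrow> 'a" where
  "family_weight l n u w F = (\<Prod>r<n. \<Prod>i=1..l. if F (Suc r) i = F r i then u r (F r i) else w r (F r i))"

lemma minor_transpose: "minor l K s t = minor l (\<lambda>a b. K b a) t s"
proof -
  have "mat l l (\<lambda>(i, j). K (s (j + 1)) (t (i + 1))) = transpose_mat (mat l l (\<lambda>(i, j). K (s (i + 1)) (t (j + 1))))"
    by (intro eq_matI) auto
  then show ?thesis unfolding minor_def by (simp add: det_transpose[where n = l])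
qed

lemma minor_leibniz:
  "minor l K s t = (\<Sum>p | p permutes {0..<l}. signof p * (\<Prod>i=1..l. K (s i) (t (p (i - 1) + 1))))"
proof -
  have "minor l K s t = (\<Sum>p | p permutes {0..<l}. signof p * (\<Prod>i=0..<l. K (s (i + 1)) (t (p i + 1))))"
    unfolding minor_def
  proof (subst det_def')
    show "mat l l (\<lambda>(i, j). K (s (i + 1)) (t (j + 1))) \<in> carrier_mat l l" by simp
    show "(\<Sum>p | p permutes {0..<l}. signof p * (\<Prod>i=0..<l. mat l l (\<lambda>(i, j). K (s (i + 1)) (t (j + 1))) $$ (i, p i)))
      = (\<Sum>p | p permutes {0..<l}. signof p * (\<Prod>i=0..<l. K (s (i + 1)) (t (p i + 1))))"
    proof (intro sum.cong refl arg_cong2[of _ _ _ _ "(*)"] prod.cong)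
      fix p i assume "p \<in> {p. p permutes {0..<l}}" "i \<in> {0..<l}"
      then have "i < l" "p i < l" using permutes_in_image[of p "{0..<l}" i] by auto
      then show "mat l l (\<lambda>(i, j). K (s (i + 1)) (t (j + 1))) $$ (i, p i) = K (s (i + 1)) (t (p i + 1))" by simp
    qed
  qed
  also have "\<dots> = (\<Sum>p | p permutes {0..<l}. signof p * (\<Prod>i=1..l. K (s i) (t (p (i - 1) + 1))))"
  proof (intro sum.cong refl arg_cong2[of _ _ _ _ "(*)"])
    fix p
    show "(\<Prod>i=0..<l. K (s (i + 1)) (t (p i + 1))) = (\<Prod>i=1..l. K (s i) (t (p (i - 1) + 1)))"
      by (rule prod.reindex_bij_witness[of _ "\<lambda>i. i - 1" Suc]) auto
  qed
  finally show ?thesis .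
qed

lemma minor_cong:
  assumes "\<And>i j. i \<in> {1..l} \<Longrightarrow> j \<in> {1..l} \<Longrightarrow> K (s i) (t j) = K' (s' i) (t' j)"
  shows "minor l K s t = minor l K' s' t'"
proof -
  have "mat l l (\<lambda>(i, j). K (s (i + 1)) (t (j + 1))) = mat l l (\<lambda>(i, j). K' (s' (i + 1)) (t' (j + 1)))"
    by (intro eq_matI) (auto intro!: assms)
  then show ?thesis by (simp add: minor_def)
qed

lemma minor_equal_rows:
  assumes "i \<in> {1..l}" "j \<in> {1..l}" "i \<noteq> j" "\<And>k. k \<in> {1..l} \<Longrightarrow> K (s i) (t k) = K (s j) (t k)"
  shows "minor l K s t = 0"
  unfolding minor_def
proof (rule det_identical_rows[of _ l "i - 1" "j - 1"])
  show "row (mat l l (\<lambda>(i, j). K (s (i + 1)) (t (j + 1)))) (i - 1) = row (mat l l (\<lambda>(i, j). K (s (i + 1)) (t (j + 1)))) (j - 1)"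
    using assms by (intro eq_vecI) auto
qed (use assms in auto)

lemma minor_scale:
  "minor l (\<lambda>a b. g a * h b * K a b) s t = (\<Prod>i=1..l. g (s i)) * (\<Prod>j=1..l. h (t j)) * minor l K s t"
proof -
  have "minor l (\<lambda>a b. g a * h b * K a b) s t =
    (\<Sum>p | p permutes {0..<l}. (\<Prod>i=1..l. g (s i)) * (\<Prod>j=1..l. h (t j)) * (signof p * (\<Prod>i=1..l. K (s i) (t (p (i - 1) + 1)))))"
    unfolding minor_leibniz
  proof (rule sum.cong)
    fix p assume "p \<in> {p. p permutes {0..<l}}"
    then have p: "p permutes {0..<l}" by simp
    have "(\<Prod>i=1..l. h (t (p (i - 1) + 1))) = (\<Prod>i=0..<l. h (t (p i + 1)))"
      by (rule prod.reindex_bij_witness[of _ Suc "\<lambda>i. i - 1"]) auto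
    also have "\<dots> = (\<Prod>i=0..<l. h (t (i + 1)))"
      using prod.permute[OF p, of "\<lambda>i. h (t (i + 1))"] by (simp add: comp_def)
    also have "\<dots> = (\<Prod>j=1..l. h (t j))" by (rule prod.reindex_bij_witness[of _ "\<lambda>i. i - 1" Suc]) auto
    finally show "signof p * (\<Prod>i=1..l. g (s i) * h (t (p (i - 1) + 1)) * K (s i) (t (p (i - 1) + 1))) =
      (\<Prod>i=1..l. g (s i)) * (\<Prod>j=1..l. h (t j)) * (signof p * (\<Prod>i=1..l. K (s i) (t (p (i - 1) + 1))))"
      by (simp only: prod.distrib mult.assoc mult.left_commute mult.commute)
  qed simp
  then show ?thesis by (simp add: minor_leibniz sum_distrib_left)
qed

text \<open>Every row is expanded into its two terms. \<open>T\<close> is strictly decreasing and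
  each entry moves by at most 1, so a choice that fails to be strictly decreasing repeats an entry,
  and its minor has two equal rows. Intersecting families thus vanish without a path-swapping
  involution.\<close>

lemma minor_row_step:
  assumes T: "T \<in> tuples l" and K': "\<And>a b. K' a b = u a * K a b + w (a - 1) * K (a - 1) b"
  shows "minor l K' T t = (\<Sum>X | X \<in> tuples l \<and> (\<forall>i\<in>{1..l}. T i = X i \<or> T i = X i + 1).
    (\<Prod>i=1..l. if T i = X i then u (X i) else w (X i)) * minor l K X t)"
proof -
  let ?c = "\<lambda>X i. if T i = X i then u (X i) else w (X i)"
  let ?P = "PiE {1..l} (\<lambda>i. {T i, T i - 1})"
  have "minor l K' T t = (\<Sum>p | p permutes {0..<l}. \<Sum>X\<in>?P. signof p * ((\<Prod>i=1..l. ?c X i) * (\<Prod>i=1..l. K (X i) (t (p (i - 1) + 1)))))"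
    unfolding minor_leibniz
  proof (rule sum.cong)
    fix p
    have "(\<Prod>i=1..l. K' (T i) (t (p (i - 1) + 1))) =
      (\<Prod>i=1..l. \<Sum>v\<in>{T i, T i - 1}. (if T i = v then u v else w v) * K v (t (p (i - 1) + 1)))"
      by (intro prod.cong) (auto simp: K')
    also have "\<dots> = (\<Sum>X\<in>?P. \<Prod>i=1..l. ?c X i * K (X i) (t (p (i - 1) + 1)))" by (subst prod_sum_PiE) auto
    finally show "signof p * (\<Prod>i=1..l. K' (T i) (t (p (i - 1) + 1))) =
      (\<Sum>X\<in>?P. signof p * ((\<Prod>i=1..l. ?c X i) * (\<Prod>i=1..l. K (X i) (t (p (i - 1) + 1)))))"
      by (simp only: prod.distrib sum_distrib_left)
  qed simp
  also have "\<dots> = (\<Sum>X\<in>?P. (\<Prod>i=1..l. ?c X i) * minor l K X t)"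
    unfolding minor_leibniz sum_distrib_left by (subst sum.swap) (simp only: mult.left_commute)
  also have "\<dots> = (\<Sum>X | X \<in> tuples l \<and> (\<forall>i\<in>{1..l}. T i = X i \<or> T i = X i + 1). (\<Prod>i=1..l. ?c X i) * minor l K X t)"
  proof (rule sum.mono_neutral_right)
    show "finite ?P" by (intro finite_PiE) auto
    show "{X. X \<in> tuples l \<and> (\<forall>i\<in>{1..l}. T i = X i \<or> T i = X i + 1)} \<subseteq> ?P" by (force simp: tuples_def PiE_iff)
    show "\<forall>X\<in>?P - {X. X \<in> tuples l \<and> (\<forall>i\<in>{1..l}. T i = X i \<or> T i = X i + 1)}. (\<Prod>i=1..l. ?c X i) * minor l K X t = 0"
    proof
      fix X assume X: "X \<in> ?P - {X. X \<in> tuples l \<and> (\<forall>i\<in>{1..l}. T i = X i \<or> T i = X i + 1)}"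
      have XT: "X i = T i \<or> X i = T i - 1" if "i \<in> {1..l}" for i using X that by (auto simp: PiE_iff)
      have "X \<notin> tuples l" using X XT by force
      moreover have "X \<in> extensional {1..l}" using X by (auto simp: PiE_iff)
      ultimately obtain i j where ij: "1 \<le> i" "i < j" "j \<le> l" "X i \<le> X j" by (auto simp: tuples_def not_less)
      have "T j < T i" using tuples_strict[OF T ij(1-3)] .
      then have "X i = X j" using XT[of i] XT[of j] ij by auto
      then have "minor l K X t = 0" using ij by (intro minor_equal_rows[of i l j]) auto
      then show "(\<Prod>i=1..l. ?c X i) * minor l K X t = 0" by simp
    qed
  qed
  finally show ?thesis .
qed

lemma families_0: "T \<in> tuples l \<Longrightarrow> families l 0 T = {restrict (\<lambda>_. T) {..0}}"
proof (intro equalityI subsetI)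
  fix F assume T: "T \<in> tuples l" and F: "F \<in> families l 0 T"
  have "F 0 = T"
  proof (rule extensionalityI)
    show "F 0 \<in> extensional {1..l}" "T \<in> extensional {1..l}"
      using T families_tuples[OF F, of 0] by (auto simp: tuples_def)
  qed (use families_top[OF F] in auto)
  then show "F \<in> {restrict (\<lambda>_. T) {..0}}" using F by (auto simp: families_def extensional_def fun_eq_iff)
qed (auto simp: families_def)

lemma families_Suc:
  assumes "T \<in> tuples l"
  shows "bij_betw (\<lambda>F. restrict F {..n}) (families l (Suc n) T)
    (\<Union>X\<in>{X \<in> tuples l. \<forall>i\<in>{1..l}. T i = X i \<or> T i = X i + 1}. families l n X)"
proof (rule bij_betw_byWitness[where f' = "\<lambda>F. F(Suc n := T)"])
  have topT: "F (Suc n) = T" if "F \<in> families l (Suc n) T" for F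
  proof (rule extensionalityI)
    show "F (Suc n) \<in> extensional {1..l}" "T \<in> extensional {1..l}"
      using assms families_tuples[OF that, of "Suc n"] by (auto simp: tuples_def)
  qed (use families_top[OF that] in auto)
  show "\<forall>F\<in>families l (Suc n) T. (restrict F {..n})(Suc n := T) = F"
  proof
    fix F assume F: "F \<in> families l (Suc n) T"
    then have "F r = undefined" if "r > Suc n" for r using that by (auto simp: families_def extensional_def)
    then show "(restrict F {..n})(Suc n := T) = F" using topT[OF F] by (auto simp: fun_eq_iff not_le)
  qed
  show "\<forall>F\<in>(\<Union>X\<in>{X \<in> tuples l. \<forall>i\<in>{1..l}. T i = X i \<or> T i = X i + 1}. families l n X). restrict (F(Suc n := T)) {..n} = F"
    by (auto simp: families_def extensional_def fun_eq_iff)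
  show "(\<lambda>F. restrict F {..n}) ` families l (Suc n) T
    \<subseteq> (\<Union>X\<in>{X \<in> tuples l. \<forall>i\<in>{1..l}. T i = X i \<or> T i = X i + 1}. families l n X)"
  proof clarify
    fix F assume F: "F \<in> families l (Suc n) T"
    have "F n \<in> tuples l" using families_tuples[OF F] by simp
    moreover have "\<forall>i\<in>{1..l}. T i = F n i \<or> T i = F n i + 1"
      using families_step[OF F, of n] topT[OF F] by auto
    moreover have "restrict F {..n} \<in> families l n (F n)" using F by (auto simp: families_def)
    ultimately show "restrict F {..n} \<in> (\<Union>X\<in>{X \<in> tuples l. \<forall>i\<in>{1..l}. T i = X i \<or> T i = X i + 1}. families l n X)"
      by blast
  qed
  show "(\<lambda>F. F(Suc n := T)) ` (\<Union>X\<in>{X \<in> tuples l. \<forall>i\<in>{1..l}. T i = X i \<or> T i = X i + 1}. families l n X)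
    \<subseteq> families l (Suc n) T"
  proof clarify
    fix F X assume X: "X \<in> tuples l" "\<forall>i\<in>{1..l}. T i = X i \<or> T i = X i + 1" and F: "F \<in> families l n X"
    have "(F(Suc n := T)) r \<in> tuples l" if "r \<le> Suc n" for r
      using that assms families_tuples[OF F, of r] by (cases "r = Suc n") auto
    moreover have "(F(Suc n := T)) (Suc r) i = (F(Suc n := T)) r i \<or> (F(Suc n := T)) (Suc r) i = (F(Suc n := T)) r i + 1"
      if "r < Suc n" "i \<in> {1..l}" for r i
      using that families_step[OF F, of r i] X(2) families_top[OF F, of i] by (cases "r = n") auto
    moreover have "F(Suc n := T) \<in> extensional {..Suc n}" using F by (auto simp: families_def extensional_def)
    ultimately show "F(Suc n := T) \<in> families l (Suc n) T" by (auto simp: families_def)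
  qed
qed

theorem minor_families:
  assumes "T \<in> tuples l" and "\<And>r a b. r < n \<Longrightarrow> K (Suc r) a b = u r a * K r a b + w r (a - 1) * K r (a - 1) b"
  shows "minor l (K n) T t = (\<Sum>F\<in>families l n T. family_weight l n u w F * minor l (K 0) (F 0) t)"
  using assms
proof (induction n arbitrary: T)
  case 0
  then show ?case by (simp add: families_0 family_weight_def)
next
  case (Suc n)
  let ?S = "{X. X \<in> tuples l \<and> (\<forall>i\<in>{1..l}. T i = X i \<or> T i = X i + 1)}"
  have fin: "finite ?S"
  proof (rule finite_subset)
    show "?S \<subseteq> PiE {1..l} (\<lambda>i. {T i, T i - 1})" by (force simp: tuples_def PiE_iff)
    show "finite (PiE {1..l} (\<lambda>i. {T i, T i - 1}))" by (intro finite_PiE) auto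
  qed
  have "minor l (K (Suc n)) T t = (\<Sum>X\<in>?S. (\<Prod>i=1..l. if T i = X i then u n (X i) else w n (X i)) * minor l (K n) X t)"
    by (rule minor_row_step[OF Suc.prems(1)]) (rule Suc.prems(2), simp)
  also have "\<dots> = (\<Sum>X\<in>?S. \<Sum>F\<in>families l n X. (\<Prod>i=1..l. if T i = F n i then u n (F n i) else w n (F n i)) *
      (family_weight l n u w F * minor l (K 0) (F 0) t))"
  proof (rule sum.cong)
    fix X assume X: "X \<in> ?S"
    then have "minor l (K n) X t = (\<Sum>F\<in>families l n X. family_weight l n u w F * minor l (K 0) (F 0) t)"
      using Suc.prems(2) by (intro Suc.IH) auto
    then show "(\<Prod>i=1..l. if T i = X i then u n (X i) else w n (X i)) * minor l (K n) X t =
      (\<Sum>F\<in>families l n X. (\<Prod>i=1..l. if T i = F n i then u n (F n i) else w n (F n i)) *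
        (family_weight l n u w F * minor l (K 0) (F 0) t))" unfolding sum_distrib_left
      by (auto intro!: sum.cong arg_cong2[of _ _ _ _ "(*)"] prod.cong simp: families_top sum_distrib_left)
  qed simp
  also have "\<dots> = (\<Sum>F\<in>(\<Union>X\<in>?S. families l n X). (\<Prod>i=1..l. if T i = F n i then u n (F n i) else w n (F n i)) *
      (family_weight l n u w F * minor l (K 0) (F 0) t))"
  proof (rule sum.UNION_disjoint[symmetric, OF fin])
    show "\<forall>X\<in>?S. finite (families l n X)" by (simp add: finite_families)
    show "\<forall>X\<in>?S. \<forall>Y\<in>?S. X \<noteq> Y \<longrightarrow> families l n X \<inter> families l n Y = {}"
    proof (intro ballI impI equals0I)
      fix X Y F assume *: "X \<in> ?S" "Y \<in> ?S" "X \<noteq> Y" "F \<in> families l n X \<inter> families l n Y"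
      have "X = Y"
      proof (rule extensionalityI)
        show "X \<in> extensional {1..l}" "Y \<in> extensional {1..l}" using * by (auto simp: tuples_def)
        show "X i = Y i" if "i \<in> {1..l}" for i
          using families_top[of F l n X i] families_top[of F l n Y i] * that by auto
      qed
      with * show False by simp
    qed
  qed
  also have "\<dots> = (\<Sum>F\<in>families l (Suc n) T. family_weight l (Suc n) u w F * minor l (K 0) (F 0) t)"
  proof (subst sum.reindex_bij_betw[OF families_Suc[OF Suc.prems(1)], symmetric], rule sum.cong)
    fix F assume F: "F \<in> families l (Suc n) T"
    have "(\<Prod>i=1..l. if T i = restrict F {..n} n i then u n (restrict F {..n} n i) else w n (restrict F {..n} n i))
      = (\<Prod>i=1..l. if F (Suc n) i = F n i then u n (F n i) else w n (F n i))"
      by (rule prod.cong) (auto simp: families_top[OF F])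
    moreover have "family_weight l n u w (restrict F {..n}) = family_weight l n u w F"
      unfolding family_weight_def by (intro prod.cong) auto
    ultimately show "(\<Prod>i=1..l. if T i = restrict F {..n} n i then u n (restrict F {..n} n i) else w n (restrict F {..n} n i)) *
        (family_weight l n u w (restrict F {..n}) * minor l (K 0) (restrict F {..n} 0) t)
      = family_weight l (Suc n) u w F * minor l (K 0) (F 0) t"
      by (simp add: family_weight_def mult.commute mult.left_commute)
  qed simp
  finally show ?case .
qed

text \<open>
  The middle factor without its weights: the E-steps lead from \<open>a + 1\<close>, the end of the lower path with
  dual end \<open>a\<close>, to \<open>b\<close>, and their number is even.
\<close>

definition hop :: "int \<Rightarrow> int \<Rightarrow> int" where
  "hop a b = (if a < b \<and> odd (b - a) then 1 else 0)"

section \<open>Evaluating the minors of the 0/1-kernel\<close>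

text \<open>The same sums as in \<open>tuple_pair\<close>, but free of its assumptions: in
  \<open>minor_hop\<close> they are taken for shorter prefixes and for altered tuples.\<close>

definition pos_charge :: "nat \<Rightarrow> (nat \<Rightarrow> int) \<Rightarrow> (nat \<Rightarrow> int) \<Rightarrow> int \<Rightarrow> int" where
  "pos_charge l F G x = (\<Sum>i=1..l. of_bool (x < F i) * sgp (F i) + of_bool (x < G i) * sgp (G i))"

definition pos_cover :: "nat \<Rightarrow> (nat \<Rightarrow> int) \<Rightarrow> (nat \<Rightarrow> int) \<Rightarrow> int \<Rightarrow> int" where
  "pos_cover l F G x = above l G x - above l F x"

abbreviation hop_bounded :: "nat \<Rightarrow> (nat \<Rightarrow> int) \<Rightarrow> (nat \<Rightarrow> int) \<Rightarrow> int \<Rightarrow> bool" where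
  "hop_bounded l F G x \<equiv> \<bar>pos_charge l F G x\<bar> \<le> 1 \<and> \<bar>pos_cover l F G x - 1\<bar> \<le> 1"

definition hop_value :: "nat \<Rightarrow> (nat \<Rightarrow> int) \<Rightarrow> (nat \<Rightarrow> int) \<Rightarrow> int" where
  "hop_value l F G = (if \<forall>x. hop_bounded l F G x
     then (- 1) ^ card {x. pos_cover l F G x = 2} else 0)"

text \<open>The order condition of \<open>tuples\<close> without extensionality, so that it passes
  to prefixes.\<close>

definition decreasing :: "nat \<Rightarrow> (nat \<Rightarrow> int) \<Rightarrow> bool" where
  "decreasing l X \<longleftrightarrow> (\<forall>i j. 1 \<le> i \<longrightarrow> i < j \<longrightarrow> j \<le> l \<longrightarrow> X j < X i)"

lemma above_Suc: "above (Suc l) X x = above l X x + of_bool (x < X (Suc l))"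
proof -
  have "{i \<in> {1..Suc l}. x < X i} = {i \<in> {1..l}. x < X i} \<union> (if x < X (Suc l) then {Suc l} else {})"
    by (auto simp: le_Suc_eq)
  then show ?thesis by (auto simp: above_def)
qed

lemma pos_charge_Suc:
  "pos_charge (Suc l) F G x = pos_charge l F G x + of_bool (x < F (Suc l)) * sgp (F (Suc l)) + of_bool (x < G (Suc l)) * sgp (G (Suc l))"
  by (simp add: pos_charge_def)

lemma pos_cover_Suc:
  "pos_cover (Suc l) F G x = pos_cover l F G x + of_bool (x < G (Suc l)) - of_bool (x < F (Suc l))"
  by (simp add: pos_cover_def above_Suc)

lemma pos_charge_cong: "(\<And>i. i \<in> {1..l} \<Longrightarrow> F i = F' i) \<Longrightarrow> (\<And>i. i \<in> {1..l} \<Longrightarrow> G i = G' i) \<Longrightarrow> pos_charge l F G x = pos_charge l F' G' x"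
  unfolding pos_charge_def by (rule sum.cong) auto

lemma above_cong: "(\<And>i. i \<in> {1..l} \<Longrightarrow> X i = Y i) \<Longrightarrow> above l X x = above l Y x"
proof -
  assume "\<And>i. i \<in> {1..l} \<Longrightarrow> X i = Y i"
  then have "{i \<in> {1..l}. x < X i} = {i \<in> {1..l}. x < Y i}" by auto
  then show ?thesis by (simp add: above_def)
qed

lemma pos_cover_cong: "(\<And>i. i \<in> {1..l} \<Longrightarrow> F i = F' i) \<Longrightarrow> (\<And>i. i \<in> {1..l} \<Longrightarrow> G i = G' i) \<Longrightarrow> pos_cover l F G x = pos_cover l F' G' x"
  unfolding pos_cover_def using above_cong[of l F F' x] above_cong[of l G G' x] by simp

text \<open>The charge to the left of all entries. It is even, so the bound by 1 forces it to be
  0.\<close>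

definition full_charge :: "nat \<Rightarrow> (nat \<Rightarrow> int) \<Rightarrow> (nat \<Rightarrow> int) \<Rightarrow> int" where
  "full_charge l F G = (\<Sum>i=1..l. sgp (F i) + sgp (G i))"

lemma pos_charge_low:
  "(\<And>i. i \<in> {1..l} \<Longrightarrow> x < F i \<and> x < G i) \<Longrightarrow> pos_charge l F G x = full_charge l F G"
  unfolding pos_charge_def full_charge_def by (rule sum.cong) auto

lemma pos_cover_low:
  "(\<And>i. i \<in> {1..l} \<Longrightarrow> x < F i \<and> x < G i) \<Longrightarrow> pos_cover l F G x = 0"
  unfolding pos_cover_def using above_left[of l x F] above_left[of l x G] by simp

lemma even_full_charge: "even (full_charge l F G)"
  unfolding full_charge_def by (rule dvd_sum) (auto simp: sgp_def)

lemma full_charge_Suc: "full_charge (Suc l) F G = full_charge l F G + sgp (F (Suc l)) + sgp (G (Suc l))"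
  by (simp add: full_charge_def)

lemma sgp_cases: "sgp z = 1 \<or> sgp z = - 1"
  by (simp add: sgp_def)

lemma sgp_add: "sgp (z + 1) = - sgp z" "sgp (z + 2) = sgp z"
  by (auto simp: sgp_def)

text \<open>The two data differ at \<open>u\<close> and \<open>v\<close> only. At the other point
  \<open>y\<close> the charge is even; if bounded by 1 it is 0, and then \<open>special\<close>
  settles \<open>u\<close> and \<open>v\<close> for both data.\<close>

lemma hop_bounded_transfer:
  assumes agree: "\<And>x. x \<noteq> u \<Longrightarrow> x \<noteq> v \<Longrightarrow>
      pos_charge l F G x = pos_charge l' F' G' x \<and> pos_cover l F G x = pos_cover l' F' G' x"
    and y: "y \<noteq> u" "y \<noteq> v" "even (pos_charge l F G y)"
    and special: "\<And>x. pos_charge l F G y = 0 \<Longrightarrow> x = u \<or> x = v \<Longrightarrow> hop_bounded l F G x \<and> hop_bounded l' F' G' x"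
  shows "(\<forall>x. hop_bounded l F G x) \<longleftrightarrow> (\<forall>x. hop_bounded l' F' G' x)"
proof -
  have eq: "hop_bounded l F G x \<longleftrightarrow> hop_bounded l' F' G' x" if b: "\<bar>pos_charge l F G y\<bar> \<le> 1" for x
  proof (cases "x = u \<or> x = v")
    case True
    have "pos_charge l F G y = 0" using b y(3) by (cases "\<bar>pos_charge l F G y\<bar> = 1") auto
    then show ?thesis using special True by blast
  next
    case False
    then show ?thesis using agree[of x] by simp
  qed
  have "pos_charge l' F' G' y = pos_charge l F G y" using agree[OF y(1,2)] by simp
  then show ?thesis using eq by metis
qed

lemma hop_value_cong:
  assumes "\<And>x. pos_cover l F G x = 2 \<longleftrightarrow> pos_cover l' F' G' x = 2" and "(\<forall>x. hop_bounded l F G x) \<longleftrightarrow>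
      (\<forall>x. hop_bounded l' F' G' x)"
  shows "hop_value l F G = hop_value l' F' G'"
  unfolding hop_value_def assms ..

lemma hop_value_zero:
  assumes "1 < \<bar>pos_charge l F G x\<bar> \<or> 1 < \<bar>pos_cover l F G x - 1\<bar>"
  shows "hop_value l F G = 0"
proof -
  have "\<not> (\<forall>x. hop_bounded l F G x)" using assms by (metis not_less)
  then show ?thesis by (simp only: hop_value_def if_False)
qed

lemma hop_value_full_charge:
  assumes "\<And>i. i \<in> {1..l} \<Longrightarrow> x < F i \<and> x < G i" "full_charge l F G \<noteq> 0"
  shows "hop_value l F G = 0"
proof (rule hop_value_zero)
  have "even (full_charge l F G)" by (rule even_full_charge)
  then have "1 < \<bar>full_charge l F G\<bar>" using assms(2) by (cases "\<bar>full_charge l F G\<bar> = 1") auto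
  then show "1 < \<bar>pos_charge l F G x\<bar> \<or> 1 < \<bar>pos_cover l F G x - 1\<bar>" using pos_charge_low[OF assms(1)] by simp
qed

lemma finite_pos_cover: "finite {x. pos_cover l F G x = 2}"
proof -
  define b where "b = (\<Sum>i=1..l. \<bar>F i\<bar> + \<bar>G i\<bar>)"
  have b: "\<bar>F i\<bar> \<le> b" "\<bar>G i\<bar> \<le> b" if "i \<in> {1..l}" for i
    using member_le_sum[of i "{1..l}" "\<lambda>i. \<bar>F i\<bar> + \<bar>G i\<bar>"] that by (auto simp: b_def)
  have "{x. pos_cover l F G x = 2} \<subseteq> {- b - 1..b}"
  proof
    fix x assume x: "x \<in> {x. pos_cover l F G x = 2}"
    show "x \<in> {- b - 1..b}"
    proof (rule ccontr)
      assume "x \<notin> {- b - 1..b}"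
      then consider "x < - b - 1" | "b < x" by fastforce
      then have "pos_cover l F G x = 0"
      proof cases
        case 1
        have "x < F i \<and> x < G i" if "i \<in> {1..l}" for i using b[OF that] 1 by auto
        then show ?thesis by (rule pos_cover_low)
      next
        case 2
        have "F i \<le> x" "G i \<le> x" if "i \<in> {1..l}" for i using b[OF that] 2 by auto
        then show ?thesis using above_right[of l F x] above_right[of l G x] by (simp add: pos_cover_def)
      qed
      with x show False by simp
    qed
  qed
  then show ?thesis by (rule finite_subset) simp
qed

lemma hop_value_sign:
  assumes "\<And>x. pos_cover l F G x = 2 \<longleftrightarrow> pos_cover l F' G x = 2 \<or> x = y" "pos_cover l F' G y \<noteq> 2"
    and "(\<forall>x. hop_bounded l F G x) \<longleftrightarrow> (\<forall>x. hop_bounded l F' G x)"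
  shows "hop_value l F G = - hop_value l F' G"
proof -
  have "{x. pos_cover l F G x = 2} = insert y {x. pos_cover l F' G x = 2}" using assms(1) by auto
  then have "card {x. pos_cover l F G x = 2} = Suc (card {x. pos_cover l F' G x = 2})"
    using assms(2) finite_pos_cover[of l F' G] by simp
  then show ?thesis unfolding hop_value_def assms(3) by simp
qed

lemma decreasing_Suc: "decreasing (Suc l) X \<longleftrightarrow> decreasing l X \<and> (\<forall>i\<in>{1..l}. X (Suc l) < X i)"
proof (intro iffI conjI ballI)
  assume r: "decreasing l X \<and> (\<forall>i\<in>{1..l}. X (Suc l) < X i)"
  show "decreasing (Suc l) X" unfolding decreasing_def
  proof (intro allI impI)
    fix i j :: nat
    assume "1 \<le> i" "i < j" "j \<le> Suc l"
    then show "X j < X i" using r by (cases "j = Suc l") (auto simp: decreasing_def)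
  qed
qed (auto simp: decreasing_def)

lemma decreasing_cong: "(\<And>i. i \<in> {1..l} \<Longrightarrow> X i = Y i) \<Longrightarrow> decreasing l X \<longleftrightarrow> decreasing l Y"
proof -
  assume eq: "\<And>i. i \<in> {1..l} \<Longrightarrow> X i = Y i"
  have "X j < X i \<longleftrightarrow> Y j < Y i" if "1 \<le> i" "i < j" "j \<le> l" for i j using eq[of i] eq[of j] that by auto
  then show ?thesis unfolding decreasing_def by blast
qed

lemma decreasing_last: "decreasing l X \<Longrightarrow> i \<in> {1..l} \<Longrightarrow> X l \<le> X i"
  by (cases "i = l") (auto simp: decreasing_def less_imp_le)

lemma minor_last_column:
  assumes "\<And>i. i \<in> {1..l} \<Longrightarrow> K (s i) (t (Suc l)) = 0"
  shows "minor (Suc l) K s t = K (s (Suc l)) (t (Suc l)) * minor l K s t"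
proof -
  define A where "A = mat (Suc l) (Suc l) (\<lambda>(i, j). K (s (i + 1)) (t (j + 1)))"
  have A: "A \<in> carrier_mat (Suc l) (Suc l)" by (simp add: A_def)
  have "det A = (\<Sum>i<Suc l. A $$ (i, l) * cofactor A i l)" by (rule laplace_expansion_column[OF A]) simp
  also have "\<dots> = (\<Sum>i<l. A $$ (i, l) * cofactor A i l) + A $$ (l, l) * cofactor A l l" by simp
  also have "(\<Sum>i<l. A $$ (i, l) * cofactor A i l) = 0" by (rule sum.neutral) (use assms in \<open>auto simp: A_def\<close>)
  also have "cofactor A l l = minor l K s t"
  proof -
    have "mat_delete A l l = mat l l (\<lambda>(i, j). K (s (i + 1)) (t (j + 1)))"
      by (rule eq_matI) (auto simp: mat_delete_def A_def)
    then show ?thesis by (simp add: cofactor_def minor_def)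
  qed
  finally show ?thesis by (simp add: minor_def A_def)
qed

lemma minor_swap_rows:
  assumes "i \<in> {1..l}" "j \<in> {1..l}" "i \<noteq> j"
  shows "minor l K (s(i := s j, j := s i)) t = - minor l K s t"
proof -
  define A where "A = mat l l (\<lambda>(i, j). K (s (i + 1)) (t (j + 1)))"
  have "mat l l (\<lambda>(i', j'). K ((s(i := s j, j := s i)) (i' + 1)) (t (j' + 1))) = swaprows (i - 1) (j - 1) A"
    by (rule eq_matI) (use assms in \<open>auto simp: A_def\<close>)
  moreover have "det (swaprows (i - 1) (j - 1) A) = - det A"
    by (rule det_swaprows[of _ l]) (use assms in \<open>auto simp: A_def\<close>)
  ultimately show ?thesis by (simp add: minor_def A_def)
qed

text \<open>Outer induction on the size, inner induction on the distance from the last entry of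
  \<open>F\<close> to the last entry of \<open>G\<close>. If it is at most 1, the last column
  vanishes outside the corner. Otherwise the last entry of \<open>F\<close> is moved right by 2,
  which changes no entry of the matrix, and two rows are exchanged if it passes its neighbour; these
  exchanges are the origin of the sign.\<close>

theorem minor_hop:
  assumes "decreasing l F" "decreasing l G"
  shows "minor l hop F G = hop_value l F G"
  using assms
proof (induction l arbitrary: F G)
  case 0
  have "pos_charge 0 F G x = 0" "pos_cover 0 F G x = 0" for x by (simp_all add: pos_charge_def pos_cover_def above_def)
  then show ?case by (simp add: hop_value_def minor_def)
next
  case (Suc l)
  note outer = Suc.IH
  show ?case using Suc.prems
  proof (induction "nat (G (Suc l) - F (Suc l))" arbitrary: F rule: less_induct)
    case less
    define f g where "f = F (Suc l)" and "g = G (Suc l)"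
    define s where "s = sgp f"
    have Fl: "f < F i" and Gl: "g < G i" if "i \<in> {1..l}" for i
      using less.prems that unfolding decreasing_Suc f_def g_def by auto
    have dec: "decreasing l F" "decreasing l G" using less.prems by (simp_all add: decreasing_Suc)
    have s: "s = 1 \<or> s = - 1" unfolding s_def by (rule sgp_cases)
    have ch: "pos_charge (Suc l) F G x = pos_charge l F G x + of_bool (x < f) * s + of_bool (x < g) * sgp g"
      and cv: "pos_cover (Suc l) F G x = pos_cover l F G x + of_bool (x < g) - of_bool (x < f)" for x
      unfolding pos_charge_Suc pos_cover_Suc f_def g_def s_def by auto
    have fc: "full_charge (Suc l) F G = full_charge l F G + s + sgp g"
      unfolding full_charge_Suc f_def g_def s_def by simp
    have fc0: "hop_value (Suc l) F G = 0" if "full_charge (Suc l) F G \<noteq> 0"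
    proof (rule hop_value_full_charge[OF _ that])
      fix i assume "i \<in> {1..Suc l}"
      then have "i \<in> {1..l} \<or> i = Suc l" by auto
      then show "min f g - 1 < F i \<and> min f g - 1 < G i" using Fl[of i] Gl[of i] by (auto simp: f_def g_def)
    qed
    have mlow: "pos_charge l F G x = full_charge l F G" "pos_cover l F G x = 0" if "x \<le> f" "x \<le> g" for x
      using that Fl Gl by (auto intro!: pos_charge_low pos_cover_low) (meson le_less_trans)+
    consider "g < f" | "g = f" | "g = f + 1" | "f + 2 \<le> g" by linarith
    then show ?case
    proof cases
      case 1
      have "minor (Suc l) hop F G = hop f g * minor l hop F G"
        unfolding f_def g_def by (rule minor_last_column) (use Fl 1 in \<open>force simp: hop_def f_def g_def\<close>)
      moreover have "hop_value (Suc l) F G = 0"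
      proof (rule hop_value_zero[of _ _ _ g])
        show "1 < \<bar>pos_charge (Suc l) F G g\<bar> \<or> 1 < \<bar>pos_cover (Suc l) F G g - 1\<bar>"
          using mlow(2)[of g] 1 by (simp add: cv)
      qed
      ultimately show ?thesis using 1 by (simp add: hop_def)
    next
      case 2
      have "minor (Suc l) hop F G = hop f g * minor l hop F G"
        unfolding f_def g_def by (rule minor_last_column) (use Fl 2 in \<open>force simp: hop_def f_def g_def\<close>)
      moreover have "hop_value (Suc l) F G = 0"
      proof (cases "full_charge (Suc l) F G = 0")
        case True
        show ?thesis
        proof (rule hop_value_zero[of _ _ _ f])
          \<comment> \<open>The two equal entries at \<open>f\<close> move the charge by 2 away from
            the full charge 0.\<close>
          have "pos_charge (Suc l) F G f = - 2 * s" using mlow(1)[of f] 2 fc True by (simp add: ch s_def)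
          then show "1 < \<bar>pos_charge (Suc l) F G f\<bar> \<or> 1 < \<bar>pos_cover (Suc l) F G f - 1\<bar>" using s by auto
        qed
      qed (rule fc0)
      ultimately show ?thesis using 2 by (simp add: hop_def)
    next
      case 3
      have sg: "sgp g = - s" unfolding 3 s_def by (rule sgp_add)
      have "minor (Suc l) hop F G = hop f g * minor l hop F G"
        unfolding f_def g_def by (rule minor_last_column) (use Fl 3 in \<open>force simp: hop_def f_def g_def\<close>)
      also have "\<dots> = hop_value l F G"
      proof -
        have "hop f g = 1" using 3 by (simp add: hop_def)
        then show ?thesis using outer[OF dec] by simp
      qed
      also have "\<dots> = hop_value (Suc l) F G"
      proof (rule hop_value_cong[symmetric])
        have ch': "pos_charge (Suc l) F G x = pos_charge l F G x - of_bool (x = f) * s" for x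
          unfolding ch sg using 3 by (auto simp: of_bool_def)
        have cv': "pos_cover (Suc l) F G x = pos_cover l F G x + of_bool (x = f)" for x
          unfolding cv using 3 by (auto simp: of_bool_def)
        have f0: "pos_cover l F G f = 0" "pos_charge l F G f = full_charge l F G" using mlow[of f] 3 by auto
        have fm: "pos_charge l F G (f - 1) = full_charge l F G" using mlow(1)[of "f - 1"] 3 by simp
        show "pos_cover (Suc l) F G x = 2 \<longleftrightarrow> pos_cover l F G x = 2" for x using f0 by (auto simp: cv')
        show "(\<forall>x. hop_bounded (Suc l) F G x) \<longleftrightarrow> (\<forall>x. hop_bounded l F G x)"
          by (rule hop_bounded_transfer[where u = f and v = f and y = "f - 1"])
            (use f0 fm s even_full_charge[of l F G] in \<open>auto simp: ch' cv'\<close>)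
      qed
      finally show ?thesis .
    next
      case 4
      define F2 where "F2 = F(Suc l := f + 2)"
      have F2: "F2 (Suc l) = f + 2" "\<And>i. i \<in> {1..l} \<Longrightarrow> F2 i = F i" by (auto simp: F2_def)
      have det2: "minor (Suc l) hop F G = minor (Suc l) hop F2 G"
      proof (rule minor_cong)
        fix i j assume ij: "i \<in> {1..Suc l}" "j \<in> {1..Suc l}"
        have gj: "g \<le> G j" using ij(2) Gl[of j] by (cases "j = Suc l") (auto simp: g_def)
        show "hop (F i) (G j) = hop (F2 i) (G j)"
        proof (cases "i = Suc l")
          case True
          \<comment> \<open>\<open>hop f\<close> and \<open>hop (f + 2)\<close> differ at
            \<open>f + 1\<close> only, and no \<open>G j\<close> lies there.\<close>
          have "G j \<noteq> f + 1" using gj 4 by simp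
          moreover have "G j = f + 2 \<Longrightarrow> even (G j - f)" by simp
          ultimately have "hop f (G j) = hop (f + 2) (G j)"
            using gj 4 unfolding hop_def by (cases "G j = f + 2") auto
          then show ?thesis using True by (simp add: F2 f_def[symmetric])
        qed (use ij F2 in auto)
      qed
      have ch2: "pos_charge (Suc l) F2 G x = pos_charge (Suc l) F G x + of_bool (f \<le> x \<and> x < f + 2) * s"
        and cv2: "pos_cover (Suc l) F2 G x = pos_cover (Suc l) F G x - of_bool (f \<le> x \<and> x < f + 2)" for x
        unfolding pos_charge_Suc[of l F2] pos_cover_Suc[of l F2] F2(1) g_def[symmetric] ch cv s_def sgp_add(2)
        using pos_charge_cong[of l F2 F G G x] pos_cover_cong[of l F2 F G G x] F2(2) by (auto simp: of_bool_def)
      have at_f: "pos_charge (Suc l) F G f = full_charge (Suc l) F G - s" "pos_cover (Suc l) F G f = 1"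
        using mlow[of f] 4 fc by (simp_all add: ch cv)
      have below: "pos_charge (Suc l) F G (f - 1) = full_charge (Suc l) F G"
        using mlow(1)[of "f - 1"] 4 fc by (simp add: ch)
      have mid: "pos_charge l F G (f + 1) = full_charge l F G - of_bool (0 < l \<and> F l = f + 1) * sgp (f + 1)" (is ?A)
        "pos_cover l F G (f + 1) = of_bool (0 < l \<and> F l = f + 1)" (is ?B)
      proof -
        have big: "f + 1 < F i" if "i \<in> {1..l}" "0 < l \<longrightarrow> F l \<noteq> f + 1 \<or> i < l" for i
        proof (cases "i = l")
          case True
          then show ?thesis using that Fl[of i] by auto
        next
          case False
          then have "F l < F i" using dec(1) that unfolding decreasing_def by auto
          moreover have "f < F l" using Fl[of l] that by auto
          ultimately show ?thesis by simp
        qed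
        have Gb: "f + 1 < G i" if "i \<in> {1..l}" for i using Gl[OF that] 4 by simp
        show ?A ?B
        proof -
          have "?A \<and> ?B"
          proof (cases "0 < l \<and> F l = f + 1")
            case False
            have "f + 1 < F i \<and> f + 1 < G i" if "i \<in> {1..l}" for i using big[OF that] Gb[OF that] False by auto
            then show ?thesis using False pos_charge_low[of l "f + 1" F G] pos_cover_low[of l "f + 1" F G] by auto
          next
            case True
            then obtain k where k: "l = Suc k" by (cases l) auto
            have "f + 1 < F i \<and> f + 1 < G i" if "i \<in> {1..k}" for i using big[of i] Gb[of i] that k by auto
            then have "pos_charge k F G (f + 1) = full_charge k F G" "pos_cover k F G (f + 1) = 0"
              using pos_charge_low[of k "f + 1" F G] pos_cover_low[of k "f + 1" F G] by auto
            then show ?thesis using True Gb[of l] k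
              by (simp add: pos_charge_Suc pos_cover_Suc full_charge_Suc)
          qed
          then show ?A ?B by auto
        qed
      qed
      have at_f1: "pos_charge (Suc l) F G (f + 1) = full_charge (Suc l) F G - s + of_bool (0 < l \<and> F l = f + 1) * s"
        "pos_cover (Suc l) F G (f + 1) = 1 + of_bool (0 < l \<and> F l = f + 1)"
        using mid 4 fc by (simp_all add: ch cv s_def sgp_add)
      show ?thesis
      proof (cases "0 < l \<and> F l \<le> f + 2")
        case False
        then have gt: "f + 2 < F i" if "i \<in> {1..l}" for i using that decreasing_last[OF dec(1) that] by auto
        have "decreasing (Suc l) F2"
          using decreasing_cong[of l F2 F] dec(1) gt F2 by (simp add: decreasing_Suc)
        then have "minor (Suc l) hop F2 G = hop_value (Suc l) F2 G"
          using less.prems 4 by (intro less.hyps) (auto simp: F2 f_def g_def)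
        also have "\<dots> = hop_value (Suc l) F G"
        proof (rule hop_value_cong[symmetric])
          have at1: "pos_charge (Suc l) F G (f + 1) = full_charge (Suc l) F G - s" "pos_cover (Suc l) F G (f + 1) = 1"
            using at_f1 False by auto
          have range: "f \<le> x \<and> x < f + 2 \<longleftrightarrow> x = f \<or> x = f + 1" for x by auto
          show "pos_cover (Suc l) F G x = 2 \<longleftrightarrow> pos_cover (Suc l) F2 G x = 2" for x
            using at1 at_f unfolding cv2 range by auto
          show "(\<forall>x. hop_bounded (Suc l) F G x) \<longleftrightarrow> (\<forall>x. hop_bounded (Suc l) F2 G x)"
            by (rule hop_bounded_transfer[where u = f and v = "f + 1" and y = "f - 1"])
              (unfold cv2 ch2 range, use at1 at_f below s even_full_charge[of "Suc l" F G] in auto)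
        qed
        finally show ?thesis using det2 by simp
      next
        case True
        then have l0: "0 < l" and lin: "l \<in> {1..l}" by auto
        have "f < F l" using Fl[OF lin] .
        then consider "F l = f + 2" | "F l = f + 1" using True by linarith
        then show ?thesis
        proof cases
          case 1
          \<comment> \<open>The moved entry meets \<open>F l\<close> and makes two rows equal. On
            the side of \<open>hop_value\<close>, two entries of equal sign at distance 2 take the
            charge out of its bounds.\<close>
          have "minor (Suc l) hop F2 G = 0"
            by (rule minor_equal_rows[of l _ "Suc l"]) (use l0 1 F2 lin in auto)
          moreover have "hop_value (Suc l) F G = 0"
          proof (cases "full_charge (Suc l) F G = 0")
            case fz: True
            obtain k where k: "l = Suc k" using l0 by (cases l) auto
            have kb: "f + 2 < F i \<and> f + 2 < G i" if "i \<in> {1..k}" for i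
              using dec(1) that 1 k Gl[of i] 4 unfolding k decreasing_Suc by auto
            have ck: "pos_charge k F G (f + 2) = full_charge k F G" using kb by (rule pos_charge_low)
            have "G l > f + 2" using Gl[OF lin] 4 by simp
            then have "pos_charge (Suc l) F G (f + 2) = full_charge (Suc l) F G - 2 * s - of_bool (\<not> f + 2 < g) * sgp g"
              using ck 1 unfolding ch fc by (simp add: k pos_charge_Suc full_charge_Suc s_def sgp_add)
            moreover have "\<not> f + 2 < g \<Longrightarrow> sgp g = s" using 4 sgp_add(2)[of f] by (simp add: s_def)
            ultimately have "1 < \<bar>pos_charge (Suc l) F G (f + 2)\<bar>" using fz s by (cases "f + 2 < g") auto
            then show ?thesis by (intro hop_value_zero[of _ _ _ "f + 2"]) simp
          qed (rule fc0)
          ultimately show ?thesis using det2 by simp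
        next
          case 2
          \<comment> \<open>The moved entry has passed \<open>F l\<close>, and exchanging the two
            rows restores the order. The cover at \<open>f + 1\<close> drops from 2 to 1, which
            accounts for the sign.\<close>
          define F3 where "F3 = F(Suc l := f + 1, l := f + 2)"
          have F3eq: "F3 = F2(l := F2 (Suc l), Suc l := F2 l)" using 2 l0 by (auto simp: F3_def F2_def fun_eq_iff)
          have det3: "minor (Suc l) hop F2 G = - minor (Suc l) hop F3 G"
            unfolding F3eq using minor_swap_rows[of l "Suc l" "Suc l" hop F2 G] l0 by simp
          obtain k where k: "l = Suc k" using l0 by (cases l) auto
          show ?thesis
          proof (cases "0 < k \<and> F k \<le> f + 2")
            case True
            then have kin: "k \<in> {1..l}" "k < l" using k by auto
            have "F l < F k" using dec(1) kin True unfolding decreasing_def by auto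
            \<comment> \<open>Three consecutive entries: after the exchange the rows
              \<open>k\<close> and \<open>l\<close> coincide. The cover reaches 3 at
              \<open>f + 2\<close>, or, if \<open>g = f + 2\<close>, the charge is out of bounds
              there.\<close>
            then have Fk: "F k = f + 2" using True 2 by simp
            have "minor (Suc l) hop F3 G = 0"
              by (rule minor_equal_rows[of k _ l]) (use kin l0 Fk k in \<open>auto simp: F3_def\<close>)
            moreover have "hop_value (Suc l) F G = 0"
            proof (cases "full_charge (Suc l) F G = 0")
              case fz: True
              obtain m where m: "k = Suc m" using True by (cases k) auto
              have mb: "f + 2 < F i \<and> f + 2 < G i" if "i \<in> {1..m}" for i
                using dec(1) that Fk k m Gl[of i] 4 unfolding k m decreasing_Suc by auto
              have cm: "pos_charge m F G (f + 2) = full_charge m F G" "pos_cover m F G (f + 2) = 0"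
                using pos_charge_low[OF mb] pos_cover_low[OF mb] by auto
              have gb: "f + 2 < G l" "f + 2 < G k" using Gl[of l] Gl[of k] kin lin 4 by auto
              have e: "pos_charge (Suc l) F G (f + 2) = full_charge (Suc l) F G - s - of_bool (\<not> f + 2 < g) * sgp g"
                "pos_cover (Suc l) F G (f + 2) = 2 + of_bool (f + 2 < g)" using cm gb Fk 2 unfolding ch fc cv
                by (simp_all add: k m pos_charge_Suc full_charge_Suc pos_cover_Suc s_def sgp_add)
              show ?thesis
              proof (cases "f + 2 < g")
                case True
                then show ?thesis using e by (intro hop_value_zero[of _ _ _ "f + 2"]) simp
              next
                case False
                then have "sgp g = s" using 4 sgp_add(2)[of f] by (simp add: s_def)
                then have "1 < \<bar>pos_charge (Suc l) F G (f + 2)\<bar>" using e fz False s by auto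
                then show ?thesis by (intro hop_value_zero[of _ _ _ "f + 2"]) simp
              qed
            qed (rule fc0)
            ultimately show ?thesis using det2 det3 by simp
          next
            case False
            have "decreasing k F" using dec(1) k by (simp add: decreasing_Suc)
            with False have gt: "f + 2 < F i" if "i \<in> {1..k}" for i
              using that decreasing_last[of k F i] by auto
            have F3v: "F3 (Suc l) = f + 1" "F3 l = f + 2" "\<And>i. i \<in> {1..k} \<Longrightarrow> F3 i = F i" using k by (auto simp: F3_def)
            have "decreasing k F" using dec(1) k by (simp add: decreasing_Suc)
            then have d3: "decreasing k F3" using decreasing_cong[of k F3 F] F3v(3) by simp
            have "f + 2 < F3 i" if "i \<in> {1..k}" for i using gt[OF that] F3v(3)[OF that] by simp
            then have "decreasing l F3" using d3 F3v(2) by (simp add: k decreasing_Suc)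
            moreover have "f + 1 < F3 i" if "i \<in> {1..l}" for i
              using gt[of i] F3v(2) F3v(3)[of i] that k by (cases "i = l") auto
            ultimately have "decreasing (Suc l) F3" using F3v(1) by (simp add: decreasing_Suc)
            then have "minor (Suc l) hop F3 G = hop_value (Suc l) F3 G"
              using less.prems 4 by (intro less.hyps) (auto simp: F3v f_def g_def)
            moreover have "hop_value (Suc l) F G = - hop_value (Suc l) F3 G"
            proof (rule hop_value_sign[of _ _ _ _ "f + 1"])
              have ch3: "pos_charge (Suc l) F3 G x = pos_charge (Suc l) F2 G x"
                and cv3: "pos_cover (Suc l) F3 G x = pos_cover (Suc l) F2 G x" for x
                using pos_charge_cong[of k F3 F2 G G x] pos_cover_cong[of k F3 F2 G G x] F3v F2 2 k
                by (simp_all add: pos_charge_Suc pos_cover_Suc)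
              have at1: "pos_charge (Suc l) F G (f + 1) = full_charge (Suc l) F G" "pos_cover (Suc l) F G (f + 1) = 2"
                using at_f1 2 l0 by auto
              have range: "f \<le> x \<and> x < f + 2 \<longleftrightarrow> x = f \<or> x = f + 1" for x by auto
              show "pos_cover (Suc l) F G x = 2 \<longleftrightarrow> pos_cover (Suc l) F3 G x = 2 \<or> x = f + 1" for x
                using at1 at_f unfolding cv3 cv2 range by auto
              show "pos_cover (Suc l) F3 G (f + 1) \<noteq> 2" using at1 unfolding cv3 cv2 by simp
              show "(\<forall>x. hop_bounded (Suc l) F G x) \<longleftrightarrow> (\<forall>x. hop_bounded (Suc l) F3 G x)"
                by (rule hop_bounded_transfer[where u = f and v = "f + 1" and y = "f - 1"])
                  (unfold cv3 ch3 cv2 ch2 range, use at1 at_f below s even_full_charge[of "Suc l" F G] in auto)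
            qed
            ultimately show ?thesis using det2 det3 by simp
          qed
        qed
      qed
    qed
  qed
qed

section \<open>Admissible bottom words in terms of intervals\<close>

context strip_heights
begin

definition bottom_turning :: "(nat \<times> int \<Rightarrow> int) \<Rightarrow> bool" where
  "bottom_turning c \<longleftrightarrow> (\<forall>x y. lo \<le> x \<and> y \<le> hi \<and> x + 1 < y \<and> even (c (0, x)) \<and> even (c (0, y)) \<and>
     (\<forall>z. x < z \<and> z < y \<longrightarrow> odd (c (0, z)) \<and> 0 < c (0, z)) \<longrightarrow> (even (y - x - 1) \<longleftrightarrow> c (0, x) = c (0, y)))"

lemma run_interval:
  assumes "0 < k" "k + 1 < runs"
  obtains x y where "lo \<le> x" "y \<le> hi" "x + 1 < y" "idx jumps x = k - 1" "idx jumps y = k + 1"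
    "\<And>z. x < z \<Longrightarrow> z < y \<Longrightarrow> idx jumps z = k"
proof -
  define R where "R = {z. lo \<le> z \<and> z \<le> hi \<and> idx jumps z = k}"
  have fin: "finite R" by (rule finite_subset[of _ "{lo..hi}"]) (auto simp: R_def)
  have ne: "R \<noteq> {}" using idx_surj[of hi k jumps] lo_less_hi assms by (auto simp: R_def)
  have mn: "Min R \<in> R" and mx: "Max R \<in> R" using fin ne by auto
  have bd: "lo \<le> Min R" "Min R \<le> hi" "idx jumps (Min R) = k" "lo \<le> Max R" "Max R \<le> hi" "idx jumps (Max R) = k"
    using mn mx unfolding R_def by blast+
  have le: "Min R \<le> Max R" using fin mx by simp
  have "Min R \<noteq> lo" using bd(3) assms(1) idx_lo[of jumps] by auto
  then have l1: "lo \<le> Min R - 1" using bd(1) by linarith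
  have "Max R \<noteq> hi" using bd(6) assms(2) by auto
  then have h1: "Max R + 1 \<le> hi" using bd(5) by linarith
  have "Min R - 1 \<notin> R" using Min_le[OF fin, of "Min R - 1"] by auto
  then have "idx jumps (Min R - 1) \<noteq> k" using l1 bd(2) by (auto simp: R_def)
  then have i1: "idx jumps (Min R - 1) = k - 1"
    using idx_Suc[OF l1, of jumps] bd(3) by (auto simp: of_bool_def split: if_splits)
  have "Max R + 1 \<notin> R" using Max_ge[OF fin, of "Max R + 1"] by auto
  then have "idx jumps (Max R + 1) \<noteq> k" using h1 bd(4) by (auto simp: R_def)
  then have i2: "idx jumps (Max R + 1) = k + 1"
    using idx_Suc[OF bd(4), of jumps] bd(6) by (auto simp: of_bool_def split: if_splits)
  show thesis
  proof (rule that[of "Min R - 1" "Max R + 1"])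
    fix z assume "Min R - 1 < z" "z < Max R + 1"
    then have "Min R \<le> z" "z \<le> Max R" by auto
    then show "idx jumps z = k"
      using idx_mono[of "Min R" z jumps] idx_mono[of z "Max R" jumps] bd by simp
  qed (use l1 h1 i1 i2 le in auto)
qed

lemma run_length_interval:
  assumes "lo \<le> x" "y \<le> hi" "x + 1 < y" "idx jumps x < k" "k < idx jumps y"
    "\<And>z. x < z \<Longrightarrow> z < y \<Longrightarrow> idx jumps z = k"
  shows "even (run_length k) \<longleftrightarrow> even (y - x - 1)"
proof -
  have "{z. lo \<le> z \<and> z \<le> hi \<and> idx jumps z = k} = {x<..<y}"
  proof (intro equalityI subsetI)
    fix z assume z: "z \<in> {z. lo \<le> z \<and> z \<le> hi \<and> idx jumps z = k}"
    show "z \<in> {x<..<y}" using idx_mono[of z x jumps] idx_mono[of y z jumps] z assms(4,5)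
      by (metis (mono_tags, lifting) greaterThanLessThan_iff mem_Collect_eq not_le)
  qed (use assms in auto)
  then have "int (run_length k) = y - x - 1" using assms(3) by (simp add: run_length_def)
  moreover have "even (run_length k) \<longleftrightarrow> even (int (run_length k))" by simp
  ultimately show ?thesis by (simp only:)
qed

text \<open>An inner run of the bottom word is the interval of columns between two jumps, and the
  letters before and after it are the values in the adjacent columns. Neighbouring letters have
  opposite parities, so an odd run ends where the values become even.\<close>

lemma bottom_admissible_iff:
  assumes "c \<in> configs box"
  shows "bottom_admissible c \<longleftrightarrow> (\<forall>x. lo \<le> x \<longrightarrow> x \<le> hi \<longrightarrow> - 1 \<le> c (0, x)) \<and> bottom_turning c"
proof -
  obtain f where "rep jumps (\<lambda>y. card (extensions y)) f" "\<And>y. finite (extensions y)"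
    using extensions_rep by blast
  from bottom_word[OF this assms] obtain w where w: "w \<in> walks runs" "c \<in> extensions (lift jumps w)" by blast
  let ?i = "idx jumps"
  have len: "length w = runs" and wk: "walk w" using w(1) by (auto simp: walks_def)
  have c: "c (0, x) = w ! ?i x" if "lo \<le> x" "x \<le> hi" for x
    using extensions_row[OF w(2), of x] that by (simp add: lift_def)
  have ib: "?i x < length w" if "x \<le> hi" for x using idx_mono[OF that, of jumps] len by simp
  have step: "even (w ! k) \<longleftrightarrow> odd (w ! Suc k)" if "Suc k < length w" for k
  proof -
    define u v where "u = w ! k" and "v = w ! Suc k"
    have "\<bar>u - v\<bar> = 1" using walk_nth[OF wk that] by (simp add: u_def v_def)
    then have "u = v + 1 \<or> v = u + 1" by arith
    then show ?thesis unfolding u_def[symmetric] v_def[symmetric] by auto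
  qed
  have 1: "(\<forall>v\<in>set w. - 1 \<le> v) \<longleftrightarrow> (\<forall>x. lo \<le> x \<longrightarrow> x \<le> hi \<longrightarrow> - 1 \<le> c (0, x))"
  proof
    assume a: "\<forall>x. lo \<le> x \<longrightarrow> x \<le> hi \<longrightarrow> - 1 \<le> c (0, x)"
    show "\<forall>v\<in>set w. - 1 \<le> v"
    proof
      fix v assume "v \<in> set w"
      then obtain k where k: "k < runs" "v = w ! k" using len by (auto simp: in_set_conv_nth)
      obtain x where "lo \<le> x" "x \<le> hi" "?i x = k" using word_at[OF w(1) k(1)] by blast
      then show "- 1 \<le> v" using a c[of x] k by auto
    qed
  qed (use c ib in auto)
  have 2: "(\<forall>k. 0 < k \<and> k + 1 < length w \<and> 1 \<le> w ! k \<and> odd (w ! k) \<longrightarrow>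
        (even (run_length k) \<longleftrightarrow> w ! (k - 1) = w ! (k + 1))) \<longleftrightarrow> bottom_turning c" (is "?L \<longleftrightarrow> _")
  proof
    assume t: "bottom_turning c"
    show ?L
    proof (intro allI impI, elim conjE)
      fix k assume k: "0 < k" "k + 1 < length w" "1 \<le> w ! k" "odd (w ! k)"
      then have "k + 1 < runs" by (simp only: len)
      from run_interval[OF k(1) this] obtain x y where xy: "lo \<le> x" "y \<le> hi" "x + 1 < y" "?i x = k - 1" "?i y = k + 1"
        "\<And>z. x < z \<Longrightarrow> z < y \<Longrightarrow> ?i z = k" by blast
      have cx: "c (0, x) = w ! (k - 1)" "c (0, y) = w ! (k + 1)" using c[of x] c[of y] xy by auto
      have cz: "c (0, z) = w ! k" if "x < z" "z < y" for z using c[of z] xy(1,2) xy(6)[OF that] that by auto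
      have ev: "even (w ! (k - 1))" "even (w ! (k + 1))" using step[of "k - 1"] step[of k] k by auto
      have "even (y - x - 1) \<longleftrightarrow> c (0, x) = c (0, y)"
        using t[unfolded bottom_turning_def, rule_format, of x y] xy(1-3) ev cx cz k(3,4) by auto
      moreover have "even (run_length k) \<longleftrightarrow> even (y - x - 1)"
        by (rule run_length_interval[OF xy(1-3) _ _ xy(6)]) (use xy k in auto)
      ultimately show "even (run_length k) \<longleftrightarrow> w ! (k - 1) = w ! (k + 1)" using cx by simp
    qed
  next
    assume L: ?L
    show "bottom_turning c" unfolding bottom_turning_def
    proof (intro allI impI, elim conjE)
      fix x y assume xy: "lo \<le> x" "y \<le> hi" "x + 1 < y" "even (c (0, x))" "even (c (0, y))"
        and mid: "\<forall>z. x < z \<and> z < y \<longrightarrow> odd (c (0, z)) \<and> 0 < c (0, z)"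
      define k where "k = ?i (x + 1)"
      have jump: "?i (z + 1) = ?i z \<and> c (0, z + 1) = c (0, z) \<or> ?i (z + 1) = Suc (?i z) \<and> (even (c (0, z)) \<longleftrightarrow> odd (c (0, z + 1)))"
        if "lo \<le> z" "z < hi" for z
      proof (cases "jumps z")
        case True
        then have i: "?i (z + 1) = Suc (?i z)" using idx_Suc[OF that(1), of jumps] by simp
        then show ?thesis using step[of "?i z"] ib[of "z + 1"] that c[of z] c[of "z + 1"] by auto
      next
        case False
        then have i: "?i (z + 1) = ?i z" using idx_Suc[OF that(1), of jumps] by simp
        then show ?thesis using that c[of z] c[of "z + 1"] by auto
      qed
      have ik: "?i z = k" if "x + 1 \<le> z" "z < y" for z using that
      proof (induction z rule: int_ge_induct)
        case (step z)
        have "odd (c (0, z))" "odd (c (0, z + 1))" using mid[rule_format, of z] mid[rule_format, of "z + 1"] step by auto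
        then show ?case using jump[of z] step xy(1,2) by auto
      qed (simp add: k_def)
      have "odd (c (0, x + 1))" "odd (c (0, y - 1))" "0 < c (0, x + 1)"
        using mid[rule_format, of "x + 1"] mid[rule_format, of "y - 1"] xy(3) by auto
      moreover have "?i (y - 1) = k" using ik[of "y - 1"] xy(3) by simp
      ultimately have i: "k = Suc (?i x)" "?i y = Suc k"
        using jump[of x] jump[of "y - 1"] xy by (auto simp: k_def)
      have kb: "k + 1 < length w" using ib[of y] xy(2) i(2) by simp
      have ck: "c (0, x + 1) = w ! k" using c[of "x + 1"] xy by (simp add: k_def)
      have "even (run_length k) \<longleftrightarrow> w ! (k - 1) = w ! (k + 1)"
        using L[rule_format, of k] i(1) kb ck \<open>odd (c (0, x + 1))\<close> \<open>0 < c (0, x + 1)\<close> by auto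
      moreover have "even (run_length k) \<longleftrightarrow> even (y - x - 1)"
        by (rule run_length_interval) (use xy i ik in auto)
      moreover have "c (0, x) = w ! (k - 1)" "c (0, y) = w ! (k + 1)" using c[of x] c[of y] i xy by auto
      ultimately show "even (y - x - 1) \<longleftrightarrow> c (0, x) = c (0, y)" by simp
    qed
  qed
  have "bottom_admissible c \<longleftrightarrow> admissible run_length w" by (rule bottom_admissible_word[OF w])
  then show ?thesis unfolding admissible_def 1 2 .
qed

end

section \<open>The signed sum over pairs of families\<close>

context family_pairs
begin

definition row_matched :: "family \<times> family \<Rightarrow> bool" where
  "row_matched p \<longleftrightarrow> tuple_pair.matched l (fst p 0) (snd p 0)"

definition row_good :: "family \<times> family \<Rightarrow> bool" where
  "row_good p \<longleftrightarrow> (\<forall>x. \<bar>pos_charge l (fst p 0) (snd p 0) x\<bar> \<le> 1)"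

lemma row_pair: "p \<in> pairs \<Longrightarrow> tuple_pair l (fst p 0) (snd p 0)"
  using pair_tuples[of p 0] by unfold_locales auto

lemma boxed_configs: "p \<in> pairs \<Longrightarrow> boxed (gap p) \<in> strip_heights.configs n (total p) crown (strip_heights.box (- M) M n)"
  using boxed_bij[of p] unfolding bij_betw_def by (auto simp: same_total_def)

lemma pair_cover_gap:
  assumes "p \<in> pairs"
  shows "pos_cover l (fst p 0) (snd p 0) x = gap p (0, x) + 1" and "x \<le> - M \<or> M \<le> x \<Longrightarrow> gap p (0, x) = - 1"
    and "boxed (gap p) (0, x) = (if - M \<le> x \<and> x \<le> M then gap p (0, x) else 0)"
  using gap_left[OF assms, of "(0, x)"] gap_right[OF assms, of "(0, x)"]
  by (auto simp: pos_cover_def gap_def boxed_def)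

text \<open>\<open>matched_iff\<close> translated by cover = gap + 1: even cover is odd height, and
  nonnegative cover is height at least -1.\<close>

lemma row_matched_iff:
  assumes p: "p \<in> pairs"
  shows "row_matched p \<longleftrightarrow> row_good p \<and> strip_heights.bottom_admissible (- M) M (total p) (boxed (gap p))"
proof -
  interpret strip_heights "- M" M n "total p" crown by (rule strip[OF p])
  interpret rp: tuple_pair l "fst p 0" "snd p 0" by (rule row_pair[OF p])
  note g = pair_cover_gap[OF p]
  have cov: "rp.cover x = gap p (0, x) + 1" for x using g(1)[of x] by (simp add: rp.cover_def pos_cover_def)
  have gd: "rp.good \<longleftrightarrow> row_good p" by (simp add: rp.good_def row_good_def rp.charge_def pos_charge_def)
  have pos: "(\<forall>x. 0 \<le> rp.cover x) \<longleftrightarrow> (\<forall>x. - M \<le> x \<longrightarrow> x \<le> M \<longrightarrow> - 1 \<le> boxed (gap p) (0, x))"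
  proof
    assume a: "\<forall>x. - M \<le> x \<longrightarrow> x \<le> M \<longrightarrow> - 1 \<le> boxed (gap p) (0, x)"
    show "\<forall>x. 0 \<le> rp.cover x"
    proof
      fix x
      show "0 \<le> rp.cover x"
        using a[rule_format, of x] g(2,3)[of x] cov[of x] by (cases "- M \<le> x \<and> x \<le> M") auto
    qed
  next
    assume a: "\<forall>x. 0 \<le> rp.cover x"
    show "\<forall>x. - M \<le> x \<longrightarrow> x \<le> M \<longrightarrow> - 1 \<le> boxed (gap p) (0, x)"
    proof (intro allI impI)
      fix x assume "- M \<le> x" "x \<le> M"
      then show "- 1 \<le> boxed (gap p) (0, x)" using a[rule_format, of x] g(3)[of x] cov[of x] by simp
    qed
  qed
  have "rp.turning \<longleftrightarrow> bottom_turning (boxed (gap p))" unfolding rp.turning_def bottom_turning_def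
  proof (intro iff_allI)
    fix x y
    \<comment> \<open>At the border and outside the box the gap is -1 and the cover 0, so end points
      of odd cover lie inside.\<close>
    have z1: "odd (rp.cover z) \<Longrightarrow> - M \<le> z \<and> z \<le> M" for z
    proof (rule ccontr)
      assume "odd (rp.cover z)" "\<not> (- M \<le> z \<and> z \<le> M)"
      then have "gap p (0, z) = - 1" by (intro g(2)) auto
      then show False using \<open>odd (rp.cover z)\<close> cov[of z] by simp
    qed
    have bx: "boxed (gap p) (0, z) = rp.cover z - 1" if "- M \<le> z" "z \<le> M" for z
      using g(3)[of z] cov[of z] that by simp
    show "(x + 1 < y \<and> odd (rp.cover x) \<and> odd (rp.cover y) \<and> (\<forall>z. x < z \<and> z < y \<longrightarrow> even (rp.cover z) \<and> 0 < rp.cover z) \<longrightarrow>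
        even (y - x - 1) = (rp.cover x = rp.cover y)) \<longleftrightarrow>
      (- M \<le> x \<and> y \<le> M \<and> x + 1 < y \<and> even (boxed (gap p) (0, x)) \<and> even (boxed (gap p) (0, y)) \<and>
        (\<forall>z. x < z \<and> z < y \<longrightarrow> odd (boxed (gap p) (0, z)) \<and> 0 < boxed (gap p) (0, z)) \<longrightarrow>
        even (y - x - 1) = (boxed (gap p) (0, x) = boxed (gap p) (0, y)))" (is "?A \<longleftrightarrow> ?B")
    proof (cases "- M \<le> x \<and> y \<le> M \<and> x + 1 < y")
      case True
      have "(\<forall>z. x < z \<and> z < y \<longrightarrow> even (rp.cover z) \<and> 0 < rp.cover z) \<longleftrightarrow>
        (\<forall>z. x < z \<and> z < y \<longrightarrow> odd (boxed (gap p) (0, z)) \<and> 0 < boxed (gap p) (0, z))"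
      proof (intro iff_allI imp_cong refl)
        fix z assume "x < z \<and> z < y"
        then have "boxed (gap p) (0, z) = rp.cover z - 1" using bx[of z] True by simp
        then show "even (rp.cover z) \<and> 0 < rp.cover z \<longleftrightarrow> odd (boxed (gap p) (0, z)) \<and> 0 < boxed (gap p) (0, z)"
          by (cases "rp.cover z = 1") auto
      qed
      moreover have "boxed (gap p) (0, x) = rp.cover x - 1" "boxed (gap p) (0, y) = rp.cover y - 1"
        using bx[of x] bx[of y] True by auto
      ultimately show ?thesis using True by simp
    next
      case False
      then show ?thesis using z1[of x] z1[of y] by blast
    qed
  qed
  then show ?thesis
    unfolding row_matched_def rp.matched_iff bottom_admissible_iff[OF boxed_configs[OF p]] gd pos by simp
qed

text \<open>The charge is 0 on the far right, and by \<open>charge_step\<close> each of its steps is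
  determined by the drop of the total.\<close>

lemma row_good_total:
  assumes "p \<in> pairs" "q \<in> pairs" "same_total p q"
  shows "row_good p \<longleftrightarrow> row_good q"
proof -
  have charge_down: "pos_charge l (fst p 0) (snd p 0) x = pos_charge l (fst p 0) (snd p 0) (x + 1) + sgp (x + 1) * (total p (0, x) - total p (0, x + 1))"
    if "p \<in> pairs" for p x
  proof -
    interpret rp: tuple_pair l "fst p 0" "snd p 0" by (rule row_pair[OF that])
    have ch: "rp.charge x = pos_charge l (fst p 0) (snd p 0) x" for x by (simp add: rp.charge_def pos_charge_def)
    show ?thesis using rp.charge_step[of x] unfolding ch total_def by (simp add: algebra_simps)
  qed
  have right: "pos_charge l (fst p 0) (snd p 0) x = 0" if "p \<in> pairs" "M \<le> x" for p x unfolding pos_charge_def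
  proof (rule sum.neutral, intro ballI)
    fix i assume "i \<in> {1..l}"
    from pair_bounds[OF that(1) _ this, of 0] that(2)
    show "of_bool (x < fst p 0 i) * sgp (fst p 0 i) + of_bool (x < snd p 0 i) * sgp (snd p 0 i) = 0" by simp
  qed
  have eq: "pos_charge l (fst p 0) (snd p 0) x = pos_charge l (fst q 0) (snd q 0) x" for x
  proof (cases "M \<le> x")
    case True
    then show ?thesis using right assms by simp
  next
    case False
    then have "x \<le> M" by simp
    then show ?thesis
    proof (induction x rule: int_le_induct)
      case base
      then show ?case using right assms by simp
    next
      case (step x)
      then show ?case using charge_down[OF assms(1), of "x - 1"] charge_down[OF assms(2), of "x - 1"] assms(3)
        by (simp add: same_total_def)
    qed
  qed
  show ?thesis unfolding row_good_def eq ..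
qed

text \<open>The cover is the height plus 1, so its bounds say that the height is at most 1 in
  absolute value, and the sign in \<open>hop_value\<close> counts the points of height 1, as
  \<open>bottom_sign\<close> does.\<close>

lemma minor_hop_sign:
  assumes p: "p \<in> pairs"
  shows "minor l hop (fst p 0) (snd p 0) = (if row_good p
    then strip_heights.bottom_sign (boxed (gap p)) else 0)"
proof -
  interpret strip_heights "- M" M n "total p" crown by (rule strip[OF p])
  note g = pair_cover_gap[OF p]
  have bx: "\<bar>boxed (gap p) (0, x)\<bar> \<le> 1 \<longleftrightarrow> \<bar>pos_cover l (fst p 0) (snd p 0) x - 1\<bar> \<le> 1"
    "boxed (gap p) (0, x) = 1 \<longleftrightarrow> pos_cover l (fst p 0) (snd p 0) x = 2" for x
    using g(1-3)[of x] by (cases "- M \<le> x \<and> x \<le> M"; force)+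
  have "decreasing l (fst p 0)" "decreasing l (snd p 0)"
    using pair_tuples[OF p, of 0] by (auto simp: tuples_def decreasing_def)
  then have "minor l hop (fst p 0) (snd p 0) = hop_value l (fst p 0) (snd p 0)" by (rule minor_hop)
  then show ?thesis unfolding hop_value_def bottom_sign_def bx row_good_def by (simp add: all_conj_distrib)
qed

lemma finite_pairs: "finite pairs"
  by (simp add: finite_families)

text \<open>The pairs are grouped by their total. On a class the weight and \<open>row_good\<close>
  are constant, the members correspond to the height functions for this total by
  \<open>boxed_bij\<close>, and \<open>signed_count\<close> evaluates the remaining signed
  sum.\<close>

theorem sum_pairs:
  fixes W :: "family \<times> family \<Rightarrow> 'r::comm_ring_1"
  assumes W: "\<And>p q. p \<in> pairs \<Longrightarrow> q \<in> pairs \<Longrightarrow> same_total p q \<Longrightarrow> W p = W q"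
  shows "(\<Sum>p\<in>pairs. W p * of_int (minor l hop (fst p 0) (snd p 0)))
    = (\<Sum>p | p \<in> pairs \<and> row_matched p \<and> \<not> odd_neg_region n (gap p). W p)"
proof -
  define key where "key p = (\<lambda>t. if fst t \<le> n then total p t else 0)" for p
  have key: "key p = key q \<longleftrightarrow> same_total p q" for p q
  proof
    assume eq: "key p = key q"
    show "same_total p q" unfolding same_total_def
    proof (intro allI impI)
      fix r x assume "r \<le> n"
      then show "total p (r, x) = total q (r, x)" using fun_cong[OF eq, of "(r, x)"] by (simp add: key_def)
    qed
  qed (auto simp: key_def same_total_def fun_eq_iff)
  let ?P = "\<lambda>p. row_matched p \<and> \<not> odd_neg_region n (gap p)"
  have cls: "(\<Sum>p | p \<in> pairs \<and> key p = y. W p * of_int (minor l hop (fst p 0) (snd p 0)))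
    = (\<Sum>p | p \<in> pairs \<and> key p = y. if ?P p then W p else 0)" if y: "y \<in> key ` pairs" for y
  proof -
    obtain p0 where p0: "p0 \<in> pairs" "y = key p0" using imageE[OF y] by metis
    define C where "C = {p \<in> pairs. same_total p p0}"
    have C: "{p. p \<in> pairs \<and> key p = y} = C" unfolding C_def p0(2) key by simp
    have finC: "finite C" using finite_pairs unfolding C_def by simp
    interpret strip_heights "- M" M n "total p0" crown by (rule strip[OF p0(1)])
    have bij: "bij_betw (\<lambda>p. boxed (gap p)) C (configs box)" using boxed_bij[OF p0(1)] by (simp add: C_def)
    have Wc: "W p = W p0" if "p \<in> C" for p using W[of p p0] that p0 by (simp add: C_def)
    have gc: "row_good p \<longleftrightarrow> row_good p0" if "p \<in> C" for p using row_good_total[of p p0] that p0 by (simp add: C_def)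
    have Pc: "?P p \<longleftrightarrow> row_good p0 \<and> bottom_admissible (boxed (gap p)) \<and> \<not> odd_region (boxed (gap p))" if p: "p \<in> C" for p
    proof -
      have pp: "p \<in> pairs" "same_total p p0" using p by (auto simp: C_def)
      have "strip_heights.bottom_admissible (- M) M (total p) (boxed (gap p)) \<longleftrightarrow> bottom_admissible (boxed (gap p))"
      proof -
        interpret q: strip_heights "- M" M n "total p" crown by (rule strip[OF pp(1)])
        have "boxed (gap p) \<in> configs box" using bij p by (auto simp: bij_betw_def)
        then show ?thesis
          using q.bottom_admissible_iff[OF boxed_configs[OF pp(1)]] bottom_admissible_iff[of "boxed (gap p)"]
          by (simp add: q.bottom_turning_def bottom_turning_def)
      qed
      then show ?thesis unfolding row_matched_iff[OF pp(1)] odd_region_boxed[OF pp(1), symmetric] gc[OF p] by simp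
    qed
    have "(\<Sum>p\<in>C. W p * of_int (minor l hop (fst p 0) (snd p 0)))
      = (\<Sum>p\<in>C. W p0 * of_int (if row_good p0 then bottom_sign (boxed (gap p)) else 0))"
    proof (rule sum.cong[OF refl])
      fix p assume p: "p \<in> C"
      then have "p \<in> pairs" by (simp add: C_def)
      then show "W p * of_int (minor l hop (fst p 0) (snd p 0)) = W p0 * of_int (if row_good p0 then bottom_sign (boxed (gap p)) else 0)"
        by (simp only: minor_hop_sign[OF \<open>p \<in> pairs\<close>] Wc[OF p] gc[OF p])
    qed
    also have "\<dots> = W p0 * of_int (\<Sum>p\<in>C. if row_good p0 then bottom_sign (boxed (gap p)) else 0)"
      by (simp add: sum_distrib_left)
    also have "(\<Sum>p\<in>C. if row_good p0 then bottom_sign (boxed (gap p)) else 0)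
      = (if row_good p0 then int (card {c \<in> configs box. bottom_admissible c \<and> \<not> odd_region c}) else 0)"
      using sum.reindex_bij_betw[OF bij, of bottom_sign] signed_count(1) by simp
    also have "\<dots> = int (card {p \<in> C. ?P p})"
    proof (cases "row_good p0")
      case True
      have "bij_betw (\<lambda>p. boxed (gap p)) {p \<in> C. ?P p} {c \<in> configs box. bottom_admissible c \<and> \<not> odd_region c}"
        using bij Pc True unfolding bij_betw_def inj_on_def by blast
      then show ?thesis using True by (simp add: bij_betw_same_card)
    next
      case False
      then have "{p \<in> C. ?P p} = {}" using Pc by blast
      then show ?thesis unfolding if_not_P[OF False] by (simp only: card.empty of_nat_0)
    qed
    also have "W p0 * of_int (int (card {p \<in> C. ?P p})) = (\<Sum>p\<in>{p \<in> C. ?P p}. W p0)"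
      by (simp add: mult.commute)
    also have "\<dots> = (\<Sum>p\<in>{p \<in> C. ?P p}. W p)"
      by (rule sum.cong[OF refl]) (metis (no_types, lifting) Wc mem_Collect_eq)
    also have "\<dots> = (\<Sum>p\<in>C. if ?P p then W p else 0)" by (rule sum.inter_filter[OF finC])
    finally show ?thesis unfolding C .
  qed
  have "(\<Sum>p\<in>pairs. W p * of_int (minor l hop (fst p 0) (snd p 0)))
    = (\<Sum>y\<in>key ` pairs. \<Sum>p | p \<in> pairs \<and> key p = y. W p * of_int (minor l hop (fst p 0) (snd p 0)))"
    by (rule sum.image_gen[OF finite_pairs])
  also have "\<dots> = (\<Sum>y\<in>key ` pairs. \<Sum>p | p \<in> pairs \<and> key p = y. if ?P p then W p else 0)"
    by (rule sum.cong[OF refl cls])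
  also have "\<dots> = (\<Sum>p\<in>pairs. if ?P p then W p else 0)" by (rule sum.image_gen[OF finite_pairs, symmetric])
  also have "\<dots> = (\<Sum>p | p \<in> pairs \<and> ?P p. W p)" by (rule sum.inter_filter[OF finite_pairs, symmetric])
  finally show ?thesis .
qed

end

section \<open>Weights and series\<close>

text \<open>A multiplicative antiderivative of \<open>e\<close> and its inverse: finite products to
  the right of 0 and products of inverses to the left. It turns a product over steps into a product
  over vertices.\<close>

lemma ex_potential:
  fixes e :: "int \<Rightarrow> 'r::comm_ring_1"
  assumes "\<And>x. e x dvd 1"
  shows "\<exists>f f'. \<forall>x. f x * f' x = 1 \<and> f (x + 1) = e x * f x \<and> f' x = e x * f' (x + 1)"
proof -
  have "\<forall>x. \<exists>y. e x * y = 1" using assms by (metis dvdE)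
  then obtain e' where e': "\<And>x. e x * e' x = 1" by metis
  define P where "P g g' x = (if 0 \<le> x then \<Prod>k\<in>{0..<x}. g k else \<Prod>k\<in>{x..<0}. g' k)" for g g' :: "int \<Rightarrow> 'r" and x
  have up: "P g g' (x + 1) = g x * P g g' x" if "0 \<le> x" for g g' x
  proof -
    have "{0..<x + 1} = insert x {0..<x}" using that by auto
    then show ?thesis using that by (simp add: P_def)
  qed
  have down: "P g g' x = g' x * P g g' (x + 1)" if "x < 0" for g g' x
  proof -
    have "{x..<0} = insert x {x + 1..<0}" using that by auto
    then show ?thesis using that by (cases "x = -1") (auto simp: P_def)
  qed
  have "P e e' x * P e' e x = 1" for x by (simp add: P_def prod.distrib[symmetric] e' mult.commute[of "e' _"])
  moreover have "P e e' (x + 1) = e x * P e e' x" for x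
    using up[of x e e'] down[of x e e'] e'[of x] by (cases "0 \<le> x") (auto simp: mult.assoc[symmetric])
  moreover have "P e' e x = e x * P e' e (x + 1)" for x
    using up[of x e' e] down[of x e' e] e'[of x] by (cases "0 \<le> x") (auto simp: mult.assoc[symmetric])
  ultimately show ?thesis by blast
qed

text \<open>Even and odd integers form two independent chains. The step 2 suits the middle factor,
  where E-steps come in pairs.\<close>

lemma ex_potential_two:
  fixes e :: "int \<Rightarrow> 'r::comm_ring_1"
  assumes "\<And>x. e x dvd 1"
  shows "\<exists>f f'. \<forall>x. f x * f' x = 1 \<and> f (x + 2) = e x * f x \<and> f' x = e x * f' (x + 2)"
proof -
  obtain f f' where f: "\<And>x. f x * f' x = 1" "\<And>x. f (x + 1) = e (2 * x) * f x" "\<And>x. f' x = e (2 * x) * f' (x + 1)"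
    using ex_potential[of "\<lambda>x. e (2 * x)"] assms by blast
  obtain g g' where g: "\<And>x. g x * g' x = 1" "\<And>x. g (x + 1) = e (2 * x + 1) * g x" "\<And>x. g' x = e (2 * x + 1) * g' (x + 1)"
    using ex_potential[of "\<lambda>x. e (2 * x + 1)"] assms by blast
  define h h' where "h x = (if even x then f (x div 2) else g (x div 2))"
    and "h' x = (if even x then f' (x div 2) else g' (x div 2))" for x :: int
  have "h x * h' x = 1 \<and> h (x + 2) = e x * h x \<and> h' x = e x * h' (x + 2)" for x
  proof (cases "even x")
    case True
    then have "2 * (x div 2) = x" by simp
    then show ?thesis using f(1,2)[of "x div 2"] f(3)[of "x div 2"] True by (simp add: h_def h'_def)
  next
    case False
    then have "2 * (x div 2) + 1 = x" by simp
    then show ?thesis using g(1,2)[of "x div 2"] g(3)[of "x div 2"] False by (simp add: h_def h'_def)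
  qed
  then show ?thesis by blast
qed

text \<open>\<open>f\<close> and \<open>g\<close> grow by the same ratios and \<open>g\<close> is
  invertible, so their quotient is constant.\<close>

lemma unit_ratio:
  fixes f g g' :: "int \<Rightarrow> 'r::comm_ring_1"
  assumes g: "\<And>x. g x * g' x = 1" and step: "\<And>x. f (x + 1) * g x = f x * g (x + 1)"
  shows "f x = f 0 * g' 0 * g x"
proof -
  define c where "c x = f x * g' x" for x
  have cs: "c (x + 1) = c x" for x
  proof -
    have "c (x + 1) = f (x + 1) * g' (x + 1) * (g x * g' x)" by (simp add: g c_def)
    also have "\<dots> = (f (x + 1) * g x) * g' (x + 1) * g' x" by (simp only: ac_simps)
    also have "\<dots> = f x * g' x * (g (x + 1) * g' (x + 1))" unfolding step by (simp only: ac_simps)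
    finally show ?thesis by (simp add: g c_def)
  qed
  have "c x = c 0"
  proof (induction x rule: int_induct[of _ 0])
    case (step2 i)
    then show ?case using cs[of "i - 1"] by simp
  qed (simp_all add: cs)
  then have "f x * g' x * g x = f 0 * g' 0 * g x" by (simp add: c_def)
  moreover have "f x * g' x * g x = f x" using g[of x] by (simp add: mult.assoc mult.commute[of "g' x"])
  ultimately show ?thesis by simp
qed

section \<open>Coefficients of skew series as kernels\<close>

lemma skew_nth_add: "skew_nth (f + g) k = skew_nth f k + skew_nth g k"
  by (simp add: skew_nth_simps)

lemma skew_nth_mult: "skew_nth (f * g) k = (\<Sum>i=0..k. skew_nth f i * (zshift ^^ i) (skew_nth g (k - i)))"
  by (simp add: skew_nth_simps)

lemma skew_nth_const_mult: "skew_nth (skew_const x * g) k = x * skew_nth g k"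
proof -
  have "skew_nth (skew_const x * g) k = (\<Sum>i=0..k. if i = 0 then x * skew_nth g k else 0)"
    unfolding skew_nth_mult by (rule sum.cong) (auto simp: skew_const_def)
  then show ?thesis by simp
qed

lemma skew_nth_X_mult: "skew_nth (skew_X * g) k = (if k = 0 then 0 else zshift (skew_nth g (k - 1)))"
proof -
  have "skew_nth (skew_X * g) k = (\<Sum>i=0..k. if i = 1 then zshift (skew_nth g (k - 1)) else 0)"
    unfolding skew_nth_mult by (rule sum.cong) (auto simp: skew_X_def)
  then show ?thesis by simp
qed

lemma skew_nth_mult_const: "skew_nth (f * skew_const x) k = skew_nth f k * (zshift ^^ k) x"
proof -
  have "skew_nth (f * skew_const x) k = (\<Sum>i=0..k. if i = k then skew_nth f k * (zshift ^^ k) x else 0)"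
    unfolding skew_nth_mult by (rule sum.cong) (auto simp: skew_const_def zshift_pow_0)
  then show ?thesis by simp
qed

lemma skew_nth_mult_X: "skew_nth (f * skew_X) k = (if k = 0 then 0 else skew_nth f (k - 1))"
proof (cases k)
  case (Suc m)
  have "skew_nth (f * skew_X) k = (\<Sum>i=0..k. if i = m then skew_nth f m else 0)" unfolding skew_nth_mult
  proof (rule sum.cong[OF refl])
    fix i assume "i \<in> {0..k}"
    then show "skew_nth f i * (zshift ^^ i) (skew_nth skew_X (k - i)) = (if i = m then skew_nth f m else 0)"
      using Suc by (cases "i = m") (auto simp: skew_X_def zshift_pow_0 zshift_pow_1)
  qed
  then show ?thesis using Suc by simp
qed (simp add: skew_nth_mult skew_X_def zshift_pow_0)

lemma zshift_pow_zgen: "(zshift ^^ k) (zgen i b) = zgen i (b - 2 * of_nat k)"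
  by (induction k) (simp_all add: zshift_zgen algebra_simps)

lemma zshift_prod: "zshift (prod f A) = (\<Prod>i\<in>A. zshift (f i))"
  by (induction A rule: infinite_finite_induct) (simp_all add: zshift_1 zshift_mult)

definition linear_factor :: "letter \<Rightarrow> complex \<Rightarrow> 'n::finite skew_series" where
  "linear_factor i b = 1 + skew_const (zgen i b) * skew_X"

definition middle :: "complex \<Rightarrow> 'n::finite skew_series" where
  "middle b = skew_inverse (1 - skew_const (zgen (Barred CARD('n)) b) * skew_X
                         * skew_const (zgen (Unbarred CARD('n)) b) * skew_X)"

text \<open>The matrix of a series: its coefficient for \<open>t - s\<close> steps when started at
  \<open>s\<close>. Moving the start by 1 shifts the parameter by -2, which is conjugation by X;
  \<open>equivariant\<close> says that the series respects this.\<close>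

definition kernel :: "complex \<Rightarrow> (complex \<Rightarrow> 'n::finite skew_series) \<Rightarrow> int \<Rightarrow> int \<Rightarrow> 'n zring" where
  "kernel a f s t = (if t < s then 0 else skew_nth (f (a - 2 * of_int s)) (nat (t - s)))"

definition equivariant :: "(complex \<Rightarrow> 'n::finite skew_series) \<Rightarrow> bool" where
  "equivariant f \<longleftrightarrow> (\<forall>b k. zshift (skew_nth (f b) k) = skew_nth (f (b - 2)) k)"

text \<open>A linear factor on the right contributes either 1 or its linear term, which is the last
  step, from \<open>t - 1\<close> to \<open>t\<close>.\<close>

lemma kernel_mult_linear:
  fixes f :: "complex \<Rightarrow> 'a::finite skew_series"
  shows "kernel a (\<lambda>b. f b * linear_factor i b) s t = kernel a f s t + zgen i (a - 2 * of_int (t - 1)) * kernel a f s (t - 1)"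
proof (cases "s < t")
  case True
  define m where "m = nat (t - 1 - s)"
  have m: "nat (t - s) = Suc m" "int m = t - 1 - s" using True by (auto simp: m_def)
  have e: "of_nat m = (of_int (t - 1 - s) :: complex)" unfolding m(2)[symmetric] by simp
  have "a - 2 * of_int s - 2 * of_nat m = a - 2 * of_int (t - 1)" unfolding e by (simp add: algebra_simps)
  then have "x * zgen i (a - 2 * of_int s - 2 * of_nat m) = zgen i (a - 2 * of_int (t - 1)) * x" for x :: "'a zring"
    by (simp only: mult.commute)
  then show ?thesis
    using True m(1) by (simp add: kernel_def linear_factor_def distrib_left mult.assoc[symmetric] skew_nth_add
        skew_nth_mult_X skew_nth_mult_const zshift_pow_zgen m_def[symmetric])
qed (auto simp: kernel_def linear_factor_def distrib_left mult.assoc[symmetric] skew_nth_add skew_nth_mult_X)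

text \<open>Here the linear term is the first step, from \<open>s\<close> to \<open>s + 1\<close>;
  moving X past the series uses equivariance.\<close>

lemma kernel_linear_mult:
  assumes "equivariant f"
  shows "kernel a (\<lambda>b. linear_factor i b * f b) s t = kernel a f s t + zgen i (a - 2 * of_int s) * kernel a f (s + 1) t"
proof (cases "s < t")
  case True
  define m where "m = nat (t - (s + 1))"
  have m: "nat (t - s) = Suc m" using True by (auto simp: m_def)
  have "f (a - 2 * of_int s - 2) = f (a - 2 * of_int (s + 1))" by (rule arg_cong[of _ _ f]) (simp add: algebra_simps)
  then show ?thesis
    using True m assms by (simp add: kernel_def linear_factor_def distrib_right mult.assoc skew_nth_add
        skew_nth_X_mult skew_nth_const_mult m_def[symmetric] equivariant_def)
qed (auto simp: kernel_def linear_factor_def distrib_right mult.assoc skew_nth_add skew_nth_X_mult skew_nth_const_mult)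

lemma equivariant_linear: "equivariant (linear_factor i :: _ \<Rightarrow> 'n::finite skew_series)"
proof -
  have "skew_nth (linear_factor i b :: 'n skew_series) k = (if k = 0 then 1 else if k = 1 then zgen i b else 0)" for b k
    by (simp add: linear_factor_def skew_nth_add skew_nth_const_mult one_skew_series_def skew_X_def)
  then show ?thesis by (simp add: equivariant_def zshift_0 zshift_1 zshift_zgen)
qed

lemma zshift_sum: "zshift (sum f A) = (\<Sum>i\<in>A. zshift (f i))"
  by (induction A rule: infinite_finite_induct) (simp_all add: zshift_0 zshift_add)

lemma equivariant_mult:
  assumes "equivariant f" "equivariant g"
  shows "equivariant (\<lambda>b. f b * g b)"
  using assms by (simp add: equivariant_def skew_nth_mult zshift_sum zshift_mult funpow_swap1)

text \<open>A geometric series whose ratio is barred times X times unbarred times X. Collecting X on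
  the right shifts the second generator by 2 and each further pair by 4. The explicit series
  \<open>N\<close> is a right inverse of the denominator, hence the inverse.\<close>

lemma middle_nth:
  "skew_nth (middle b :: 'n::finite skew_series) k = (if even k then \<Prod>j<k div 2.
     zgen (Barred CARD('n)) (b - 4 * of_nat j) * zgen (Unbarred CARD('n)) (b - 4 * of_nat j - 2) else 0)"
proof -
  define e :: "nat \<Rightarrow> 'n zring" where
    "e j = zgen (Barred CARD('n)) (b - 4 * of_nat j) * zgen (Unbarred CARD('n)) (b - 4 * of_nat j - 2)" for j
  have e: "zshift (zshift (e j)) = e (Suc j)" for j by (simp add: e_def zshift_mult zshift_zgen algebra_simps)
  define D :: "'n skew_series" where "D = 1 - skew_const (zgen (Barred CARD('n)) b) * skew_X
                         * skew_const (zgen (Unbarred CARD('n)) b) * skew_X"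
  define N :: "'n skew_series" where "N = Skew (\<lambda>k. if even k then \<Prod>j<k div 2. e j else 0)"
  have "D * N = 1"
  proof (rule skew_eqI)
    fix k
    have minus: "skew_nth (f - g) k = skew_nth f k - skew_nth g k" for f g :: "'n skew_series"
      by (simp add: skew_nth_simps)
    have 1: "skew_nth (D * N) k = skew_nth N k - zgen (Barred CARD('n)) b * (if k = 0 then 0 else
        zshift (zgen (Unbarred CARD('n)) b * (if k - 1 = 0 then 0 else zshift (skew_nth N (k - 1 - 1)))))"
      unfolding D_def left_diff_distrib mult.assoc minus skew_nth_const_mult skew_nth_X_mult mult_1 ..
    consider "k = 0" | "k = 1" | m where "k = Suc (Suc m)" by (metis One_nat_def not0_implies_Suc)
    then show "skew_nth (D * N) k = skew_nth 1 k"
    proof cases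
      case 3
      have "zshift (zshift (\<Prod>j<m div 2. e j)) = (\<Prod>j<m div 2. e (Suc j))" unfolding zshift_prod e ..
      moreover have "e 0 = zgen (Barred CARD('n)) b * zgen (Unbarred CARD('n)) (b - 2)" by (simp add: e_def)
      ultimately show ?thesis
        unfolding 1 using 3 by (simp add: N_def one_skew_series_def zshift_0 zshift_mult zshift_zgen
            prod.lessThan_Suc_shift del: prod.lessThan_Suc)
    qed (unfold 1, auto simp: N_def one_skew_series_def zshift_0)
  qed
  then have "middle b * (D * N) = middle b" by simp
  moreover have "middle b * D = 1" unfolding middle_def D_def by (rule skew_inverse(2)[OF E_series_denominator])
  ultimately have "middle b = N" by (simp add: mult.assoc[symmetric])
  then show ?thesis by (simp add: N_def e_def)
qed

lemma equivariant_middle: "equivariant middle"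
  by (simp add: equivariant_def middle_nth zshift_0 zshift_prod zshift_mult zshift_zgen algebra_simps)

definition east_weight :: "complex \<Rightarrow> int \<Rightarrow> int \<Rightarrow> 'n::finite zring" where
  "east_weight a s t = (\<Prod>j<nat ((t - s) div 2). zgen (Barred CARD('n)) (a - 2 * of_int (s + 2 * int j))
     * zgen (Unbarred CARD('n)) (a - 2 * of_int (s + 2 * int j + 1)))"

lemma kernel_middle: "kernel a middle s t = (if s \<le> t \<and> even (t - s) then east_weight a s t else 0)"
proof (cases "s \<le> t")
  case True
  have "even (nat (t - s)) \<longleftrightarrow> even (t - s)" using True by (simp add: even_nat_iff)
  moreover have "nat (t - s) div 2 = nat ((t - s) div 2)" using True by (simp add: nat_div_distrib)
  ultimately show ?thesis using True by (simp add: kernel_def middle_nth east_weight_def algebra_simps)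
qed (simp add: kernel_def)

text \<open>The \<open>r\<close> linear factors nearest to the middle. Rows are numbered from height
  0 outwards, so passing from row \<open>r\<close> to \<open>Suc r\<close> adds one factor on the
  outside.\<close>

definition left_series :: "nat \<Rightarrow> complex \<Rightarrow> 'n::finite skew_series" where
  "left_series r b = (\<Prod>i\<leftarrow>[Suc CARD('n) - r..<Suc CARD('n)]. linear_factor (Unbarred i) b) * middle b"

definition right_series :: "nat \<Rightarrow> complex \<Rightarrow> 'n::finite skew_series" where
  "right_series r b = left_series CARD('n) b * (\<Prod>i\<leftarrow>rev [Suc CARD('n) - r..<Suc CARD('n)]. linear_factor (Barred i) b)"

lemma upt_step: "r < n \<Longrightarrow> [Suc n - Suc r..<Suc n] = (n - r) # [Suc n - r..<Suc n]"
  by (simp add: upt_conv_Cons Suc_diff_le del: upt_Suc)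

lemma left_series_Suc:
  "r < CARD('n::finite) \<Longrightarrow> left_series (Suc r) b = linear_factor (Unbarred (CARD('n) - r)) b * (left_series r b :: 'n skew_series)"
  unfolding left_series_def upt_step by (simp add: mult.assoc)

lemma left_series_0: "left_series 0 = middle"
  by (simp add: left_series_def fun_eq_iff)

lemma right_series_Suc:
  "r < CARD('n::finite) \<Longrightarrow> right_series (Suc r) b = (right_series r b :: 'n skew_series) * linear_factor (Barred (CARD('n) - r)) b"
  unfolding right_series_def upt_step by (simp add: mult.assoc)

lemma right_series_0: "right_series 0 = (left_series CARD('n) :: _ \<Rightarrow> 'n::finite skew_series)"
  by (simp add: right_series_def fun_eq_iff)

lemma E_series_right: "E_series = (right_series CARD('n) :: _ \<Rightarrow> 'n::finite skew_series)"
  by (simp add: fun_eq_iff E_series_def right_series_def left_series_def middle_def linear_factor_def del: upt_Suc)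

lemma equivariant_left: "r \<le> CARD('n::finite) \<Longrightarrow> equivariant (left_series r :: _ \<Rightarrow> 'n skew_series)"
proof (induction r)
  case 0
  then show ?case by (simp add: left_series_0 equivariant_middle)
next
  case (Suc r)
  then have "(left_series (Suc r) :: _ \<Rightarrow> 'n skew_series) = (\<lambda>b. linear_factor (Unbarred (CARD('n) - r)) b * left_series r b)"
    by (simp add: left_series_Suc fun_eq_iff)
  then show ?case using equivariant_mult[OF equivariant_linear] Suc by simp
qed

text \<open>Induction on the index: by the relation a product for index \<open>i\<close> equals a
  product of two generators of index \<open>i - 1\<close>, which are units, and those of index 0 are
  1. As the parameter is arbitrary, both factors are units for every parameter.\<close>

lemma zgen_unit: "zgen k b dvd (1 :: 'n::finite zring)"
proof (cases "k \<in> letters CARD('n)")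
  case True
  have "i \<le> CARD('n) \<Longrightarrow> (\<forall>b. zgen (Unbarred i) b dvd (1 :: 'n zring)) \<and> (\<forall>b. zgen (Barred i) b dvd (1 :: 'n zring))" for i
  proof (induction i)
    case 0
    have "Unbarred 0 \<notin> letters CARD('n)" "Barred 0 \<notin> letters CARD('n)" by (auto simp: letters_def)
    then show ?case by (simp add: zgen_eq_1)
  next
    case (Suc i)
    have rel: "zgen (Unbarred (Suc i)) c * zgen (Barred (Suc i)) (c - 2 * of_nat CARD('n) + 2 * of_nat (Suc i)) dvd (1 :: 'n zring)" for c
      using zgen_relation[where 'n = 'n, of "Suc i" c] Suc
        mult_dvd_mono[of "zgen (Unbarred i) c :: 'n zring" 1 "zgen (Barred i) (c - 2 * of_nat CARD('n) + 2 * of_nat (Suc i))" 1]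
      by simp
    show ?case
    proof (intro conjI allI)
      fix b
      show "zgen (Unbarred (Suc i)) b dvd (1 :: 'n zring)" using rel[of b] by (rule dvd_mult_left)
      have "b + 2 * of_nat CARD('n) - 2 * of_nat (Suc i) - 2 * of_nat CARD('n) + 2 * of_nat (Suc i) = b" by simp
      then show "zgen (Barred (Suc i)) b dvd (1 :: 'n zring)"
        using rel[of "b + 2 * of_nat CARD('n) - 2 * of_nat (Suc i)"] by (metis dvd_mult_right)
    qed
  qed
  then show ?thesis using True by (auto simp: letters_def)
qed (simp add: zgen_eq_1)

definition lower_weight :: "complex \<Rightarrow> nat \<Rightarrow> family \<Rightarrow> 'n::finite zring" where
  "lower_weight a l = family_weight l CARD('n) (\<lambda>r f. zgen (Unbarred (CARD('n) - r)) (a - 2 * of_int (f - int r))) (\<lambda>_ _. 1)"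

definition upper_weight :: "complex \<Rightarrow> nat \<Rightarrow> family \<Rightarrow> 'n::finite zring" where
  "upper_weight a l = family_weight l CARD('n) (\<lambda>_ _. 1) (\<lambda>r x. zgen (Barred (CARD('n) - r)) (a - 2 * of_int x))"

definition pair_weight :: "complex \<Rightarrow> nat \<Rightarrow> family \<times> family \<Rightarrow> 'n::finite zring" where
  "pair_weight a l p = lower_weight a l (fst p) * upper_weight a l (snd p) * (\<Prod>i=1..l. east_weight a (fst p 0 i + 1) (snd p 0 i))"

lemma minor_of_int: "minor l (\<lambda>a b. of_int (K a b)) s t = (of_int (minor l K s t) :: 'r::comm_ring_1)"
proof -
  have "mat l l (\<lambda>(i, j). of_int (K (s (i + 1)) (t (j + 1)))) = map_mat (of_int :: int \<Rightarrow> 'r) (mat l l (\<lambda>(i, j). K (s (i + 1)) (t (j + 1))))"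
    by (rule eq_matI) auto
  then show ?thesis unfolding minor_def by (simp only: of_int_hom.hom_det)
qed

abbreviation east_unit :: "nat \<Rightarrow> complex \<Rightarrow> int \<Rightarrow> 'n::finite zring" where
  "east_unit n a x \<equiv> zgen (Barred n) (a - 2 * of_int x) * zgen (Unbarred n) (a - 2 * of_int (x + 1))"

section \<open>Weights depend only on the union of the vertices\<close>

context family_pairs
begin

text \<open>This makes the product over a row of vertices a function of the union of the two families.\<close>

lemma prod_row_total:
  fixes g :: "int \<Rightarrow> 'r::comm_ring_1"
  assumes p: "p \<in> pairs" and r: "r \<le> n"
  shows "(\<Prod>i=1..l. g (fst p r i)) * (\<Prod>i=1..l. g (snd p r i))
    = (\<Prod>x\<in>{- M<..M}. g x ^ nat (total p (r, x - 1) - total p (r, x)))"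
proof -
  have one: "(\<Prod>i=1..l. g (X i)) = (\<Prod>x\<in>{- M<..M}. g x ^ card {i \<in> {1..l}. X i = x})"
    if "\<And>i. i \<in> {1..l} \<Longrightarrow> - M < X i \<and> X i \<le> M" for X
  proof -
    have "(\<Prod>x\<in>{- M<..M}. \<Prod>i\<in>{i \<in> {1..l}. X i = x}. g (X i)) = (\<Prod>i=1..l. g (X i))"
      by (rule prod.group) (use that in auto)
    moreover have "(\<Prod>i\<in>{i \<in> {1..l}. X i = x}. g (X i)) = g x ^ card {i \<in> {1..l}. X i = x}" for x by simp
    ultimately show ?thesis by simp
  qed
  have "total p (r, x - 1) - total p (r, x) = int (card {i \<in> {1..l}. fst p r i = x} + card {i \<in> {1..l}. snd p r i = x})" for x
    using above_diff[of l "fst p r" "x - 1"] above_diff[of l "snd p r" "x - 1"] by (simp add: total_def)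
  then have "g x ^ nat (total p (r, x - 1) - total p (r, x)) = g x ^ card {i \<in> {1..l}. fst p r i = x} * g x ^ card {i \<in> {1..l}. snd p r i = x}" for x
    by (simp only: nat_int power_add)
  moreover have "(\<Prod>i=1..l. g (fst p r i)) = (\<Prod>x\<in>{- M<..M}. g x ^ card {i \<in> {1..l}. fst p r i = x})"
    "(\<Prod>i=1..l. g (snd p r i)) = (\<Prod>x\<in>{- M<..M}. g x ^ card {i \<in> {1..l}. snd p r i = x})"
    using pair_bounds[OF p r] by (intro one; simp)+
  ultimately show ?thesis by (simp add: prod.distrib)
qed

text \<open>The constant \<open>C\<close> enters once per strand, hence with exponent
  \<open>l\<close> for both pairs; what remains is a product of \<open>g\<close> over all vertices
  of the row.\<close>

lemma prod_row_cong:
  fixes f g :: "int \<Rightarrow> 'r::comm_ring_1"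
  assumes "p \<in> pairs" "q \<in> pairs" "same_total p q" "r \<le> n" and C: "\<And>x. f x = C * g x"
  shows "(\<Prod>i=1..l. f (fst p r i)) * (\<Prod>i=1..l. g (snd p r i)) = (\<Prod>i=1..l. f (fst q r i)) * (\<Prod>i=1..l. g (snd q r i))"
proof -
  have "(\<Prod>i=1..l. f (fst p r i)) * (\<Prod>i=1..l. g (snd p r i)) = C ^ l * ((\<Prod>i=1..l. g (fst p r i)) * (\<Prod>i=1..l. g (snd p r i)))"
    for p :: "family \<times> family" by (simp add: C prod.distrib)
  moreover have "total p (r, x) = total q (r, x)" for x using assms(3,4) by (simp add: same_total_def)
  ultimately show ?thesis using prod_row_total[OF assms(1,4), of g] prod_row_total[OF assms(2,4), of g] by simp
qed

text \<open>By means of potentials every step weight becomes a quotient of two vertex weights, and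
  the factors are regrouped by rows. Within a row the relations of the ring make the vertex weights
  of lower and upper strands proportional, so \<open>prod_row_cong\<close> applies; the top rows are
  prescribed.\<close>

lemma weight_same_total:
  fixes a :: complex and th th' :: "int \<Rightarrow> 'n::finite zring"
  assumes n: "n = CARD('n)" and pq: "p \<in> pairs" "q \<in> pairs" "same_total p q" and th: "\<And>x. th x * th' x = 1"
      "\<And>x. th (x + 2) = east_unit n a x * th x"
      "\<And>x. th' x = east_unit n a x * th' (x + 2)"
  shows "lower_weight a l (fst p) * upper_weight a l (snd p) * (\<Prod>i=1..l. th' (fst p 0 i + 1)) * (\<Prod>i=1..l. th (snd p 0 i))
    = lower_weight a l (fst q) * upper_weight a l (snd q) * (\<Prod>i=1..l. th' (fst q 0 i + 1)) * (\<Prod>i=1..l. th (snd q 0 i))"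
proof -
  define zu zb :: "nat \<Rightarrow> int \<Rightarrow> 'n zring" where "zu r x = zgen (Unbarred (n - r)) (a - 2 * of_int (x - int r))"
    and "zb r x = zgen (Barred (n - r)) (a - 2 * of_int x)" for r x
  have "\<exists>f f'. \<forall>x. f x * f' x = 1 \<and> f (x + 1) = zb r x * f x \<and> f' x = zb r x * f' (x + 1)" for r
    by (rule ex_potential) (simp add: zb_def zgen_unit)
  then obtain ps ps' where ps: "\<And>r x. ps r x * ps' r x = 1" "\<And>r x. ps r (x + 1) = zb r x * ps r x"
    "\<And>r x. ps' r x = zb r x * ps' r (x + 1)" by metis
  have "\<exists>f f'. \<forall>x. f x * f' x = 1 \<and> f (x + 1) = zu r x * f x \<and> f' x = zu r x * f' (x + 1)" for r
    by (rule ex_potential) (simp add: zu_def zgen_unit)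
  then obtain ch ch' where ch: "\<And>r x. ch r x * ch' r x = 1" "\<And>r x. ch r (x + 1) = zu r x * ch r x"
    "\<And>r x. ch' r x = zu r x * ch' r (x + 1)" by metis
  obtain m where m: "n = Suc m" using n_pos by (cases n) auto
  \<comment> \<open>What row \<open>Suc r\<close> contributes, from the steps on either side of
    it.\<close>
  define R where "R r F G = (\<Prod>i=1..l. ch (Suc r) (F i + 1) * ch' r (F i)) * (\<Prod>i=1..l. ps r (G i) * ps' (Suc r) (G i))" for r F G
  have W: "lower_weight a l (fst p) * upper_weight a l (snd p) * (\<Prod>i=1..l. th' (fst p 0 i + 1)) * (\<Prod>i=1..l. th (snd p 0 i))
    = ((\<Prod>i=1..l. ch 0 (fst p 0 i + 1) * th' (fst p 0 i + 1)) * (\<Prod>i=1..l. th (snd p 0 i) * ps' 0 (snd p 0 i))) *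
      (\<Prod>r<m. R r (fst p (Suc r)) (snd p (Suc r))) * ((\<Prod>i=1..l. ch' m (T i)) * (\<Prod>i=1..l. ps m (T' i)))"
    if p: "p \<in> pairs" for p
  proof -
    have F: "fst p \<in> families l n T" and G: "snd p \<in> families l n T'" using p by auto
    have lw: "lower_weight a l (fst p) = (\<Prod>r<n. \<Prod>i=1..l. ch r (fst p r i + 1) * ch' r (fst p (Suc r) i))"
      unfolding lower_weight_def family_weight_def n[symmetric]
    proof (intro prod.cong refl)
      fix r i assume "r \<in> {..<n}" "i \<in> {1..l}"
      then have "fst p (Suc r) i = fst p r i \<or> fst p (Suc r) i = fst p r i + 1" using families_step[OF F] by simp
      then show "(if fst p (Suc r) i = fst p r i then zgen (Unbarred (n - r)) (a - 2 * of_int (fst p r i - int r)) else 1)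
        = ch r (fst p r i + 1) * ch' r (fst p (Suc r) i)"
        using ch(1)[of r "fst p r i"] ch(1)[of r "fst p r i + 1"] ch(2)[of r "fst p r i"]
        by (auto simp: zu_def mult.assoc)
    qed
    have uw: "upper_weight a l (snd p) = (\<Prod>r<n. \<Prod>i=1..l. ps r (snd p (Suc r) i) * ps' r (snd p r i))"
      unfolding upper_weight_def family_weight_def n[symmetric]
    proof (intro prod.cong refl)
      fix r i assume "r \<in> {..<n}" "i \<in> {1..l}"
      then have "snd p (Suc r) i = snd p r i \<or> snd p (Suc r) i = snd p r i + 1" using families_step[OF G] by simp
      then show "(if snd p (Suc r) i = snd p r i then 1 else zgen (Barred (n - r)) (a - 2 * of_int (snd p r i)))
        = ps r (snd p (Suc r) i) * ps' r (snd p r i)"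
        using ps(1)[of r "snd p r i"] ps(2)[of r "snd p r i"] by (auto simp: zb_def mult.assoc)
    qed
    have tops: "(\<Prod>i=1..l. ch' m (fst p (Suc m) i)) = (\<Prod>i=1..l. ch' m (T i))"
      "(\<Prod>i=1..l. ps m (snd p (Suc m) i)) = (\<Prod>i=1..l. ps m (T' i))"
      using families_top[OF F] families_top[OF G] unfolding m by auto
    have split: "(\<Prod>r<Suc m. A r * B r) * (\<Prod>r<Suc m. U r * V r) * x * y
      = ((A 0 * x) * (y * V 0)) * (\<Prod>r<m. (A (Suc r) * B r) * (U r * V (Suc r))) * (B m * U m)"
      for A B U V :: "nat \<Rightarrow> 'n zring" and x y
    proof -
      have "(\<Prod>r<Suc m. A r * B r) * (\<Prod>r<Suc m. U r * V r) * x * y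
        = (A 0 * (\<Prod>r<m. A (Suc r))) * ((\<Prod>r<m. B r) * B m) * (((\<Prod>r<m. U r) * U m) * (V 0 * (\<Prod>r<m. V (Suc r)))) * x * y"
        unfolding prod.distrib prod.lessThan_Suc_shift[of A m] prod.lessThan_Suc_shift[of V m]
          prod.lessThan_Suc[of B m] prod.lessThan_Suc[of U m] by (rule refl)
      also have "\<dots> = ((A 0 * x) * (y * V 0)) * ((\<Prod>r<m. A (Suc r)) * (\<Prod>r<m. B r) * ((\<Prod>r<m. U r) * (\<Prod>r<m. V (Suc r)))) * (B m * U m)"
        by (simp only: ac_simps)
      finally show ?thesis by (simp only: prod.distrib)
    qed
    show ?thesis unfolding lw uw m R_def prod.distrib[of _ _ "{1..l}"] split tops ..
  qed
  \<comment> \<open>The defining relation for the index \<open>i = n - r\<close>. Its shift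
    \<open>2 * i - 2 * n = - 2 * r\<close> is the difference of the parameters of
    \<open>zb r x\<close> and \<open>zu r x\<close>.\<close>
  have zbu: "zu (Suc r) (x + 1) * zb (Suc r) x = zu r x * zb r x" if "r < m" for r x
  proof -
    define i where "i = n - r"
    have i: "1 \<le> i" "i \<le> CARD('n)" "n - Suc r = i - 1" "int i = int n - int r" using that m n by (auto simp: i_def)
    have ci: "of_nat i = (of_nat n - of_nat r :: complex)" using that m by (simp add: i_def of_nat_diff)
    define b where "b = a - 2 * of_int (x - int r)"
    have "b - 2 * of_nat CARD('n) + 2 * of_nat i = a - 2 * of_int x" unfolding ci n[symmetric] b_def by (simp add: algebra_simps)
    then have "zgen (Unbarred i) b * zgen (Barred i) (a - 2 * of_int x)
      = (zgen (Unbarred (i - 1)) b * zgen (Barred (i - 1)) (a - 2 * of_int x) :: 'n zring)"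
      using zgen_relation[where 'n = 'n, OF i(1,2), of b] by simp
    moreover have "a - 2 * of_int (x + 1 - int (Suc r)) = b" by (simp add: b_def)
    ultimately show ?thesis unfolding zu_def zb_def i(3) i_def[symmetric] b_def[symmetric] by simp
  qed
  have Rinv: "R r (fst p (Suc r)) (snd p (Suc r)) = R r (fst q (Suc r)) (snd q (Suc r))" if r: "r < m" for r
  proof -
    have "ch (Suc r) (x + 1 + 1) * ch' r (x + 1) * (ps r x * ps' (Suc r) x)
      = ch (Suc r) (x + 1) * ch' r x * (ps r (x + 1) * ps' (Suc r) (x + 1))" for x
    proof -
      have "ch (Suc r) (x + 1 + 1) * ch' r (x + 1) * (ps r x * ps' (Suc r) x)
        = (zu (Suc r) (x + 1) * zb (Suc r) x) * (ch (Suc r) (x + 1) * ch' r (x + 1) * ps r x * ps' (Suc r) (x + 1))"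
        unfolding ch(2)[of "Suc r" "x + 1"] ps(3)[of "Suc r" x] by (simp only: ac_simps)
      also have "\<dots> = ch (Suc r) (x + 1) * ch' r x * (ps r (x + 1) * ps' (Suc r) (x + 1))"
        unfolding zbu[OF r] ch(3)[of r x] ps(2)[of r x] by (simp only: ac_simps)
      finally show ?thesis .
    qed
    moreover have "ps r x * ps' (Suc r) x * (ps' r x * ps (Suc r) x) = 1" for x
    proof -
      have "ps r x * ps' (Suc r) x * (ps' r x * ps (Suc r) x) = (ps r x * ps' r x) * (ps (Suc r) x * ps' (Suc r) x)"
        by (simp only: ac_simps)
      then show ?thesis by (simp add: ps(1))
    qed
    ultimately have "ch (Suc r) (x + 1) * ch' r x = ch (Suc r) (0 + 1) * ch' r 0 * (ps' r 0 * ps (Suc r) 0) * (ps r x * ps' (Suc r) x)" for x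
      using unit_ratio[of "\<lambda>x. ps r x * ps' (Suc r) x" "\<lambda>x. ps' r x * ps (Suc r) x" "\<lambda>x. ch (Suc r) (x + 1) * ch' r x" x] by blast
    then show ?thesis unfolding R_def using r m by (intro prod_row_cong[OF pq]) auto
  qed
  \<comment> \<open>In row 0 the potentials of the E-steps take the place of the steps on its other
    side, and their recursion supplies the proportionality.\<close>
  have R0: "(\<Prod>i=1..l. ch 0 (fst p 0 i + 1) * th' (fst p 0 i + 1)) * (\<Prod>i=1..l. th (snd p 0 i) * ps' 0 (snd p 0 i))
    = (\<Prod>i=1..l. ch 0 (fst q 0 i + 1) * th' (fst q 0 i + 1)) * (\<Prod>i=1..l. th (snd q 0 i) * ps' 0 (snd q 0 i))"
  proof -
    have zz: "zu 0 (x + 1) * zb 0 x * th' (x + 2) = th' x" for x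
      unfolding th(3)[of x] by (simp add: zu_def zb_def ac_simps)
    have "ch 0 (x + 1 + 1) * th' (x + 1 + 1) * (th x * ps' 0 x) = ch 0 (x + 1) * th' (x + 1) * (th (x + 1) * ps' 0 (x + 1))" for x
    proof -
      have "ch 0 (x + 1 + 1) * th' (x + 1 + 1) * (th x * ps' 0 x)
        = ch 0 (x + 1) * ps' 0 (x + 1) * (th x * (zu 0 (x + 1) * zb 0 x * th' (x + 2)))"
        unfolding ch(2)[of 0 "x + 1"] ps(3)[of 0 x] by (simp add: ac_simps)
      also have "\<dots> = ch 0 (x + 1) * ps' 0 (x + 1) * (th (x + 1) * th' (x + 1))" unfolding zz th(1) ..
      finally show ?thesis by (simp only: ac_simps)
    qed
    moreover have "th x * ps' 0 x * (th' x * ps 0 x) = 1" for x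
    proof -
      have "th x * ps' 0 x * (th' x * ps 0 x) = (th x * th' x) * (ps 0 x * ps' 0 x)" by (simp only: ac_simps)
      then show ?thesis by (simp add: ps(1) th(1))
    qed
    ultimately have "ch 0 (x + 1) * th' (x + 1) = ch 0 (0 + 1) * th' (0 + 1) * (th' 0 * ps 0 0) * (th x * ps' 0 x)" for x
      using unit_ratio[of "\<lambda>x. th x * ps' 0 x" "\<lambda>x. th' x * ps 0 x" "\<lambda>x. ch 0 (x + 1) * th' (x + 1)" x] by blast
    then show ?thesis by (intro prod_row_cong[OF pq]) auto
  qed
  have "(\<Prod>r<m. R r (fst p (Suc r)) (snd p (Suc r))) = (\<Prod>r<m. R r (fst q (Suc r)) (snd q (Suc r)))"
    by (rule prod.cong) (use Rinv in auto)
  then show ?thesis unfolding W[OF pq(1)] W[OF pq(2)] R0 by simp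
qed

text \<open>The barred linear factors act on the end points and produce the upper families; after a
  transposition the unbarred ones act on the starting points and produce the lower families. A minor
  of the middle kernel remains; the potentials \<open>th\<close>, \<open>th'\<close> reduce it to a
  minor of \<open>hop\<close>, and \<open>sum_pairs\<close> applies.\<close>

theorem minor_kernel_pairs:
  fixes a :: complex
  assumes n: "n = CARD('n::finite)"
  shows "minor l (\<lambda>t s. kernel a (E_series :: _ \<Rightarrow> 'n skew_series) s t) T' (\<lambda>i. T i + 1 - int n)
    = (\<Sum>p | p \<in> pairs \<and> row_matched p \<and> \<not> odd_neg_region n (gap p). pair_weight a l p)"
proof -
  have "(\<lambda>t s. kernel a (E_series :: _ \<Rightarrow> 'n skew_series) s t) = (\<lambda>t s. kernel a (right_series n) s t)"
    by (simp add: E_series_right n)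
  then have "minor l (\<lambda>t s. kernel a (E_series :: _ \<Rightarrow> 'n skew_series) s t) T' (\<lambda>i. T i + 1 - int n)
    = minor l ((\<lambda>r t s. kernel a (right_series r :: _ \<Rightarrow> 'n skew_series) s t) n) T' (\<lambda>i. T i + 1 - int n)" by simp
  also have "\<dots> = (\<Sum>G\<in>families l n T'. upper_weight a l G * minor l (\<lambda>t s. kernel a (left_series n :: _ \<Rightarrow> 'n skew_series) s t) (G 0) (\<lambda>i. T i + 1 - int n))"
  proof (subst minor_families[OF T', where u = "\<lambda>_ _. 1" and w = "\<lambda>r x. zgen (Barred (n - r)) (a - 2 * of_int x)"])
    show "kernel a (right_series (Suc r) :: _ \<Rightarrow> 'n skew_series) s t = 1 * kernel a (right_series r) s t
      + zgen (Barred (n - r)) (a - 2 * of_int (t - 1)) * kernel a (right_series r) s (t - 1)" if "r < n" for r t s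
    proof -
      have "(right_series (Suc r) :: _ \<Rightarrow> 'n skew_series) = (\<lambda>b. right_series r b * linear_factor (Barred (n - r)) b)"
        unfolding n by (rule ext, rule right_series_Suc) (use that n in simp)
      then show ?thesis by (simp only: kernel_mult_linear mult_1)
    qed
  qed (simp add: right_series_0 upper_weight_def n)
  also have "\<dots> = (\<Sum>G\<in>families l n T'. \<Sum>F\<in>families l n T. upper_weight a l G * (lower_weight a l F *
      minor l (\<lambda>f t. kernel a (middle :: _ \<Rightarrow> 'n skew_series) (f + 1) t) (F 0) (G 0)))"
  proof (rule sum.cong[OF refl])
    fix G assume "G \<in> families l n T'"
    have "minor l (\<lambda>t s. kernel a (left_series n :: _ \<Rightarrow> 'n skew_series) s t) (G 0) (\<lambda>i. T i + 1 - int n)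
      = minor l (\<lambda>s t. kernel a (left_series n :: _ \<Rightarrow> 'n skew_series) s t) (\<lambda>i. T i + 1 - int n) (G 0)"
      by (rule minor_transpose)
    \<comment> \<open>Dual coordinates: in row \<open>r\<close> the lower path with dual position
      \<open>f\<close> has x-coordinate \<open>f + 1 - r\<close>.\<close>
    also have "\<dots> = minor l ((\<lambda>r f t. kernel a (left_series r :: _ \<Rightarrow> 'n skew_series) (f + 1 - int r) t) n) T (G 0)"
      by (rule minor_cong) simp
    also have "\<dots> = (\<Sum>F\<in>families l n T. lower_weight a l F * minor l (\<lambda>f t. kernel a (middle :: _ \<Rightarrow> 'n skew_series) (f + 1) t) (F 0) (G 0))"
    proof (subst minor_families[OF T, where u = "\<lambda>r f. zgen (Unbarred (n - r)) (a - 2 * of_int (f - int r))" and w = "\<lambda>_ _. 1"])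
      show "kernel a (left_series (Suc r) :: _ \<Rightarrow> 'n skew_series) (f + 1 - int (Suc r)) t
        = zgen (Unbarred (n - r)) (a - 2 * of_int (f - int r)) * kernel a (left_series r) (f + 1 - int r) t
          + 1 * kernel a (left_series r) (f - 1 + 1 - int r) t" if "r < n" for r f t proof -
        have "(left_series (Suc r) :: _ \<Rightarrow> 'n skew_series) = (\<lambda>b. linear_factor (Unbarred (n - r)) b * left_series r b)"
          unfolding n by (rule ext, rule left_series_Suc) (use that n in simp)
        moreover have "equivariant (left_series r :: _ \<Rightarrow> 'n skew_series)" by (rule equivariant_left) (use that n in simp)
        moreover have "f + 1 - int (Suc r) = f - int r" "f - 1 + 1 - int r = f - int r" "f + 1 - int r = f - int r + 1" by simp_all
        ultimately show ?thesis by (simp only: kernel_linear_mult mult_1 add.commute)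
      qed
    qed (simp add: left_series_0 lower_weight_def n)
    finally show "upper_weight a l G * minor l (\<lambda>t s. kernel a (left_series n :: _ \<Rightarrow> 'n skew_series) s t) (G 0) (\<lambda>i. T i + 1 - int n)
      = (\<Sum>F\<in>families l n T. upper_weight a l G * (lower_weight a l F * minor l (\<lambda>f t. kernel a middle (f + 1) t) (F 0) (G 0)))"
      by (simp add: sum_distrib_left)
  qed
  also have "\<dots> = (\<Sum>p\<in>pairs. upper_weight a l (snd p) * (lower_weight a l (fst p) *
      minor l (\<lambda>f t. kernel a (middle :: _ \<Rightarrow> 'n skew_series) (f + 1) t) (fst p 0) (snd p 0)))"
    by (subst sum.swap) (simp add: sum.cartesian_product split_def)
  finally have chi: "minor l (\<lambda>t s. kernel a (E_series :: _ \<Rightarrow> 'n skew_series) s t) T' (\<lambda>i. T i + 1 - int n) = \<dots>" .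
  have "\<exists>f f'. \<forall>x. f x * f' x = (1 :: 'n zring) \<and> f (x + 2) = east_unit n a x * f x \<and>
    f' x = east_unit n a x * f' (x + 2)"
    by (rule ex_potential_two) (metis mult_dvd_mono mult_1 zgen_unit)
  then obtain th th' :: "int \<Rightarrow> 'n zring" where th: "\<And>x. th x * th' x = 1"
      "\<And>x. th (x + 2) = east_unit n a x * th x"
      "\<And>x. th' x = east_unit n a x * th' (x + 2)"
    by blast
  have east: "east_weight a s t = th' s * th t" if st: "s \<le> t" "even (t - s)" for s t
  proof -
    obtain k where k: "t = s + 2 * int k"
    proof
      show "t = s + 2 * int (nat ((t - s) div 2))" using st by simp
    qed
    have "(\<Prod>j<k. zgen (Barred n) (a - 2 * of_int (s + 2 * int j)) * zgen (Unbarred n) (a - 2 * of_int (s + 2 * int j + 1))) = th' s * th (s + 2 * int k)"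
    proof (induction k)
      case 0
      then show ?case using th(1)[of s] by (simp add: mult.commute)
    next
      case (Suc k)
      have "s + 2 * int (Suc k) = s + 2 * int k + 2" by simp
      then show ?case using Suc th(2)[of "s + 2 * int k"] by (simp only: prod.lessThan_Suc) (simp only: ac_simps)
    qed
    then show ?thesis unfolding east_weight_def n[symmetric] k by simp
  qed
  \<comment> \<open>\<open>hop\<close> is the middle kernel without its weight. The E-steps start at
    \<open>f + 1\<close>, so an even number of them means that \<open>t - f\<close> is odd.\<close>
  have ker: "kernel a middle (f + 1) t = th' (f + 1) * th t * of_int (hop f t)" for f t
    using east[of "f + 1" t] by (auto simp: kernel_middle hop_def)
  define W :: "family \<times> family \<Rightarrow> 'n zring" where
    "W p = lower_weight a l (fst p) * upper_weight a l (snd p) * (\<Prod>i=1..l. th' (fst p 0 i + 1)) * (\<Prod>i=1..l. th (snd p 0 i))" for p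
  have "minor l (\<lambda>t s. kernel a (E_series :: _ \<Rightarrow> 'n skew_series) s t) T' (\<lambda>i. T i + 1 - int n)
    = (\<Sum>p\<in>pairs. W p * of_int (minor l hop (fst p 0) (snd p 0)))"
    unfolding chi ker minor_scale[of l "\<lambda>f. th' (f + 1)" th] minor_of_int W_def by (simp only: ac_simps)
  also have "\<dots> = (\<Sum>p | p \<in> pairs \<and> row_matched p \<and> \<not> odd_neg_region n (gap p). W p)"
    by (rule sum_pairs) (unfold W_def, rule weight_same_total[OF n _ _ _ th])
  also have "\<dots> = (\<Sum>p | p \<in> pairs \<and> row_matched p \<and> \<not> odd_neg_region n (gap p). pair_weight a l p)"
  proof (rule sum.cong[OF refl])
    fix p assume "p \<in> {p. p \<in> pairs \<and> row_matched p \<and> \<not> odd_neg_region n (gap p)}"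
    then have p: "p \<in> pairs" "row_matched p" by auto
    interpret rp: tuple_pair l "fst p 0" "snd p 0" by (rule row_pair[OF p(1)])
    have "east_weight a (fst p 0 i + 1) (snd p 0 i) = th' (fst p 0 i + 1) * th (snd p 0 i)" if "i \<in> {1..l}" for i
    proof (rule east)
      have "fst p 0 i < snd p 0 i \<and> odd (snd p 0 i - fst p 0 i)"
        using p(2) that unfolding row_matched_def rp.matched_def by blast
      then show "fst p 0 i + 1 \<le> snd p 0 i" "even (snd p 0 i - (fst p 0 i + 1))" by auto
    qed
    then have "(\<Prod>i=1..l. east_weight a (fst p 0 i + 1) (snd p 0 i)) = (\<Prod>i=1..l. th' (fst p 0 i + 1)) * (\<Prod>i=1..l. th (snd p 0 i))"
      by (simp add: prod.distrib)
    then show "W p = pair_weight a l p" by (simp only: W_def pair_weight_def mult.assoc)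
  qed
  finally show ?thesis .
qed

end

lemma chi_det_minor:
  "(chi_det lam mu a :: 'n::finite zring) = minor (lam 1) (\<lambda>t s. kernel a E_series s t)
     (\<lambda>i. int (conjugate_partition lam i) - int i + 1) (\<lambda>j. int (conjugate_partition mu j) - int j + 1)"
proof -
  have e: "e_coeff (t - s) (a - 2 * of_int s) = (kernel a E_series s t :: 'n zring)" for s t
    by (simp add: e_coeff_def kernel_def)
  have "e_coeff (x - y - int i + int j) (a - 2 * of_int (y - int j + 1))
    = (kernel a E_series (y - int j + 1) (x - int i + 1) :: 'n zring)" for x y i j
  proof -
    have "x - y - int i + int j = (x - int i + 1) - (y - int j + 1)" by simp
    then show ?thesis by (simp only: e)
  qed
  then show ?thesis unfolding chi_det_def minor_def Let_def by (simp only:)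
qed

section \<open>Paths and their strands\<close>

text \<open>\<open>f r\<close> is the \<open>x\<close>-coordinate of the dual point, whence the shift by \<open>1 - r\<close> at height \<open>- r\<close>.\<close>

definition low_point :: "(nat \<Rightarrow> int) \<Rightarrow> nat \<Rightarrow> point" where
  "low_point f r = (f r + 1 - int r, - f r - 1)"

definition up_point :: "(nat \<Rightarrow> int) \<Rightarrow> nat \<Rightarrow> point" where
  "up_point g r = (g r, int r - g r)"

text \<open>Row 0 appears in the middle segment only, which runs from \<open>f 0 + 1\<close>, the
  end of the lower path, to \<open>g 0\<close>; it is nonempty exactly if
  \<open>eastward f g\<close>.\<close>

definition strand :: "nat \<Rightarrow> (nat \<Rightarrow> int) \<Rightarrow> (nat \<Rightarrow> int) \<Rightarrow> path" where
  "strand n f g = map (low_point f) (rev [1..<Suc n]) @ map (\<lambda>x. (x, - x)) [f 0 + 1..g 0] @ map (up_point g) [1..<Suc n]"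

definition eastward :: "(nat \<Rightarrow> int) \<Rightarrow> (nat \<Rightarrow> int) \<Rightarrow> bool" where
  "eastward f g \<longleftrightarrow> f 0 < g 0"

definition strand_ok :: "nat \<Rightarrow> (nat \<Rightarrow> int) \<Rightarrow> (nat \<Rightarrow> int) \<Rightarrow> bool" where
  "strand_ok n f g \<longleftrightarrow> eastward f g \<and> (\<forall>r<n. f (Suc r) = f r \<or> f (Suc r) = f r + 1) \<and> (\<forall>r<n. g (Suc r) = g r \<or> g (Suc r) = g r + 1)"

definition east_count :: "(nat \<Rightarrow> int) \<Rightarrow> (nat \<Rightarrow> int) \<Rightarrow> nat" where
  "east_count f g = nat (g 0 - f 0 - 1)"

lemma ht_low [simp]: "ht (low_point f r) = - int r"
  by (simp add: low_point_def)

lemma ht_up [simp]: "ht (up_point g r) = int r"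
  by (simp add: up_point_def)

lemma set_strand:
  "set (strand n f g) = low_point f ` {1..n} \<union> (\<lambda>x. (x, - x)) ` {f 0<..g 0} \<union> up_point g ` {1..n}"
proof -
  have "{f 0 + 1..g 0} = {f 0<..g 0}" by auto
  moreover have "set [1..<Suc n] = {1..n}" by auto
  ultimately show ?thesis unfolding strand_def set_append set_map set_rev set_upto by (simp only: Un_assoc)
qed

lemma length_strand: "eastward f g \<Longrightarrow> length (strand n f g) = Suc (2 * n + east_count f g)"
  by (simp add: strand_def east_count_def eastward_def del: upt_Suc)

lemma nth_strand:
  assumes "eastward f g" "k \<le> 2 * n + east_count f g"
  shows "strand n f g ! k = (if k < n then low_point f (n - k)
    else if k \<le> n + east_count f g then (f 0 + 1 + int (k - n), - (f 0 + 1 + int (k - n)))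
    else up_point g (k - n - east_count f g))"
proof -
  let ?A = "map (low_point f) (rev [1..<Suc n])" and ?B = "map (\<lambda>x. (x, - x)) [f 0 + 1..g 0]" and ?C = "map (up_point g) [1..<Suc n]"
  have len: "length ?A = n" "length ?B = Suc (east_count f g)" using assms(1) by (auto simp: east_count_def eastward_def simp del: upt_Suc)
  have s: "strand n f g = ?A @ ?B @ ?C" by (simp add: strand_def del: upt_Suc)
  consider "k < n" | "n \<le> k" "k \<le> n + east_count f g" | "n + east_count f g < k" by linarith
  then show ?thesis
  proof cases
    case 1
    then show ?thesis unfolding s nth_append len by (simp add: rev_nth Suc_diff_Suc del: upt_Suc)
  next
    case 2
    then have "f 0 + 1 + int (k - n) \<le> g 0" using assms(1) unfolding east_count_def eastward_def by linarith
    then have "?B ! (k - n) = (f 0 + 1 + int (k - n), - (f 0 + 1 + int (k - n)))"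
      using 2 len(2) by (subst nth_map) (auto simp: nth_upto)
    moreover have "k - n < Suc (east_count f g)" using 2 by linarith
    ultimately show ?thesis using 2 unfolding s nth_append len by (simp del: upt_Suc)
  next
    case 3
    have "?C ! (k - n - Suc (east_count f g)) = up_point g (1 + (k - n - Suc (east_count f g)))"
      using 3 assms(2) by (subst nth_map) (auto simp del: upt_Suc)
    moreover have "1 + (k - n - Suc (east_count f g)) = k - n - east_count f g" using 3 by simp
    moreover have "\<not> k - n < Suc (east_count f g)" using 3 by linarith
    ultimately show ?thesis using 3 unfolding s nth_append len by (simp del: upt_Suc)
  qed
qed

lemma int_east: "eastward f g \<Longrightarrow> int (east_count f g) = g 0 - f 0 - 1"
  by (simp add: east_count_def eastward_def)

lemma strand_low:
  assumes "eastward f g" "k < n"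
  shows "strand n f g ! k = low_point f (Suc (n - Suc k))" "strand n f g ! Suc k = low_point f (n - Suc k)"
  using assms nth_strand[of f g k n] nth_strand[of f g "Suc k" n] by (auto simp: low_point_def Suc_diff_Suc)

lemma strand_mid:
  assumes "eastward f g" "j \<le> east_count f g"
  shows "strand n f g ! (n + j) = (f 0 + 1 + int j, - (f 0 + 1 + int j))"
  using assms nth_strand[of f g "n + j" n] by auto

lemma strand_up:
  assumes "eastward f g" "r \<le> n"
  shows "strand n f g ! (n + east_count f g + r) = up_point g r"
proof (cases "r = 0")
  case True
  then show ?thesis using strand_mid[OF assms(1), of "east_count f g" n] int_east[OF assms(1)] by (simp add: up_point_def)
next
  case False
  then show ?thesis using nth_strand[OF assms(1), of "n + east_count f g + r" n] assms by simp
qed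

lemma position_cases:
  fixes k n e :: nat
  assumes "k < 2 * n + e"
  obtains "k < n" | j where "k = n + j" "j < e" | r where "k = n + e + r" "r < n"
proof -
  consider "k < n" | "n \<le> k" "k < n + e" | "n + e \<le> k" by linarith
  then show thesis
  proof cases
    case 2
    then show thesis using that(2)[of "k - n"] by simp
  next
    case 3
    then show thesis using that(3)[of "k - n - e"] assms by simp
  qed (use that in auto)
qed

lemma strand_steps:
  assumes ok: "strand_ok n f g" and k: "k < 2 * n + east_count f g"
  shows "E_step (strand n f g ! k) (strand n f g ! Suc k) \<longleftrightarrow> n \<le> k \<and> k < n + east_count f g" (is ?E)
    and "NE_step (strand n f g ! k) (strand n f g ! Suc k) \<longleftrightarrow> k < n \<and> f (Suc (n - Suc k)) = f (n - Suc k) \<or>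
      n + east_count f g \<le> k \<and> g (Suc (k - n - east_count f g)) \<noteq> g (k - n - east_count f g)" (is ?N)
    and "NE_step (strand n f g ! k) (strand n f g ! Suc k) \<or> NW_step (strand n f g ! k) (strand n f g ! Suc k) \<or>
      E_step (strand n f g ! k) (strand n f g ! Suc k) \<and> ht (strand n f g ! k) = 0" (is ?S)
proof -
  have fg: "eastward f g" using ok by (simp add: strand_ok_def)
  have "?E \<and> ?N \<and> ?S" using k
  proof (cases rule: position_cases)
    case 1
    have "f (Suc (n - Suc k)) = f (n - Suc k) \<or> f (Suc (n - Suc k)) = f (n - Suc k) + 1"
      using ok 1 by (simp add: strand_ok_def)
    then show ?thesis unfolding strand_low[OF fg 1] using 1 by (auto simp: low_point_def)
  next
    case (2 j)
    have e: "strand n f g ! k = (f 0 + 1 + int j, - (f 0 + 1 + int j))"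
      "strand n f g ! Suc k = (f 0 + 1 + int (Suc j), - (f 0 + 1 + int (Suc j)))"
      using strand_mid[OF fg, of j n] strand_mid[OF fg, of "Suc j" n] 2 by auto
    show ?thesis unfolding e using 2 by auto
  next
    case (3 r)
    have e: "strand n f g ! k = up_point g r" "strand n f g ! Suc k = up_point g (Suc r)"
      using strand_up[OF fg, of r n] strand_up[OF fg, of "Suc r" n] 3 by auto
    have "g (Suc r) = g r \<or> g (Suc r) = g r + 1" using ok 3 by (simp add: strand_ok_def)
    then show ?thesis unfolding e using 3 by (auto simp: up_point_def)
  qed
  then show ?E ?N ?S by blast+
qed

lemma E_steps_strand:
  assumes "strand_ok n f g" "0 < n"
  shows "E_steps (strand n f g) = {n..<n + east_count f g}"
proof -
  have "eastward f g" using assms by (simp add: strand_ok_def)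
  then show ?thesis using strand_steps(1)[OF assms(1)] assms(2) by (auto simp: E_steps_def length_strand)
qed

lemma strand_ends:
  assumes "eastward f g" "0 < n"
  shows "hd (strand n f g) = low_point f n" "last (strand n f g) = up_point g n"
proof -
  have ne: "strand n f g \<noteq> []" using length_strand[OF assms(1), of n] by (metis length_0_conv nat.distinct(1))
  show "hd (strand n f g) = low_point f n"
    using strand_low(1)[OF assms] assms(2) ne by (simp add: hd_conv_nth)
  have "length (strand n f g) - 1 = n + east_count f g + n" by (simp add: length_strand[OF assms(1)])
  then have "last (strand n f g) = strand n f g ! (n + east_count f g + n)"
    using last_conv_nth[OF ne] by (simp only:)
  then show "last (strand n f g) = up_point g n" using strand_up[OF assms(1), of n n] by simp
qed

lemma is_path_strand:
  assumes "strand_ok n f g" "0 < n" "odd (g 0 - f 0)"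
  shows "is_path n (strand n f g)"
proof -
  have fg: "eastward f g" using assms by (simp add: strand_ok_def)
  have "even (int (east_count f g))" unfolding int_east[OF fg] using assms(3) by simp
  then have "even (card (E_steps (strand n f g)))" unfolding E_steps_strand[OF assms(1,2)] by simp
  moreover have "strand n f g \<noteq> []" using length_strand[OF fg, of n] by (metis length_0_conv nat.distinct(1))
  ultimately show ?thesis
    using strand_steps(3)[OF assms(1)] strand_ends[OF fg assms(2)] by (simp add: is_path_def length_strand[OF fg])
qed

lemma mem_strand:
  assumes "eastward f g"
  shows "1 \<le> r \<Longrightarrow> r \<le> n \<Longrightarrow> w \<in> set (strand n f g) \<and> ht w = - int r \<longleftrightarrow> w = low_point f r"
    and "1 \<le> r \<Longrightarrow> r \<le> n \<Longrightarrow> w \<in> set (strand n f g) \<and> ht w = int r \<longleftrightarrow> w = up_point g r"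
    and "w \<in> set (strand n f g) \<and> ht w = 0 \<longleftrightarrow> (\<exists>x. f 0 < x \<and> x \<le> g 0 \<and> w = (x, - x))"
  unfolding set_strand by (auto simp: image_iff)

lemma strand_eqD:
  assumes eq: "strand n f g = strand n f' g'" and fg: "eastward f g" "eastward f' g'" and r: "r \<le> n"
  shows "f r = f' r" "g r = g' r"
proof -
  have mid: "f 0 < x \<and> x \<le> g 0 \<longleftrightarrow> f' 0 < x \<and> x \<le> g' 0" for x
    using mem_strand(3)[OF fg(1), of "(x, - x)" n] mem_strand(3)[OF fg(2), of "(x, - x)" n] unfolding eq by auto
  have zero: "f 0 = f' 0 \<and> g 0 = g' 0"
    using mid[of "f 0 + 1"] mid[of "f' 0 + 1"] mid[of "g 0"] mid[of "g' 0"] fg by (auto simp: eastward_def)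
  show "f r = f' r"
  proof (cases "r = 0")
    case False
    then have "low_point f r = low_point f' r"
      using mem_strand(1)[OF fg(1), of r n "low_point f r"] mem_strand(1)[OF fg(2), of r n "low_point f r"] r unfolding eq by auto
    then show ?thesis by (simp add: low_point_def)
  qed (use zero in simp)
  show "g r = g' r"
  proof (cases "r = 0")
    case False
    then have "up_point g r = up_point g' r"
      using mem_strand(2)[OF fg(1), of r n "up_point g r"] mem_strand(2)[OF fg(2), of r n "up_point g r"] r unfolding eq by auto
    then show ?thesis by (simp add: up_point_def)
  qed (use zero in simp)
qed

lemma NE_step_iff: "NE_step v w \<longleftrightarrow> fst w = fst v + 1 \<and> ht w = ht v + 1"
  by (cases v; cases w) auto

lemma NW_step_iff: "NW_step v w \<longleftrightarrow> fst w = fst v \<and> ht w = ht v + 1"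
  by (cases v; cases w) auto

lemma E_step_iff: "E_step v w \<longleftrightarrow> fst w = fst v + 1 \<and> ht w = ht v"
  by (cases v; cases w) auto

text \<open>Every step except an E-step raises the height by 1, and E-steps need height 0. So the
  first and the last \<open>n\<close> steps rise, everything between stays at height 0, and
  \<open>f\<close> and \<open>g\<close> are read off from the x-coordinates.\<close>

lemma path_strand:
  assumes path: "is_path n q" and n: "0 < n"
  obtains f g where "strand_ok n f g" "odd (g 0 - f 0)" "q = strand n f g"
proof -
  define N where "N = length q - 1"
  have len: "length q = Suc N" using path by (cases q) (auto simp: is_path_def N_def)
  define h where "h k = ht (q ! k)" for k
  have ends: "h 0 = - int n" "h N = int n"
    using path len by (auto simp: is_path_def h_def hd_conv_nth last_conv_nth)
  have steps: "fst (q ! Suc k) = fst (q ! k) + 1 \<and> h (Suc k) = h k + 1 \<or> fst (q ! Suc k) = fst (q ! k) \<and> h (Suc k) = h k + 1 \<or>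
      fst (q ! Suc k) = fst (q ! k) + 1 \<and> h (Suc k) = h k \<and> h k = 0" if "k < N" for k
    using path that len by (simp add: is_path_def NE_step_iff NW_step_iff E_step_iff h_def)
  have mono: "h k \<le> h k'" if "k \<le> k'" "k' \<le> N" for k k' using that
  proof (induction k' rule: dec_induct)
    case (step j)
    then show ?case using steps[of j] by auto
  qed simp
  have low: "k \<le> N \<and> h k = int k - int n" if "k \<le> n" for k using that
  proof (induction k)
    case (Suc k)
    then have IH: "k \<le> N" "h k = int k - int n" by auto
    have "k \<noteq> N" using ends(2) IH(2) Suc.prems by auto
    then show ?case using steps[of k] IH Suc.prems by auto
  qed (use ends in simp)
  have high: "k \<le> N \<and> h (N - k) = int n - int k" if "k \<le> n" for k using that
  proof (induction k)
    case (Suc k)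
    then have IH: "k \<le> N" "h (N - k) = int n - int k" by auto
    have "k \<noteq> N" using ends(1) IH(2) Suc.prems by auto
    then have "Suc (N - Suc k) = N - k" "N - Suc k < N" using IH by auto
    then show ?case using steps[of "N - Suc k"] IH Suc.prems by auto
  qed (use ends in simp)
  define e where "e = N - 2 * n"
  \<comment> \<open>The point \<open>n\<close> steps before the end has height 0, whereas all points
    before position \<open>n\<close> have negative height.\<close>
  have "\<not> N - n < n"
  proof
    assume "N - n < n"
    then show False using low[of "N - n"] high[of n] by auto
  qed
  then have N: "N = 2 * n + e" using high[of n] by (auto simp: e_def)
  define f g where "f r = fst (q ! (n - r)) - 1 + int r" and "g r = fst (q ! (n + e + r))" for r
  have zero: "h (n + j) = 0" if "j \<le> e" for j
    using mono[of n "n + j"] mono[of "n + j" "N - n"] low[of n] high[of n] N that by auto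
  have mid: "fst (q ! (n + j)) = f 0 + 1 + int j" if "j \<le> e" for j using that
  proof (induction j)
    case 0
    then show ?case by (simp add: f_def)
  next
    case (Suc j)
    then show ?case using steps[of "n + j"] zero[of j] zero[of "Suc j"] N n by auto
  qed
  have g0: "g 0 = f 0 + 1 + int e" using mid[of e] by (simp add: g_def)
  then have fg: "eastward f g" by (simp add: eastward_def)
  have ec: "east_count f g = e" using g0 by (simp add: east_count_def)
  have fs: "f (Suc r) = f r \<or> f (Suc r) = f r + 1" if "r < n" for r
  proof -
    have "Suc (n - Suc r) = n - r" "n - Suc r < N" using that N by auto
    then show ?thesis using steps[of "n - Suc r"] low[of "n - Suc r"] low[of "n - r"] that by (auto simp: f_def)
  qed
  have gs: "g (Suc r) = g r \<or> g (Suc r) = g r + 1" if "r < n" for r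
  proof -
    have *: "N - (n - r) = n + e + r" "N - (n - Suc r) = Suc (n + e + r)" "n + e + r < N" using that N by auto
    then show ?thesis using steps[of "n + e + r"] high[of "n - r"] high[of "n - Suc r"] that by (auto simp: g_def)
  qed
  have ok: "strand_ok n f g" using fg fs gs by (simp add: strand_ok_def)
  have pt: "w = (fst w, ht w - fst w)" for w :: point by (cases w) simp
  have q: "q = strand n f g"
  proof (rule nth_equalityI)
    show "length q = length (strand n f g)" by (simp add: length_strand[OF fg] len ec N)
    fix k assume "k < length q"
    then have k: "k \<le> 2 * n + e" using len N by simp
    consider "k < n" | j where "k = n + j" "j \<le> e" | r where "k = n + e + r" "r \<le> n"
    proof -
      assume *: "k < n \<Longrightarrow> thesis" "\<And>j. k = n + j \<Longrightarrow> j \<le> e \<Longrightarrow> thesis" "\<And>r. k = n + e + r \<Longrightarrow> r \<le> n \<Longrightarrow> thesis"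
      show thesis
        using *(1) *(2)[of "k - n"] *(3)[of "k - n - e"] k by (cases "k < n"; cases "k \<le> n + e") auto
    qed
    then show "q ! k = strand n f g ! k"
    proof cases
      case 1
      have "q ! k = (fst (q ! k), ht (q ! k) - fst (q ! k))" by (rule pt)
      moreover have "ht (q ! k) = int k - int n" using low[of k] 1 by (simp add: h_def)
      moreover have "fst (q ! k) = f (n - k) + 1 - int (n - k)" using 1 by (simp add: f_def)
      ultimately show ?thesis using nth_strand[OF fg, of k n] 1 by (simp add: low_point_def of_nat_diff)
    next
      case (2 j)
      have "q ! k = (fst (q ! k), ht (q ! k) - fst (q ! k))" by (rule pt)
      then show ?thesis using strand_mid[OF fg, of j n] mid[of j] zero[of j] 2 by (simp add: ec h_def)
    next
      case (3 r)
      have "q ! k = (fst (q ! k), ht (q ! k) - fst (q ! k))" by (rule pt)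
      moreover have "N - (n - r) = k" using 3 N by simp
      then have "ht (q ! k) = int r" using high[of "n - r"] 3 by (simp add: h_def of_nat_diff)
      ultimately show ?thesis using strand_up[OF fg, of r n] 3 by (simp add: ec up_point_def g_def)
    qed
  qed
  have "even (card (E_steps q))" using path by (simp add: is_path_def)
  then have "even e" unfolding q E_steps_strand[OF ok n] ec by simp
  then have "odd (g 0 - f 0)" unfolding g0 by simp
  then show thesis using that ok q by blast
qed

lemma NE_steps_strand:
  assumes "strand_ok n f g" "0 < n"
  shows "NE_steps (strand n f g) = {k. k < n \<and> f (Suc (n - Suc k)) = f (n - Suc k)} \<union>
    {k. n + east_count f g \<le> k \<and> k < 2 * n + east_count f g \<and> g (Suc (k - n - east_count f g)) \<noteq> g (k - n - east_count f g)}"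
proof -
  have "eastward f g" using assms by (simp add: strand_ok_def)
  then show ?thesis using strand_steps(2)[OF assms(1)] by (auto simp: NE_steps_def length_strand)
qed

lemma prod_split_positions:
  fixes w :: "nat \<Rightarrow> 'r::comm_monoid_mult"
  shows "(\<Prod>k<2 * n + e. w k) = (\<Prod>r<n. w (n - Suc r)) * (\<Prod>j<e. w (n + j)) * (\<Prod>r<n. w (n + e + r))"
proof -
  have add: "(\<Prod>k<a + b. v k) = (\<Prod>k<a. v k) * (\<Prod>k<b. v (a + k))" for a b and v :: "nat \<Rightarrow> 'r"
    by (induction b) (simp_all add: mult.assoc)
  have "2 * n + e = n + e + n" by simp
  then show ?thesis by (simp only: add prod.nat_diff_reindex)
qed

definition low_weight :: "complex \<Rightarrow> nat \<Rightarrow> (nat \<Rightarrow> int) \<Rightarrow> 'n::finite zring" where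
  "low_weight a n f = (\<Prod>r<n. if f (Suc r) = f r then zgen (Unbarred (n - r)) (a - 2 * of_int (f r - int r)) else 1)"

definition up_weight :: "complex \<Rightarrow> nat \<Rightarrow> (nat \<Rightarrow> int) \<Rightarrow> 'n::finite zring" where
  "up_weight a n g = (\<Prod>r<n. if g (Suc r) = g r then 1 else zgen (Barred (n - r)) (a - 2 * of_int (g r)))"

lemma path_weight_strand:
  assumes ok: "strand_ok n f g" and odd: "odd (g 0 - f 0)" and n: "n = CARD('n::finite)"
  shows "(path_weight a (strand n f g) :: 'n zring)
    = low_weight a n f
      * up_weight a n g
      * east_weight a (f 0 + 1) (g 0)"
proof -
  have n0: "0 < n" by (simp add: n)
  have fg: "eastward f g" using ok by (simp add: strand_ok_def)
  let ?q = "strand n f g"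
  define e where "e = east_count f g"
  define S where "S = NE_steps ?q \<union> E_steps ?q"
  define v :: "nat \<Rightarrow> 'n zring" where "v k = zgen (step_label n ?q k) (a - 2 * of_int (fst (?q ! k)))" for k
  have S: "S \<subseteq> {..<2 * n + e}" unfolding S_def NE_steps_strand[OF ok n0] E_steps_strand[OF ok n0] e_def by auto
  have Sl: "n - Suc r \<in> S \<longleftrightarrow> f (Suc r) = f r" if "r < n" for r
    using that unfolding S_def NE_steps_strand[OF ok n0] E_steps_strand[OF ok n0] by (auto simp: Suc_diff_Suc)
  have Sm: "n + j \<in> S" if "j < e" for j
    using that unfolding S_def NE_steps_strand[OF ok n0] E_steps_strand[OF ok n0] e_def by auto
  have Su: "n + e + r \<in> S \<longleftrightarrow> g (Suc r) \<noteq> g r" if "r < n" for r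
    using that unfolding S_def NE_steps_strand[OF ok n0] E_steps_strand[OF ok n0] e_def by auto
  have vl: "v (n - Suc r) = zgen (Unbarred (n - r)) (a - 2 * of_int (f r - int r))" if "r < n" "f (Suc r) = f r" for r
  proof -
    have q: "?q ! (n - Suc r) = low_point f (Suc r)"
      using strand_low(1)[OF fg, of "n - Suc r" n] that by (simp add: Suc_diff_Suc)
    have "step_label n ?q (n - Suc r) = Unbarred (n - r)"
      using that(1) unfolding step_label_def q Let_def by (simp add: nat_diff_distrib')
    then show ?thesis using that(2) unfolding v_def q by (simp add: low_point_def)
  qed
  have vu: "v (n + e + r) = zgen (Barred (n - r)) (a - 2 * of_int (g r))" if "r < n" for r
  proof -
    have q: "?q ! (n + e + r) = up_point g r" using strand_up[OF fg, of r n] that by (simp add: e_def)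
    have "n + e + r \<notin> E_steps ?q" unfolding E_steps_strand[OF ok n0] by (simp add: e_def)
    then have "step_label n ?q (n + e + r) = Barred (n - r)"
      using that unfolding step_label_def q Let_def by (simp add: nat_diff_distrib')
    then show ?thesis unfolding v_def q by (simp add: up_point_def)
  qed
  \<comment> \<open>The labels of the E-steps alternate, starting with the barred letter;
    \<open>j\<close> counts from 0, so the 2nd, 4th, ... E-steps have odd \<open>j\<close>.\<close>
  have vm: "v (n + j) = zgen (if even j then Barred n else Unbarred n) (a - 2 * of_int (f 0 + 1 + int j))" if "j < e" for j
  proof -
    have q: "?q ! (n + j) = (f 0 + 1 + int j, - (f 0 + 1 + int j))"
      using strand_mid[OF fg, of j n] that by (simp add: e_def)
    have "E_steps ?q \<inter> {..n + j} = {n..n + j}" "n + j \<in> E_steps ?q"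
      using that unfolding E_steps_strand[OF ok n0] e_def by auto
    then have "step_label n ?q (n + j) = (if even j then Barred n else Unbarred n)"
      unfolding step_label_def q Let_def by simp
    then show ?thesis unfolding v_def q by simp
  qed
  have "path_weight a ?q = (\<Prod>k\<in>S. v k)" by (simp add: path_weight_def S_def v_def n)
  also have "\<dots> = (\<Prod>k<2 * n + e. if k \<in> S then v k else 1)" using S by (simp add: prod.If_cases Int_absorb1)
  also have "\<dots> = (\<Prod>r<n. if n - Suc r \<in> S then v (n - Suc r) else 1) * (\<Prod>j<e. if n + j \<in> S then v (n + j) else 1)
      * (\<Prod>r<n. if n + e + r \<in> S then v (n + e + r) else 1)" by (rule prod_split_positions)
  also have "(\<Prod>r<n. if n - Suc r \<in> S then v (n - Suc r) else 1) = low_weight a n f"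
    unfolding low_weight_def by (rule prod.cong) (use Sl vl in auto)
  also have "(\<Prod>r<n. if n + e + r \<in> S then v (n + e + r) else 1) = up_weight a n g"
    unfolding up_weight_def by (rule prod.cong) (use Su vu in auto)
  also have "(\<Prod>j<e. if n + j \<in> S then v (n + j) else 1)
    = (\<Prod>j<e. zgen (if even j then Barred n else Unbarred n) (a - 2 * of_int (f 0 + 1 + int j)))"
    by (rule prod.cong) (use Sm vm in auto)
  also have "\<dots> = east_weight a (f 0 + 1) (g 0)"
  proof -
    define m where "m = e div 2"
    have "even (int e)" unfolding e_def int_east[OF fg] using odd by simp
    then have m: "e = 2 * m" by (simp add: m_def)
    have "int e = g 0 - f 0 - 1" unfolding e_def by (rule int_east[OF fg])
    then have "nat ((g 0 - (f 0 + 1)) div 2) = m" using m by simp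
    then show ?thesis unfolding east_weight_def m n[symmetric]
    proof (simp only:)
      show "(\<Prod>j<2 * m. zgen (if even j then Barred n else Unbarred n) (a - 2 * of_int (f 0 + 1 + int j)))
        = (\<Prod>j<m. zgen (Barred n) (a - 2 * of_int (f 0 + 1 + 2 * int j)) * zgen (Unbarred n) (a - 2 * of_int (f 0 + 1 + 2 * int j + 1)) :: 'n zring)"
      proof (induction m)
        case (Suc m)
        have "2 * Suc m = Suc (Suc (2 * m))" by simp
        then show ?case using Suc by (simp add: mult.assoc algebra_simps)
      qed simp
    qed
  qed
  finally show ?thesis by (simp only: ac_simps)
qed

lemma strand_cong:
  assumes "\<And>r. r \<le> n \<Longrightarrow> f r = f' r" "\<And>r. r \<le> n \<Longrightarrow> g r = g' r"
  shows "strand n f g = strand n f' g'"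
  unfolding strand_def using assms by (auto simp: low_point_def up_point_def)

lemma leftmost_strand:
  assumes "eastward f g"
  shows "leftmost_hp0 (strand n f g) = of_int (f 0 + 1)"
proof -
  have "{w \<in> set (strand n f g). ht w = 0} = (\<lambda>x. (x, - x)) ` {f 0<..g 0}"
    using mem_strand(3)[OF assms] by auto
  then have "hp ` {w \<in> set (strand n f g). ht w = 0} = real_of_int ` {f 0<..g 0}" by (auto simp: image_image)
  moreover have "Min (real_of_int ` {f 0<..g 0}) = of_int (f 0 + 1)"
  proof (rule Min_eqI)
    show "real_of_int (f 0 + 1) \<in> real_of_int ` {f 0<..g 0}"
      by (rule imageI) (use assms in \<open>simp add: eastward_def\<close>)
  qed auto
  ultimately show ?thesis by (simp add: leftmost_hp0_def)
qed

text \<open>Off height 0 no meeting is allowed, so going from the top row inwards the strands keep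
  their strict order, each moving by at most 1 per row. At height 0 coinciding left or right ends
  would be an ordinary intersection. Otherwise a meeting is special iff \<open>f 0 - f' 0\<close> is
  odd, which is the same as \<open>g' 0 - f 0\<close> being even because both strands have odd
  length there.\<close>

lemma not_ordinarily_iff:
  assumes ok: "strand_ok n f g" "strand_ok n f' g'" and odd: "odd (g 0 - f 0)" "odd (g' 0 - f' 0)"
    and top: "f' n < f n" "g' n < g n"
  shows "\<not> ordinarily_intersecting (strand n f g) (strand n f' g') \<longleftrightarrow>
    (\<forall>r\<le>n. f' r < f r \<and> g' r < g r) \<and> (g' 0 \<le> f 0 \<or> even (g' 0 - f 0))"
proof -
  have ew: "eastward f g" "eastward f' g'" using ok by (auto simp: strand_ok_def)
  then have lt: "f 0 < g 0" "f' 0 < g' 0" by (auto simp: eastward_def)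
  let ?I = "set (strand n f g) \<inter> set (strand n f' g')"
  define nz where "nz \<longleftrightarrow> (\<exists>r. 1 \<le> r \<and> r \<le> n \<and> (f r = f' r \<or> g r = g' r))"
  define z where "z \<longleftrightarrow> (\<exists>x. f 0 < x \<and> x \<le> g 0 \<and> f' 0 < x \<and> x \<le> g' 0)"
  have low: "low_point f r = low_point f' r \<longleftrightarrow> f r = f' r" and up: "up_point g r = up_point g' r \<longleftrightarrow> g r = g' r" for r
    by (auto simp: low_point_def up_point_def)
  have nz: "(\<exists>w\<in>?I. ht w \<noteq> 0) \<longleftrightarrow> nz"
  proof
    assume "\<exists>w\<in>?I. ht w \<noteq> 0"
    then obtain w where w: "w \<in> set (strand n f g)" "w \<in> set (strand n f' g')" "ht w \<noteq> 0" by auto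
    have "(\<exists>r\<in>{1..n}. w = low_point f r) \<or> (\<exists>r\<in>{1..n}. w = up_point g r)"
      using w(1,3) unfolding set_strand by auto
    then consider r where "1 \<le> r" "r \<le> n" "w = low_point f r" | r where "1 \<le> r" "r \<le> n" "w = up_point g r"
      by (meson atLeastAtMost_iff)
    then show nz
    proof cases
      case (1 r)
      then have "w = low_point f' r" using mem_strand(1)[OF ew(2), of r n w] w(2) by auto
      then show ?thesis using 1 low[of r] by (auto simp: nz_def)
    next
      case (2 r)
      then have "w = up_point g' r" using mem_strand(2)[OF ew(2), of r n w] w(2) by auto
      then show ?thesis using 2 up[of r] by (auto simp: nz_def)
    qed
  next
    assume nz
    then obtain r where r: "1 \<le> r" "r \<le> n" "f r = f' r \<or> g r = g' r" by (auto simp: nz_def)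
    then show "\<exists>w\<in>?I. ht w \<noteq> 0"
    proof (elim disjE)
      assume "f r = f' r"
      then have "low_point f r \<in> ?I" using low[of r] mem_strand(1)[OF ew(1) r(1,2), of "low_point f r"] mem_strand(1)[OF ew(2) r(1,2), of "low_point f r"] by blast
      then show ?thesis by (rule bexI[rotated]) (use r in simp)
    next
      assume "g r = g' r"
      then have "up_point g r \<in> ?I" using up[of r] mem_strand(2)[OF ew(1) r(1,2), of "up_point g r"] mem_strand(2)[OF ew(2) r(1,2), of "up_point g r"] by blast
      then show ?thesis by (rule bexI[rotated]) (use r in simp)
    qed
  qed
  have z: "(\<exists>w\<in>?I. ht w = 0) \<longleftrightarrow> z"
  proof
    assume "\<exists>w\<in>?I. ht w = 0"
    then obtain w where w: "w \<in> set (strand n f g)" "w \<in> set (strand n f' g')" "ht w = 0" by blast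
    obtain x where x: "f 0 < x" "x \<le> g 0" "w = (x, - x)" using mem_strand(3)[OF ew(1), of w n] w by blast
    obtain y where y: "f' 0 < y" "y \<le> g' 0" "w = (y, - y)" using mem_strand(3)[OF ew(2), of w n] w by blast
    have "x = y" using x(3) y(3) by simp
    then show z using x y unfolding z_def by blast
  next
    assume z
    then obtain x where x: "f 0 < x" "x \<le> g 0" "f' 0 < x" "x \<le> g' 0" unfolding z_def by blast
    then have "(x, - x) \<in> ?I \<and> ht (x, - x) = 0"
      using mem_strand(3)[OF ew(1), of "(x, - x)" n] mem_strand(3)[OF ew(2), of "(x, - x)" n] by blast
    then show "\<exists>w\<in>?I. ht w = 0" by blast
  qed
  have "(\<exists>d::int. odd d \<and> leftmost_hp0 (strand n f g) - leftmost_hp0 (strand n f' g') = of_int d) \<longleftrightarrow> odd (f 0 - f' 0)"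
  proof -
    have "leftmost_hp0 (strand n f g) - leftmost_hp0 (strand n f' g') = real_of_int (f 0 - f' 0)"
      by (simp add: leftmost_strand[OF ew(1)] leftmost_strand[OF ew(2)])
    then show ?thesis by (simp only: of_int_eq_iff) blast
  qed
  moreover have "?I \<noteq> {} \<longleftrightarrow> nz \<or> z" unfolding nz[symmetric] z[symmetric] by blast
  moreover have "(\<forall>w\<in>?I. ht w = 0) \<longleftrightarrow> \<not> nz" unfolding nz[symmetric] by blast
  ultimately have ord: "\<not> ordinarily_intersecting (strand n f g) (strand n f' g') \<longleftrightarrow> \<not> nz \<and> (\<not> z \<or> odd (f 0 - f' 0))"
    unfolding ordinarily_intersecting_def specially_intersecting_def intersecting_def by blast
  show ?thesis unfolding ord
  proof
    assume a: "\<not> nz \<and> (\<not> z \<or> odd (f 0 - f' 0))"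
    have le: "f' r \<le> f r \<and> g' r \<le> g r \<and> (1 \<le> r \<longrightarrow> f' r < f r \<and> g' r < g r)" if "r \<le> n" for r using that
    proof (induction "n - r" arbitrary: r)
      case 0
      then have "r = n" by simp
      then show ?case using top by simp
    next
      case (Suc d)
      then have r: "r < n" "d = n - Suc r" by auto
      have IH: "f' (Suc r) < f (Suc r)" "g' (Suc r) < g (Suc r)" using Suc.hyps(1)[OF r(2)] r(1) by auto
      have "f (Suc r) = f r \<or> f (Suc r) = f r + 1" "f' (Suc r) = f' r \<or> f' (Suc r) = f' r + 1"
        "g (Suc r) = g r \<or> g (Suc r) = g r + 1" "g' (Suc r) = g' r \<or> g' (Suc r) = g' r + 1"
        using ok r(1) by (auto simp: strand_ok_def)
      then have "f' r \<le> f r" "g' r \<le> g r" using IH by auto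
      moreover have "1 \<le> r \<Longrightarrow> f r \<noteq> f' r \<and> g r \<noteq> g' r" using a r(1) unfolding nz_def by auto
      ultimately show ?case by force
    qed
    have "f' 0 \<noteq> f 0"
    proof
      assume eq: "f' 0 = f 0"
      then have z unfolding z_def using lt by (intro exI[of _ "f 0 + 1"]) auto
      then show False using a eq by simp
    qed
    moreover have "g' 0 \<noteq> g 0"
    proof
      assume eq: "g' 0 = g 0"
      then have z unfolding z_def using lt by (intro exI[of _ "g 0"]) auto
      moreover have "even ((g' 0 - f' 0) - (g 0 - f 0))" using odd by simp
      then have "even (f 0 - f' 0)" using eq by simp
      ultimately show False using a by blast
    qed
    moreover have "f' 0 \<le> f 0" "g' 0 \<le> g 0" using le[of 0] by auto
    ultimately have zero: "f' 0 < f 0" "g' 0 < g 0" by auto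
    have "even (g' 0 - f 0)" if "f 0 < g' 0"
    proof -
      have z unfolding z_def using lt zero that by (intro exI[of _ "g' 0"]) auto
      then have "odd (f 0 - f' 0)" using a by blast
      then have "even ((g' 0 - f' 0) - (f 0 - f' 0))" using odd by simp
      then show ?thesis by simp
    qed
    moreover have "f' r < f r \<and> g' r < g r" if "r \<le> n" for r using le[OF that] zero by (cases "r = 0") auto
    ultimately show "(\<forall>r\<le>n. f' r < f r \<and> g' r < g r) \<and> (g' 0 \<le> f 0 \<or> even (g' 0 - f 0))" by (meson not_le)
  next
    assume a: "(\<forall>r\<le>n. f' r < f r \<and> g' r < g r) \<and> (g' 0 \<le> f 0 \<or> even (g' 0 - f 0))"
    then have "\<not> nz" unfolding nz_def by (metis less_irrefl)
    moreover have "odd (f 0 - f' 0)" if z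
    proof -
      have "f 0 < g' 0" using that unfolding z_def by auto
      then have "even (g' 0 - f 0)" using a by auto
      then have "odd ((g' 0 - f' 0) - (g' 0 - f 0))" using odd by simp
      then show ?thesis by simp
    qed
    ultimately show "\<not> nz \<and> (\<not> z \<or> odd (f 0 - f' 0))" by blast
  qed
qed

section \<open>Tuples of paths as pairs of families\<close>

context family_pairs
begin

definition tuple_paths :: "family \<times> family \<Rightarrow> nat \<Rightarrow> path" where
  "tuple_paths p = restrict (\<lambda>i. strand n (\<lambda>r. fst p r i) (\<lambda>r. snd p r i)) {1..l}"

lemma row_matchedD:
  assumes "p \<in> pairs" "row_matched p" "i \<in> {1..l}"
  shows "fst p 0 i < snd p 0 i" "odd (snd p 0 i - fst p 0 i)"
    "i < l \<Longrightarrow> snd p 0 (i + 1) \<le> fst p 0 i \<or> even (snd p 0 (i + 1) - fst p 0 i)"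
proof -
  interpret rp: tuple_pair l "fst p 0" "snd p 0" by (rule row_pair[OF assms(1)])
  show "fst p 0 i < snd p 0 i" "odd (snd p 0 i - fst p 0 i)"
    "i < l \<Longrightarrow> snd p 0 (i + 1) \<le> fst p 0 i \<or> even (snd p 0 (i + 1) - fst p 0 i)"
    using assms(2,3) unfolding row_matched_def rp.matched_def by blast+
qed

lemma matched_strand_ok:
  assumes "p \<in> pairs" "row_matched p" "i \<in> {1..l}"
  shows "strand_ok n (\<lambda>r. fst p r i) (\<lambda>r. snd p r i)"
proof -
  have "fst p \<in> families l n T" "snd p \<in> families l n T'" using assms(1) by auto
  then show ?thesis
    using row_matchedD(1)[OF assms] families_step[of "fst p" l n T _ i] families_step[of "snd p" l n T' _ i] assms(3)
    by (auto simp: strand_ok_def eastward_def)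
qed

definition end_paths :: "nat \<Rightarrow> path set" where
  "end_paths i = {q. is_path n q \<and> hd q = (T i + 1 - int n, - T i - 1) \<and> last q = (T' i, int n - T' i)}"

text \<open>Condition (i) concerns adjacent paths only, but the order that it enforces is
  transitive, so all rows are strictly decreasing tuples. What it says beyond this at height 0 is
  \<open>row_matched\<close>.\<close>

lemma tuple_paths_bij:
  "bij_betw tuple_paths {p \<in> pairs. row_matched p}
     {P \<in> (\<Pi>\<^sub>E i\<in>{1..l}. end_paths i). \<forall>i\<in>{1..<l}. \<not> ordinarily_intersecting (P i) (P (i + 1))}"
  unfolding bij_betw_def
proof
  show "inj_on tuple_paths {p \<in> pairs. row_matched p}"
  proof (rule inj_onI)
    fix p q assume "p \<in> {p \<in> pairs. row_matched p}" "q \<in> {p \<in> pairs. row_matched p}" and eq: "tuple_paths p = tuple_paths q"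
    then have p: "p \<in> pairs" "row_matched p" and q: "q \<in> pairs" "row_matched q" by blast+
    have eqi: "fst p r i = fst q r i \<and> snd p r i = snd q r i" if "r \<le> n" "i \<in> {1..l}" for r i
    proof -
      have s: "strand n (\<lambda>r. fst p r i) (\<lambda>r. snd p r i) = strand n (\<lambda>r. fst q r i) (\<lambda>r. snd q r i)"
        using fun_cong[OF eq, of i] that(2) by (simp add: tuple_paths_def)
      have "eastward (\<lambda>r. fst p r i) (\<lambda>r. snd p r i)" "eastward (\<lambda>r. fst q r i) (\<lambda>r. snd q r i)"
        using matched_strand_ok[OF p that(2)] matched_strand_ok[OF q that(2)] by (auto simp: strand_ok_def)
      from strand_eqD[OF s this that(1)] show ?thesis by simp
    qed
    have ext: "F = F'" if "F \<in> families l n X" "F' \<in> families l n X" "\<And>r i. r \<le> n \<Longrightarrow> i \<in> {1..l} \<Longrightarrow> F r i = F' r i" for F F' X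
    proof (rule extensionalityI)
      show "F \<in> extensional {..n}" "F' \<in> extensional {..n}" using that by (auto simp: families_def)
      fix r assume "r \<in> {..n}"
      then have r: "r \<le> n" by simp
      show "F r = F' r"
      proof (rule extensionalityI)
        show "F r \<in> extensional {1..l}" "F' r \<in> extensional {1..l}"
          using families_tuples[OF that(1) r] families_tuples[OF that(2) r] by (auto simp: tuples_def)
      qed (use that(3)[OF r] in auto)
    qed
    have "fst p = fst q" using p(1) q(1) eqi by (intro ext[of _ T]) auto
    moreover have "snd p = snd q" using p(1) q(1) eqi by (intro ext[of _ T']) auto
    ultimately show "p = q" by (simp add: prod_eq_iff)
  qed
  show "tuple_paths ` {p \<in> pairs. row_matched p}
    = {P \<in> (\<Pi>\<^sub>E i\<in>{1..l}. end_paths i). \<forall>i\<in>{1..<l}. \<not> ordinarily_intersecting (P i) (P (i + 1))}" (is "_ = ?B")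
  proof (intro equalityI subsetI)
    fix P assume "P \<in> tuple_paths ` {p \<in> pairs. row_matched p}"
    then obtain p where p: "p \<in> pairs" "row_matched p" "P = tuple_paths p" by blast
    have Pi: "P i = strand n (\<lambda>r. fst p r i) (\<lambda>r. snd p r i)" if "i \<in> {1..l}" for i
      using that by (simp add: p(3) tuple_paths_def)
    have "P i \<in> end_paths i" if i: "i \<in> {1..l}" for i
    proof -
      have ok: "strand_ok n (\<lambda>r. fst p r i) (\<lambda>r. snd p r i)" by (rule matched_strand_ok[OF p(1,2) i])
      then have ew: "eastward (\<lambda>r. fst p r i) (\<lambda>r. snd p r i)" by (simp add: strand_ok_def)
      have "fst p n i = T i" "snd p n i = T' i" using p(1) i families_top[of "fst p" l n T i] families_top[of "snd p" l n T' i] by auto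
      then show ?thesis
        using is_path_strand[OF ok n_pos] row_matchedD(2)[OF p(1,2) i] strand_ends[OF ew n_pos]
        by (simp add: end_paths_def Pi[OF i] low_point_def up_point_def)
    qed
    moreover have "\<not> ordinarily_intersecting (P i) (P (i + 1))" if "i \<in> {1..<l}" for i
    proof -
      have i: "i \<in> {1..l}" "i + 1 \<in> {1..l}" "i < l" using that by auto
      have strict: "fst p r (i + 1) < fst p r i \<and> snd p r (i + 1) < snd p r i" if "r \<le> n" for r
        using pair_tuples[OF p(1) that] tuples_strict[of _ l i "i + 1"] i by auto
      have "\<not> ordinarily_intersecting (strand n (\<lambda>r. fst p r i) (\<lambda>r. snd p r i)) (strand n (\<lambda>r. fst p r (i + 1)) (\<lambda>r. snd p r (i + 1)))"
        using not_ordinarily_iff[OF matched_strand_ok[OF p(1,2) i(1)] matched_strand_ok[OF p(1,2) i(2)]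
            row_matchedD(2)[OF p(1,2) i(1)] row_matchedD(2)[OF p(1,2) i(2)]]
          strict row_matchedD(3)[OF p(1,2) i(1,3)] by blast
      then show ?thesis by (simp only: Pi[OF i(1)] Pi[OF i(2)] not_False_eq_True)
    qed
    moreover have "P \<in> extensional {1..l}" by (simp add: p(3) tuple_paths_def)
    ultimately show "P \<in> ?B" by (simp add: PiE_iff)
  next
    fix P assume P: "P \<in> ?B"
    have "\<forall>i. \<exists>f g. i \<in> {1..l} \<longrightarrow> strand_ok n f g \<and> odd (g 0 - f 0) \<and> P i = strand n f g"
    proof
      fix i
      show "\<exists>f g. i \<in> {1..l} \<longrightarrow> strand_ok n f g \<and> odd (g 0 - f 0) \<and> P i = strand n f g"
      proof (cases "i \<in> {1..l}")
        case True
        then have "is_path n (P i)" using P by (auto simp: end_paths_def PiE_iff)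
        from path_strand[OF this n_pos] show ?thesis by blast
      qed blast
    qed
    then obtain f g where fg: "\<And>i. i \<in> {1..l} \<Longrightarrow> strand_ok n (f i) (g i)" "\<And>i. i \<in> {1..l} \<Longrightarrow> odd (g i 0 - f i 0)"
      "\<And>i. i \<in> {1..l} \<Longrightarrow> P i = strand n (f i) (g i)" by metis
    have tops: "f i n = T i \<and> g i n = T' i" if i: "i \<in> {1..l}" for i
    proof -
      have "eastward (f i) (g i)" using fg(1)[OF i] by (simp add: strand_ok_def)
      moreover have "P i \<in> end_paths i" using P i by (auto simp: PiE_iff)
      ultimately show ?thesis
        using strand_ends[of "f i" "g i" n] n_pos by (simp add: end_paths_def fg(3)[OF i] low_point_def up_point_def)
    qed
    have adj: "(\<forall>r\<le>n. f (i + 1) r < f i r \<and> g (i + 1) r < g i r) \<and> (g (i + 1) 0 \<le> f i 0 \<or> even (g (i + 1) 0 - f i 0))"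
      if "i \<in> {1..<l}" for i
    proof -
      have i: "i \<in> {1..l}" "i + 1 \<in> {1..l}" using that by auto
      have "\<not> ordinarily_intersecting (strand n (f i) (g i)) (strand n (f (i + 1)) (g (i + 1)))"
        using P that unfolding fg(3)[OF i(1), symmetric] fg(3)[OF i(2), symmetric] by blast
      moreover have "f (i + 1) n < f i n" "g (i + 1) n < g i n"
        using tops[OF i(1)] tops[OF i(2)] tuples_strict[OF T, of i "i + 1"] tuples_strict[OF T', of i "i + 1"] that by auto
      ultimately show ?thesis
        using not_ordinarily_iff[OF fg(1)[OF i(1)] fg(1)[OF i(2)] fg(2)[OF i(1)] fg(2)[OF i(2)]] by blast
    qed
    have strict: "f j r < f i r \<and> g j r < g i r" if "1 \<le> i" "i < j" "j \<le> l" "r \<le> n" for i j r using that(2,3)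
    proof (induction j)
      case (Suc j)
      then show ?case
      proof (cases "i = j")
        case True
        then show ?thesis using adj[of i] that(1,4) Suc.prems by simp
      next
        case False
        then have "f j r < f i r \<and> g j r < g i r" using Suc by simp
        moreover have "f (j + 1) r < f j r \<and> g (j + 1) r < g j r" using adj[of j] that(1,4) Suc.prems by simp
        ultimately show ?thesis by simp
      qed
    qed simp
    define F G where "F = restrict (\<lambda>r. restrict (\<lambda>i. f i r) {1..l}) {..n}" and "G = restrict (\<lambda>r. restrict (\<lambda>i. g i r) {1..l}) {..n}"
    have FG: "F r i = f i r" "G r i = g i r" if "r \<le> n" "i \<in> {1..l}" for r i using that by (auto simp: F_def G_def)
    have fam: "F \<in> families l n T" "G \<in> families l n T'"
    proof -
      have st: "f i (Suc r) = f i r \<or> f i (Suc r) = f i r + 1" "g i (Suc r) = g i r \<or> g i (Suc r) = g i r + 1"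
        if "r < n" "i \<in> {1..l}" for i r using fg(1)[OF that(2)] that(1) by (auto simp: strand_ok_def)
      have tup: "F r \<in> tuples l" "G r \<in> tuples l" if "r \<le> n" for r
        using strict that by (auto simp: tuples_def F_def G_def)
      have "F \<in> extensional {..n}" "G \<in> extensional {..n}" by (simp_all add: F_def G_def)
      moreover have "F (Suc r) i = F r i \<or> F (Suc r) i = F r i + 1" "G (Suc r) i = G r i \<or> G (Suc r) i = G r i + 1"
        if "r < n" "i \<in> {1..l}" for r i using st[OF that] FG[of r i] FG[of "Suc r" i] that by simp_all
      moreover have "F n i = T i" "G n i = T' i" if "i \<in> {1..l}" for i
        using tops[OF that] FG[of n i] that by simp_all
      ultimately show "F \<in> families l n T" "G \<in> families l n T'" unfolding families_def using tup by blast+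
    qed
    have pr: "(F, G) \<in> pairs" using fam by simp
    interpret rp: tuple_pair l "fst (F, G) 0" "snd (F, G) 0" by (rule row_pair[OF pr])
    have "row_matched (F, G)" unfolding row_matched_def rp.matched_def
    proof (intro ballI)
      fix i assume i: "i \<in> {1..l}"
      have "f i 0 < g i 0" using fg(1)[OF i] by (simp add: strand_ok_def eastward_def)
      moreover have "i < l \<Longrightarrow> G 0 (i + 1) = g (i + 1) 0" using FG(2)[of 0 "i + 1"] by simp
      ultimately show "fst (F, G) 0 i < snd (F, G) 0 i \<and> odd (snd (F, G) 0 i - fst (F, G) 0 i) \<and>
        (i < l \<longrightarrow> snd (F, G) 0 (i + 1) \<le> fst (F, G) 0 i \<or> even (snd (F, G) 0 (i + 1) - fst (F, G) 0 i))"
        using fg(2)[OF i] adj[of i] FG[of 0 i] i by simp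
    qed
    moreover have "tuple_paths (F, G) = P"
    proof (rule extensionalityI)
      show "tuple_paths (F, G) \<in> extensional {1..l}" "P \<in> extensional {1..l}" using P by (auto simp: tuple_paths_def PiE_iff)
      fix i assume i: "i \<in> {1..l}"
      have "strand n (\<lambda>r. F r i) (\<lambda>r. G r i) = strand n (f i) (g i)" by (rule strand_cong) (use FG i in auto)
      then show "tuple_paths (F, G) i = P i" using i by (simp add: tuple_paths_def fg(3)[OF i])
    qed
    ultimately show "P \<in> tuple_paths ` {p \<in> pairs. row_matched p}" using pr by (intro image_eqI[of _ _ "(F, G)"]) auto
  qed
qed

lemma tuple_weight_paths:
  assumes n: "n = CARD('n::finite)" and p: "p \<in> pairs" "row_matched p"
  shows "(tuple_weight l a (tuple_paths p) :: 'n zring) = pair_weight a l p"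
proof -
  have "(tuple_weight l a (tuple_paths p) :: 'n zring)
    = (\<Prod>i=1..l. low_weight a n (\<lambda>r. fst p r i)
      * up_weight a n (\<lambda>r. snd p r i)
      * east_weight a (fst p 0 i + 1) (snd p 0 i))" unfolding tuple_weight_def
  proof (rule prod.cong[OF refl])
    fix i assume i: "i \<in> {1..l}"
    have "path_weight a (tuple_paths p i) = (path_weight a (strand n (\<lambda>r. fst p r i) (\<lambda>r. snd p r i)) :: 'n zring)"
      using i by (simp add: tuple_paths_def)
    then show "(path_weight a (tuple_paths p i) :: 'n zring) = low_weight a n (\<lambda>r. fst p r i)
      * up_weight a n (\<lambda>r. snd p r i)
      * east_weight a (fst p 0 i + 1) (snd p 0 i)"
      by (simp only: path_weight_strand[OF matched_strand_ok[OF p i] row_matchedD(2)[OF p i] n])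
  qed
  also have "\<dots> = pair_weight a l p"
    unfolding low_weight_def up_weight_def prod.distrib prod.swap[of _ "{..<n}" "{1..l}"] pair_weight_def lower_weight_def upper_weight_def family_weight_def n[symmetric] ..
  finally show ?thesis .
qed

end

section \<open>Lower and upper parts of a strand\<close>

lemma filter_strand:
  shows "filter (\<lambda>w. ht w < 0) (strand n f g) = map (low_point f) (rev [1..<Suc n])"
    and "filter (\<lambda>w. ht w = 0) (strand n f g) = map (\<lambda>x. (x, - x)) [f 0 + 1..g 0]"
    and "filter (\<lambda>w. ht w > 0) (strand n f g) = map (up_point g) [1..<Suc n]"
proof -
  let ?A = "map (low_point f) (rev [1..<Suc n])" and ?B = "map (\<lambda>x. (x, - x)) [f 0 + 1..g 0]" and ?C = "map (up_point g) [1..<Suc n]"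
  have A: "w \<in> set ?A \<Longrightarrow> ht w < 0" and B: "w \<in> set ?B \<Longrightarrow> ht w = 0" and C: "w \<in> set ?C \<Longrightarrow> 0 < ht w" for w
    by (auto simp del: upt_Suc)
  have all: "filter Q xs = xs" if "\<And>w. w \<in> set xs \<Longrightarrow> Q w" for Q and xs :: "point list"
    using that by (simp add: filter_id_conv)
  have none: "filter Q xs = []" if "\<And>w. w \<in> set xs \<Longrightarrow> \<not> Q w" for Q and xs :: "point list"
    using that by (simp add: filter_empty_conv)
  have "filter (\<lambda>w. ht w < 0) ?A = ?A" "filter (\<lambda>w. ht w < 0) ?B = []" "filter (\<lambda>w. ht w < 0) ?C = []"
    by (rule all, erule A) (rule none, drule B C, simp)+
  then show "filter (\<lambda>w. ht w < 0) (strand n f g) = ?A"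
    unfolding strand_def filter_append by (simp only: append_Nil2)
  have "filter (\<lambda>w. ht w = 0) ?A = []" "filter (\<lambda>w. ht w = 0) ?B = ?B" "filter (\<lambda>w. ht w = 0) ?C = []"
    by (rule none, drule A, simp) (rule all, erule B, rule none, drule C, simp)
  then show "filter (\<lambda>w. ht w = 0) (strand n f g) = ?B"
    unfolding strand_def filter_append by (simp only: append_Nil2 append_Nil)
  have "filter (\<lambda>w. ht w > 0) ?A = []" "filter (\<lambda>w. ht w > 0) ?B = []" "filter (\<lambda>w. ht w > 0) ?C = ?C"
    by (rule none, drule A, simp) (rule none, drule B, simp, rule all, erule C)
  then show "filter (\<lambda>w. ht w > 0) (strand n f g) = ?C"
    unfolding strand_def filter_append by (simp only: append_Nil)
qed

lemma strand_parts:
  assumes "eastward f g"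
  shows "lower_part (strand n f g) = map (low_point f) (rev [0..<Suc n])"
    and "upper_part (strand n f g) = map (up_point g) [0..<Suc n]"
proof -
  have "f 0 + 1 \<le> g 0" using assms by (simp add: eastward_def)
  then have "[f 0 + 1..g 0] = (f 0 + 1) # [f 0 + 1 + 1..g 0]" "[f 0 + 1..g 0] = [f 0 + 1..g 0 - 1] @ [g 0]"
    by (rule upto_rec1, rule upto_rec2)
  then have ne: "[f 0 + 1..g 0] \<noteq> []" "hd [f 0 + 1..g 0] = f 0 + 1" "last [f 0 + 1..g 0] = g 0"
    by (metis list.distinct(1), metis list.sel(1), metis last_snoc)
  have up: "[0..<Suc n] = 0 # [1..<Suc n]" by (simp add: upt_conv_Cons del: upt_Suc)
  show "lower_part (strand n f g) = map (low_point f) (rev [0..<Suc n])"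
    unfolding lower_part_def filter_strand up using ne by (simp add: hd_map low_point_def del: upt_Suc)
  show "upper_part (strand n f g) = map (up_point g) [0..<Suc n]"
    unfolding upper_part_def filter_strand up using ne by (simp add: last_map up_point_def del: upt_Suc)
qed

lemma hp_at_strand:
  assumes "eastward f g" "r \<le> n"
  shows "hp_at (lower_part (strand n f g)) (- int r) = of_int (f r) + 1 - of_nat r / 2"
    and "hp_at (upper_part (strand n f g)) (int r) = of_int (g r) - of_nat r / 2"
proof -
  have hp: "hp (low_point f r) = of_int (f r) + 1 - of_nat r / 2" "hp (up_point g r) = of_int (g r) - of_nat r / 2"
    by (simp_all add: low_point_def up_point_def field_simps)
  have mem: "w \<in> set (map (low_point f) (rev [0..<Suc n])) \<and> ht w = - int r \<longleftrightarrow> w = low_point f r"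
    "w \<in> set (map (up_point g) [0..<Suc n]) \<and> ht w = int r \<longleftrightarrow> w = up_point g r" for w
    using assms(2) by (auto simp del: upt_Suc)
  show "hp_at (lower_part (strand n f g)) (- int r) = of_int (f r) + 1 - of_nat r / 2"
    unfolding hp_at_def strand_parts(1)[OF assms(1)]
  proof (rule the_equality)
    show "\<exists>w\<in>set (map (low_point f) (rev [0..<Suc n])). ht w = - int r \<and> hp w = of_int (f r) + 1 - of_nat r / 2"
      using mem(1)[of "low_point f r"] hp(1) by blast
    show "x = of_int (f r) + 1 - of_nat r / 2"
      if "\<exists>w\<in>set (map (low_point f) (rev [0..<Suc n])). ht w = - int r \<and> hp w = x" for x
      using that mem(1) hp(1) by metis
  qed
  show "hp_at (upper_part (strand n f g)) (int r) = of_int (g r) - of_nat r / 2"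
    unfolding hp_at_def strand_parts(2)[OF assms(1)]
  proof (rule the_equality)
    show "\<exists>w\<in>set (map (up_point g) [0..<Suc n]). ht w = int r \<and> hp w = of_int (g r) - of_nat r / 2"
      using mem(2)[of "up_point g r"] hp(2) by blast
    show "x = of_int (g r) - of_nat r / 2"
      if "\<exists>w\<in>set (map (up_point g) [0..<Suc n]). ht w = int r \<and> hp w = x" for x
      using that mem(2) hp(2) by metis
  qed
qed

section \<open>II-regions\<close>

text \<open>
  Both strips are parametrised so that the unit at \<open>(r, x)\<close> is a II-unit iff \<open>gap p (r, x) < 0\<close>
  (see \<open>II_tile_at\<close>); for the lower strip this is the reflection that defines the duals.
\<close>

fun tile_at :: "strip \<Rightarrow> nat \<times> int \<Rightarrow> tile" where
  "tile_at Plus (r, x) = (Plus, (x, int r - x))"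
| "tile_at Minus (r, x) = (Minus, (x - int r + 1, - x - 1))"

lemma tile_at_simps:
  "fst (tile_at s t) = s" "tile_ht (tile_at s t) = (if s = Plus then int (fst t) else - int (fst t))"
  by (cases s; cases t; simp)+

lemma tile_at_tiles: "fst t \<le> n \<Longrightarrow> tile_at s t \<in> tiles n"
  by (cases s; cases t) (auto simp: tiles_def)

lemma tile_at_cases:
  assumes "U \<in> tiles n"
  obtains t where "fst t \<le> n" "U = tile_at (fst U) t"
proof -
  obtain s x y where U: "U = (s, (x, y))" by (cases U) auto
  show thesis
  proof (cases s)
    case Plus
    then show thesis using assms U by (intro that[of "(nat (x + y), x)"]) (auto simp: tiles_def)
  next
    case Minus
    then show thesis using assms U by (intro that[of "(nat (- x - y), - y - 1)"]) (auto simp: tiles_def)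
  qed
qed

lemma tile_at_image: "(s', w) \<in> tile_at s ` S \<longleftrightarrow> s' = s \<and> (\<exists>r x. (r, x) \<in> S \<and> (s, w) = tile_at s (r, x))"
proof
  assume "(s', w) \<in> tile_at s ` S"
  then obtain r x where "(r, x) \<in> S" "(s', w) = tile_at s (r, x)" by (metis imageE surj_pair)
  then show "s' = s \<and> (\<exists>r x. (r, x) \<in> S \<and> (s, w) = tile_at s (r, x))" by (metis fst_conv tile_at_simps(1))
qed (metis imageI)

text \<open>In each strip a side vertex of one unit is a vertex of the other exactly for equal units
  and for the six neighbours in the triangular lattice. The corner lost by a half unit does not
  matter, since side vertices in question lie inside the strip.\<close>

lemma adjacent_tile_at:
  assumes "fst t \<le> n" "fst u \<le> n"
  shows "adjacent n (tile_at s t) (tile_at s u) \<longleftrightarrow> t = u \<or> edge t u \<or> edge u t"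
proof -
  obtain r x q y where tu: "t = (r, x)" "u = (q, y)" by (cases t; cases u) auto
  define R Q where "R = int r" and "Q = int q"
  have RQ: "0 \<le> R" "0 \<le> Q" "R \<le> int n" "Q \<le> int n" using assms tu by (auto simp: R_def Q_def)
  have e: "t = u \<or> edge t u \<or> edge u t \<longleftrightarrow> R = Q \<and> (x = y \<or> y = x + 1 \<or> x = y + 1) \<or> R = Q + 1 \<and> (x = y \<or> x = y + 1) \<or>
      Q = R + 1 \<and> (x = y \<or> y = x + 1)"
    unfolding tu edge_def R_def Q_def prod.inject fst_conv snd_conv by presburger
  have disj: "{v, w} \<inter> B \<noteq> {} \<longleftrightarrow> v \<in> B \<or> w \<in> B" for v w :: point and B by auto
  have plus: "(a, R - a) \<in> vertices n (Plus, (y, Q - y)) \<longleftrightarrow> R = Q \<and> (a = y \<or> a = y + 1) \<or> R = Q + 1 \<and> a = y + 1 \<or> Q = R + 1 \<and> a = y"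
    if "0 \<le> R" "R \<le> int n" for a y R Q using that by (simp, arith)
  have minus: "(a - R + 1, - a - 1) \<in> vertices n (Minus, (y - Q + 1, - y - 1)) \<longleftrightarrow>
      R = Q \<and> (a = y \<or> a = y + 1) \<or> R = Q + 1 \<and> a = y + 1 \<or> Q = R + 1 \<and> a = y"
    if "0 \<le> R" "R \<le> int n" for a y R Q using that by (simp, arith)
  have "adjacent n (tile_at s t) (tile_at s u) \<longleftrightarrow>
    (R = Q \<and> (x = y \<or> x = y + 1) \<or> R = Q + 1 \<and> x = y + 1 \<or> Q = R + 1 \<and> x = y) \<or>
    (R = Q \<and> (x + 1 = y \<or> x + 1 = y + 1) \<or> R = Q + 1 \<and> x + 1 = y + 1 \<or> Q = R + 1 \<and> x + 1 = y) \<or>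
    (Q = R \<and> (y = x \<or> y = x + 1) \<or> Q = R + 1 \<and> y = x + 1 \<or> R = Q + 1 \<and> y = x) \<or>
    (Q = R \<and> (y + 1 = x \<or> y + 1 = x + 1) \<or> Q = R + 1 \<and> y + 1 = x + 1 \<or> R = Q + 1 \<and> y + 1 = x)"
  proof (cases s)
    case Plus
    have s: "R - x - 1 = R - (x + 1)" "Q - y - 1 = Q - (y + 1)" by simp_all
    have "adjacent n (tile_at s t) (tile_at s u) \<longleftrightarrow>
      (x, R - x) \<in> vertices n (Plus, (y, Q - y)) \<or> (x + 1, R - x - 1) \<in> vertices n (Plus, (y, Q - y)) \<or>
      (y, Q - y) \<in> vertices n (Plus, (x, R - x)) \<or> (y + 1, Q - y - 1) \<in> vertices n (Plus, (x, R - x))"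
      unfolding adjacent_def Plus tu tile_at.simps side_vertices.simps disj by (simp only: R_def Q_def fst_conv) blast
    then show ?thesis unfolding s plus[OF RQ(1,3)] plus[OF RQ(2,4)] .
  next
    case Minus
    have s: "x - R + 1 + 1 = x + 1 - R + 1" "- x - 1 - 1 = - (x + 1) - 1" "y - Q + 1 + 1 = y + 1 - Q + 1" "- y - 1 - 1 = - (y + 1) - 1"
      by simp_all
    have "adjacent n (tile_at s t) (tile_at s u) \<longleftrightarrow>
      (x - R + 1, - x - 1) \<in> vertices n (Minus, (y - Q + 1, - y - 1)) \<or> (x - R + 1 + 1, - x - 1 - 1) \<in> vertices n (Minus, (y - Q + 1, - y - 1)) \<or>
      (y - Q + 1, - y - 1) \<in> vertices n (Minus, (x - R + 1, - x - 1)) \<or> (y - Q + 1 + 1, - y - 1 - 1) \<in> vertices n (Minus, (x - R + 1, - x - 1))"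
      unfolding adjacent_def Minus tu tile_at.simps side_vertices.simps disj by (simp only: R_def Q_def fst_conv) blast
    then show ?thesis unfolding s minus[OF RQ(1,3)] minus[OF RQ(2,4)] .
  qed
  also have "\<dots> \<longleftrightarrow> R = Q \<and> (x = y \<or> y = x + 1 \<or> x = y + 1) \<or> R = Q + 1 \<and> (x = y \<or> x = y + 1) \<or>
      Q = R + 1 \<and> (x = y \<or> y = x + 1)" by (rule iffI; elim disjE conjE; simp)
  finally show ?thesis unfolding e .
qed

section \<open>Components of II-units and holes\<close>

locale matched_pair = family_pairs +
  fixes p :: "family \<times> family" and P :: "nat \<Rightarrow> path"
  assumes p: "p \<in> pairs" and matched: "row_matched p"
    and P: "\<And>i. i \<in> {1..l} \<Longrightarrow> P i = strand n (\<lambda>r. fst p r i) (\<lambda>r. snd p r i)"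
begin

sublocale row: tuple_pair l "fst p 0" "snd p 0"
  by (rule row_pair[OF p])

lemma row_matched: "row.matched"
  using matched by (simp add: row_matched_def)

lemma row_less: "i \<in> {1..l} \<Longrightarrow> fst p 0 i < snd p 0 i"
  using row_matched unfolding row.matched_def by blast

lemma P_eastward: "i \<in> {1..l} \<Longrightarrow> eastward (\<lambda>r. fst p r i) (\<lambda>r. snd p r i)"
  using row_less by (simp add: eastward_def)

lemma alpha_P: "i \<in> {1..l} \<Longrightarrow> r \<le> n \<Longrightarrow> alpha P i (- int r) = of_int (fst p r i) + 1 - of_nat r / 2"
  using hp_at_strand(1)[OF P_eastward] by (simp add: alpha_def P)

lemma beta_P: "i \<in> {1..l} \<Longrightarrow> r \<le> n \<Longrightarrow> beta P i (int r) = of_int (snd p r i) - of_nat r / 2"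
  using hp_at_strand(2)[OF P_eastward] by (simp add: beta_def P)

abbreviation A :: "nat \<times> int \<Rightarrow> int" where "A t \<equiv> above l (fst p (fst t)) (snd t)"
abbreviation B :: "nat \<times> int \<Rightarrow> int" where "B t \<equiv> above l (snd p (fst t)) (snd t)"

text \<open>The two position inequalities say that at most \<open>i\<close> upper entries and at
  least \<open>i\<close> dual lower entries lie beyond \<open>x\<close>. In the lower strip all
  positions are shifted by the same amount, so the condition is the same.\<close>

lemma II_cond_tile_at:
  assumes t: "fst t \<le> n" and i: "i \<le> l"
  shows "II_cond l P i (tile_at s t) \<longleftrightarrow> B t \<le> int i \<and> int i \<le> A t"
proof -
  obtain r x where rx: "t = (r, x)" by (cases t)
  have r: "r \<le> n" using t rx by simp
  have b: "i = l \<or> snd p r (i + 1) \<le> x \<longleftrightarrow> B t \<le> int i"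
  proof (cases "i = l")
    case True
    then show ?thesis using above_range(2)[of l "snd p r" x] by (simp add: rx)
  next
    case False
    then have "i + 1 \<in> {1..l}" using i by simp
    from le_above_iff[OF pair_tuples(2)[OF p r] this, of x] False show ?thesis by (auto simp: rx)
  qed
  have a: "i = 0 \<or> x < fst p r i \<longleftrightarrow> int i \<le> A t"
  proof (cases "i = 0")
    case True
    then show ?thesis using above_range(1)[of l "fst p r" x] by (simp add: rx)
  next
    case False
    then have "i \<in> {1..l}" using i by simp
    from le_above_iff[OF pair_tuples(1)[OF p r] this, of x] False show ?thesis by (auto simp: rx)
  qed
  have "II_cond l P i (tile_at s t) \<longleftrightarrow> (i = l \<or> snd p r (i + 1) \<le> x) \<and> (i = 0 \<or> x < fst p r i)"
  proof (cases s)
    case Plus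
    have hpw: "hp (x, int r - x) = of_int x - of_nat r / 2" by (simp add: field_simps)
    have "i < l \<Longrightarrow> beta P (i + 1) (int r) = of_int (snd p r (i + 1)) - of_nat r / 2" by (rule beta_P) (use r in auto)
    moreover have "i \<noteq> 0 \<Longrightarrow> alpha_dual P i (int r) = of_int (fst p r i) - of_nat r / 2"
      unfolding alpha_dual_def by (subst alpha_P) (use r i in auto)
    moreover have "of_int x - of_nat r / 2 + 1 \<le> real_of_int (fst p r i) - of_nat r / 2 \<longleftrightarrow> x < fst p r i"
      by linarith
    ultimately show ?thesis unfolding Plus rx tile_at.simps II_cond.simps hpw using i by (cases "i = l"; cases "i = 0") auto
  next
    case Minus
    have hpw: "hp (x - int r + 1, - x - 1) = of_int x + 1 - of_nat r / 2" by (simp add: field_simps)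
    have h: "ht (x - int r + 1, - x - 1) = - int r" by simp
    have "i < l \<Longrightarrow> beta_dual P (i + 1) (- int r) = of_int (snd p r (i + 1)) + 1 - of_nat r / 2"
      unfolding beta_dual_def minus_minus by (subst beta_P) (use r in auto)
    moreover have "i \<noteq> 0 \<Longrightarrow> alpha P i (- int r) = of_int (fst p r i) + 1 - of_nat r / 2"
      by (rule alpha_P) (use r i in auto)
    moreover have "of_int x + 1 - of_nat r / 2 + 1 \<le> real_of_int (fst p r i) + 1 - of_nat r / 2 \<longleftrightarrow> x < fst p r i"
      by linarith
    ultimately show ?thesis unfolding Minus rx tile_at.simps II_cond.simps hpw h using i by (cases "i = l"; cases "i = 0") auto
  qed
  then show ?thesis unfolding a b .
qed

lemma gap_neg: "gap p t < 0 \<longleftrightarrow> B t \<le> A t"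
  by (auto simp: gap_def)

lemma II_tile_at:
  assumes "fst t \<le> n"
  shows "tile_at s t \<in> II_tiles n l P \<longleftrightarrow> gap p t < 0"
proof -
  have "(\<exists>i\<le>l. B t \<le> int i \<and> int i \<le> A t) \<longleftrightarrow> B t \<le> A t"
  proof
    assume "B t \<le> A t"
    then show "\<exists>i\<le>l. B t \<le> int i \<and> int i \<le> A t"
      using above_range[of l "fst p (fst t)" "snd t"] by (intro exI[of _ "nat (A t)"]) auto
  qed auto
  then show ?thesis
    using tile_at_tiles[OF assms] II_cond_tile_at[OF assms] by (auto simp: II_tiles_def gap_neg)
qed

abbreviation N :: "((nat \<times> int) \<times> (nat \<times> int)) set" where
  "N \<equiv> (neg_link n (gap p))\<^sup>*"

lemma N_inside: "(t, u) \<in> N \<Longrightarrow> fst t \<le> n \<Longrightarrow> gap p t < 0 \<Longrightarrow> fst u \<le> n \<and> gap p u < 0"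
  by (cases rule: rtrancl.cases) (auto simp: neg_link_def)

lemma N_sym: "(t, u) \<in> N \<Longrightarrow> (u, t) \<in> N"
proof -
  have "sym (neg_link n (gap p))" by (auto simp: sym_def neg_link_def)
  then show "(t, u) \<in> N \<Longrightarrow> (u, t) \<in> N" by (rule symD[OF sym_rtrancl])
qed

lemma N_step:
  "(t, u) \<in> N \<Longrightarrow> fst u \<le> n \<Longrightarrow> gap p u < 0 \<Longrightarrow> fst v \<le> n \<Longrightarrow> gap p v < 0 \<Longrightarrow> edge u v \<or> edge v u \<Longrightarrow> (t, v) \<in> N"
  by (rule rtrancl_into_rtrancl[of _ u]) (auto simp: neg_link_def)

text \<open>Adjacency never leaves a strip, and within it \<open>tile_at s\<close> identifies the
  II-units and their adjacencies with the points of negative gap and the edges.\<close>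

lemma component_tile_at:
  assumes t: "fst t \<le> n" "gap p t < 0"
  shows "II_connected n l P `` {tile_at s t} = tile_at s ` {u. (t, u) \<in> N}"
proof -
  define R where "R U W \<longleftrightarrow> U \<in> II_tiles n l P \<and> W \<in> II_tiles n l P \<and> adjacent n U W" for U W
  have R_sym: "R U W \<Longrightarrow> R W U" for U W by (auto simp: R_def adjacent_def)
  have conn: "(U, W) \<in> II_connected n l P \<longleftrightarrow> U \<in> II_tiles n l P \<and> W \<in> II_tiles n l P \<and> equivclp R U W" for U W
  proof -
    have "R = (\<lambda>U W. U \<in> II_tiles n l P \<and> W \<in> II_tiles n l P \<and> adjacent n U W)" by (intro ext) (simp add: R_def)
    then show ?thesis by (simp add: II_connected_def)
  qed
  have fwd: "W \<in> tile_at s ` {u. (t, u) \<in> N}" if "equivclp R (tile_at s t) W" for W using that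
  proof (induction rule: equivclp_induct)
    case base
    then show ?case by blast
  next
    case (step U W)
    then obtain u where u: "U = tile_at s u" "(t, u) \<in> N" by blast
    have un: "fst u \<le> n" "gap p u < 0" using N_inside[OF u(2) t] by auto
    have UW: "R U W" using step.hyps(2) R_sym by blast
    then have W: "W \<in> II_tiles n l P" "adjacent n U W" by (auto simp: R_def)
    then have "W \<in> tiles n" "fst W = s" by (auto simp: II_tiles_def adjacent_def u(1) tile_at_simps)
    then obtain v where v: "fst v \<le> n" "W = tile_at s v" by (metis tile_at_cases)
    have "gap p v < 0" using II_tile_at[OF v(1)] W(1) v(2) by blast
    moreover have "u = v \<or> edge u v \<or> edge v u"
      using adjacent_tile_at[OF un(1) v(1)] W(2) unfolding u(1) v(2) by blast
    ultimately have "(t, v) \<in> N" using N_step[OF u(2) un v(1)] u(2) by blast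
    then show ?case using v(2) by blast
  qed
  have bwd: "equivclp R (tile_at s t) (tile_at s u)" if "(t, u) \<in> N" for u using that
  proof (induction rule: rtrancl_induct)
    case (step u v)
    have un: "fst u \<le> n" "gap p u < 0" "fst v \<le> n" "gap p v < 0" "edge u v \<or> edge v u"
      using step.hyps(2) by (auto simp: neg_link_def)
    then have "R (tile_at s u) (tile_at s v)"
      using adjacent_tile_at[OF un(1,3)] II_tile_at[OF un(1)] II_tile_at[OF un(3)] by (auto simp: R_def)
    then show ?case using equivclp_into_equivclp[OF step.IH] by blast
  qed simp
  show ?thesis
  proof (intro equalityI subsetI)
    fix W assume "W \<in> II_connected n l P `` {tile_at s t}"
    then have "equivclp R (tile_at s t) W" by (simp add: conn)
    then show "W \<in> tile_at s ` {u. (t, u) \<in> N}" by (rule fwd)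
  next
    fix W assume "W \<in> tile_at s ` {u. (t, u) \<in> N}"
    then obtain u where u: "W = tile_at s u" "(t, u) \<in> N" by blast
    then have "fst u \<le> n \<and> gap p u < 0" using N_inside t by blast
    then show "W \<in> II_connected n l P `` {tile_at s t}"
      using bwd[OF u(2)] II_tile_at t u(1) by (simp add: conn)
  qed
qed

lemma row_walk:
  assumes "r \<le> n" "x \<le> y" "\<And>z. x \<le> z \<Longrightarrow> z \<le> y \<Longrightarrow> gap p (r, z) < 0"
  shows "((r, x), (r, y)) \<in> N"
  using assms(2,3)
proof (induction y rule: int_ge_induct)
  case (step y)
  then have "((r, x), (r, y)) \<in> N" by auto
  then show ?case by (rule N_step) (use step assms(1) in \<open>auto simp: edge_def\<close>)
qed simp

text \<open>If no upper entry lies beyond \<open>t\<close>, the gap stays negative all the way to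
  the right, so the component extends past \<open>M\<close> and climbs to row \<open>n\<close>
  there. If all dual lower entries lie beyond \<open>t\<close>, the same happens on the
  left.\<close>

lemma side_reaches_top:
  assumes t: "fst t \<le> n" and side: "B t = 0 \<or> A t = int l"
  shows "\<exists>y. (t, (n, y)) \<in> N"
proof -
  obtain r x where rx: "t = (r, x)" by (cases t)
  have r: "r \<le> n" using t rx by simp
  have far: "((r, z), (n, z)) \<in> N" if "z \<le> - M \<or> M \<le> z" for z
    by (rule neg_column[OF p _ r]) (use gap_left[OF p] gap_right[OF p] that in force)
  from side show ?thesis
  proof
    assume "B t = 0"
    then have "gap p (r, z) < 0" if "x \<le> z" for z
      using above_mono[of l z "snd p r" x "snd p r"] above_range[of l "snd p r" z] above_range[of l "fst p r" z] that
      by (simp add: rx gap_def)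
    then have "((r, x), (r, max x M)) \<in> N" by (intro row_walk[OF r]) auto
    moreover have "((r, max x M), (n, max x M)) \<in> N" by (rule far) simp
    ultimately have "((r, x), (n, max x M)) \<in> N" by (rule rtrancl_trans)
    then show ?thesis by (auto simp: rx)
  next
    assume "A t = int l"
    then have "gap p (r, z) < 0" if "z \<le> x" for z
      using above_mono[of l x "fst p r" z "fst p r"] above_range[of l "snd p r" z] above_range[of l "fst p r" z] that
      by (simp add: rx gap_def)
    then have "((r, min x (- M)), (r, x)) \<in> N" by (intro row_walk[OF r]) auto
    then have "((r, x), (r, min x (- M))) \<in> N" by (rule N_sym)
    moreover have "((r, min x (- M)), (n, min x (- M))) \<in> N" by (rule far) simp
    ultimately have "((r, x), (n, min x (- M))) \<in> N" by (rule rtrancl_trans)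
    then show ?thesis by (auto simp: rx)
  qed
qed

lemma boundary_tile_at:
  assumes "fst t \<le> n" "gap p t < 0"
  shows "boundary_II_tile n l P (tile_at s t) \<longleftrightarrow> B t = 0 \<or> A t = int l \<or> fst t = n"
proof -
  have "II_cond l P 0 (tile_at s t) \<longleftrightarrow> B t = 0"
    using II_cond_tile_at[OF assms(1), of 0 s] above_range[of l "snd p (fst t)" "snd t"] above_range[of l "fst p (fst t)" "snd t"] by auto
  moreover have "II_cond l P l (tile_at s t) \<longleftrightarrow> A t = int l"
    using II_cond_tile_at[OF assms(1), of l s] above_range[of l "snd p (fst t)" "snd t"] above_range[of l "fst p (fst t)" "snd t"] by auto
  moreover have "\<bar>tile_ht (tile_at s t)\<bar> = int n \<longleftrightarrow> fst t = n" by (simp add: tile_at_simps)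
  ultimately show ?thesis using II_tile_at[OF assms(1)] assms(2) unfolding boundary_II_tile_def by blast
qed

text \<open>By \<open>side_reaches_top\<close> a boundary unit with \<open>i = 0\<close> or
  \<open>i = l\<close> also forces the component to reach row \<open>n\<close>.\<close>

lemma boundary_component:
  assumes "fst t \<le> n" "gap p t < 0"
  shows "(\<forall>u. (t, u) \<in> N \<longrightarrow> \<not> boundary_II_tile n l P (tile_at s u)) \<longleftrightarrow> (\<forall>u. (t, u) \<in> N \<longrightarrow> fst u \<noteq> n)"
proof
  assume a: "\<forall>u. (t, u) \<in> N \<longrightarrow> \<not> boundary_II_tile n l P (tile_at s u)"
  show "\<forall>u. (t, u) \<in> N \<longrightarrow> fst u \<noteq> n" using a boundary_tile_at N_inside assms by blast
next
  assume a: "\<forall>u. (t, u) \<in> N \<longrightarrow> fst u \<noteq> n"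
  show "\<forall>u. (t, u) \<in> N \<longrightarrow> \<not> boundary_II_tile n l P (tile_at s u)"
  proof (intro allI impI notI)
    fix u assume u: "(t, u) \<in> N" "boundary_II_tile n l P (tile_at s u)"
    have un: "fst u \<le> n" "gap p u < 0" using N_inside[OF u(1) assms] by auto
    then have "B u = 0 \<or> A u = int l" using u a boundary_tile_at[OF un] by blast
    then obtain y where "(u, (n, y)) \<in> N" using side_reaches_top[OF un(1)] by blast
    with u(1) have "(t, (n, y)) \<in> N" by (rule rtrancl_trans)
    then have "fst (n, y) \<noteq> n" using a by blast
    then show False by simp
  qed
qed

text \<open>In row 0 the matching gives \<open>A \<le> B\<close>, so a negative gap means
  \<open>A = B\<close>; a common value \<open>i\<close> describes the hole between path
  \<open>i + 1\<close> and path \<open>i\<close>.\<close>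

lemma hole_iff:
  assumes i: "i \<in> {1..<l}"
  shows "gap p (0, x) < 0 \<and> A (0, x) = int i \<longleftrightarrow> snd p 0 (i + 1) \<le> x \<and> x < fst p 0 i"
proof -
  have ii: "i \<in> {1..l}" "i + 1 \<in> {1..l}" using i by auto
  have "0 \<le> row.cover x" by (rule row.matched_cover[OF row_matched])
  then have le: "A (0, x) \<le> B (0, x)" by (simp add: row.cover_def)
  have "x < fst p 0 i \<longleftrightarrow> int i \<le> A (0, x)" "x < snd p 0 (i + 1) \<longleftrightarrow> int (i + 1) \<le> B (0, x)"
    using le_above_iff[OF pair_tuples(1)[OF p, of 0] ii(1), of x] le_above_iff[OF pair_tuples(2)[OF p, of 0] ii(2), of x] by auto
  then show ?thesis unfolding gap_neg using le by auto
qed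

text \<open>The points of row 0 next to the two ends of the hole are covered by path
  \<open>i\<close> and by path \<open>i + 1\<close>, so the hole cannot be extended within the
  row.\<close>

lemma hole_ends:
  assumes i: "i \<in> {1..<l}"
  shows "0 \<le> gap p (0, fst p 0 i)" "0 \<le> gap p (0, snd p 0 (i + 1) - 1)"
proof -
  have ii: "i \<in> {1..l}" "i + 1 \<in> {1..l}" using i by auto
  have tp: "fst p 0 \<in> tuples l" "snd p 0 \<in> tuples l" using pair_tuples[OF p, of 0] by auto
  have "A (0, fst p 0 i) < int i" "int i \<le> B (0, fst p 0 i)"
    using le_above_iff[OF tp(1) ii(1), of "fst p 0 i"] le_above_iff[OF tp(2) ii(1), of "fst p 0 i"] row_less[OF ii(1)] by auto
  then show "0 \<le> gap p (0, fst p 0 i)" by (simp add: gap_def)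
  have "A (0, snd p 0 (i + 1) - 1) < int (i + 1)" "int (i + 1) \<le> B (0, snd p 0 (i + 1) - 1)"
    using le_above_iff[OF tp(1) ii(2), of "snd p 0 (i + 1) - 1"] le_above_iff[OF tp(2) ii(2), of "snd p 0 (i + 1) - 1"] row_less[OF ii(2)] by auto
  then show "0 \<le> gap p (0, snd p 0 (i + 1) - 1)" by (simp add: gap_def)
qed

lemma hole_connected:
  assumes i: "i \<in> {1..<l}" and "snd p 0 (i + 1) \<le> x" "x < fst p 0 i" "snd p 0 (i + 1) \<le> y" "y < fst p 0 i"
  shows "((0, x), (0, y)) \<in> N"
proof -
  have neg: "gap p (0, z) < 0" if "snd p 0 (i + 1) \<le> z" "z < fst p 0 i" for z using hole_iff[OF i] that by blast
  show ?thesis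
  proof (cases "x \<le> y")
    case True
    show ?thesis by (rule row_walk) (use True assms neg in auto)
  next
    case False
    have "((0, y), (0, x)) \<in> N" by (rule row_walk) (use False assms neg in auto)
    then show ?thesis by (rule N_sym)
  qed
qed

text \<open>The end point at height 0 is a vertex of three units of the strip: the end unit of the
  hole, its neighbour in row 0 outside the hole, which is no II-unit by \<open>hole_ends\<close>,
  and one unit of row 1, which is adjacent to the end unit.\<close>

lemma hole_meets_iff:
  assumes i: "i \<in> {1..<l}" "snd p 0 (i + 1) < fst p 0 i" and t: "fst t \<le> n" "gap p t < 0"
  shows "hole_meets n P i (tile_at s ` {u. (t, u) \<in> N}) \<longleftrightarrow> (t, (0, fst p 0 i - 1)) \<in> N"
proof -
  have ii: "i \<in> {1..l}" "i + 1 \<in> {1..l}" using i by auto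
  let ?V = "tile_at s ` {u. (t, u) \<in> N}"
  define X Y where "X = fst p 0 i" and "Y = snd p 0 (i + 1)"
  have last: "last (lower_part (P i)) = (X + 1, - X - 1)"
    unfolding P[OF ii(1)] strand_parts(1)[OF P_eastward[OF ii(1)]] by (simp add: last_map last_rev low_point_def X_def hd_append del: upt_Suc)
  have hd: "hd (upper_part (P (i + 1))) = (Y, - Y)"
    unfolding P[OF ii(2)] strand_parts(2)[OF P_eastward[OF ii(2)]] by (simp add: hd_map up_point_def Y_def upt_conv_Cons del: upt_Suc)
  have XY: "Y < X" "0 \<le> gap p (0, X)" "0 \<le> gap p (0, Y - 1)"
    using i(2) hole_ends[OF i(1)] by (auto simp: X_def Y_def)
  have conn: "((0, X - 1), (0, Y)) \<in> N" using hole_connected[OF i(1), of "X - 1" Y] XY(1) by (simp add: X_def Y_def)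
  have "Y \<le> X - 1 \<and> X - 1 < X" "Y \<le> Y \<and> Y < X" using XY(1) by simp_all
  then have neg: "gap p (0, X - 1) < 0" "gap p (0, Y) < 0"
    using hole_iff[OF i(1), of "X - 1"] hole_iff[OF i(1), of Y] unfolding X_def[symmetric] Y_def[symmetric] by blast+
  have inN: "gap p u < 0" "fst u \<le> n" if "(t, u) \<in> N" for u using N_inside[OF that t] by auto
  have XYN: "(t, (0, X - 1)) \<in> N \<longleftrightarrow> (t, (0, Y)) \<in> N" using rtrancl_trans[OF _ conn, of t] rtrancl_trans[OF _ N_sym[OF conn], of t] by blast
  show ?thesis
  proof (cases s)
    case Plus
    have up: "(t, (1, Y)) \<in> N \<Longrightarrow> (t, (0, Y)) \<in> N"
      using N_step[of t "(1, Y)" "(0, Y)"] inN[of "(1, Y)"] neg(2) by (auto simp: edge_def)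
    have "hole_meets n P i ?V \<longleftrightarrow> (\<exists>r x. (t, (r, x)) \<in> N \<and> (Y, - Y) \<in> vertices n (Plus, (x, int r - x)))"
      unfolding hole_meets_def last hd Plus tile_at_image mem_Collect_eq tile_at.simps prod.inject
      by (simp only: strip.distinct simp_thms) blast
    also have "\<dots> \<longleftrightarrow> (t, (0, Y)) \<in> N"
    proof
      assume "\<exists>r x. (t, (r, x)) \<in> N \<and> (Y, - Y) \<in> vertices n (Plus, (x, int r - x))"
      then obtain r x where rx: "(t, (r, x)) \<in> N" "(Y, - Y) \<in> vertices n (Plus, (x, int r - x))" by blast
      from rx(2) have "Y = x \<and> - Y = int r - x \<or> Y = x + 1 \<and> - Y = int r - x - 1 \<or>
          Y = x + 1 \<and> - Y = int r - x \<or> Y = x \<and> - Y = int r - x - 1"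
        unfolding vertices.simps mem_Collect_eq insert_iff empty_iff prod.inject by blast
      then have "r = 0 \<and> x = Y \<or> r = 0 \<and> x = Y - 1 \<or> r = 1 \<and> x = Y" by (elim disjE conjE) auto
      then show "(t, (0, Y)) \<in> N"
      proof (elim disjE conjE)
        assume "r = 0" "x = Y - 1"
        then show ?thesis using inN(1)[OF rx(1)] XY(3) by simp
      qed (use rx(1) up in simp_all)
    next
      assume "(t, (0, Y)) \<in> N"
      moreover have "(Y, - Y) \<in> vertices n (Plus, (Y, int 0 - Y))" by simp
      ultimately show "\<exists>r x. (t, (r, x)) \<in> N \<and> (Y, - Y) \<in> vertices n (Plus, (x, int r - x))" by blast
    qed
    finally show ?thesis using XYN by (simp add: X_def)
  next
    case Minus
    have up: "(t, (1, X)) \<in> N \<Longrightarrow> (t, (0, X - 1)) \<in> N"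
      using N_step[of t "(1, X)" "(0, X - 1)"] inN[of "(1, X)"] neg(1) by (auto simp: edge_def)
    have "hole_meets n P i ?V \<longleftrightarrow> (\<exists>r x. (t, (r, x)) \<in> N \<and> (X + 1, - X - 1) \<in> vertices n (Minus, (x - int r + 1, - x - 1)))"
      unfolding hole_meets_def last hd Minus tile_at_image mem_Collect_eq tile_at.simps prod.inject
      by (simp only: strip.distinct simp_thms) blast
    also have "\<dots> \<longleftrightarrow> (t, (0, X - 1)) \<in> N"
    proof
      assume "\<exists>r x. (t, (r, x)) \<in> N \<and> (X + 1, - X - 1) \<in> vertices n (Minus, (x - int r + 1, - x - 1))"
      then obtain r x where rx: "(t, (r, x)) \<in> N" "(X + 1, - X - 1) \<in> vertices n (Minus, (x - int r + 1, - x - 1))" by blast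
      from rx(2) have "X + 1 = x - int r + 1 \<and> - X - 1 = - x - 1 \<or> X + 1 = x - int r + 1 + 1 \<and> - X - 1 = - x - 1 - 1 \<or>
          X + 1 = x - int r + 1 + 1 \<and> - X - 1 = - x - 1 \<or> X + 1 = x - int r + 1 \<and> - X - 1 = - x - 1 - 1"
        unfolding vertices.simps mem_Collect_eq insert_iff empty_iff prod.inject by blast
      then have "r = 0 \<and> x = X \<or> r = 0 \<and> x = X - 1 \<or> r = 1 \<and> x = X" by (elim disjE conjE) auto
      then show "(t, (0, X - 1)) \<in> N"
      proof (elim disjE conjE)
        assume "r = 0" "x = X"
        then show ?thesis using inN(1)[OF rx(1)] XY(2) by simp
      qed (use rx(1) up in simp_all)
    next
      assume "(t, (0, X - 1)) \<in> N"
      moreover have "(X + 1, - X - 1) \<in> vertices n (Minus, (X - 1 - int 0 + 1, - (X - 1) - 1))" by simp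
      ultimately show "\<exists>r x. (t, (r, x)) \<in> N \<and> (X + 1, - X - 1) \<in> vertices n (Minus, (x - int r + 1, - x - 1))" by blast
    qed
    finally show ?thesis by (simp add: X_def)
  qed
qed

text \<open>The lower path ends at \<open>fst p 0 i + 1\<close>, one beyond its dual; hence an even
  hole contains an odd number of units of row 0.\<close>

lemma even_hole_P:
  assumes i: "i \<in> {1..<l}"
  shows "even_hole P i \<longleftrightarrow> snd p 0 (i + 1) < fst p 0 i \<and> odd (fst p 0 i - snd p 0 (i + 1))"
proof -
  have "alpha P i 0 - beta P (i + 1) 0 = of_int (fst p 0 i + 1 - snd p 0 (i + 1))"
    using alpha_P[of i 0] beta_P[of "i + 1" 0] i by simp
  then have "even_hole P i \<longleftrightarrow> 0 < fst p 0 i + 1 - snd p 0 (i + 1) \<and> even (fst p 0 i + 1 - snd p 0 (i + 1))"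
    unfolding even_hole_def by (simp only: of_int_eq_iff) blast
  also have "\<dots> \<longleftrightarrow> snd p 0 (i + 1) < fst p 0 i \<and> odd (fst p 0 i - snd p 0 (i + 1))"
    by (cases "fst p 0 i = snd p 0 (i + 1)") auto
  finally show ?thesis .
qed

text \<open>Each hole is connected within row 0, so the component meets row 0 in a disjoint union of
  whole holes; the outer stretches are excluded because they reach row \<open>n\<close>. Modulo 2
  only holes with an odd number of units count, and these are the even holes.\<close>

lemma hole_parity:
  assumes t: "fst t \<le> n" "gap p t < 0" and inner: "\<forall>u. (t, u) \<in> N \<longrightarrow> fst u \<noteq> n"
  shows "finite {x. (t, (0, x)) \<in> N}"
    and "even (card {x. (t, (0, x)) \<in> N}) \<longleftrightarrow> even (card {i \<in> {1..<l}. even_hole P i \<and> hole_meets n P i (tile_at s ` {u. (t, u) \<in> N})})" (is ?E)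
proof -
  define X where "X = {x. (t, (0, x)) \<in> N}"
  have hole: "\<exists>i\<in>{1..<l}. A (0, x) = int i" if "x \<in> X" for x
  proof -
    have tx: "(t, (0, x)) \<in> N" using that by (simp add: X_def)
    have neg: "gap p (0, x) < 0" using N_inside[OF tx t] by simp
    have "\<not> (B (0, x) = 0 \<or> A (0, x) = int l)"
    proof
      assume "B (0, x) = 0 \<or> A (0, x) = int l"
      then obtain y where "((0, x), (n, y)) \<in> N" using side_reaches_top[of "(0, x)"] by auto
      with tx have "(t, (n, y)) \<in> N" by (rule rtrancl_trans)
      then have "fst (n, y) \<noteq> n" using inner by blast
      then show False by simp
    qed
    then show ?thesis using neg above_range[of l "fst p 0" x] above_range[of l "snd p 0" x] unfolding gap_neg
      by (intro bexI[of _ "nat (A (0, x))"]) auto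
  qed
  have neg: "gap p (0, x) < 0" if "x \<in> X" for x
  proof -
    have "(t, (0, x)) \<in> N" using that by (simp add: X_def)
    then show ?thesis using N_inside t by blast
  qed
  have fibre: "{x \<in> X. A (0, x) = int i} = (if snd p 0 (i + 1) < fst p 0 i \<and> (t, (0, fst p 0 i - 1)) \<in> N
      then {snd p 0 (i + 1)..<fst p 0 i} else {})" if i: "i \<in> {1..<l}" for i
  proof (cases "snd p 0 (i + 1) < fst p 0 i \<and> (t, (0, fst p 0 i - 1)) \<in> N")
    case True
    have "x \<in> X \<and> A (0, x) = int i \<longleftrightarrow> snd p 0 (i + 1) \<le> x \<and> x < fst p 0 i" for x
    proof
      assume "x \<in> X \<and> A (0, x) = int i"
      then show "snd p 0 (i + 1) \<le> x \<and> x < fst p 0 i" using hole_iff[OF i, of x] neg by blast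
    next
      assume x: "snd p 0 (i + 1) \<le> x \<and> x < fst p 0 i"
      then have "((0, fst p 0 i - 1), (0, x)) \<in> N" using hole_connected[OF i, of "fst p 0 i - 1" x] by auto
      with conjunct2[OF True] have "(t, (0, x)) \<in> N" by (rule rtrancl_trans)
      then have "x \<in> X" by (simp only: X_def mem_Collect_eq)
      then show "x \<in> X \<and> A (0, x) = int i" using hole_iff[OF i, of x] x by blast
    qed
    note mem = this
    show ?thesis unfolding if_P[OF True] set_eq_iff mem_Collect_eq atLeastLessThan_iff using mem by blast
  next
    case False
    have "\<not> (x \<in> X \<and> A (0, x) = int i)" for x
    proof
      assume x: "x \<in> X \<and> A (0, x) = int i"
      then have b: "snd p 0 (i + 1) \<le> x \<and> x < fst p 0 i" using hole_iff[OF i, of x] neg by blast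
      then have "((0, x), (0, fst p 0 i - 1)) \<in> N" using hole_connected[OF i, of x "fst p 0 i - 1"] by auto
      moreover have "(t, (0, x)) \<in> N" using x by (simp only: X_def mem_Collect_eq)
      ultimately have "(t, (0, fst p 0 i - 1)) \<in> N" using rtrancl_trans by metis
      moreover have "snd p 0 (i + 1) < fst p 0 i" using b by linarith
      ultimately show False using False by blast
    qed
    then show ?thesis unfolding if_not_P[OF False] by blast
  qed
  have X: "X = (\<Union>i\<in>{1..<l}. {x \<in> X. A (0, x) = int i})" using hole by blast
  have fin: "finite {x \<in> X. A (0, x) = int i}" if "i \<in> {1..<l}" for i unfolding fibre[OF that] by simp
  show "finite {x. (t, (0, x)) \<in> N}" unfolding X_def[symmetric] by (subst X) (use fin in blast)
  have "card X = (\<Sum>i\<in>{1..<l}. card {x \<in> X. A (0, x) = int i})"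
    by (subst X, rule card_UN_disjoint) (use fin in auto)
  then have "even (card X) \<longleftrightarrow> even (card {i \<in> {1..<l}. odd (card {x \<in> X. A (0, x) = int i})})"
    by (simp only: even_sum_iff finite_atLeastLessThan)
  also have "{i \<in> {1..<l}. odd (card {x \<in> X. A (0, x) = int i})} = {i \<in> {1..<l}. even_hole P i \<and> hole_meets n P i (tile_at s ` {u. (t, u) \<in> N})}"
  proof (rule Collect_cong, rule conj_cong[OF refl])
    fix i assume i: "i \<in> {1..<l}"
    have par: "odd (nat (b - a)) \<longleftrightarrow> odd (b - a)" if "a < b" for a b :: int using that by (simp add: even_nat_iff)
    show "odd (card {x \<in> X. A (0, x) = int i}) \<longleftrightarrow> even_hole P i \<and> hole_meets n P i (tile_at s ` {u. (t, u) \<in> N})"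
    proof (cases "snd p 0 (i + 1) < fst p 0 i")
      case True
      then show ?thesis
        unfolding fibre[OF i] even_hole_P[OF i] hole_meets_iff[OF i True t] using par[OF True] by simp
    next
      case False
      then show ?thesis unfolding fibre[OF i] even_hole_P[OF i] by simp
    qed
  qed
  finally show ?E unfolding X_def .
qed

theorem odd_II_region_iff: "(\<exists>V. odd_II_region n l P V) \<longleftrightarrow> odd_neg_region n (gap p)"
proof
  assume "\<exists>V. odd_II_region n l P V"
  then obtain V where V: "V \<in> II_components n l P" "\<forall>U\<in>V. \<not> boundary_II_tile n l P U"
    "odd (card {i \<in> {1..<l}. even_hole P i \<and> hole_meets n P i V})"
    by (auto simp: odd_II_region_def II_regions_def)
  then obtain U where U: "U \<in> II_tiles n l P" "V = II_connected n l P `` {U}" by (auto simp: II_components_def quotient_def)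
  then obtain t where t: "fst t \<le> n" "U = tile_at (fst U) t" by (metis (no_types, lifting) II_tiles_def mem_Collect_eq tile_at_cases)
  define s where "s = fst U"
  have neg: "gap p t < 0" using II_tile_at[OF t(1)] U(1) t(2) by metis
  have Vt: "V = tile_at s ` {u. (t, u) \<in> N}" using component_tile_at[OF t(1) neg, of s] U(2) t(2) by (simp add: s_def)
  then have inner: "\<forall>u. (t, u) \<in> N \<longrightarrow> fst u \<noteq> n" using V(2) boundary_component[OF t(1) neg, of s] by blast
  have "odd (card {x. (t, (0, x)) \<in> N})" using hole_parity(2)[OF t(1) neg inner, of s] V(3) Vt by blast
  then show "odd_neg_region n (gap p)" unfolding odd_neg_region_def using t(1) neg inner by blast
next
  assume "odd_neg_region n (gap p)"
  then obtain t where t: "fst t \<le> n" "gap p t < 0" "\<forall>u. (t, u) \<in> N \<longrightarrow> fst u \<noteq> n" "odd (card {x. (t, (0, x)) \<in> N})"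
    unfolding odd_neg_region_def by blast
  \<comment> \<open>Either strip would do: by \<open>component_tile_at\<close> their components are
    copies of each other.\<close>
  define V where "V = tile_at Plus ` {u. (t, u) \<in> N}"
  have "V \<in> II_components n l P" unfolding II_components_def V_def component_tile_at[OF t(1,2), symmetric]
    by (rule quotientI) (use II_tile_at[OF t(1)] t(2) in blast)
  moreover have "\<forall>U\<in>V. \<not> boundary_II_tile n l P U"
    using boundary_component[OF t(1,2), of Plus] t(3) by (auto simp: V_def)
  moreover have "\<exists>U\<in>V. tile_ht U = 0"
  proof -
    have "{x. (t, (0, x)) \<in> N} \<noteq> {}"
    proof
      assume e: "{x. (t, (0, x)) \<in> N} = {}"
      show False using t(4) unfolding e by simp
    qed
    then obtain x where "(t, (0, x)) \<in> N" by blast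
    then have "tile_at Plus (0, x) \<in> V" unfolding V_def by (intro imageI) simp
    then show ?thesis by (rule bexI[rotated]) simp
  qed
  moreover have "odd (card {i \<in> {1..<l}. even_hole P i \<and> hole_meets n P i V})"
    using hole_parity(2)[OF t(1-3), of Plus] t(4) unfolding V_def by blast
  ultimately show "\<exists>V. odd_II_region n l P V" by (auto simp: odd_II_region_def II_regions_def)
qed

end

section \<open>Top rows given by conjugate partitions\<close>

lemma conjugate_partition_antimono:
  assumes "is_partition lam" "1 \<le> i" "i \<le> j"
  shows "conjugate_partition lam j \<le> conjugate_partition lam i"
  unfolding conjugate_partition_def
proof (rule card_mono)
  have "finite {k. 1 \<le> k \<and> lam k \<noteq> 0}" using assms(1) by (simp add: is_partition_def)
  then show "finite {k. 1 \<le> k \<and> i \<le> lam k}" by (rule rev_finite_subset) (use assms(2) in auto)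
qed (use assms(3) in auto)

lemma conjugate_tuples:
  assumes "is_partition lam"
  shows "restrict (\<lambda>i. int (conjugate_partition lam i) - int i + c) {1..l} \<in> tuples l"
  unfolding tuples_def
proof (intro CollectI conjI allI impI restrict_extensional)
  fix i j :: nat
  assume "1 \<le> i" "i < j" "j \<le> l"
  then show "restrict (\<lambda>i. int (conjugate_partition lam i) - int i + c) {1..l} j
    < restrict (\<lambda>i. int (conjugate_partition lam i) - int i + c) {1..l} i"
    using conjugate_partition_antimono[OF assms, of i j] by simp
qed

theorem theorem5p2:
  fixes lam mu :: "nat \<Rightarrow> nat" and a :: complex
  assumes "skew_diagram lam mu" and "\<And>i. 1 \<le> i \<Longrightarrow> i < lam 1 \<Longrightarrow>
           int (conjugate_partition lam (i + 1)) - int (conjugate_partition mu i)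
             \<le> int CARD('n::finite)"
  shows "(chi_det lam mu a :: 'n zring) = (\<Sum>p\<in>path_tuples CARD('n) lam mu. tuple_weight (lam 1) a p)"
proof -
  define n l where "n = CARD('n)" and "l = lam 1"
  \<comment> \<open>In row \<open>n\<close> the lower path with dual position \<open>T i\<close> has
    x-coordinate \<open>T i + 1 - n\<close>, which is that of \<open>start_point\<close>;
    \<open>T' i\<close> is the x-coordinate of \<open>end_point\<close>.\<close>
  define T T' where "T = restrict (\<lambda>i. int (conjugate_partition mu i) - int i + int n) {1..l}"
    and "T' = restrict (\<lambda>i. int (conjugate_partition lam i) - int i + 1) {1..l}"
  have tops: "T i = int (conjugate_partition mu i) - int i + int n" "T' i = int (conjugate_partition lam i) - int i + 1"
    if "i \<in> {1..l}" for i using that by (simp_all add: T_def T'_def)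
  interpret family_pairs l n T T'
  proof
    show "0 < n" by (simp add: n_def)
    show "T \<in> tuples l" "T' \<in> tuples l"
      unfolding T_def T'_def by (rule conjugate_tuples, use assms(1) in \<open>simp add: skew_diagram_def\<close>)+
    \<comment> \<open>In these coordinates the inequality is the positivity hypothesis for
      \<open>i\<close>.\<close>
    show "T' (i + 1) \<le> T i" if "1 \<le> i" "i < l" for i
      using assms(2)[of i] that tops(1)[of i] tops(2)[of "i + 1"] by (simp add: n_def l_def)
  qed
  have ends: "end_paths i = {q. is_path n q \<and> hd q = start_point n mu i \<and> last q = end_point n lam i}" if "i \<in> {1..l}" for i
  proof -
    have "(T i + 1 - int n, - T i - 1) = start_point n mu i" "(T' i, int n - T' i) = end_point n lam i"
      unfolding start_point_def end_point_def Let_def prod.inject tops[OF that] by simp_all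
    then show ?thesis by (simp only: end_paths_def)
  qed
  define Q where "Q = {p \<in> pairs. row_matched p}"
  have region: "(\<exists>V. odd_II_region n l (tuple_paths p) V) \<longleftrightarrow> odd_neg_region n (gap p)" if "p \<in> Q" for p
  proof -
    interpret matched_pair l n T T' p "tuple_paths p"
      by unfold_locales (use that in \<open>simp_all add: Q_def tuple_paths_def\<close>)
    show ?thesis by (rule odd_II_region_iff)
  qed
  have "path_tuples n lam mu = {P \<in> {P \<in> (\<Pi>\<^sub>E i\<in>{1..l}. end_paths i). \<forall>i\<in>{1..<l}. \<not> ordinarily_intersecting (P i) (P (i + 1))}.
      \<not> (\<exists>V. odd_II_region n l P V)}"
  proof -
    have "(\<Pi>\<^sub>E i\<in>{1..l}. {q. is_path n q \<and> hd q = start_point n mu i \<and> last q = end_point n lam i}) = (\<Pi>\<^sub>E i\<in>{1..l}. end_paths i)"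
      by (rule PiE_cong) (simp add: ends)
    then show ?thesis unfolding path_tuples_def l_def[symmetric] by blast
  qed
  then have paths: "path_tuples n lam mu = {P \<in> tuple_paths ` Q. \<not> (\<exists>V. odd_II_region n l P V)}"
    using tuple_paths_bij unfolding bij_betw_def Q_def by metis
  have bij: "bij_betw tuple_paths {p \<in> Q. \<not> odd_neg_region n (gap p)} (path_tuples n lam mu)"
    unfolding paths bij_betw_def
  proof
    show "inj_on tuple_paths {p \<in> Q. \<not> odd_neg_region n (gap p)}"
      using tuple_paths_bij unfolding bij_betw_def Q_def[symmetric] by (metis (no_types, lifting) inj_on_subset mem_Collect_eq subsetI)
    show "tuple_paths ` {p \<in> Q. \<not> odd_neg_region n (gap p)} = {P \<in> tuple_paths ` Q. \<not> (\<exists>V. odd_II_region n l P V)}"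
      using region by blast
  qed
  have "(chi_det lam mu a :: 'n zring) = minor l (\<lambda>t s. kernel a E_series s t) T' (\<lambda>i. T i + 1 - int n)"
    unfolding chi_det_minor l_def[symmetric]
  proof (rule minor_cong)
    fix i j assume i: "i \<in> {1..l}" and j: "j \<in> {1..l}"
    have "T j + 1 - int n = int (conjugate_partition mu j) - int j + 1" unfolding tops(1)[OF j] by simp
    then show "(kernel a E_series (int (conjugate_partition mu j) - int j + 1) (int (conjugate_partition lam i) - int i + 1) :: 'n zring)
      = kernel a E_series (T j + 1 - int n) (T' i)" by (simp only: tops(2)[OF i])
  qed
  also have "\<dots> = (\<Sum>p | p \<in> pairs \<and> row_matched p \<and> \<not> odd_neg_region n (gap p). pair_weight a l p)"
    by (rule minor_kernel_pairs[OF n_def])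
  also have "\<dots> = (\<Sum>p\<in>{p \<in> Q. \<not> odd_neg_region n (gap p)}. tuple_weight l a (tuple_paths p))"
  proof (rule sum.cong)
    show "{p. p \<in> pairs \<and> row_matched p \<and> \<not> odd_neg_region n (gap p)} = {p \<in> Q. \<not> odd_neg_region n (gap p)}"
      unfolding Q_def by blast
    show "pair_weight a l p = (tuple_weight l a (tuple_paths p) :: 'n zring)"
      if "p \<in> {p \<in> Q. \<not> odd_neg_region n (gap p)}" for p
      using tuple_weight_paths[OF n_def, of p a] that by (simp add: Q_def)
  qed
  also have "\<dots> = (\<Sum>P\<in>path_tuples n lam mu. tuple_weight l a P)" by (rule sum.reindex_bij_betw[OF bij])
  finally show ?thesis unfolding n_def l_def .
qed

end
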